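(* Let $K$ be an algebraically closed field, let an algebraic group $G$ act on a variety $X$ over $K$, and let $h:X'\to X$ be a morphism of algebraic varieties. For $x'\in X'$ and every open neighbourhood $U'\subset X'$ of $x'$ we have $$G\text{-}\mathrm{par}_h(U')=G\text{-}\mathrm{mod}_h(U'),$$ and therefore $G\text{-}\mathrm{par}_h(x')=G\text{-}\mathrm{mod}_h(x')$ for all $x'\in X'$.
   Context: Varieties are separated schemes of finite type over $K$, points are closed points. $\dim$ is the dimension of constructible sets, with $\dim\emptyset=-\infty$. A Rosenlicht stratification of $X$ under $G$ is a finite disjoint decomposition $X=X_1\cup\dots\cup X_s$ into $G$-invariant locally closed subvarieties, $X_j$ open dense in $X\setminus(X_1\cup\dots\cup X_{j-1})$, such that each $X_j$ has a geometric quotient $p_j:X_j\to X_j/G$ which is a variety (it always exists by Rosenlicht's theorem). Fix any such stratification. For $U'\subset X'$ open put $U'_j:=U'\cap h^{-1}(X_j)$ and $$G\text{-}\mathrm{mod}_h(U'):=\max_{j=1,\dots,s}\dim p_j(h(U'_j)),$$ and for $x'\in X'$, $G\text{-}\mathrm{mod}_h(x'):=\min\{G\text{-}\mathrm{mod}_h(U'):U'\text{ an open neighbourhood of }x'\text{ in }X'\}$. For $W$ constructible and $x\in W$, $\dim_xW$ is the maximum of $\dim Z$ over the irreducible components $Z$ of $W$ containing $x$. For $u'\in U'$ and $i\ge0$, $$V_{G,h}(u'):=h^{-1}(G\cdot h(u')),\qquad U'_{G,h}(i):=\{u'\in U':\dim_{u'}(U'\cap V_{G,h}(u'))=i\},$$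 $$G\text{-}\mathrm{par}_h(U'):=\max_{i\ge0}\{\dim U'_{G,h}(i)-i\},$$ and $G\text{-}\mathrm{par}_h(x'):=\min\{G\text{-}\mathrm{par}_h(U'):U'\text{ an open neighbourhood of }x'\text{ in }X'\}$. *)

theory Defs
  imports "HOL-Algebra.Algebra" "HOL-Analysis.Abstract_Topology"
    "HOL-Analysis.Product_Topology" "HOL-Library.Extended_Real"
begin

(* frees the letter X, otherwise the polynomial indeterminate *)
no_notation var ("X\<index>")

section \<open>Dimension\<close>

definition irreducible_in :: "'a topology \<Rightarrow> 'a set \<Rightarrow> bool" where
  "irreducible_in T S \<longleftrightarrow> S \<subseteq> topspace T \<and> S \<noteq> {} \<and>
     (\<forall>A B. closedin T A \<and> closedin T B \<and> S \<subseteq> A \<union> B \<longrightarrow> S \<subseteq> A \<or> S \<subseteq> B)"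

definition irreducible_components :: "'a topology \<Rightarrow> 'a set set" where
  "irreducible_components T =
     {Z. irreducible_in T Z \<and> (\<forall>S. irreducible_in T S \<and> Z \<subseteq> S \<longrightarrow> S = Z)}"

text \<open>Krull dimension of a space; the empty space has dimension \<open>Sup {} = -\<infinity>\<close>.\<close>

definition krull_dim :: "'a topology \<Rightarrow> ereal" where
  "krull_dim T = (SUP n \<in> {n. \<exists>C :: nat \<Rightarrow> 'a set.
       (\<forall>i\<le>n. closedin T (C i) \<and> irreducible_in T (C i)) \<and> (\<forall>i<n. C i \<subset> C (Suc i))}.
     ereal (real n))"

definition dim_of :: "'a topology \<Rightarrow> 'a set \<Rightarrow> ereal" where
  "dim_of T W = krull_dim (subtopology T W)"

definition dim_at :: "'a topology \<Rightarrow> 'a set \<Rightarrow> 'a \<Rightarrow> ereal" where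
  "dim_at T W x =
     (SUP Z \<in> {Z \<in> irreducible_components (subtopology T W). x \<in> Z}. dim_of T Z)"


section \<open>Schemes of finite type and varieties\<close>

text \<open>
  A scheme of finite type over \<open>K\<close> is represented by its space of closed points together with
  the structure sheaf on it (locally \<open>Spm A\<close> for a finitely generated \<open>K\<close>-algebra \<open>A\<close>, which may
  have nilpotents).  A section over \<open>U\<close> is identified with the family of its germs, i.e. with an
  extensional function on \<open>U\<close> taking values in the stalks; restriction of sections is then
  restriction of functions.  \<open>Scal X x\<close> is the structure map from \<open>K\<close> to the stalk at \<open>x\<close>.
\<close>

record ('k, 'p, 'f) kspace =
  Top :: "'p topology"
  Stalk :: "'p \<Rightarrow> 'f ring"
  Scal :: "'p \<Rightarrow> 'k \<Rightarrow> 'f"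
  Sect :: "'p set \<Rightarrow> ('p \<Rightarrow> 'f) set"

abbreviation pts :: "('k, 'p, 'f) kspace \<Rightarrow> 'p set" where
  "pts X \<equiv> topspace (Top X)"

definition sect_ring :: "('k, 'p, 'f) kspace \<Rightarrow> 'p set \<Rightarrow> ('p \<Rightarrow> 'f) ring" where
  "sect_ring X U =
    \<lparr> carrier = Sect X U,
      monoid.mult = (\<lambda>s t. \<lambda>x\<in>U. s x \<otimes>\<^bsub>Stalk X x\<^esub> t x),
      one = (\<lambda>x\<in>U. \<one>\<^bsub>Stalk X x\<^esub>),
      ring.zero = (\<lambda>x\<in>U. \<zero>\<^bsub>Stalk X x\<^esub>),
      ring.add = (\<lambda>s t. \<lambda>x\<in>U. s x \<oplus>\<^bsub>Stalk X x\<^esub> t x) \<rparr>"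

definition sect_const :: "('k, 'p, 'f) kspace \<Rightarrow> 'p set \<Rightarrow> 'k \<Rightarrow> 'p \<Rightarrow> 'f" where
  "sect_const X U c = (\<lambda>x\<in>U. Scal X x c)"

definition local_ring :: "'f ring \<Rightarrow> bool" where
  "local_ring R \<longleftrightarrow> cring R \<and> \<one>\<^bsub>R\<^esub> \<noteq> \<zero>\<^bsub>R\<^esub> \<and>
     (\<forall>a \<in> carrier R - Units R. \<forall>b \<in> carrier R - Units R. a \<oplus>\<^bsub>R\<^esub> b \<notin> Units R)"

text \<open>
  The fifth clause is the gluing axiom; the last two say that \<open>Stalk X x\<close> is the colimit of the
  \<open>Sect X U\<close> over the open neighbourhoods \<open>U\<close> of \<open>x\<close>.
\<close>

definition locally_ringed_kspace :: "'k ring \<Rightarrow> ('k, 'p, 'f) kspace \<Rightarrow> bool" where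
  "locally_ringed_kspace K X \<longleftrightarrow>
     (\<forall>x \<in> pts X. local_ring (Stalk X x) \<and> Scal X x \<in> ring_hom K (Stalk X x)) \<and>
     (\<forall>U. openin (Top X) U \<longrightarrow> Sect X U \<subseteq> (\<Pi>\<^sub>E x\<in>U. carrier (Stalk X x))) \<and>
     (\<forall>U. openin (Top X) U \<longrightarrow>
        cring (sect_ring X U) \<and> sect_const X U \<in> ring_hom K (sect_ring X U)) \<and>
     (\<forall>U V s. openin (Top X) U \<and> openin (Top X) V \<and> V \<subseteq> U \<and> s \<in> Sect X U
        \<longrightarrow> restrict s V \<in> Sect X V) \<and>
     (\<forall>U s. openin (Top X) U \<and> s \<in> (\<Pi>\<^sub>E x\<in>U. carrier (Stalk X x)) \<and>
        (\<forall>x\<in>U. \<exists>V. openin (Top X) V \<and> x \<in> V \<and> V \<subseteq> U \<and> restrict s V \<in> Sect X V)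
        \<longrightarrow> s \<in> Sect X U) \<and>
     (\<forall>x \<in> pts X. \<forall>a \<in> carrier (Stalk X x).
        \<exists>U s. openin (Top X) U \<and> x \<in> U \<and> s \<in> Sect X U \<and> s x = a) \<and>
     (\<forall>U s t. openin (Top X) U \<and> s \<in> Sect X U \<and> t \<in> Sect X U \<longrightarrow>
        (\<forall>x\<in>U. s x = t x \<longrightarrow>
          (\<exists>V. openin (Top X) V \<and> x \<in> V \<and> V \<subseteq> U \<and> restrict s V = restrict t V)))"

definition nonvan :: "('k, 'p, 'f) kspace \<Rightarrow> 'p set \<Rightarrow> ('p \<Rightarrow> 'f) \<Rightarrow> 'p set" where
  "nonvan X U f = {x \<in> U. f x \<in> Units (Stalk X x)}"

text \<open>
  \<open>U\<close> is affine: with \<open>A = sect_ring X U\<close>, the algebra \<open>A\<close> is finitely generated over \<open>K\<close> and the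
  canonical map \<open>U \<rightarrow> Spm A\<close> is an isomorphism, i.e. it is bijective, it is a homeomorphism (the
  sets \<open>nonvan X U f\<close> are the preimages of the basic open sets \<open>D(f)\<close>), and the restriction
  \<open>A \<rightarrow> Sect X (nonvan X U f)\<close> is the localisation of \<open>A\<close> at \<open>f\<close>.
\<close>

definition affine_open :: "'k ring \<Rightarrow> ('k, 'p, 'f) kspace \<Rightarrow> 'p set \<Rightarrow> bool" where
  "affine_open K X U \<longleftrightarrow> openin (Top X) U \<and>
     (let A = sect_ring X U in
       (\<exists>F. finite F \<and> F \<subseteq> carrier A \<and>
          carrier A = generate_ring A (sect_const X U ` carrier K \<union> F)) \<and>
       bij_betw (\<lambda>x. {f \<in> carrier A. f x \<notin> Units (Stalk X x)}) U {M. maximalideal M A} \<and>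
       (\<forall>V \<subseteq> U. openin (Top X) V \<longleftrightarrow> (\<exists>F \<subseteq> carrier A. V = (\<Union>f\<in>F. nonvan X U f))) \<and>
       (\<forall>f \<in> carrier A. let D = nonvan X U f; B = sect_ring X D in
          (\<forall>s \<in> carrier B. \<exists>n::nat. \<exists>a \<in> carrier A.
             (restrict f D [^]\<^bsub>B\<^esub> n) \<otimes>\<^bsub>B\<^esub> s = restrict a D) \<and>
          (\<forall>a \<in> carrier A. restrict a D = \<zero>\<^bsub>B\<^esub> \<longrightarrow>
             (\<exists>n::nat. (f [^]\<^bsub>A\<^esub> n) \<otimes>\<^bsub>A\<^esub> a = \<zero>\<^bsub>A\<^esub>))))"

definition finite_type_scheme :: "'k ring \<Rightarrow> ('k, 'p, 'f) kspace \<Rightarrow> bool" where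
  "finite_type_scheme K X \<longleftrightarrow> locally_ringed_kspace K X \<and>
     (\<exists>\<U>. finite \<U> \<and> (\<forall>U\<in>\<U>. affine_open K X U) \<and> \<Union>\<U> = pts X)"


subsection \<open>Products\<close>

text \<open>
  The value of a germ in the residue field, which is \<open>K\<close> at closed points of a scheme of finite
  type over an algebraically closed field.
\<close>

definition germ_val :: "'k ring \<Rightarrow> ('k, 'p, 'f) kspace \<Rightarrow> 'p \<Rightarrow> 'f \<Rightarrow> 'k" where
  "germ_val K X x a = (THE c. c \<in> carrier K \<and> a \<ominus>\<^bsub>Stalk X x\<^esub> Scal X x c \<notin> Units (Stalk X x))"

definition list_sum :: "('a, 'm) ring_scheme \<Rightarrow> 'a list \<Rightarrow> 'a" where
  "list_sum R l = foldr (\<lambda>a b. a \<oplus>\<^bsub>R\<^esub> b) l \<zero>\<^bsub>R\<^esub>"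

text \<open>
  The stalk of \<open>X \<times> Y\<close> at \<open>(x, y)\<close> is the localisation of \<open>O_x \<otimes>\<^sub>K O_y\<close> at the maximal ideal of
  the point.  A tensor is represented by a list \<open>[(a\<^sub>1, b\<^sub>1), \<dots>]\<close> standing for the sum of the
  \<open>a\<^sub>i \<otimes> b\<^sub>i\<close>; it is zero iff every \<open>K\<close>-bilinear form annihilates it.
\<close>

definition tensors :: "('k, 'p, 'f) kspace \<Rightarrow> ('k, 'q, 'g) kspace \<Rightarrow> 'p \<times> 'q \<Rightarrow> ('f \<times> 'g) list set"
  where
  "tensors X Y = (\<lambda>(x, y). lists (carrier (Stalk X x) \<times> carrier (Stalk Y y)))"

definition bilinear_forms ::
    "'k ring \<Rightarrow> ('k, 'p, 'f) kspace \<Rightarrow> ('k, 'q, 'g) kspace \<Rightarrow> 'p \<times> 'q \<Rightarrow> ('f \<Rightarrow> 'g \<Rightarrow> 'k) set" where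
  "bilinear_forms K X Y = (\<lambda>(x, y). let R = Stalk X x; S = Stalk Y y in
     {\<beta>. (\<forall>a \<in> carrier R. \<forall>b \<in> carrier S. \<beta> a b \<in> carrier K) \<and>
         (\<forall>a \<in> carrier R. \<forall>a' \<in> carrier R. \<forall>b \<in> carrier S.
            \<beta> (a \<oplus>\<^bsub>R\<^esub> a') b = \<beta> a b \<oplus>\<^bsub>K\<^esub> \<beta> a' b) \<and>
         (\<forall>a \<in> carrier R. \<forall>b \<in> carrier S. \<forall>b' \<in> carrier S.
            \<beta> a (b \<oplus>\<^bsub>S\<^esub> b') = \<beta> a b \<oplus>\<^bsub>K\<^esub> \<beta> a b') \<and>
         (\<forall>c \<in> carrier K. \<forall>a \<in> carrier R. \<forall>b \<in> carrier S.
            \<beta> (Scal X x c \<otimes>\<^bsub>R\<^esub> a) b = c \<otimes>\<^bsub>K\<^esub> \<beta> a b \<and>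
            \<beta> a (Scal Y y c \<otimes>\<^bsub>S\<^esub> b) = c \<otimes>\<^bsub>K\<^esub> \<beta> a b)})"

definition tensor_null ::
    "'k ring \<Rightarrow> ('k, 'p, 'f) kspace \<Rightarrow> ('k, 'q, 'g) kspace \<Rightarrow> 'p \<times> 'q \<Rightarrow> ('f \<times> 'g) list \<Rightarrow> bool"
  where
  "tensor_null K X Y z t \<longleftrightarrow>
     (\<forall>\<beta> \<in> bilinear_forms K X Y z. list_sum K (map (\<lambda>(a, b). \<beta> a b) t) = \<zero>\<^bsub>K\<^esub>)"

definition tensor_val ::
    "'k ring \<Rightarrow> ('k, 'p, 'f) kspace \<Rightarrow> ('k, 'q, 'g) kspace \<Rightarrow> 'p \<times> 'q \<Rightarrow> ('f \<times> 'g) list \<Rightarrow> 'k"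
  where
  "tensor_val K X Y = (\<lambda>(x, y) t.
     list_sum K (map (\<lambda>(a, b). germ_val K X x a \<otimes>\<^bsub>K\<^esub> germ_val K Y y b) t))"

definition tensor_mult ::
    "('k, 'p, 'f) kspace \<Rightarrow> ('k, 'q, 'g) kspace \<Rightarrow> 'p \<times> 'q \<Rightarrow>
     ('f \<times> 'g) list \<Rightarrow> ('f \<times> 'g) list \<Rightarrow> ('f \<times> 'g) list" where
  "tensor_mult X Y = (\<lambda>(x, y) t u.
     [(a \<otimes>\<^bsub>Stalk X x\<^esub> a', b \<otimes>\<^bsub>Stalk Y y\<^esub> b'). (a, b) \<leftarrow> t, (a', b') \<leftarrow> u])"

definition tensor_neg ::
    "('k, 'p, 'f) kspace \<Rightarrow> 'p \<times> 'q \<Rightarrow> ('f \<times> 'g) list \<Rightarrow> ('f \<times> 'g) list" where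
  "tensor_neg X = (\<lambda>(x, y). map (\<lambda>(a, b). (\<ominus>\<^bsub>Stalk X x\<^esub> a, b)))"

definition tensor_one ::
    "('k, 'p, 'f) kspace \<Rightarrow> ('k, 'q, 'g) kspace \<Rightarrow> 'p \<times> 'q \<Rightarrow> ('f \<times> 'g) list" where
  "tensor_one X Y = (\<lambda>(x, y). [(\<one>\<^bsub>Stalk X x\<^esub>, \<one>\<^bsub>Stalk Y y\<^esub>)])"

type_synonym ('f, 'g) fraction = "('f \<times> 'g) list \<times> ('f \<times> 'g) list"

definition fractions ::
    "'k ring \<Rightarrow> ('k, 'p, 'f) kspace \<Rightarrow> ('k, 'q, 'g) kspace \<Rightarrow> 'p \<times> 'q \<Rightarrow> ('f, 'g) fraction set" where
  "fractions K X Y z =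
     {(t, d). t \<in> tensors X Y z \<and> d \<in> tensors X Y z \<and> tensor_val K X Y z d \<noteq> \<zero>\<^bsub>K\<^esub>}"

text \<open>
  \<open>t/d = t'/d'\<close> iff \<open>e (t d' - t' d) = 0\<close> for some \<open>e\<close> outside the maximal ideal.  Appending
  lists is addition of tensors.
\<close>

definition frac_class ::
    "'k ring \<Rightarrow> ('k, 'p, 'f) kspace \<Rightarrow> ('k, 'q, 'g) kspace \<Rightarrow> 'p \<times> 'q \<Rightarrow>
     ('f, 'g) fraction \<Rightarrow> ('f, 'g) fraction set" where
  "frac_class K X Y z = (\<lambda>(t, d). {(t', d') \<in> fractions K X Y z.
     \<exists>e \<in> tensors X Y z. tensor_val K X Y z e \<noteq> \<zero>\<^bsub>K\<^esub> \<and>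
       tensor_null K X Y z (tensor_mult X Y z e
         (tensor_mult X Y z t d' @ tensor_neg X z (tensor_mult X Y z t' d)))})"

definition frac_rep :: "('f, 'g) fraction set \<Rightarrow> ('f, 'g) fraction" where
  "frac_rep A = (SOME r. r \<in> A)"

definition prod_stalk ::
    "'k ring \<Rightarrow> ('k, 'p, 'f) kspace \<Rightarrow> ('k, 'q, 'g) kspace \<Rightarrow> 'p \<times> 'q \<Rightarrow> ('f, 'g) fraction set ring"
  where
  "prod_stalk K X Y z =
    \<lparr> carrier = frac_class K X Y z ` fractions K X Y z,
      monoid.mult = (\<lambda>A B. let (t, d) = frac_rep A; (t', d') = frac_rep B in
        frac_class K X Y z (tensor_mult X Y z t t', tensor_mult X Y z d d')),
      one = frac_class K X Y z (tensor_one X Y z, tensor_one X Y z),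
      ring.zero = frac_class K X Y z ([], tensor_one X Y z),
      ring.add = (\<lambda>A B. let (t, d) = frac_rep A; (t', d') = frac_rep B in
        frac_class K X Y z
          (tensor_mult X Y z t d' @ tensor_mult X Y z t' d, tensor_mult X Y z d d')) \<rparr>"

definition tensor_germ ::
    "(('p \<Rightarrow> 'f) \<times> ('q \<Rightarrow> 'g)) list \<Rightarrow> 'p \<times> 'q \<Rightarrow> ('f \<times> 'g) list" where
  "tensor_germ t = (\<lambda>(x, y). map (\<lambda>(f, g). (f x, g y)) t)"

text \<open>
  The open sets of \<open>X \<times> Y\<close> are generated by the nonvanishing loci of sums of \<open>f\<^sub>i(x) g\<^sub>i(y)\<close> with
  sections \<open>f\<^sub>i\<close> over \<open>U\<close> and \<open>g\<^sub>i\<close> over \<open>V\<close>.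
\<close>

definition prod_top ::
    "'k ring \<Rightarrow> ('k, 'p, 'f) kspace \<Rightarrow> ('k, 'q, 'g) kspace \<Rightarrow> ('p \<times> 'q) topology" where
  "prod_top K X Y = topology_generated_by
     {{z \<in> U \<times> V. tensor_val K X Y z (tensor_germ t z) \<noteq> \<zero>\<^bsub>K\<^esub>} | U V t.
        openin (Top X) U \<and> openin (Top Y) V \<and> t \<in> lists (Sect X U \<times> Sect Y V)}"

definition prod_sect ::
    "'k ring \<Rightarrow> ('k, 'p, 'f) kspace \<Rightarrow> ('k, 'q, 'g) kspace \<Rightarrow> ('p \<times> 'q) set \<Rightarrow>
     ('p \<times> 'q \<Rightarrow> ('f, 'g) fraction set) set" where
  "prod_sect K X Y W = {s \<in> (\<Pi>\<^sub>E z\<in>W. carrier (prod_stalk K X Y z)).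
     \<forall>z\<in>W. \<exists>U V t d W'. openin (Top X) U \<and> openin (Top Y) V \<and>
       t \<in> lists (Sect X U \<times> Sect Y V) \<and> d \<in> lists (Sect X U \<times> Sect Y V) \<and>
       openin (prod_top K X Y) W' \<and> z \<in> W' \<and> W' \<subseteq> W \<inter> (U \<times> V) \<and>
       (\<forall>w\<in>W'. tensor_val K X Y w (tensor_germ d w) \<noteq> \<zero>\<^bsub>K\<^esub> \<and>
          s w = frac_class K X Y w (tensor_germ t w, tensor_germ d w))}"

definition prod_space ::
    "'k ring \<Rightarrow> ('k, 'p, 'f) kspace \<Rightarrow> ('k, 'q, 'g) kspace \<Rightarrow>
     ('k, 'p \<times> 'q, ('f, 'g) fraction set) kspace" where
  "prod_space K X Y =
    \<lparr> Top = prod_top K X Y,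
      Stalk = prod_stalk K X Y,
      Scal = (\<lambda>z c. case z of (x, y) \<Rightarrow>
        frac_class K X Y z ([(Scal X x c, \<one>\<^bsub>Stalk Y y\<^esub>)], tensor_one X Y z)),
      Sect = prod_sect K X Y \<rparr>"

definition variety :: "'k ring \<Rightarrow> ('k, 'p, 'f) kspace \<Rightarrow> bool" where
  "variety K X \<longleftrightarrow> finite_type_scheme K X \<and>
     closedin (Top (prod_space K X X)) {(x, x) | x. x \<in> pts X}"


subsection \<open>Morphisms\<close>

text \<open>\<open>Com f x\<close> is the induced homomorphism of stalks \<open>O_{Y, f(x)} \<rightarrow> O_{X, x}\<close>.\<close>

record ('p, 'q, 'f, 'g) mor =
  Pt :: "'p \<Rightarrow> 'q"
  Com :: "'p \<Rightarrow> 'g \<Rightarrow> 'f"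

definition preimage :: "('k, 'p, 'f) kspace \<Rightarrow> ('p, 'q, 'f, 'g) mor \<Rightarrow> 'q set \<Rightarrow> 'p set" where
  "preimage X f V = {x \<in> pts X. Pt f x \<in> V}"

definition pullback ::
    "('k, 'p, 'f) kspace \<Rightarrow> ('p, 'q, 'f, 'g) mor \<Rightarrow> 'q set \<Rightarrow> ('q \<Rightarrow> 'g) \<Rightarrow> 'p \<Rightarrow> 'f" where
  "pullback X f V s = (\<lambda>x \<in> preimage X f V. Com f x (s (Pt f x)))"

definition morphism ::
    "'k ring \<Rightarrow> ('k, 'p, 'f) kspace \<Rightarrow> ('k, 'q, 'g) kspace \<Rightarrow> ('p, 'q, 'f, 'g) mor \<Rightarrow> bool" where
  "morphism K X Y f \<longleftrightarrow> continuous_map (Top X) (Top Y) (Pt f) \<and>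
     (\<forall>x \<in> pts X. Com f x \<in> ring_hom (Stalk Y (Pt f x)) (Stalk X x) \<and>
        (\<forall>a \<in> carrier (Stalk Y (Pt f x)).
           Com f x a \<in> Units (Stalk X x) \<longrightarrow> a \<in> Units (Stalk Y (Pt f x))) \<and>
        (\<forall>c \<in> carrier K. Com f x (Scal Y (Pt f x) c) = Scal X x c)) \<and>
     (\<forall>V. openin (Top Y) V \<longrightarrow> (\<forall>s \<in> Sect Y V. pullback X f V s \<in> Sect X (preimage X f V)))"

text \<open>Equality of morphisms, disregarding values outside the carriers.\<close>

definition mor_eq ::
    "('k, 'p, 'f) kspace \<Rightarrow> ('k, 'q, 'g) kspace \<Rightarrow> ('p, 'q, 'f, 'g) mor \<Rightarrow> ('p, 'q, 'f, 'g) mor \<Rightarrow> bool"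
  where
  "mor_eq X Y f g \<longleftrightarrow> (\<forall>x \<in> pts X. Pt f x = Pt g x \<and>
     (\<forall>a \<in> carrier (Stalk Y (Pt f x)). Com f x a = Com g x a))"

definition mor_id :: "('p, 'p, 'f, 'f) mor" where
  "mor_id = \<lparr> Pt = (\<lambda>x. x), Com = (\<lambda>x a. a) \<rparr>"

definition mor_comp ::
    "('q, 'r, 'g, 'h) mor \<Rightarrow> ('p, 'q, 'f, 'g) mor \<Rightarrow> ('p, 'r, 'f, 'h) mor" (infixl "\<circ>\<^sub>m" 55) where
  "g \<circ>\<^sub>m f = \<lparr> Pt = (\<lambda>x. Pt g (Pt f x)), Com = (\<lambda>x a. Com f x (Com g (Pt f x) a)) \<rparr>"

text \<open>The morphism \<open>T \<rightarrow> Spm K \<rightarrow> Y\<close> given by a point of \<open>Y\<close>.\<close>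

definition mor_const ::
    "'k ring \<Rightarrow> ('k, 't, 'h) kspace \<Rightarrow> ('k, 'q, 'g) kspace \<Rightarrow> 'q \<Rightarrow> ('t, 'q, 'h, 'g) mor" where
  "mor_const K T Y y = \<lparr> Pt = (\<lambda>_. y), Com = (\<lambda>t a. Scal T t (germ_val K Y y a)) \<rparr>"

definition mor_fst ::
    "'k ring \<Rightarrow> ('k, 'p, 'f) kspace \<Rightarrow> ('k, 'q, 'g) kspace \<Rightarrow>
     ('p \<times> 'q, 'p, ('f, 'g) fraction set, 'f) mor" where
  "mor_fst K X Y = \<lparr> Pt = fst,
     Com = (\<lambda>z a. frac_class K X Y z ([(a, \<one>\<^bsub>Stalk Y (snd z)\<^esub>)], tensor_one X Y z)) \<rparr>"

definition mor_snd ::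
    "'k ring \<Rightarrow> ('k, 'p, 'f) kspace \<Rightarrow> ('k, 'q, 'g) kspace \<Rightarrow>
     ('p \<times> 'q, 'q, ('f, 'g) fraction set, 'g) mor" where
  "mor_snd K X Y = \<lparr> Pt = snd,
     Com = (\<lambda>z b. frac_class K X Y z ([(\<one>\<^bsub>Stalk X (fst z)\<^esub>, b)], tensor_one X Y z)) \<rparr>"

text \<open>
  The morphism \<open>(f, g) : T \<rightarrow> X \<times> Y\<close>; on stalks a tensor goes to the sum of the \<open>f^*(a\<^sub>i) g^*(b\<^sub>i)\<close>.
\<close>

definition mor_pair ::
    "('k, 't, 'h) kspace \<Rightarrow> ('t, 'p, 'h, 'f) mor \<Rightarrow> ('t, 'q, 'h, 'g) mor \<Rightarrow>
     ('t, 'p \<times> 'q, 'h, ('f, 'g) fraction set) mor" where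
  "mor_pair T f g = \<lparr> Pt = (\<lambda>x. (Pt f x, Pt g x)),
     Com = (\<lambda>x A.
       let R = Stalk T x; (t, d) = frac_rep A;
         ev = (\<lambda>l. list_sum R (map (\<lambda>(a, b). Com f x a \<otimes>\<^bsub>R\<^esub> Com g x b) l))
       in ev t \<otimes>\<^bsub>R\<^esub> inv\<^bsub>R\<^esub> (ev d)) \<rparr>"


section \<open>Algebraic groups, actions and quotients\<close>

definition algebraic_group ::
    "'k ring \<Rightarrow> ('k, 'g, 'a) kspace \<Rightarrow> ('g \<times> 'g, 'g, ('a, 'a) fraction set, 'a) mor \<Rightarrow> 'g \<Rightarrow>
     ('g, 'g, 'a, 'a) mor \<Rightarrow> bool" where
  "algebraic_group K G \<mu> e \<iota> \<longleftrightarrow>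
     variety K G \<and> morphism K (prod_space K G G) G \<mu> \<and> e \<in> pts G \<and> morphism K G G \<iota> \<and>
     (let T = prod_space K (prod_space K G G) G;
          p12 = mor_fst K (prod_space K G G) G;
          p1 = mor_fst K G G \<circ>\<^sub>m p12;
          p2 = mor_snd K G G \<circ>\<^sub>m p12;
          p3 = mor_snd K (prod_space K G G) G
      in mor_eq T G (\<mu> \<circ>\<^sub>m mor_pair T (\<mu> \<circ>\<^sub>m mor_pair T p1 p2) p3)
           (\<mu> \<circ>\<^sub>m mor_pair T p1 (\<mu> \<circ>\<^sub>m mor_pair T p2 p3))) \<and>
     mor_eq G G (\<mu> \<circ>\<^sub>m mor_pair G (mor_const K G G e) mor_id) mor_id \<and>
     mor_eq G G (\<mu> \<circ>\<^sub>m mor_pair G mor_id (mor_const K G G e)) mor_id \<and>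
     mor_eq G G (\<mu> \<circ>\<^sub>m mor_pair G \<iota> mor_id) (mor_const K G G e) \<and>
     mor_eq G G (\<mu> \<circ>\<^sub>m mor_pair G mor_id \<iota>) (mor_const K G G e)"

definition algebraic_action ::
    "'k ring \<Rightarrow> ('k, 'g, 'a) kspace \<Rightarrow> ('g \<times> 'g, 'g, ('a, 'a) fraction set, 'a) mor \<Rightarrow> 'g \<Rightarrow>
     ('k, 'x, 'b) kspace \<Rightarrow> ('g \<times> 'x, 'x, ('a, 'b) fraction set, 'b) mor \<Rightarrow> bool" where
  "algebraic_action K G \<mu> e X \<sigma> \<longleftrightarrow>
     morphism K (prod_space K G X) X \<sigma> \<and>
     (let T = prod_space K (prod_space K G G) X;
          p12 = mor_fst K (prod_space K G G) X;
          p1 = mor_fst K G G \<circ>\<^sub>m p12;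
          p2 = mor_snd K G G \<circ>\<^sub>m p12;
          p3 = mor_snd K (prod_space K G G) X
      in mor_eq T X (\<sigma> \<circ>\<^sub>m mor_pair T (\<mu> \<circ>\<^sub>m mor_pair T p1 p2) p3)
           (\<sigma> \<circ>\<^sub>m mor_pair T p1 (\<sigma> \<circ>\<^sub>m mor_pair T p2 p3))) \<and>
     mor_eq X X (\<sigma> \<circ>\<^sub>m mor_pair X (mor_const K X G e) mor_id) mor_id"

definition orbit_of ::
    "('k, 'g, 'a) kspace \<Rightarrow> ('g \<times> 'x, 'x, ('a, 'b) fraction set, 'b) mor \<Rightarrow> 'x \<Rightarrow> 'x set" where
  "orbit_of G \<sigma> x = (\<lambda>g. Pt \<sigma> (g, x)) ` pts G"

text \<open>
  A locally closed subvariety \<open>Z\<close> of \<open>X\<close>: its points form a locally closed subset of \<open>X\<close>, and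
  \<open>\<epsilon> : Z \<rightarrow> X\<close> is an immersion which is the inclusion on points.
\<close>

definition locally_closed_subvariety ::
    "'k ring \<Rightarrow> ('k, 'x, 'b) kspace \<Rightarrow> ('k, 'x, 'c) kspace \<Rightarrow> ('x, 'x, 'c, 'b) mor \<Rightarrow> bool" where
  "locally_closed_subvariety K X Z \<epsilon> \<longleftrightarrow>
     variety K Z \<and> morphism K Z X \<epsilon> \<and> (\<forall>z \<in> pts Z. Pt \<epsilon> z = z) \<and>
     (\<exists>U C. openin (Top X) U \<and> closedin (Top X) C \<and> pts Z = U \<inter> C) \<and>
     Top Z = subtopology (Top X) (pts Z) \<and>
     (\<forall>z \<in> pts Z. Com \<epsilon> z ` carrier (Stalk X z) = carrier (Stalk Z z))"

text \<open>\<open>Z\<close> is invariant under the action \<open>\<sigma>\<close>, the induced action on \<open>Z\<close> being \<open>\<tau>\<close>.\<close>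

definition invariant_subvariety ::
    "'k ring \<Rightarrow> ('k, 'g, 'a) kspace \<Rightarrow> ('k, 'x, 'b) kspace \<Rightarrow>
     ('g \<times> 'x, 'x, ('a, 'b) fraction set, 'b) mor \<Rightarrow>
     ('k, 'x, 'c) kspace \<Rightarrow> ('x, 'x, 'c, 'b) mor \<Rightarrow>
     ('g \<times> 'x, 'x, ('a, 'c) fraction set, 'c) mor \<Rightarrow> bool" where
  "invariant_subvariety K G X \<sigma> Z \<epsilon> \<tau> \<longleftrightarrow>
     locally_closed_subvariety K X Z \<epsilon> \<and>
     morphism K (prod_space K G Z) Z \<tau> \<and>
     mor_eq (prod_space K G Z) X (\<epsilon> \<circ>\<^sub>m \<tau>)
       (\<sigma> \<circ>\<^sub>m mor_pair (prod_space K G Z) (mor_fst K G Z) (\<epsilon> \<circ>\<^sub>m mor_snd K G Z))"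

text \<open>
  \<open>p : Z \<rightarrow> Y\<close> is a geometric quotient by the action \<open>\<tau>\<close>: it is invariant, surjective with the
  orbits as fibres and submersive, and \<open>O_Y\<close> is the sheaf of invariant functions.
\<close>

definition geometric_quotient ::
    "'k ring \<Rightarrow> ('k, 'g, 'a) kspace \<Rightarrow> ('k, 'z, 'c) kspace \<Rightarrow>
     ('g \<times> 'z, 'z, ('a, 'c) fraction set, 'c) mor \<Rightarrow>
     ('k, 'y, 'd) kspace \<Rightarrow> ('z, 'y, 'c, 'd) mor \<Rightarrow> bool" where
  "geometric_quotient K G Z \<tau> Y p \<longleftrightarrow>
     morphism K Z Y p \<and>
     mor_eq (prod_space K G Z) Y (p \<circ>\<^sub>m \<tau>) (p \<circ>\<^sub>m mor_snd K G Z) \<and>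
     Pt p ` pts Z = pts Y \<and>
     (\<forall>z \<in> pts Z. {w \<in> pts Z. Pt p w = Pt p z} = orbit_of G \<tau> z) \<and>
     (\<forall>V \<subseteq> pts Y. openin (Top Y) V \<longleftrightarrow> openin (Top Z) (preimage Z p V)) \<and>
     (\<forall>V. openin (Top Y) V \<longrightarrow>
        bij_betw (pullback Z p V) (Sect Y V)
          {s \<in> Sect Z (preimage Z p V).
             pullback (prod_space K G Z) \<tau> (preimage Z p V) s =
             pullback (prod_space K G Z) (mor_snd K G Z) (preimage Z p V) s})"

definition rosenlicht_stratification ::
    "'k ring \<Rightarrow> ('k, 'g, 'a) kspace \<Rightarrow> ('k, 'x, 'b) kspace \<Rightarrow>
     ('g \<times> 'x, 'x, ('a, 'b) fraction set, 'b) mor \<Rightarrow> nat \<Rightarrow>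
     (nat \<Rightarrow> ('k, 'x, 'c) kspace) \<Rightarrow> (nat \<Rightarrow> ('x, 'x, 'c, 'b) mor) \<Rightarrow>
     (nat \<Rightarrow> ('g \<times> 'x, 'x, ('a, 'c) fraction set, 'c) mor) \<Rightarrow>
     (nat \<Rightarrow> ('k, 'y, 'd) kspace) \<Rightarrow> (nat \<Rightarrow> ('x, 'y, 'c, 'd) mor) \<Rightarrow> bool" where
  "rosenlicht_stratification K G X \<sigma> s Z \<epsilon> \<tau> Y p \<longleftrightarrow>
     pts X = (\<Union>j\<in>{1..s}. pts (Z j)) \<and>
     disjoint_family_on (\<lambda>j. pts (Z j)) {1..s} \<and>
     (\<forall>j\<in>{1..s}.
        invariant_subvariety K G X \<sigma> (Z j) (\<epsilon> j) (\<tau> j) \<and>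
        (let R = pts X - (\<Union>i\<in>{1..<j}. pts (Z i)) in
           openin (subtopology (Top X) R) (pts (Z j)) \<and>
           (subtopology (Top X) R) closure_of (pts (Z j)) = R) \<and>
        variety K (Y j) \<and>
        geometric_quotient K G (Z j) (\<tau> j) (Y j) (p j))"


section \<open>Modality and parameters\<close>

text \<open>
  \<open>h\<close> is a morphism from \<open>X'\<close> to \<open>X\<close>, on which \<open>G\<close> acts by \<open>\<sigma>\<close>.  The maxima and minima are taken
  in the complete lattice \<open>ereal\<close>.
\<close>

definition G_mod ::
    "nat \<Rightarrow> (nat \<Rightarrow> ('k, 'x, 'c) kspace) \<Rightarrow> (nat \<Rightarrow> ('k, 'y, 'd) kspace) \<Rightarrow>
     (nat \<Rightarrow> ('x, 'y, 'c, 'd) mor) \<Rightarrow> ('k, 'w, 'm) kspace \<Rightarrow> ('w, 'x, 'm, 'b) mor \<Rightarrow>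
     'w set \<Rightarrow> ereal" where
  "G_mod s Z Y p X' h U' =
     (SUP j\<in>{1..s}. dim_of (Top (Y j)) (Pt (p j) ` Pt h ` (U' \<inter> preimage X' h (pts (Z j)))))"

definition G_mod_at ::
    "nat \<Rightarrow> (nat \<Rightarrow> ('k, 'x, 'c) kspace) \<Rightarrow> (nat \<Rightarrow> ('k, 'y, 'd) kspace) \<Rightarrow>
     (nat \<Rightarrow> ('x, 'y, 'c, 'd) mor) \<Rightarrow> ('k, 'w, 'm) kspace \<Rightarrow> ('w, 'x, 'm, 'b) mor \<Rightarrow>
     'w \<Rightarrow> ereal" where
  "G_mod_at s Z Y p X' h x' =
     (INF U' \<in> {U'. openin (Top X') U' \<and> x' \<in> U'}. G_mod s Z Y p X' h U')"

definition orbit_preimage ::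
    "('k, 'g, 'a) kspace \<Rightarrow> ('g \<times> 'x, 'x, ('a, 'b) fraction set, 'b) mor \<Rightarrow>
     ('k, 'w, 'm) kspace \<Rightarrow> ('w, 'x, 'm, 'b) mor \<Rightarrow> 'w \<Rightarrow> 'w set" where
  "orbit_preimage G \<sigma> X' h u' = preimage X' h (orbit_of G \<sigma> (Pt h u'))"

definition par_stratum ::
    "('k, 'g, 'a) kspace \<Rightarrow> ('g \<times> 'x, 'x, ('a, 'b) fraction set, 'b) mor \<Rightarrow>
     ('k, 'w, 'm) kspace \<Rightarrow> ('w, 'x, 'm, 'b) mor \<Rightarrow> 'w set \<Rightarrow> nat \<Rightarrow> 'w set" where
  "par_stratum G \<sigma> X' h U' i =
     {u' \<in> U'. dim_at (Top X') (U' \<inter> orbit_preimage G \<sigma> X' h u') u' = ereal (real i)}"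

definition G_par ::
    "('k, 'g, 'a) kspace \<Rightarrow> ('g \<times> 'x, 'x, ('a, 'b) fraction set, 'b) mor \<Rightarrow>
     ('k, 'w, 'm) kspace \<Rightarrow> ('w, 'x, 'm, 'b) mor \<Rightarrow> 'w set \<Rightarrow> ereal" where
  "G_par G \<sigma> X' h U' =
     (SUP i::nat. dim_of (Top X') (par_stratum G \<sigma> X' h U' i) - ereal (real i))"

definition G_par_at ::
    "('k, 'g, 'a) kspace \<Rightarrow> ('g \<times> 'x, 'x, ('a, 'b) fraction set, 'b) mor \<Rightarrow>
     ('k, 'w, 'm) kspace \<Rightarrow> ('w, 'x, 'm, 'b) mor \<Rightarrow> 'w \<Rightarrow> ereal" where
  "G_par_at G \<sigma> X' h x' =
     (INF U' \<in> {U'. openin (Top X') U' \<and> x' \<in> U'}. G_par G \<sigma> X' h U')"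

end

(*
  Let V_j be the part of U' lying over the stratum X_j and f_j = p_j o h on V_j, so that the sets
  U' \<inter> V_{G,h}(u') are the fibres of the f_j.  Over a dense open subset of an irreducible piece of V_j
  all fibres are equidimensional, of dimension dim V_j - dim f_j(V_j); comparing dimensions on
  suitable pieces gives both inequalities.

  Only the K-valued functions given by the sections matter, nilpotents play no role.  By the
  Nullstellensatz every affine open set becomes a closed subset of some K^F, and dimensions are
  measured by the number of functions that satisfy no polynomial relation.  The fibre theorem comes
  from extending points of K^J to zeros of a prime ideal, one coordinate at a time.
*)

theory Submission
  imports Defs
begin

section \<open>Polynomial functions in one variable\<close>

text \<open>Parameter strata and images of strata are arbitrary subspaces here, so every comparison
  of dimensions is made between natural numbers: a chain of length n in such a set yields a chart in
  which at least n functions are independent on its largest member, and conversely independent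
  functions yield a chain, by cutting with level sets. Only closures of irreducible sets are
  embedded as affine sets; a general point of the closure is then moved back into the original set
  by density. The fibre theorem is needed at every point of a dense open set, with a lower bound for
  a component through that very point. The lower bound comes from openness of the projection to a
  transcendence basis. This shapes the extension of points: the denominator c depends only on the
  prime ideal I, while the assertion is made for all prime ideals M above I that do not contain c. M
  = I gives existence of points, the ideal of a point for M gives openness at that point.
  Polynomials are kept as functions. The field is infinite, so coefficients can be read off from
  values.\<close>

primrec horner :: "('a, 'm) ring_scheme \<Rightarrow> 'a list \<Rightarrow> 'a \<Rightarrow> 'a" where
  "horner R [] x = \<zero>\<^bsub>R\<^esub>"
| "horner R (a # as) x = a \<oplus>\<^bsub>R\<^esub> x \<otimes>\<^bsub>R\<^esub> horner R as x"

context cring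
begin

lemma horner_closed [simp, intro]:
  "set as \<subseteq> carrier R \<Longrightarrow> x \<in> carrier R \<Longrightarrow> horner R as x \<in> carrier R"
  by (induction as) auto

lemma horner_append:
  assumes "set as \<subseteq> carrier R" "set bs \<subseteq> carrier R" "x \<in> carrier R"
  shows "horner R (as @ bs) x = horner R as x \<oplus> x [^] length as \<otimes> horner R bs x"
  using assms(1)
proof (induction as)
  case Nil
  then show ?case using assms by simp
next
  case (Cons a as)
  note h = horner_closed[of as x] horner_closed[OF assms(2,3)]
  have "horner R ((a # as) @ bs) x = a \<oplus> x \<otimes> (horner R as x \<oplus> x [^] length as \<otimes> horner R bs x)"
    using Cons by simp
  also have "\<dots> = (a \<oplus> x \<otimes> horner R as x) \<oplus> (x [^] length as \<otimes> x) \<otimes> horner R bs x"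
    using h Cons.prems assms(3) nat_pow_closed[OF assms(3), of "length as"]
    by (simp add: r_distr a_assoc m_assoc[symmetric] m_comm[of x "x [^] length as"])
  finally show ?case by simp
qed

lemma horner_replicate_zero:
  assumes "set bs \<subseteq> carrier R" "x \<in> carrier R"
  shows "horner R (replicate m \<zero> @ bs) x = x [^] m \<otimes> horner R bs x"
proof (induction m)
  case 0
  then show ?case using assms by simp
next
  case (Suc m)
  have "horner R (replicate (Suc m) \<zero> @ bs) x = x \<otimes> (x [^] m \<otimes> horner R bs x)"
    using Suc assms by simp
  also have "\<dots> = (x [^] m \<otimes> x) \<otimes> horner R bs x"
    using assms horner_closed[OF assms] nat_pow_closed[OF assms(2), of m] by algebra
  finally show ?case by simp
qed

lemma horner_all_zero:
  "set as \<subseteq> {\<zero>} \<Longrightarrow> x \<in> carrier R \<Longrightarrow> horner R as x = \<zero>"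
  by (induction as) auto

text \<open>The quotient keeps the leading coefficient \<open>c\<close>, which is why
  \<open>c\<close> stands apart from the list. The induction runs on the version with remainder,
  p(x) = (x - a) q(x) + p(a), since the tail of a polynomial with root \<open>a\<close> need not
  vanish at \<open>a\<close>.\<close>

lemma synthetic_division:
  assumes "c \<in> carrier R" "a \<in> carrier R" "set as \<subseteq> carrier R" "length as = n"
    "horner R (as @ [c]) a = \<zero>" "n > 0"
  shows "\<exists>bs. set bs \<subseteq> carrier R \<and> length bs = n - 1 \<and>
    (\<forall>x\<in>carrier R. horner R (as @ [c]) x = (x \<ominus> a) \<otimes> horner R (bs @ [c]) x)"
proof -
  have "\<exists>bs. set bs \<subseteq> carrier R \<and> length bs = length as - 1 \<and>
    (\<forall>x\<in>carrier R. horner R (as @ [c]) x =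
        (x \<ominus> a) \<otimes> horner R (bs @ [c]) x \<oplus> horner R (as @ [c]) a)" if "length as > 0"
    using assms(3) that
  proof (induction as)
    case Nil then show ?case by simp
  next
    case (Cons u as)
    have u: "u \<in> carrier R" "set as \<subseteq> carrier R" using Cons.prems by auto
    show ?case
    proof (cases "as = []")
      case True
      have "\<forall>x\<in>carrier R. u \<oplus> x \<otimes> (c \<oplus> x \<otimes> \<zero>) = (x \<ominus> a) \<otimes> (c \<oplus> x \<otimes> \<zero>) \<oplus> (u \<oplus> a \<otimes> (c \<oplus> a \<otimes> \<zero>))"
      proof
        fix x assume "x \<in> carrier R"
        then show "u \<oplus> x \<otimes> (c \<oplus> x \<otimes> \<zero>) = (x \<ominus> a) \<otimes> (c \<oplus> x \<otimes> \<zero>) \<oplus> (u \<oplus> a \<otimes> (c \<oplus> a \<otimes> \<zero>))"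
          using u assms(1,2) by algebra
      qed
      then show ?thesis using True by (intro exI[of _ "[]"]) auto
    next
      case False
      then obtain bs where bs: "set bs \<subseteq> carrier R" "length bs = length as - 1"
        "\<forall>x\<in>carrier R. horner R (as @ [c]) x =
        (x \<ominus> a) \<otimes> horner R (bs @ [c]) x \<oplus> horner R (as @ [c]) a"
        using Cons by auto
      \<comment> \<open>The value of the tail at \<open>a\<close> becomes the constant coefficient
        of the quotient, as in Horner's scheme.\<close>
      let ?r = "horner R (as @ [c]) a"
      have r: "?r \<in> carrier R" using u assms by auto
      show ?thesis
      proof (intro exI[of _ "?r # bs"] conjI ballI)
        show "set (?r # bs) \<subseteq> carrier R" using bs r by auto
        show "length (?r # bs) = length (u # as) - 1" using bs False by (cases as) auto
        fix x assume x: "x \<in> carrier R"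
        let ?b = "horner R (bs @ [c]) x"
        have b: "?b \<in> carrier R" using bs x assms by auto
        have "horner R ((u # as) @ [c]) x = u \<oplus> x \<otimes> ((x \<ominus> a) \<otimes> ?b \<oplus> ?r)"
          using bs x by simp
        also have "\<dots> = (x \<ominus> a) \<otimes> (?r \<oplus> x \<otimes> ?b) \<oplus> (u \<oplus> a \<otimes> ?r)"
          using x b r u assms(2) by algebra
        finally show "horner R ((u # as) @ [c]) x =
          (x \<ominus> a) \<otimes> horner R ((?r # bs) @ [c]) x \<oplus> horner R ((u # as) @ [c]) a" by simp
      qed
    qed
  qed
  then obtain bs where bs: "set bs \<subseteq> carrier R" "length bs = length as - 1"
    "\<forall>x\<in>carrier R. horner R (as @ [c]) x =
        (x \<ominus> a) \<otimes> horner R (bs @ [c]) x \<oplus> horner R (as @ [c]) a" using assms by auto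
  have "\<forall>x\<in>carrier R. horner R (as @ [c]) x = (x \<ominus> a) \<otimes> horner R (bs @ [c]) x"
  proof
    fix x assume x: "x \<in> carrier R"
    have "horner R (bs @ [c]) x \<in> carrier R" using bs x assms by auto
    then show "horner R (as @ [c]) x = (x \<ominus> a) \<otimes> horner R (bs @ [c]) x"
      using bs(3) x assms(2,5) by simp
  qed
  then show ?thesis using bs assms by auto
qed

end

text \<open>Splitting off one root lowers the degree, and in a domain a root of a product is a root
  of a factor. The count needs a nonzero leading coefficient, so zeros at the end of the list are
  removed first.\<close>

lemma (in domain) horner_finite_roots:
  assumes "set as \<subseteq> carrier R" "\<exists>a\<in>set as. a \<noteq> \<zero>"
  shows "finite {x \<in> carrier R. horner R as x = \<zero>}"
proof -
  have *: "finite {x \<in> carrier R. horner R (as @ [c]) x = \<zero>}"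
    if "set as \<subseteq> carrier R" "c \<in> carrier R" "c \<noteq> \<zero>" "length as = n" for as c n
    using that
  proof (induction n arbitrary: as)
    case 0
    then have "{x \<in> carrier R. horner R (as @ [c]) x = \<zero>} = {}" by auto
    then show ?case by (metis finite.emptyI)
  next
    case (Suc n)
    show ?case
    proof (cases "\<exists>a\<in>carrier R. horner R (as @ [c]) a = \<zero>")
      case True
      then obtain a where a: "a \<in> carrier R" "horner R (as @ [c]) a = \<zero>" by auto
      obtain bs where bs: "set bs \<subseteq> carrier R" "length bs = n"
        "\<forall>x\<in>carrier R. horner R (as @ [c]) x = (x \<ominus> a) \<otimes> horner R (bs @ [c]) x"
        using synthetic_division[OF Suc.prems(2) a(1) Suc.prems(1) _ a(2), of "Suc n"] Suc.prems(4) by auto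
      have "{x \<in> carrier R. horner R (as @ [c]) x = \<zero>} \<subseteq>
        insert a {x \<in> carrier R. horner R (bs @ [c]) x = \<zero>}"
      proof
        fix x assume x: "x \<in> {x \<in> carrier R. horner R (as @ [c]) x = \<zero>}"
        then have "(x \<ominus> a) \<otimes> horner R (bs @ [c]) x = \<zero>" using bs by auto
        then have "x \<ominus> a = \<zero> \<or> horner R (bs @ [c]) x = \<zero>"
          using x a bs Suc.prems by (intro integral) auto
        then show "x \<in> insert a {x \<in> carrier R. horner R (bs @ [c]) x = \<zero>}" using x a by auto
      qed
      moreover have "finite {x \<in> carrier R. horner R (bs @ [c]) x = \<zero>}"
        using Suc bs by auto
      ultimately show ?thesis by (meson finite.insertI finite_subset)
    next
      case False
      then have "{x \<in> carrier R. horner R (as @ [c]) x = \<zero>} = {}" by auto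
      then show ?thesis by (metis finite.emptyI)
    qed
  qed
  from assms show ?thesis
  proof (induction as rule: rev_induct)
    case Nil then show ?case by simp
  next
    case (snoc c as)
    show ?case
    proof (cases "c = \<zero>")
      case True
      then have "horner R (as @ [c]) x = horner R as x" if "x \<in> carrier R" for x
        using horner_append[of as "[c]" x] that snoc.prems by simp
      moreover have "\<exists>a\<in>set as. a \<noteq> \<zero>" using True snoc.prems by auto
      ultimately show ?thesis using snoc by (simp cong: conj_cong)
    next
      case False then show ?thesis using * snoc.prems by auto
    qed
  qed
qed

section \<open>Polynomial functions in one variable as a ring\<close>

definition poly1 :: "('a, 'm) ring_scheme \<Rightarrow> ('a \<Rightarrow> 'a) set" where
  "poly1 R = {f. \<exists>as. set as \<subseteq> carrier R \<and> (\<forall>x\<in>carrier R. f x = horner R as x)}"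

context cring
begin

lemma poly1_horner: "set as \<subseteq> carrier R \<Longrightarrow> horner R as \<in> poly1 R"
  unfolding poly1_def by auto

lemma poly1_closed: "f \<in> poly1 R \<Longrightarrow> x \<in> carrier R \<Longrightarrow> f x \<in> carrier R"
  unfolding poly1_def by auto

lemma poly1_const: "c \<in> carrier R \<Longrightarrow> (\<lambda>x. c) \<in> poly1 R"
  unfolding poly1_def by (auto intro!: exI[of _ "[c]"])

lemma poly1_id: "(\<lambda>x. x) \<in> poly1 R"
  unfolding poly1_def by (auto intro!: exI[of _ "[\<zero>, \<one>]"])

lemma poly1_add:
  assumes "f \<in> poly1 R" "g \<in> poly1 R"
  shows "(\<lambda>x. f x \<oplus> g x) \<in> poly1 R"
proof -
  have "\<exists>cs. set cs \<subseteq> carrier R \<and> (\<forall>x\<in>carrier R. horner R as x \<oplus> horner R bs x = horner R cs x)"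
    if "set as \<subseteq> carrier R" "set bs \<subseteq> carrier R" for as bs
    using that
  proof (induction as arbitrary: bs)
    case Nil
    then show ?case by (intro exI[of _ bs]) auto
  next
    case (Cons a as)
    show ?case
    proof (cases bs)
      case Nil
      then show ?thesis using Cons.prems by (intro exI[of _ "a # as"]) auto
    next
      case (Cons b bs')
      then obtain cs where cs: "set cs \<subseteq> carrier R"
        "\<forall>x\<in>carrier R. horner R as x \<oplus> horner R bs' x = horner R cs x"
        using Cons.IH[of bs'] Cons.prems by auto
      have "horner R (a # as) x \<oplus> horner R bs x = horner R ((a \<oplus> b) # cs) x"
        if x: "x \<in> carrier R" for x
      proof -
        have "horner R as x \<in> carrier R" "horner R bs' x \<in> carrier R" "a \<in> carrier R" "b \<in> carrier R"
          using Cons Cons.prems x by auto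
        then have "(a \<oplus> x \<otimes> horner R as x) \<oplus> (b \<oplus> x \<otimes> horner R bs' x) =
           (a \<oplus> b) \<oplus> x \<otimes> (horner R as x \<oplus> horner R bs' x)" using x by algebra
        then show ?thesis using cs Cons x by simp
      qed
      then show ?thesis using cs Cons Cons.prems by (intro exI[of _ "(a \<oplus> b) # cs"]) auto
    qed
  qed
  moreover obtain as bs where "set as \<subseteq> carrier R" "\<forall>x\<in>carrier R. f x = horner R as x"
    "set bs \<subseteq> carrier R" "\<forall>x\<in>carrier R. g x = horner R bs x"
    using assms unfolding poly1_def by blast
  ultimately show ?thesis unfolding poly1_def by fastforce
qed

lemma poly1_mult:
  assumes "f \<in> poly1 R" "g \<in> poly1 R"
  shows "(\<lambda>x. f x \<otimes> g x) \<in> poly1 R"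
proof -
  have *: "(\<lambda>x. horner R as x \<otimes> g x) \<in> poly1 R" if "set as \<subseteq> carrier R" for as
    using that
  proof (induction as)
    case Nil
    have "\<forall>x\<in>carrier R. horner R [] x \<otimes> g x = horner R [] x"
      using poly1_closed[OF assms(2)] by simp
    then show ?case unfolding poly1_def using Nil by (intro CollectI exI[of _ "[]"]) simp
  next
    case (Cons a as)
    have 1: "(\<lambda>x. a \<otimes> h x) \<in> poly1 R" if "h \<in> poly1 R" "a \<in> carrier R" for h a
    proof -
      obtain hs where hs: "set hs \<subseteq> carrier R" "\<forall>x\<in>carrier R. h x = horner R hs x"
        using \<open>h \<in> poly1 R\<close> unfolding poly1_def by auto
      have "a \<otimes> horner R hs x = horner R (map ((\<otimes>) a) hs) x" if "x \<in> carrier R" for x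
        using hs(1)
      proof (induction hs)
        case Nil then show ?case using \<open>a \<in> carrier R\<close> by simp
      next
        case (Cons b hs)
        have "horner R hs x \<in> carrier R" "b \<in> carrier R" using Cons.prems that by auto
        then have "a \<otimes> (b \<oplus> x \<otimes> horner R hs x) = a \<otimes> b \<oplus> x \<otimes> (a \<otimes> horner R hs x)"
          using that \<open>a \<in> carrier R\<close> by algebra
        then show ?case using Cons by simp
      qed
      moreover have "set (map ((\<otimes>) a) hs) \<subseteq> carrier R" using hs(1) that by auto
      ultimately show ?thesis unfolding poly1_def using hs(2)
        by (intro CollectI exI[of _ "map ((\<otimes>) a) hs"]) simp
    qed
    have 2: "(\<lambda>x. x \<otimes> h x) \<in> poly1 R" if hp: "h \<in> poly1 R" for h
    proof -
      obtain hs where hs: "set hs \<subseteq> carrier R" "\<forall>x\<in>carrier R. h x = horner R hs x"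
        using hp unfolding poly1_def by auto
      then have "\<forall>x\<in>carrier R. x \<otimes> h x = horner R (\<zero> # hs) x" by simp
      then show ?thesis unfolding poly1_def using hs(1)
        by (intro CollectI exI[of _ "\<zero> # hs"]) simp
    qed
    have "(\<lambda>x. a \<otimes> g x \<oplus> x \<otimes> (horner R as x \<otimes> g x)) \<in> poly1 R"
      using Cons by (intro poly1_add 1 2 assms(2)) auto
    moreover have "horner R (a # as) x \<otimes> g x = a \<otimes> g x \<oplus> x \<otimes> (horner R as x \<otimes> g x)"
      if x: "x \<in> carrier R" for x
    proof -
      have "horner R as x \<in> carrier R" "a \<in> carrier R" "g x \<in> carrier R"
        using Cons.prems x poly1_closed[OF assms(2)] by auto
      then show ?thesis using x unfolding horner.simps by algebra
    qed
    ultimately show ?case unfolding poly1_def by auto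
  qed
  obtain as where as: "set as \<subseteq> carrier R" "\<forall>x\<in>carrier R. f x = horner R as x"
    using assms(1) unfolding poly1_def by auto
  show ?thesis using *[OF as(1)] as(2) unfolding poly1_def by auto
qed

lemma poly1_pow:
  assumes "f \<in> poly1 R"
  shows "(\<lambda>x. f x [^] (n::nat)) \<in> poly1 R"
proof (induction n)
  case 0
  then show ?case using poly1_const[OF one_closed] by simp
next
  case (Suc n)
  then show ?case using poly1_mult[OF Suc assms] by simp
qed

lemma poly1_minus:
  assumes "f \<in> poly1 R" "g \<in> poly1 R"
  shows "(\<lambda>x. f x \<ominus> g x) \<in> poly1 R"
proof -
  have "(\<lambda>x. f x \<oplus> (\<ominus> \<one>) \<otimes> g x) \<in> poly1 R"
    using assms by (intro poly1_add poly1_mult poly1_const) auto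
  moreover have "f x \<oplus> (\<ominus> \<one>) \<otimes> g x = f x \<ominus> g x" if "x \<in> carrier R" for x
    using poly1_closed[OF assms(1) that] poly1_closed[OF assms(2) that] by algebra
  ultimately show ?thesis unfolding poly1_def by auto
qed

end

section \<open>Roots over an algebraically closed field\<close>

locale acf = algebraically_closed K for K :: "'k ring" (structure)
begin

text \<open>Polynomials of \<open>poly_ring\<close> start with the leading coefficient, hence
  \<open>rev\<close>. Through this translation the splitting of polynomials yields roots in Horner
  form.\<close>

lemma horner_eval_rev:
  assumes "set as \<subseteq> carrier K" "x \<in> carrier K"
  shows "horner K as x = eval (rev as) x"
  using assms
proof (induction as rule: rev_induct)
  case Nil then show ?case by simp
next
  case (snoc c as)
  have "horner K (as @ [c]) x = horner K as x \<oplus> x [^] length as \<otimes> c"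
    using horner_append[of as "[c]" x] snoc.prems by simp
  moreover have "horner K as x \<in> carrier K" "x [^] length as \<in> carrier K" "c \<in> carrier K"
    using snoc.prems by auto
  ultimately have "horner K (as @ [c]) x = c \<otimes> x [^] length as \<oplus> horner K as x"
    by algebra
  then show ?case using snoc by simp
qed

lemma horner_has_root:
  assumes "set as \<subseteq> carrier K" "c \<in> carrier K" "c \<noteq> \<zero>" "as \<noteq> []"
  shows "\<exists>x\<in>carrier K. horner K (as @ [c]) x = \<zero>"
proof -
  let ?p = "rev (as @ [c])"
  have p: "?p \<in> carrier (poly_ring K)"
    using assms unfolding sym[OF univ_poly_carrier] polynomial_def by auto
  have "splitted ?p" using roots_over_carrier[OF p] .
  then have "size (roots ?p) = length as" unfolding splitted_def by simp
  then obtain x where "x \<in># roots ?p" using assms(4)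
    by (metis length_0_conv multiset_nonemptyE size_empty)
  then have "is_root ?p x" using roots_mem_iff_is_root[OF p] by simp
  then show ?thesis using horner_eval_rev[of "as @ [c]" x] assms unfolding is_root_def by auto
qed

text \<open>If the field were finite, adding one to the product of all x - a would give a polynomial
  of positive degree without a root.\<close>

lemma infinite_carrier: "infinite (carrier K)"
proof
  assume fin: "finite (carrier K)"
  have *: "\<exists>as. set as \<subseteq> carrier K \<and> length as = card A \<and> (\<forall>x\<in>A. horner K (as @ [\<one>]) x = \<zero>)"
    if "finite A" "A \<subseteq> carrier K" for A
    using that
  proof (induction A rule: finite_induct)
    case empty then show ?case by (intro exI[of _ "[]"]) auto
  next
    case (insert a A)
    then obtain as where as: "set as \<subseteq> carrier K" "length as = card A"
      "\<forall>x\<in>A. horner K (as @ [\<one>]) x = \<zero>" by auto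
    obtain bs where bs: "set bs \<subseteq> carrier K" "length bs = Suc (length as)"
      "\<forall>x\<in>carrier K. horner K (bs @ [\<one>]) x = (x \<ominus> a) \<otimes> horner K (as @ [\<one>]) x"
    proof -
      \<comment> \<open>Multiplication by x - a from the constant coefficient upwards; the summand
        \<open>d\<close> carries the preceding coefficient into the next step.\<close>
      have "\<exists>bs. set bs \<subseteq> carrier K \<and> length bs = Suc (length as) \<and>
        (\<forall>x\<in>carrier K. horner K (bs @ [\<one>]) x = (x \<ominus> a) \<otimes> horner K (as @ [\<one>]) x \<oplus> d)"
        if "d \<in> carrier K" for d
        using as(1) that
      proof (induction as arbitrary: d)
        case Nil
        have "(d \<ominus> a) \<oplus> x \<otimes> (\<one> \<oplus> x \<otimes> \<zero>) = (x \<ominus> a) \<otimes> (\<one> \<oplus> x \<otimes> \<zero>) \<oplus> d"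
          if "x \<in> carrier K" for x
        proof -
          have "a \<in> carrier K" using insert.prems by simp
          then show ?thesis using that Nil(2) by algebra
        qed
        then show ?case using insert.prems Nil by (intro exI[of _ "[d \<ominus> a]"]) auto
      next
        case (Cons u as)
        then have "set as \<subseteq> carrier K" "u \<in> carrier K" by auto
        from Cons.IH[OF this]
        obtain bs where bs: "set bs \<subseteq> carrier K" "length bs = Suc (length as)"
          "\<forall>x\<in>carrier K. horner K (bs @ [\<one>]) x = (x \<ominus> a) \<otimes> horner K (as @ [\<one>]) x \<oplus> u"
          by blast
        have "(d \<ominus> a \<otimes> u) \<oplus> x \<otimes> horner K (bs @ [\<one>]) x =
          (x \<ominus> a) \<otimes> (u \<oplus> x \<otimes> horner K (as @ [\<one>]) x) \<oplus> d" if "x \<in> carrier K" for x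
        proof -
          have "horner K (as @ [\<one>]) x \<in> carrier K" "a \<in> carrier K" "u \<in> carrier K" "d \<in> carrier K"
            using Cons.prems insert.prems that by auto
          then show ?thesis unfolding bs(3)[rule_format, OF that] using that by algebra
        qed
        then show ?case using bs Cons.prems insert.prems
          by (intro exI[of _ "(d \<ominus> a \<otimes> u) # bs"]) auto
      qed
      from this[of \<zero>] obtain bs where bs: "set bs \<subseteq> carrier K" "length bs = Suc (length as)"
        "\<forall>x\<in>carrier K. horner K (bs @ [\<one>]) x = (x \<ominus> a) \<otimes> horner K (as @ [\<one>]) x \<oplus> \<zero>" by auto
      have "\<forall>x\<in>carrier K. horner K (bs @ [\<one>]) x = (x \<ominus> a) \<otimes> horner K (as @ [\<one>]) x"
        using bs as insert.prems by (auto simp del: horner.simps)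
      then show ?thesis using bs that by auto
    qed
    have "horner K (bs @ [\<one>]) x = \<zero>" if "x \<in> insert a A" for x
    proof (cases "x = a")
      case True
      have "horner K (as @ [\<one>]) a \<in> carrier K" using as insert.prems by auto
      then show ?thesis using bs True insert.prems by (simp add: minus_eq r_neg)
    next
      case False
      then show ?thesis using bs as that insert.prems by auto
    qed
    then show ?case using bs as insert by (intro exI[of _ bs]) auto
  qed
  obtain as where as: "set as \<subseteq> carrier K" "length as = card (carrier K)"
    "\<forall>x\<in>carrier K. horner K (as @ [\<one>]) x = \<zero>" using *[OF fin] by auto
  have "card (carrier K) > 0" using fin by (metis card_gt_0_iff empty_iff zero_closed)
  then obtain a as' where as': "as = a # as'" using as by (cases as) auto
  \<comment> \<open>Raising the constant coefficient by one turns a polynomial that vanishes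
    everywhere into one with the constant value one.\<close>
  obtain x where x: "x \<in> carrier K" "horner K (((\<one> \<oplus> a) # as') @ [\<one>]) x = \<zero>"
    using horner_has_root[of "(\<one> \<oplus> a) # as'" \<one>] as as' by auto
  have c: "a \<in> carrier K" "horner K (as' @ [\<one>]) x \<in> carrier K" using x as as' by auto
  have "horner K (((\<one> \<oplus> a) # as') @ [\<one>]) x = \<one> \<oplus> horner K (as @ [\<one>]) x"
    using as' x c by (simp add: a_assoc)
  then show False using x as by simp
qed

text \<open>Serves to cancel factors x - a: an identity proved for all x other than a extends to x =
  a.\<close>

lemma poly1_cofinite_zero:
  assumes f: "f \<in> poly1 K" and fin: "finite E" and z: "\<And>x. x \<in> carrier K - E \<Longrightarrow> f x = \<zero>"
    and x: "x \<in> carrier K"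
  shows "f x = \<zero>"
proof -
  obtain as where as: "set as \<subseteq> carrier K" "\<forall>x\<in>carrier K. f x = horner K as x"
    using f unfolding poly1_def by auto
  have "carrier K - E \<subseteq> {x\<in>carrier K. horner K as x = \<zero>}" using z as by auto
  moreover have "infinite (carrier K - E)" using infinite_carrier fin by simp
  ultimately have "infinite {x\<in>carrier K. horner K as x = \<zero>}" using finite_subset by auto
  then have "\<forall>a\<in>set as. a = \<zero>" using horner_finite_roots[OF as(1)] by auto
  then show ?thesis using horner_all_zero[of as x] x as by auto
qed

lemma horner_zero_coeffs:
  assumes "set as \<subseteq> carrier K" "finite E" "\<And>x. x \<in> carrier K - E \<Longrightarrow> horner K as x = \<zero>" "a \<in> set as"
  shows "a = \<zero>"
proof (rule ccontr)
  assume "a \<noteq> \<zero>"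
  then have "finite {x \<in> carrier K. horner K as x = \<zero>}" using horner_finite_roots assms by auto
  moreover have "carrier K - E \<subseteq> {x\<in>carrier K. horner K as x = \<zero>}" using assms by auto
  ultimately show False using infinite_carrier assms(2) by (meson finite_Diff2 finite_subset)
qed

text \<open>If every root of \<open>P\<close>, of degree \<open>n\<close>, is a root of \<open>H\<close>, then \<open>P\<close> divides \<open>H\<^sup>n\<close>; here \<open>rs\<close> is the
  remainder of \<open>S H\<^sup>n\<close> modulo \<open>P\<close>.\<close>

lemma root_multiple_remainder_zero:
  assumes "set as \<subseteq> carrier K" "c \<in> carrier K" "c \<noteq> \<zero>" "length as = n"
    and "set rs \<subseteq> carrier K" "length rs \<le> n"
    and "S \<in> poly1 K" "H \<in> poly1 K" "Q \<in> poly1 K"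
    and "\<And>x. x \<in> carrier K \<Longrightarrow>
      horner K rs x = S x \<otimes> H x [^] n \<ominus> Q x \<otimes> horner K (as @ [c]) x"
    and "\<And>x. x \<in> carrier K \<Longrightarrow> horner K (as @ [c]) x = \<zero> \<Longrightarrow> H x = \<zero>"
    and "r \<in> set rs"
  shows "r = \<zero>"
  using assms
proof (induction n arbitrary: as rs S r)
  case 0
  have "rs = []" using 0(6) by simp
  then show ?case using 0(12) by simp
next
  case (Suc n)
  note pc = poly1_closed
  obtain a where a: "a \<in> carrier K" "horner K (as @ [c]) a = \<zero>"
  proof -
    have "as \<noteq> []" using Suc.prems(4) by auto
    then show ?thesis using horner_has_root[OF Suc.prems(1-3)] that by blast
  qed
  have Ha: "H a = \<zero>" using Suc.prems(11) a by auto
  obtain bs where bs: "set bs \<subseteq> carrier K" "length bs = n"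
    "\<forall>x\<in>carrier K. horner K (as @ [c]) x = (x \<ominus> a) \<otimes> horner K (bs @ [c]) x"
    using synthetic_division[OF Suc.prems(2) a(1) Suc.prems(1) Suc.prems(4) a(2)] by auto
  obtain hs where hs: "set hs \<subseteq> carrier K" "\<forall>x\<in>carrier K. H x = horner K hs x"
    using Suc.prems(8) unfolding poly1_def by auto
  \<comment> \<open>H vanishes at \<open>a\<close>, so x - a can be divided off. Constants are
    treated apart; vanishing at \<open>a\<close> makes them zero.\<close>
  have "\<exists>hs'. set hs' \<subseteq> carrier K \<and> (\<forall>x\<in>carrier K. H x = (x \<ominus> a) \<otimes> horner K hs' x)"
  proof (cases "length hs \<le> 1")
    case True
    have "H x = \<zero>" if "x \<in> carrier K" for x
    proof (cases hs)
      case Nil then show ?thesis using hs that by simp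
    next
      case (Cons h hs'')
      then have "hs = [h]" using True by auto
      then have "H x = h" "H a = h" "h \<in> carrier K" using hs that a by auto
      then show ?thesis using Ha by simp
    qed
    then show ?thesis using a by (intro exI[of _ "[]"]) auto
  next
    case False
    then obtain hs' u where u: "hs = hs' @ [u]" by (metis length_0_conv not_le rev_exhaust zero_le)
    have c: "u \<in> carrier K" "set hs' \<subseteq> carrier K" "0 < length hs'" "horner K (hs' @ [u]) a = \<zero>"
      using hs u a Ha False by auto
    obtain ks where "set ks \<subseteq> carrier K"
      "\<forall>x\<in>carrier K. horner K (hs' @ [u]) x = (x \<ominus> a) \<otimes> horner K (ks @ [u]) x"
      using synthetic_division[OF c(1) a(1) c(2) refl c(4,3)] by blast
    then show ?thesis using c(1) hs(2) u by (intro exI[of _ "ks @ [u]"]) simp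
  qed
  then obtain hs' where hs': "set hs' \<subseteq> carrier K" "\<forall>x\<in>carrier K. H x = (x \<ominus> a) \<otimes> horner K hs' x"
    by auto
  have ra: "horner K rs a = \<zero>"
    using Suc.prems(10)[OF a(1)] Ha a pc[OF Suc.prems(7) a(1)] pc[OF Suc.prems(9) a(1)]
    by (simp add: minus_eq)
  show ?case
  proof (cases "rs = []")
    case True then show ?thesis using Suc.prems(12) by simp
  next
    case ne: False
    then obtain rs0 u where u: "rs = rs0 @ [u]" by (meson rev_exhaust)
    show ?thesis
    proof (cases "rs0 = []")
      case True
      then show ?thesis using u ra Suc.prems(5,12) a by auto
    next
      case False
      then obtain ts where ts: "set ts \<subseteq> carrier K" "length ts = length rs0 - 1"
        "\<forall>x\<in>carrier K. horner K rs x = (x \<ominus> a) \<otimes> horner K (ts @ [u]) x"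
        using synthetic_division[of u a rs0 "length rs0"] Suc.prems(5) u a ra by auto
      \<comment> \<open>Of the n + 1 factors H one loses x - a, and its cofactor moves into S. There
        remain n factors H, as many as the degree of the quotient of P.\<close>
      define S' where "S' = (\<lambda>x. horner K hs' x \<otimes> S x)"
      have S': "S' \<in> poly1 K" unfolding S'_def using hs' Suc.prems(7) by (intro poly1_mult poly1_horner) auto
      have cl: "set (ts @ [u]) \<subseteq> carrier K" "set (bs @ [c]) \<subseteq> carrier K"
        using ts u Suc.prems(2,5) bs by auto
      \<comment> \<open>The two sides agree after multiplication by x - a. Cancelling proves the
        equation away from \<open>a\<close>, and a polynomial function that vanishes away from one
        point vanishes.\<close>
      have eq: "horner K (ts @ [u]) x = S' x \<otimes> H x [^] n \<ominus> Q x \<otimes> horner K (bs @ [c]) x"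
        (is "?l x = ?r x") if x: "x \<in> carrier K" for x
      proof -
        have "(\<lambda>x. ?l x \<ominus> ?r x) \<in> poly1 K"
          using ts S' Suc.prems bs u
          by (intro poly1_minus poly1_mult poly1_pow poly1_horner) auto
        moreover have "?l x \<ominus> ?r x = \<zero>" if xx: "x \<in> carrier K - {a}" for x
        proof -
          have x: "x \<in> carrier K" "x \<noteq> a" using xx by auto
          have c: "?l x \<in> carrier K" "S x \<in> carrier K" "H x \<in> carrier K" "Q x \<in> carrier K"
            "horner K (bs @ [c]) x \<in> carrier K" "horner K hs' x \<in> carrier K" "H x [^] n \<in> carrier K"
            by (auto intro!: horner_closed[OF cl(1) x(1)] horner_closed[OF cl(2) x(1)]
                horner_closed[OF hs'(1) x(1)] pc[OF Suc.prems(7) x(1)] pc[OF Suc.prems(8) x(1)]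
                pc[OF Suc.prems(9) x(1)] nat_pow_closed simp del: horner.simps)
          have "(x \<ominus> a) \<otimes> ?l x = horner K rs x" using ts x by simp
          also have "\<dots> = S x \<otimes> (H x [^] n \<otimes> H x) \<ominus> Q x \<otimes> ((x \<ominus> a) \<otimes> horner K (bs @ [c]) x)"
            using Suc.prems(10)[OF x(1)] bs x by simp
          also have "\<dots> = S x \<otimes> (H x [^] n \<otimes> ((x \<ominus> a) \<otimes> horner K hs' x)) \<ominus> Q x \<otimes> ((x \<ominus> a) \<otimes> horner K (bs @ [c]) x)"
            using hs' x by simp
          also have "\<dots> = (x \<ominus> a) \<otimes> ?r x" unfolding S'_def using c x a by algebra
          finally have "(x \<ominus> a) \<otimes> ?l x = (x \<ominus> a) \<otimes> ?r x" .
          then have "(x \<ominus> a) \<otimes> (?l x \<ominus> ?r x) = \<zero>"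
          proof -
            have "?r x \<in> carrier K" using c unfolding S'_def by auto
            then show ?thesis using \<open>(x \<ominus> a) \<otimes> ?l x = (x \<ominus> a) \<otimes> ?r x\<close> c x a
              by (simp add: r_distr minus_eq r_minus r_neg)
          qed
          moreover have "x \<ominus> a \<noteq> \<zero>" using x a by simp
          moreover have "?r x \<in> carrier K" using c unfolding S'_def by auto
          ultimately show ?thesis using integral[of "x \<ominus> a" "?l x \<ominus> ?r x"] x a c by auto
        qed
        ultimately have "?l x \<ominus> ?r x = \<zero>"
          using poly1_cofinite_zero[of "\<lambda>x. ?l x \<ominus> ?r x" "{a}" x] x by blast
        moreover have "?l x \<in> carrier K" by (rule horner_closed[OF cl(1) x])
        moreover have "?r x \<in> carrier K"
          using horner_closed[OF cl(2) x] pc[OF S' x] pc[OF Suc.prems(8) x] pc[OF Suc.prems(9) x]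
          by simp
        ultimately show ?thesis by simp
      qed
      have "\<forall>t\<in>set (ts @ [u]). t = \<zero>"
      proof
        fix t assume t: "t \<in> set (ts @ [u])"
        show "t = \<zero>"
        proof (rule Suc.IH[OF bs(1) Suc.prems(2,3) bs(2) _ _ S' Suc.prems(8,9) eq _ t])
          show "set (ts @ [u]) \<subseteq> carrier K" using ts u Suc.prems by auto
          show "length (ts @ [u]) \<le> n" using ts u Suc.prems False by (cases rs0) auto
          fix x assume x: "x \<in> carrier K" "horner K (bs @ [c]) x = \<zero>"
          then show "H x = \<zero>" using Suc.prems(11)[OF x(1)] bs a by auto
        qed auto
      qed
      then have z: "horner K (ts @ [u]) x = \<zero>" if "x \<in> carrier K" for x
        using that horner_all_zero[of "ts @ [u]" x] by auto
      show ?thesis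
      proof (rule horner_zero_coeffs[OF Suc.prems(5) _ _ Suc.prems(12), of "{}"])
        fix x assume "x \<in> carrier K - {}"
        then show "horner K rs x = \<zero>" using ts(3) z a by auto
      qed auto
    qed
  qed
qed

end

section \<open>Polynomial functions on affine spaces\<close>

text \<open>The identities behind one step of addition, scaling and multiplication in Horner form;
  they serve both the field and the algebras over it.\<close>

lemma (in cring) horner_step_identities:
  assumes "a \<in> carrier R" "b \<in> carrier R" "x \<in> carrier R" "A \<in> carrier R" "B \<in> carrier R"
  shows "(a \<oplus> b) \<oplus> x \<otimes> (A \<oplus> B) = (a \<oplus> x \<otimes> A) \<oplus> (b \<oplus> x \<otimes> B)"
    and "b \<otimes> a \<oplus> x \<otimes> (b \<otimes> A) = b \<otimes> (a \<oplus> x \<otimes> A)"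
    and "a \<otimes> B \<oplus> (\<zero> \<oplus> x \<otimes> (A \<otimes> B)) = (a \<oplus> x \<otimes> A) \<otimes> B"
  using assms by algebra+

context acf
begin

text \<open>Points are total functions; only the coordinates in \<open>F\<close> matter.\<close>

definition Pts :: "'i set \<Rightarrow> ('i \<Rightarrow> 'k) set" where
  "Pts F = {v. \<forall>i\<in>F. v i \<in> carrier K}"

text \<open>A polynomial is represented by its function; as K is infinite, coefficients can be
  recovered from values by \<open>horner_zero_coeffs\<close>. Different expressions may disagree at
  valuations outside the field, so only the values on \<open>Pts J\<close> carry meaning.\<close>

inductive_set Pol :: "'i set \<Rightarrow> (('i \<Rightarrow> 'k) \<Rightarrow> 'k) set" for J :: "'i set" where
  Pol_const: "c \<in> carrier K \<Longrightarrow> (\<lambda>v. c) \<in> Pol J"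
| Pol_var: "j \<in> J \<Longrightarrow> (\<lambda>v. v j) \<in> Pol J"
| Pol_add: "p \<in> Pol J \<Longrightarrow> q \<in> Pol J \<Longrightarrow> (\<lambda>v. p v \<oplus> q v) \<in> Pol J"
| Pol_mult: "p \<in> Pol J \<Longrightarrow> q \<in> Pol J \<Longrightarrow> (\<lambda>v. p v \<otimes> q v) \<in> Pol J"

text \<open>A polynomial in one further variable whose coefficients are polynomials evaluated at
  \<open>v\<close>. Keeping \<open>v\<close> and \<open>x\<close> apart lets the new coordinate move
  while the old ones stay.\<close>

abbreviation ceval :: "(('i \<Rightarrow> 'k) \<Rightarrow> 'k) list \<Rightarrow> ('i \<Rightarrow> 'k) \<Rightarrow> 'k \<Rightarrow> 'k" where
  "ceval as v x \<equiv> horner K (map (\<lambda>a. a v) as) x"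

lemma Pts_mono: "J \<subseteq> F \<Longrightarrow> v \<in> Pts F \<Longrightarrow> v \<in> Pts J"
  unfolding Pts_def by auto

lemma Pts_upd: "v \<in> Pts F \<Longrightarrow> x \<in> carrier K \<Longrightarrow> v(b := x) \<in> Pts F"
  unfolding Pts_def by auto

lemma Pol_closed: "p \<in> Pol J \<Longrightarrow> v \<in> Pts J \<Longrightarrow> p v \<in> carrier K"
  by (induction p rule: Pol.induct) (auto simp: Pts_def)

lemma Pol_mono:
  assumes "J \<subseteq> J'" "p \<in> Pol J"
  shows "p \<in> Pol J'"
  using assms(2)
proof (induction p rule: Pol.induct)
  case (Pol_var j)
  then show ?case using assms(1) by (intro Pol.Pol_var) auto
qed (rule Pol.intros; assumption)+

lemma Pol_closed_mono: "p \<in> Pol J \<Longrightarrow> J \<subseteq> F \<Longrightarrow> v \<in> Pts F \<Longrightarrow> p v \<in> carrier K"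
  using Pol_closed Pts_mono by blast

lemma Pol_cong:
  assumes "p \<in> Pol J" "\<And>j. j \<in> J \<Longrightarrow> v j = w j"
  shows "p v = p w"
  using assms(1)
proof (induction p rule: Pol.induct)
  case (Pol_var j)
  then show ?case using assms(2) by simp
qed simp_all

lemma Pol_upd: "p \<in> Pol J \<Longrightarrow> b \<notin> J \<Longrightarrow> p (v(b := x)) = p v"
  by (metis Pol_cong fun_upd_other)

lemma Pol_pow: "p \<in> Pol J \<Longrightarrow> (\<lambda>v. p v [^] (n::nat)) \<in> Pol J"
proof (induction n)
  case 0
  then show ?case using Pol_const[OF one_closed] by simp
next
  case (Suc n)
  then show ?case using Pol_mult[of "\<lambda>v. p v [^] n" J p] by simp
qed

lemma Pol_subst:
  assumes "p \<in> Pol J" "\<And>j. j \<in> J \<Longrightarrow> s j \<in> Pol L"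
  shows "(\<lambda>v. p (\<lambda>j. s j v)) \<in> Pol L"
  using assms(1)
proof (induction p rule: Pol.induct)
  case (Pol_var j)
  then show ?case using assms(2) by simp
qed (rule Pol.intros; assumption)+

lemma Pol_horner:
  assumes "set as \<subseteq> Pol J" "J \<subseteq> J'" "b \<in> J'"
  shows "(\<lambda>v. ceval as v (v b)) \<in> Pol J'"
  using assms(1)
proof (induction as)
  case Nil
  then show ?case using Pol_const[OF zero_closed] by simp
next
  case (Cons a as)
  then have "(\<lambda>v. a v \<oplus> v b \<otimes> ceval as v (v b)) \<in> Pol J'"
    using assms by (intro Pol_add Pol_mult Pol_var) (auto intro: Pol_mono)
  then show ?case by simp
qed

lemma Pol_zero [simp]: "(\<lambda>v. \<zero>) \<in> Pol J" and Pol_one [simp]: "(\<lambda>v. \<one>) \<in> Pol J"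
  by (auto intro: Pol_const)

section \<open>Arithmetic of polynomials with polynomial coefficients\<close>

lemma coeffs_closed: "set as \<subseteq> Pol J \<Longrightarrow> v \<in> Pts J \<Longrightarrow> set (map (\<lambda>a. a v) as) \<subseteq> carrier K"
  using Pol_closed by auto

lemma horner_coeffs_closed:
  "set as \<subseteq> Pol J \<Longrightarrow> v \<in> Pts J \<Longrightarrow> x \<in> carrier K \<Longrightarrow> ceval as v x \<in> carrier K"
  by (intro horner_closed coeffs_closed)

text \<open>The length is recorded as a degree bound, for division with remainder and for the basis
  theorem.\<close>

lemma coeffs_add:
  assumes "set as \<subseteq> Pol J" "set bs \<subseteq> Pol J"
  shows "\<exists>cs. set cs \<subseteq> Pol J \<and> length cs = max (length as) (length bs) \<and>
    (\<forall>v\<in>Pts J. \<forall>x\<in>carrier K. ceval cs v x =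
       ceval as v x \<oplus> ceval bs v x)"
  using assms
proof (induction as arbitrary: bs)
  case Nil
  have "ceval bs v x \<in> carrier K" if "v \<in> Pts J" "x \<in> carrier K" for v x
    using Nil that by (intro horner_closed coeffs_closed)
  then show ?case using Nil by (intro exI[of _ bs]) simp
next
  case (Cons a as)
  show ?case
  proof (cases bs)
    case Nil
    have "ceval (a # as) v x \<in> carrier K" if "v \<in> Pts J" "x \<in> carrier K" for v x
      using Cons.prems(1) that by (intro horner_closed coeffs_closed)
    then show ?thesis using Cons.prems Nil by (intro exI[of _ "a # as"]) simp
  next
    case bs: (Cons b bs')
    then obtain cs where cs: "set cs \<subseteq> Pol J" "length cs = max (length as) (length bs')"
      "\<forall>v\<in>Pts J. \<forall>x\<in>carrier K. ceval cs v x =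
         ceval as v x \<oplus> ceval bs' v x"
      using Cons.IH[of bs'] Cons.prems by auto
    show ?thesis
    proof (intro exI[of _ "(\<lambda>v. a v \<oplus> b v) # cs"] conjI ballI)
      show "set ((\<lambda>v. a v \<oplus> b v) # cs) \<subseteq> Pol J" using cs Cons.prems bs by (auto intro: Pol_add)
      show "length ((\<lambda>v. a v \<oplus> b v) # cs) = max (length (a # as)) (length bs)" using cs bs by simp
      fix v x assume v: "v \<in> Pts J" and x: "x \<in> carrier K"
      have "a v \<in> carrier K" "b v \<in> carrier K"
        "ceval as v x \<in> carrier K" "ceval bs' v x \<in> carrier K"
        using Cons.prems bs Pol_closed[OF _ v] horner_coeffs_closed[OF _ v x] by auto
      then have "(a v \<oplus> b v) \<oplus> x \<otimes> (ceval as v x \<oplus> ceval bs' v x)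
        = (a v \<oplus> x \<otimes> ceval as v x) \<oplus> (b v \<oplus> x \<otimes> ceval bs' v x)"
        using x by (intro horner_step_identities)
      then show "ceval ((\<lambda>v. a v \<oplus> b v) # cs) v x =
         ceval (a # as) v x \<oplus> ceval bs v x"
        using cs(3) v x bs by simp
    qed
  qed
qed

lemma coeffs_scale:
  assumes "set as \<subseteq> Pol J" "c \<in> Pol J"
  shows "\<exists>cs. set cs \<subseteq> Pol J \<and> length cs = length as \<and>
    (\<forall>v\<in>Pts J. \<forall>x\<in>carrier K. ceval cs v x = c v \<otimes> ceval as v x)"
proof (intro exI[of _ "map (\<lambda>a v. c v \<otimes> a v) as"] conjI ballI)
  show "set (map (\<lambda>a v. c v \<otimes> a v) as) \<subseteq> Pol J" using assms by (auto intro: Pol_mult)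
  fix v x assume v: "v \<in> Pts J" and x: "x \<in> carrier K"
  show "ceval (map (\<lambda>a v. c v \<otimes> a v) as) v x = c v \<otimes> ceval as v x"
    using assms(1)
  proof (induction as)
    case Nil
    then show ?case using Pol_closed[OF assms(2) v] by simp
  next
    case (Cons a as)
    have "a v \<in> carrier K" "c v \<in> carrier K" "ceval as v x \<in> carrier K"
      using Cons.prems assms Pol_closed[OF _ v] horner_coeffs_closed[OF _ v x] by auto
    then have "c v \<otimes> a v \<oplus> x \<otimes> (c v \<otimes> ceval as v x)
      = c v \<otimes> (a v \<oplus> x \<otimes> ceval as v x)" using x by (intro horner_step_identities)
    then show ?case using Cons by simp
  qed
qed simp

lemma coeffs_mult:
  assumes "set as \<subseteq> Pol J" "set bs \<subseteq> Pol J"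
  shows "\<exists>cs. set cs \<subseteq> Pol J \<and>
    (\<forall>v\<in>Pts J. \<forall>x\<in>carrier K. ceval cs v x =
       ceval as v x \<otimes> ceval bs v x)"
  using assms(1)
proof (induction as)
  case Nil
  have "ceval bs v x \<in> carrier K" if "v \<in> Pts J" "x \<in> carrier K" for v x
    using assms(2) that by (intro horner_closed coeffs_closed)
  then show ?case by (intro exI[of _ "[]"]) simp
next
  case (Cons a as)
  then obtain cs where cs: "set cs \<subseteq> Pol J"
    "\<forall>v\<in>Pts J. \<forall>x\<in>carrier K. ceval cs v x =
       ceval as v x \<otimes> ceval bs v x" by auto
  have a: "a \<in> Pol J" using Cons.prems by simp
  obtain ds where ds: "set ds \<subseteq> Pol J"
    "\<forall>v\<in>Pts J. \<forall>x\<in>carrier K. ceval ds v x = a v \<otimes> ceval bs v x"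
    using coeffs_scale[OF assms(2) a] by auto
  have "set ((\<lambda>v. \<zero>) # cs) \<subseteq> Pol J" using cs by simp
  from coeffs_add[OF ds(1) this] obtain es where es: "set es \<subseteq> Pol J"
    "\<forall>v\<in>Pts J. \<forall>x\<in>carrier K. ceval es v x =
       ceval ds v x \<oplus> ceval ((\<lambda>v. \<zero>) # cs) v x" by auto
  have "ceval es v x =
       ceval (a # as) v x \<otimes> ceval bs v x"
    if v: "v \<in> Pts J" and x: "x \<in> carrier K" for v x
  proof -
    let ?A = "ceval as v x" and ?B = "ceval bs v x"
    have c: "a v \<in> carrier K" "?A \<in> carrier K" "?B \<in> carrier K"
      using Cons.prems assms(2) Pol_closed[OF _ v] horner_coeffs_closed[OF _ v x] by auto
    have "ceval es v x = a v \<otimes> ?B \<oplus> (\<zero> \<oplus> x \<otimes> (?A \<otimes> ?B))"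
      using es ds cs v x by simp
    also have "\<dots> = (a v \<oplus> x \<otimes> ?A) \<otimes> ?B" using c x by (intro horner_step_identities)
    finally show ?thesis by simp
  qed
  then show ?case using es(1) by blast
qed

lemma Pol_insert_coeffs:
  assumes "h \<in> Pol (insert b J)"
  shows "\<exists>as. set as \<subseteq> Pol J \<and> (\<forall>v\<in>Pts (insert b J). h v = ceval as v (v b))"
  using assms
proof (induction h rule: Pol.induct)
  case (Pol_const c)
  then show ?case by (intro exI[of _ "[\<lambda>v. c]"]) (auto simp: Pts_def intro: Pol.intros)
next
  case (Pol_var j)
  show ?case
  proof (cases "j \<in> J")
    case True
    then show ?thesis by (intro exI[of _ "[\<lambda>v. v j]"]) (auto simp: Pts_def intro: Pol.intros)
  next
    case False
    then have "j = b" using Pol_var by auto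
    then show ?thesis
      by (intro exI[of _ "[\<lambda>v. \<zero>, \<lambda>v. \<one>]"]) (auto simp: Pts_def intro: Pol.intros)
  qed
next
  case (Pol_add p q)
  then obtain as bs where ab: "set as \<subseteq> Pol J" "set bs \<subseteq> Pol J"
    "\<forall>v\<in>Pts (insert b J). p v = ceval as v (v b)"
    "\<forall>v\<in>Pts (insert b J). q v = ceval bs v (v b)" by auto
  from coeffs_add[OF ab(1,2)] obtain cs where cs: "set cs \<subseteq> Pol J"
    "\<forall>v\<in>Pts J. \<forall>x\<in>carrier K. ceval cs v x =
       ceval as v x \<oplus> ceval bs v x" by auto
  then show ?case using ab by (intro exI[of _ cs]) (auto simp: Pts_def)
next
  case (Pol_mult p q)
  then obtain as bs where ab: "set as \<subseteq> Pol J" "set bs \<subseteq> Pol J"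
    "\<forall>v\<in>Pts (insert b J). p v = ceval as v (v b)"
    "\<forall>v\<in>Pts (insert b J). q v = ceval bs v (v b)" by auto
  from coeffs_mult[OF ab(1,2)] obtain cs where cs: "set cs \<subseteq> Pol J"
    "\<forall>v\<in>Pts J. \<forall>x\<in>carrier K. ceval cs v x =
       ceval as v x \<otimes> ceval bs v x" by auto
  then show ?case using ab by (intro exI[of _ cs]) (auto simp: Pts_def)
qed

text \<open>The leading coefficient \<open>c\<close> need not be invertible, so each step that
  removes the leading term of \<open>fs\<close> first multiplies by \<open>c\<close>; this produces
  the power \<open>N\<close>. The induction is on the length of \<open>fs\<close>.\<close>

lemma pseudo_division:
  fixes J :: "'i set"
  assumes "set as \<subseteq> Pol J" "c \<in> Pol J" "set fs \<subseteq> Pol J"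
  shows "\<exists>N qs rs. set qs \<subseteq> Pol J \<and> set rs \<subseteq> Pol J \<and> length rs \<le> length as \<and>
    (\<forall>v\<in>Pts J. \<forall>x\<in>carrier K. c v [^] (N::nat) \<otimes> ceval fs v x =
       ceval qs v x \<otimes> ceval (as @ [c]) v x
       \<oplus> ceval rs v x)"
  using assms(3)
proof (induction "length fs" arbitrary: fs)
  case 0
  then have "fs = []" by simp
  have "ceval (as @ [c]) v x \<in> carrier K"
    if v: "v \<in> Pts J" and x: "x \<in> carrier K" for v x
    using assms(1,2) by (intro horner_coeffs_closed[OF _ v x]) simp
  then show ?case unfolding \<open>fs = []\<close>
    by (intro exI[of _ "0::nat"] exI[of _ "[]"]) (simp del: map_append)
next
  case (Suc m)
  show ?case
  proof (cases "Suc m \<le> length as")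
    case True
    have "ceval (as @ [c]) v x \<in> carrier K" "ceval fs v x \<in> carrier K"
      if v: "v \<in> Pts J" and x: "x \<in> carrier K" for v x
      using assms(1,2) Suc.prems by (intro horner_coeffs_closed[OF _ v x]; simp)+
    then show ?thesis using True Suc(2,3)
      by - (rule exI[of _ "0::nat"], rule exI[of _ "[]"], rule exI[of _ fs], simp del: map_append)
  next
    case False
    define k where "k = m - length as"
    have k: "m = k + length as" using False unfolding k_def by simp
    obtain fs' l where fl: "fs = fs' @ [l]" "length fs' = m"
      using Suc(2) by (metis append_butlast_last_id diff_Suc_1 length_0_conv length_butlast nat.distinct(1))
    have l: "l \<in> Pol J" and fs': "set fs' \<subseteq> Pol J" using Suc.prems fl by auto
    define z where "z = (replicate k (\<lambda>v. \<zero>) :: (('i \<Rightarrow> 'k) \<Rightarrow> 'k) list)"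
    have zP: "set z \<subseteq> Pol J" unfolding z_def by (auto simp: set_replicate_conv_if)
    have lz: "length z = k" unfolding z_def by simp
    have z: "ceval (z @ bs) v x = x [^] k \<otimes> ceval bs v x"
      if bs: "set bs \<subseteq> Pol J" and v: "v \<in> Pts J" and x: "x \<in> carrier K" for v x bs
    proof -
      have "map (\<lambda>a. a v) (z @ bs) = replicate k \<zero> @ map (\<lambda>a. a v) bs" unfolding z_def by simp
      then show ?thesis using horner_replicate_zero[OF coeffs_closed[OF bs v] x] by simp
    qed
    have ml: "(\<lambda>v. \<ominus> \<one> \<otimes> l v) \<in> Pol J" using l by (intro Pol_mult Pol_const) auto
    obtain us where us: "set us \<subseteq> Pol J" "length us = m"
      "\<forall>v\<in>Pts J. \<forall>x\<in>carrier K. ceval us v x = c v \<otimes> ceval fs' v x"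
      using coeffs_scale[OF fs' assms(2)] fl by auto
    have zas: "set (z @ as) \<subseteq> Pol J" using zP assms by auto
    \<comment> \<open>\<open>ws\<close> is the lower part of - l x^k P. In c f - l x^k P the leading
      terms cancel; they are left out from the start, so that \<open>ts\<close> is shorter than
      \<open>fs\<close>.\<close>
    obtain ws where ws: "set ws \<subseteq> Pol J" "length ws = m"
      "\<forall>v\<in>Pts J. \<forall>x\<in>carrier K. ceval ws v x = \<ominus> \<one> \<otimes> l v \<otimes> ceval (z @ as) v x"
      using coeffs_scale[OF zas ml] k lz by auto
    obtain ts where ts: "set ts \<subseteq> Pol J" "length ts = m"
      "\<forall>v\<in>Pts J. \<forall>x\<in>carrier K. ceval ts v x =
         ceval us v x \<oplus> ceval ws v x"
      using coeffs_add[OF us(1) ws(1)] us ws by auto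
    obtain N qs rs where IH: "set qs \<subseteq> Pol J" "set rs \<subseteq> Pol J" "length rs \<le> length as"
      "\<forall>v\<in>Pts J. \<forall>x\<in>carrier K. c v [^] (N::nat) \<otimes> ceval ts v x =
       ceval qs v x \<otimes> ceval (as @ [c]) v x
       \<oplus> ceval rs v x"
      using Suc(1)[OF ts(2)[symmetric] ts(1)] by blast
    have cl: "(\<lambda>v. c v [^] N \<otimes> l v) \<in> Pol J" using l assms by (intro Pol_mult Pol_pow)
    have z1: "set (z @ [\<lambda>v. \<one>]) \<subseteq> Pol J" using zP by simp
    \<comment> \<open>The new term l x^k of the quotient, multiplied by the power of
      \<open>c\<close> that the division of \<open>ts\<close> requires.\<close>
    obtain ys where ys: "set ys \<subseteq> Pol J"
      "\<forall>v\<in>Pts J. \<forall>x\<in>carrier K. ceval ys v x =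
        (c v [^] N \<otimes> l v) \<otimes> ceval (z @ [\<lambda>v. \<one>]) v x"
      using coeffs_scale[OF z1 cl] by auto
    obtain qs' where qs': "set qs' \<subseteq> Pol J"
      "\<forall>v\<in>Pts J. \<forall>x\<in>carrier K. ceval qs' v x =
         ceval qs v x \<oplus> ceval ys v x"
      using coeffs_add[OF IH(1) ys(1)] by auto
    show ?thesis
    proof (rule exI[of _ "Suc N"], rule exI[of _ qs'], rule exI[of _ rs], intro conjI ballI)
      show "set qs' \<subseteq> Pol J" "set rs \<subseteq> Pol J" "length rs \<le> length as" using qs' IH by auto
      fix v x assume v: "v \<in> Pts J" and x: "x \<in> carrier K"
      note cc = coeffs_closed[OF _ v]
      define A where "A = ceval as v x"
      define F' where "F' = ceval fs' v x"
      define Q where "Q = ceval qs v x"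
      define R where "R = ceval rs v x"
      define Xk where "Xk = x [^] k"
      define Xa where "Xa = x [^] length as"
      define C where "C = c v"
      define L where "L = l v"
      define CN where "CN = C [^] N"
      have mem: "A \<in> carrier K" "F' \<in> carrier K" "Q \<in> carrier K" "R \<in> carrier K" "Xk \<in> carrier K"
        "Xa \<in> carrier K" "C \<in> carrier K" "L \<in> carrier K" "CN \<in> carrier K"
        unfolding A_def F'_def Q_def R_def Xk_def Xa_def C_def L_def CN_def
        using horner_closed[OF cc[OF assms(1)] x] horner_closed[OF cc[OF fs'] x]
          horner_closed[OF cc[OF IH(1)] x] horner_closed[OF cc[OF IH(2)] x] x
          Pol_closed[OF assms(2) v] Pol_closed[OF l v] by auto
      have P: "ceval (as @ [c]) v x = A \<oplus> Xa \<otimes> C"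
        using horner_append[OF cc[OF assms(1)], of "[c v]" x] x mem
        unfolding A_def Xa_def C_def by simp
      have F: "ceval fs v x = F' \<oplus> (Xk \<otimes> Xa) \<otimes> L"
        using horner_append[OF cc[OF fs'], of "[l v]" x] x mem
        unfolding F'_def Xa_def Xk_def L_def fl k nat_pow_mult[OF x] using fl k by simp
      have Y: "ceval ys v x = (CN \<otimes> L) \<otimes> Xk"
        using ys(2) v x z[of "[\<lambda>v. \<one>]", OF _ v x] Pol_const[OF one_closed] mem
        unfolding CN_def C_def L_def Xk_def by simp
      have T: "ceval ts v x = C \<otimes> F' \<oplus> \<ominus> \<one> \<otimes> L \<otimes> (Xk \<otimes> A)"
        using ts(3) us(3) ws(3) v x z[OF assms(1) v x] unfolding C_def F'_def L_def Xk_def A_def by simp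
      have IH': "CN \<otimes> (C \<otimes> F' \<oplus> \<ominus> \<one> \<otimes> L \<otimes> (Xk \<otimes> A)) = Q \<otimes> (A \<oplus> Xa \<otimes> C) \<oplus> R"
        using IH(4)[rule_format, OF v x] unfolding T P Q_def[symmetric] R_def[symmetric]
          C_def[symmetric] CN_def[symmetric] .
      have "c v [^] Suc N \<otimes> ceval fs v x = (CN \<otimes> C) \<otimes> (F' \<oplus> (Xk \<otimes> Xa) \<otimes> L)"
        unfolding F CN_def C_def by simp
      also have "\<dots> = CN \<otimes> (C \<otimes> F' \<oplus> \<ominus> \<one> \<otimes> L \<otimes> (Xk \<otimes> A)) \<oplus> ((CN \<otimes> L) \<otimes> Xk) \<otimes> (A \<oplus> Xa \<otimes> C)"
        using mem by algebra
      also have "\<dots> = (Q \<oplus> (CN \<otimes> L) \<otimes> Xk) \<otimes> (A \<oplus> Xa \<otimes> C) \<oplus> R"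
        unfolding IH' using mem by algebra
      also have "\<dots> = ceval qs' v x \<otimes> ceval (as @ [c]) v x
          \<oplus> ceval rs v x"
        using qs'(2)[rule_format, OF v x] Y unfolding P Q_def R_def by simp
      finally show "c v [^] Suc N \<otimes> ceval fs v x = \<dots>" .
    qed
  qed
qed

end

section \<open>Extension of points\<close>

lemma (in cring) add_diff_cancel:
  "b \<in> carrier R \<Longrightarrow> a \<in> carrier R \<Longrightarrow> a \<oplus> b \<ominus> a = b"
  by algebra

context acf
begin

text \<open>A prime ideal of the coordinate ring of K^F. Closure under agreement on
  \<open>Pts F\<close> identifies expressions that differ only at valuations outside the
  field.\<close>

definition prime_id :: "'i set \<Rightarrow> (('i \<Rightarrow> 'k) \<Rightarrow> 'k) set \<Rightarrow> bool" where
  "prime_id F I \<longleftrightarrow> I \<subseteq> Pol F \<and> (\<lambda>v. \<zero>) \<in> I \<and> (\<lambda>v. \<one>) \<notin> I \<and>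
     (\<forall>p\<in>Pol F. \<forall>q\<in>I. (\<forall>v\<in>Pts F. p v = q v) \<longrightarrow> p \<in> I) \<and>
     (\<forall>p\<in>I. \<forall>q\<in>I. (\<lambda>v. p v \<oplus> q v) \<in> I) \<and>
     (\<forall>p\<in>Pol F. \<forall>q\<in>I. (\<lambda>v. p v \<otimes> q v) \<in> I) \<and>
     (\<forall>p\<in>Pol F. \<forall>q\<in>Pol F. (\<lambda>v. p v \<otimes> q v) \<in> I \<longrightarrow> p \<in> I \<or> q \<in> I)"

text \<open>The points of the projection to \<open>K\<^sup>J\<close>, up to closure, of the zero set of \<open>I\<close>; the coordinates
  outside \<open>J\<close> are arbitrary.\<close>

definition zeros :: "'i set \<Rightarrow> (('i \<Rightarrow> 'k) \<Rightarrow> 'k) set \<Rightarrow> 'i set \<Rightarrow> ('i \<Rightarrow> 'k) set" where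
  "zeros F I J = {v \<in> Pts F. \<forall>p\<in>I \<inter> Pol J. p v = \<zero>}"

text \<open>Transcendence of \<open>b\<close> over \<open>J\<close> in the fraction field of the
  quotient by \<open>I\<close>: a relation for \<open>b\<close> with coefficients in
  \<open>J\<close> is trivial modulo \<open>I\<close>.\<close>

definition transc :: "(('i \<Rightarrow> 'k) \<Rightarrow> 'k) set \<Rightarrow> 'i set \<Rightarrow> 'i \<Rightarrow> bool" where
  "transc I J b \<longleftrightarrow> (\<forall>as. set as \<subseteq> Pol J \<longrightarrow>
     (\<lambda>v. ceval as v (v b)) \<in> I \<longrightarrow> set as \<subseteq> I)"

lemma prime_idD:
  assumes "prime_id F I"
  shows "I \<subseteq> Pol F" "(\<lambda>v. \<zero>) \<in> I" "(\<lambda>v. \<one>) \<notin> I"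
    and "p \<in> Pol F \<Longrightarrow> q \<in> I \<Longrightarrow> (\<And>v. v \<in> Pts F \<Longrightarrow> p v = q v) \<Longrightarrow> p \<in> I"
    and "p \<in> I \<Longrightarrow> q \<in> I \<Longrightarrow> (\<lambda>v. p v \<oplus> q v) \<in> I"
    and "p \<in> Pol F \<Longrightarrow> q \<in> I \<Longrightarrow> (\<lambda>v. p v \<otimes> q v) \<in> I"
    and "p \<in> Pol F \<Longrightarrow> q \<in> Pol F \<Longrightarrow> (\<lambda>v. p v \<otimes> q v) \<in> I \<Longrightarrow> p \<in> I \<or> q \<in> I"
  using assms unfolding prime_id_def by blast+

lemma prime_id_mult_not_in:
  "prime_id F I \<Longrightarrow> p \<in> Pol F \<Longrightarrow> q \<in> Pol F \<Longrightarrow> p \<notin> I \<Longrightarrow> q \<notin> I \<Longrightarrow> (\<lambda>v. p v \<otimes> q v) \<notin> I"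
  using prime_idD(7) by blast

lemma prime_id_pow_not_in:
  assumes "prime_id F I" "p \<in> Pol F" "p \<notin> I"
  shows "(\<lambda>v. p v [^] (n::nat)) \<notin> I"
proof (induction n)
  case 0
  then show ?case using prime_idD(3)[OF assms(1)] by simp
next
  case (Suc n)
  then show ?case
    using prime_id_mult_not_in[OF assms(1) Pol_pow[OF assms(2)] assms(2) Suc assms(3)] by simp
qed

lemma prime_id_horner:
  assumes "prime_id F I" "set as \<subseteq> I" "b \<in> F"
  shows "(\<lambda>v. ceval as v (v b)) \<in> I"
  using assms(2)
proof (induction as)
  case Nil
  then show ?case using prime_idD(2)[OF assms(1)] by simp
next
  case (Cons a as)
  then have "(\<lambda>v. v b \<otimes> ceval as v (v b)) \<in> I"
    by (intro prime_idD(6)[OF assms(1), of "\<lambda>v. v b"] Pol_var assms(3)) auto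
  then show ?case using prime_idD(5)[OF assms(1), of a] Cons.prems by simp
qed

lemma prime_id_diff:
  assumes "prime_id F I" "p \<in> Pol F" "q \<in> I" "r \<in> I" "\<And>v. v \<in> Pts F \<Longrightarrow> r v = p v \<oplus> q v"
  shows "p \<in> I"
proof -
  have P: "q \<in> Pol F" "r \<in> Pol F" using prime_idD(1)[OF assms(1)] assms by auto
  have "(\<lambda>v. \<ominus> \<one> \<otimes> q v) \<in> I"
    by (intro prime_idD(6)[OF assms(1), of "\<lambda>v. \<ominus> \<one>"] Pol_const assms(3)) auto
  from prime_idD(5)[OF assms(1) assms(4) this] have "(\<lambda>v. r v \<oplus> \<ominus> \<one> \<otimes> q v) \<in> I" .
  then show ?thesis
  proof (rule prime_idD(4)[OF assms(1,2)])
    fix v :: "'a \<Rightarrow> 'k" assume v: "v \<in> Pts F"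
    have "p v \<in> carrier K" "q v \<in> carrier K" using Pol_closed assms(2) P v by auto
    then have "(p v \<oplus> q v) \<oplus> \<ominus> \<one> \<otimes> q v = p v" by algebra
    then show "p v = r v \<oplus> \<ominus> \<one> \<otimes> q v" using assms(5)[OF v] by simp
  qed
qed

lemma prime_id_horner_not_in:
  assumes "prime_id F I" "set as \<subseteq> Pol F" "b \<in> F"
    and "(\<lambda>v. ceval as v (v b)) \<notin> I"
  shows "\<exists>a\<in>set as. a \<notin> I"
  using prime_id_horner[OF assms(1) _ assms(3)] assms by blast

lemma zerosI: "v \<in> Pts F \<Longrightarrow> (\<And>p. p \<in> I \<Longrightarrow> p \<in> Pol J \<Longrightarrow> p v = \<zero>) \<Longrightarrow> v \<in> zeros F I J"
  unfolding zeros_def by auto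

lemma zerosD: "v \<in> zeros F I J \<Longrightarrow> p \<in> I \<Longrightarrow> p \<in> Pol J \<Longrightarrow> p v = \<zero>"
  unfolding zeros_def by auto

lemma zeros_Pts: "v \<in> zeros F I J \<Longrightarrow> v \<in> Pts F"
  unfolding zeros_def by auto

lemma zeros_anti: "J \<subseteq> J' \<Longrightarrow> zeros F I J' \<subseteq> zeros F I J"
  unfolding zeros_def using Pol_mono by blast

text \<open>The coefficients do not see the coordinate \<open>b\<close>, so for fixed
  \<open>v\<close> one list describes \<open>h\<close> along the whole line on which only
  \<open>b\<close> moves.\<close>

lemma Pol_insert_split:
  assumes "h \<in> Pol (insert b J)" "prime_id F I" "J \<subseteq> F" "b \<in> F" "b \<notin> J"
  shows "\<exists>as. set as \<subseteq> Pol J \<and> (\<forall>v\<in>Pts F. h v = ceval as v (v b)) \<and>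
    (\<forall>v\<in>Pts F. \<forall>x\<in>carrier K. h (v(b := x)) = ceval as v x) \<and>
    (h \<in> I \<longleftrightarrow> (\<lambda>v. ceval as v (v b)) \<in> I)"
proof -
  obtain as where as: "set as \<subseteq> Pol J"
    "\<And>v. v \<in> Pts (insert b J) \<Longrightarrow> h v = ceval as v (v b)"
    using Pol_insert_coeffs[OF assms(1)] by blast
  have 1: "h v = ceval as v (v b)" if "v \<in> Pts F" for v
    using as(2) Pts_mono[of "insert b J" F v] that assms by auto
  have 2: "h (v(b := x)) = ceval as v x" if "v \<in> Pts F" "x \<in> carrier K" for v x
  proof -
    have m: "map (\<lambda>a. a (v(b := x))) as = map (\<lambda>a. a v) as"
      using as(1) Pol_upd[OF _ assms(5)] by (intro map_cong) auto
    show ?thesis using 1[OF Pts_upd[OF that, of b]] unfolding m by simp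
  qed
  have hF: "h \<in> Pol F" using Pol_mono[OF _ assms(1)] assms by auto
  have HF: "(\<lambda>v. ceval as v (v b)) \<in> Pol F"
    using Pol_horner[OF as(1) assms(3,4)] .
  have 3: "h \<in> I \<longleftrightarrow> (\<lambda>v. ceval as v (v b)) \<in> I"
    using prime_idD(4)[OF assms(2) hF _ 1] prime_idD(4)[OF assms(2) HF _ 1[symmetric]] by blast
  show ?thesis using as(1) 1 2 3 by blast
qed

text \<open>By transcendence a member of \<open>I\<close> in the larger set of variables has all its
  coefficients in \<open>I\<close>. They vanish at \<open>v\<close>, so the new coordinate is
  free.\<close>

lemma transc_extend:
  assumes I: "prime_id F I" "J \<subseteq> F" "b \<in> F" "b \<notin> J" and t: "transc I J b"
    and v: "v \<in> zeros F I J" and x: "x \<in> carrier K"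
  shows "v(b := x) \<in> zeros F I (insert b J)"
proof (rule zerosI)
  note vP = zeros_Pts[OF v]
  show "v(b := x) \<in> Pts F" using vP x by (rule Pts_upd)
  fix p assume p: "p \<in> I" "p \<in> Pol (insert b J)"
  obtain as where as: "set as \<subseteq> Pol J" "\<forall>v\<in>Pts F. p v = ceval as v (v b)"
      "\<forall>v\<in>Pts F. \<forall>x\<in>carrier K. p (v(b := x)) = ceval as v x"
      "p \<in> I \<longleftrightarrow> (\<lambda>v. ceval as v (v b)) \<in> I"
    using Pol_insert_split[OF p(2) I] by blast
  have "set as \<subseteq> I" using t as p unfolding transc_def by blast
  then have "set (map (\<lambda>a. a v) as) \<subseteq> {\<zero>}" using zerosD[OF v] as(1) by auto
  then show "p (v(b := x)) = \<zero>" using as(3)[rule_format, OF vP x] horner_all_zero[of "map (\<lambda>a. a v) as" x] x by simp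
qed

text \<open>\<open>g\<close> is a coefficient of \<open>h\<close> outside \<open>I\<close>; where it
  does not vanish, \<open>h\<close> is a nonzero polynomial in the coordinate
  \<open>b\<close>.\<close>

lemma nonzero_cofinite:
  assumes I: "prime_id F I" "J \<subseteq> F" "b \<in> F" "b \<notin> J"
    and h: "h \<in> Pol (insert b J)" "h \<notin> I"
  shows "\<exists>g\<in>Pol J - I. \<forall>v\<in>Pts F. g v \<noteq> \<zero> \<longrightarrow> finite {x \<in> carrier K. h (v(b := x)) = \<zero>}"
proof -
  obtain as where as: "set as \<subseteq> Pol J" "\<forall>v\<in>Pts F. h v = ceval as v (v b)"
      "\<forall>v\<in>Pts F. \<forall>x\<in>carrier K. h (v(b := x)) = ceval as v x"
      "h \<in> I \<longleftrightarrow> (\<lambda>v. ceval as v (v b)) \<in> I"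
    using Pol_insert_split[OF h(1) I] by blast
  have "set as \<subseteq> Pol F" using as(1) Pol_mono[OF I(2)] by auto
  then obtain g where g: "g \<in> set as" "g \<notin> I"
    using prime_id_horner_not_in[OF I(1) _ I(3)] as h by blast
  have "finite {x \<in> carrier K. h (v(b := x)) = \<zero>}" if v: "v \<in> Pts F" "g v \<noteq> \<zero>" for v
  proof -
    have "finite {x \<in> carrier K. ceval as v x = \<zero>}"
      using g(1) v coeffs_closed[OF as(1) Pts_mono[OF I(2) v(1)]] by (intro horner_finite_roots) auto
    moreover have "{x \<in> carrier K. h (v(b := x)) = \<zero>} = {x \<in> carrier K. ceval as v x = \<zero>}"
      using as(3)[rule_format, OF v(1)] by auto
    ultimately show ?thesis by simp
  qed
  then show ?thesis using g as(1) by blast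
qed

text \<open>Finite extensions are open away from the zeros of the leading coefficient \<open>c\<close> of a minimal
  polynomial \<open>P\<close> of \<open>b\<close>: some coefficient of the remainder of \<open>c\<^sup>N h\<^sup>n\<close> modulo \<open>P\<close>, where \<open>n\<close> is the
  degree of \<open>P\<close>, does not vanish.\<close>

lemma algebraic_extend:
  assumes I: "prime_id F I" "J \<subseteq> F" "b \<in> F" "b \<notin> J" and t: "\<not> transc I J b"
  shows "\<exists>c\<in>Pol J - I. \<forall>M h. prime_id F M \<longrightarrow> I \<subseteq> M \<longrightarrow> c \<notin> M \<longrightarrow> h \<in> Pol (insert b J) \<longrightarrow> h \<notin> M \<longrightarrow>
       (\<exists>g\<in>Pol J - M. \<forall>v\<in>zeros F I J. g v \<noteq> \<zero> \<longrightarrow>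
         (\<exists>x\<in>carrier K. v(b := x) \<in> zeros F I (insert b J) \<and> h (v(b := x)) \<noteq> \<zero>))"
proof -
  let ?H = "\<lambda>as v. ceval as v (v b)"
  define rel where "rel = (\<lambda>as. set as \<subseteq> Pol J \<and> ?H as \<in> I \<and> \<not> set as \<subseteq> I)"
  have "\<exists>as. rel as" using t unfolding transc_def rel_def by blast
  \<comment> \<open>A nontrivial relation of least length; every shorter relation has all its
    coefficients in \<open>I\<close>.\<close>
  then obtain as0 where as0: "rel as0" "\<And>bs. length bs < length as0 \<Longrightarrow> \<not> rel bs"
    using ex_has_least_nat[of rel _ length] by (metis not_less)
  have "as0 \<noteq> []" using as0(1) unfolding rel_def by auto
  then obtain as c where ac: "as0 = as @ [c]" by (meson rev_exhaust)
  have asP: "set as \<subseteq> Pol J" and cP: "c \<in> Pol J" using as0(1) ac unfolding rel_def by auto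
  have JF: "p \<in> Pol F" if "p \<in> Pol J" for p using Pol_mono[OF I(2) that] .
  have small: "set bs \<subseteq> I" if "set bs \<subseteq> Pol J" "?H bs \<in> I" "length bs \<le> length as" for bs
    using as0(2)[of bs] that ac unfolding rel_def by auto
  have PI: "?H (as @ [c]) \<in> I" using as0(1) ac unfolding rel_def by simp
  have HF: "?H bs \<in> Pol F" if "set bs \<subseteq> Pol J" for bs using Pol_horner[OF that I(2,3)] .
  \<comment> \<open>Otherwise dropping the leading term would leave a shorter relation, hence a
    trivial one, and the whole relation would be trivial.\<close>
  have cI: "c \<notin> I"
  proof
    assume c: "c \<in> I"
    have "(\<lambda>v. v b [^] length as \<otimes> c v) \<in> I"
      using c by (intro prime_idD(6)[OF I(1), of "\<lambda>v. v b [^] length as"] Pol_pow Pol_var I(3))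
    from prime_id_diff[OF I(1) HF[OF asP] this PI] have "?H as \<in> I"
    proof -
      have "?H (as @ [c]) v = ?H as v \<oplus> v b [^] length as \<otimes> c v" if v: "v \<in> Pts F" for v
      proof -
        have "v b \<in> carrier K" "c v \<in> carrier K"
          using v I(3) Pol_closed[OF JF[OF cP] v] unfolding Pts_def by auto
        then show ?thesis using horner_append[OF coeffs_closed[OF asP Pts_mono[OF I(2) v]], of "[c v]" "v b"]
          by simp
      qed
      then show ?thesis using \<open>(\<And>v. v \<in> Pts F \<Longrightarrow> ?H (as @ [c]) v = ?H as v \<oplus> v b [^] length as \<otimes> c v) \<Longrightarrow> ?H as \<in> I\<close> by blast
    qed
    then have "set as \<subseteq> I" using small asP by auto
    then show False using as0(1) ac c unfolding rel_def by auto
  qed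
  \<comment> \<open>Where \<open>c\<close> does not vanish, a root of P extends the point: the
    pseudo-remainder of a member of \<open>I\<close> is again a relation, too short to be
    nontrivial, so it vanishes at \<open>v\<close>.\<close>
  have extend: "v(b := x) \<in> zeros F I (insert b J)"
    if v: "v \<in> zeros F I J" and x: "x \<in> carrier K" and cv: "c v \<noteq> \<zero>"
      and P0: "ceval (as @ [c]) v x = \<zero>" for v x
  proof (rule zerosI)
    note vP = zeros_Pts[OF v]
    note vJ = Pts_mono[OF I(2) vP]
    show "v(b := x) \<in> Pts F" using vP x by (rule Pts_upd)
    fix f assume f: "f \<in> I" "f \<in> Pol (insert b J)"
    obtain fs where fs: "set fs \<subseteq> Pol J" "\<forall>v\<in>Pts F. f v = ceval fs v (v b)"
      "\<forall>v\<in>Pts F. \<forall>x\<in>carrier K. f (v(b := x)) = ceval fs v x"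
      "f \<in> I \<longleftrightarrow> (\<lambda>v. ceval fs v (v b)) \<in> I"
    using Pol_insert_split[OF f(2) I] by blast
    obtain N qs rs where d: "set qs \<subseteq> Pol J" "set rs \<subseteq> Pol J" "length rs \<le> length as"
      "\<forall>v\<in>Pts J. \<forall>x\<in>carrier K. c v [^] (N::nat) \<otimes> ceval fs v x =
       ceval qs v x \<otimes> ceval (as @ [c]) v x
       \<oplus> ceval rs v x"
      using pseudo_division[OF asP cP fs(1)] by blast
    have 1: "(\<lambda>v. c v [^] N \<otimes> ?H fs v) \<in> I"
      using fs(4) f(1) by (intro prime_idD(6)[OF I(1), of "\<lambda>v. c v [^] N"] Pol_pow JF cP) auto
    have 2: "(\<lambda>v. ?H qs v \<otimes> ?H (as @ [c]) v) \<in> I"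
      by (intro prime_idD(6)[OF I(1) HF[OF d(1)] PI])
    have 3: "c v [^] N \<otimes> ?H fs v = ?H rs v \<oplus> ?H qs v \<otimes> ?H (as @ [c]) v" if v: "v \<in> Pts F" for v
    proof -
      have vb: "v b \<in> carrier K" using v I(3) unfolding Pts_def by auto
      have "?H rs v \<in> carrier K" "?H qs v \<in> carrier K" "?H (as @ [c]) v \<in> carrier K"
        using Pol_closed[OF HF v] d asP cP by (auto simp del: map_append)
      then show ?thesis using d(4)[rule_format, OF Pts_mono[OF I(2) v] vb]
        by (simp add: a_comm)
    qed
    from prime_id_diff[OF I(1) HF[OF d(2)] 2 1 3] have "?H rs \<in> I" .
    then have "set rs \<subseteq> I" using small d by auto
    then have "set (map (\<lambda>a. a v) rs) \<subseteq> {\<zero>}" using zerosD[OF v] d(2) by auto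
    then have "ceval rs v x = \<zero>" using horner_all_zero x by simp
    moreover have "ceval qs v x \<in> carrier K" "ceval fs v x \<in> carrier K"
      using horner_coeffs_closed[OF _ vJ x] d(1) fs(1) by auto
    ultimately have "c v [^] N \<otimes> ceval fs v x = \<zero>"
      using d(4)[rule_format, OF vJ x] P0 by simp
    moreover have "c v [^] N \<noteq> \<zero>"
      using cv Pol_closed[OF cP vJ] by (induction N) (auto simp: integral_iff)
    ultimately have "ceval fs v x = \<zero>"
      using integral Pol_closed[OF cP vJ] \<open>ceval fs v x \<in> carrier K\<close> nat_pow_closed by metis
    then show "f (v(b := x)) = \<zero>" using fs(3)[rule_format, OF vP x] by simp
  qed
  \<comment> \<open>\<open>c\<close> depends only on \<open>I\<close>, while M ranges over the
    primes above it. With the ideal of a point for M this becomes openness of the projection at that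
    point.\<close>
  have main: "\<exists>g\<in>Pol J - M. \<forall>v\<in>zeros F I J. g v \<noteq> \<zero> \<longrightarrow>
         (\<exists>x\<in>carrier K. v(b := x) \<in> zeros F I (insert b J) \<and> h (v(b := x)) \<noteq> \<zero>)"
    if M: "prime_id F M" "I \<subseteq> M" "c \<notin> M" and h: "h \<in> Pol (insert b J)" "h \<notin> M" for M h
  proof -
    define n where "n = length as"
    have hn: "(\<lambda>v. h v [^] n) \<in> Pol (insert b J)" using h by (intro Pol_pow)
    have hF: "h \<in> Pol F" using Pol_mono[OF _ h(1)] I by auto
    obtain fs where fs: "set fs \<subseteq> Pol J" "\<forall>v\<in>Pts F. h v [^] n = ceval fs v (v b)"
      "\<forall>v\<in>Pts F. \<forall>x\<in>carrier K. h (v(b := x)) [^] n = ceval fs v x"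
      "(\<lambda>v. h v [^] n) \<in> I \<longleftrightarrow> (\<lambda>v. ceval fs v (v b)) \<in> I"
    using Pol_insert_split[OF hn I] by blast
    obtain hs where hs: "set hs \<subseteq> Pol J" "\<forall>v\<in>Pts F. h v = ceval hs v (v b)"
      "\<forall>v\<in>Pts F. \<forall>x\<in>carrier K. h (v(b := x)) = ceval hs v x"
      "h \<in> I \<longleftrightarrow> (\<lambda>v. ceval hs v (v b)) \<in> I"
    using Pol_insert_split[OF h(1) I] by blast
    obtain N qs rs where d: "set qs \<subseteq> Pol J" "set rs \<subseteq> Pol J" "length rs \<le> length as"
      "\<forall>v\<in>Pts J. \<forall>x\<in>carrier K. c v [^] (N::nat) \<otimes> ceval fs v x =
       ceval qs v x \<otimes> ceval (as @ [c]) v x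
       \<oplus> ceval rs v x"
      using pseudo_division[OF asP cP fs(1)] by blast
    \<comment> \<open>A remainder in M would put c^N h^n into M, against primality.\<close>
    have "?H rs \<notin> M"
    proof
      assume a: "?H rs \<in> M"
      have "?H (as @ [c]) \<in> M" using PI M(2) by auto
      then have "(\<lambda>v. ?H qs v \<otimes> ?H (as @ [c]) v) \<in> M" by (intro prime_idD(6)[OF M(1) HF[OF d(1)]])
      from prime_idD(5)[OF M(1) this a] have s: "(\<lambda>v. ?H qs v \<otimes> ?H (as @ [c]) v \<oplus> ?H rs v) \<in> M" .
      have cM: "(\<lambda>v. c v [^] N \<otimes> h v [^] n) \<in> Pol F" by (intro Pol_mult Pol_pow JF cP hF)
      have "(\<lambda>v. c v [^] N \<otimes> h v [^] n) \<in> M"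
      proof (rule prime_idD(4)[OF M(1) cM s])
        fix v assume v: "v \<in> Pts F"
        have vb: "v b \<in> carrier K" using v I(3) unfolding Pts_def by auto
        show "c v [^] N \<otimes> h v [^] n = ?H qs v \<otimes> ?H (as @ [c]) v \<oplus> ?H rs v"
          unfolding fs(2)[rule_format, OF v] using d(4)[rule_format, OF Pts_mono[OF I(2) v] vb] .
      qed
      then show False
        using prime_id_mult_not_in[OF M(1) Pol_pow[OF JF[OF cP]] Pol_pow[OF hF]
          prime_id_pow_not_in[OF M(1) JF[OF cP] M(3)] prime_id_pow_not_in[OF M(1) hF h(2)]] by blast
    qed
    moreover have "set rs \<subseteq> Pol F" using d(2) JF by auto
    ultimately obtain r where r: "r \<in> set rs" "r \<notin> M"
      using prime_id_horner_not_in[OF M(1) _ I(3)] by blast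
    have rP: "r \<in> Pol J" using r d by auto
    \<comment> \<open>The factor \<open>c\<close> preserves the degree of P at \<open>v\<close>, the
      factor \<open>r\<close> keeps the remainder from vanishing there.\<close>
    have g: "(\<lambda>v. c v \<otimes> r v) \<in> Pol J - M"
      using prime_id_mult_not_in[OF M(1) JF[OF cP] JF[OF rP] M(3) r(2)] Pol_mult[OF cP rP] by simp
    have "\<exists>x\<in>carrier K. v(b := x) \<in> zeros F I (insert b J) \<and> h (v(b := x)) \<noteq> \<zero>"
      if v: "v \<in> zeros F I J" and gv: "c v \<otimes> r v \<noteq> \<zero>" for v
    proof (rule ccontr)
      \<comment> \<open>Every root of P extends the point by \<open>extend\<close>. If
        \<open>h\<close> vanished at all these roots, the remainder of c^N h^n modulo P would be
        zero.\<close>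
      assume neg: "\<not> ?thesis"
      note vP = zeros_Pts[OF v]
      note vJ = Pts_mono[OF I(2) vP]
      note cl = coeffs_closed[OF _ vJ]
      have cv: "c v \<in> carrier K" "r v \<in> carrier K" using Pol_closed[OF cP vJ] Pol_closed[OF rP vJ] by auto
      have nz: "c v \<noteq> \<zero>" "r v \<noteq> \<zero>" using gv cv by auto
      have "r v = \<zero>"
      proof (rule root_multiple_remainder_zero[of "map (\<lambda>a. a v) as" "c v" n "map (\<lambda>a. a v) rs"
            "\<lambda>x. c v [^] N" "\<lambda>x. ceval hs v x" "\<lambda>x. ceval qs v x"])
        show "set (map (\<lambda>a. a v) as) \<subseteq> carrier K" "set (map (\<lambda>a. a v) rs) \<subseteq> carrier K"
          using cl asP d by blast+
        show "(\<lambda>x. ceval hs v x) \<in> poly1 K" "(\<lambda>x. ceval qs v x) \<in> poly1 K"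
          using poly1_horner[OF cl[OF hs(1)]] poly1_horner[OF cl[OF d(1)]] .
        show "(\<lambda>x. c v [^] N) \<in> poly1 K" using cv by (intro poly1_const nat_pow_closed)
        show "r v \<in> set (map (\<lambda>a. a v) rs)" using r by auto
        show "length (map (\<lambda>a. a v) as) = n" "length (map (\<lambda>a. a v) rs) \<le> n" using d unfolding n_def by auto
        show "c v \<in> carrier K" "c v \<noteq> \<zero>" by fact+
        fix x assume x: "x \<in> carrier K"
        have cc: "ceval qs v x \<in> carrier K" "ceval rs v x \<in> carrier K"
          "ceval (as @ [c]) v x \<in> carrier K"
          using horner_coeffs_closed[OF _ vJ x] d asP cP by (auto simp del: map_append)
        have "c v [^] N \<otimes> ceval fs v x \<ominus>
            ceval qs v x \<otimes> ceval (as @ [c]) v x = ceval rs v x"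
          unfolding d(4)[rule_format, OF vJ x] using cc(2) m_closed[OF cc(1,3)]
          by (rule add_diff_cancel)
        then show "ceval rs v x = c v [^] N \<otimes> ceval hs v x [^] n \<ominus>
          ceval qs v x \<otimes> horner K (map (\<lambda>a. a v) as @ [c v]) x"
          using fs(3)[rule_format, OF vP x] hs(3)[rule_format, OF vP x] by simp
        assume "horner K (map (\<lambda>a. a v) as @ [c v]) x = \<zero>"
        then have "v(b := x) \<in> zeros F I (insert b J)" using extend[OF v x nz(1)] by simp
        then show "ceval hs v x = \<zero>" using neg x hs(3)[rule_format, OF vP x] by auto
      qed
      then show False using nz by simp
    qed
    then show ?thesis by (intro bexI[OF _ g]) blast
  qed
  from main have "\<forall>M h. prime_id F M \<longrightarrow> I \<subseteq> M \<longrightarrow> c \<notin> M \<longrightarrow> h \<in> Pol (insert b J) \<longrightarrow> h \<notin> M \<longrightarrow>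
       (\<exists>g\<in>Pol J - M. \<forall>v\<in>zeros F I J. g v \<noteq> \<zero> \<longrightarrow>
         (\<exists>x\<in>carrier K. v(b := x) \<in> zeros F I (insert b J) \<and> h (v(b := x)) \<noteq> \<zero>))" by simp
  then show ?thesis by (rule bexI[of _ c]) (simp add: cP cI)
qed

text \<open>A transcendental coordinate may take all but finitely many values; for an algebraic one
  \<open>algebraic_extend\<close> is used with M = I.\<close>

lemma extend_one:
  assumes I: "prime_id F I" "J \<subseteq> F" "b \<in> F" "b \<notin> J" and h: "h \<in> Pol (insert b J)" "h \<notin> I"
  shows "\<exists>g\<in>Pol J - I. \<forall>v\<in>zeros F I J. g v \<noteq> \<zero> \<longrightarrow>
         (\<exists>x\<in>carrier K. v(b := x) \<in> zeros F I (insert b J) \<and> h (v(b := x)) \<noteq> \<zero>)"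
proof (cases "transc I J b")
  case True
  obtain g where g: "g \<in> Pol J" "g \<notin> I"
    "\<forall>v\<in>Pts F. g v \<noteq> \<zero> \<longrightarrow> finite {x \<in> carrier K. h (v(b := x)) = \<zero>}"
    using nonzero_cofinite[OF I h] by blast
  have "\<exists>x\<in>carrier K. v(b := x) \<in> zeros F I (insert b J) \<and> h (v(b := x)) \<noteq> \<zero>"
    if v: "v \<in> zeros F I J" "g v \<noteq> \<zero>" for v
  proof -
    obtain x where "x \<in> carrier K" "h (v(b := x)) \<noteq> \<zero>"
    proof (rule ccontr)
      assume "\<not> thesis"
      then have "carrier K \<subseteq> {x \<in> carrier K. h (v(b := x)) = \<zero>}" using that by auto
      then show False using g(3)[rule_format, OF zeros_Pts[OF v(1)] v(2)] infinite_carrier finite_subset by blast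
    qed
    then show ?thesis using transc_extend[OF I True v(1)] by blast
  qed
  then show ?thesis using g by blast
next
  case False
  obtain c where c: "c \<in> Pol J - I" and
    cM: "\<forall>M h. prime_id F M \<longrightarrow> I \<subseteq> M \<longrightarrow> c \<notin> M \<longrightarrow> h \<in> Pol (insert b J) \<longrightarrow> h \<notin> M \<longrightarrow>
       (\<exists>g\<in>Pol J - M. \<forall>v\<in>zeros F I J. g v \<noteq> \<zero> \<longrightarrow>
         (\<exists>x\<in>carrier K. v(b := x) \<in> zeros F I (insert b J) \<and> h (v(b := x)) \<noteq> \<zero>))"
    by (rule bexE[OF algebraic_extend[OF I False]])
  have "c \<notin> I" using c by simp
  from cM[rule_format, OF I(1) order_refl this h] show ?thesis .
qed

text \<open>A form of Chevalley's theorem: the projection to K^J covers a dense open part of its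
  closure, even with \<open>h\<close> kept nonzero. The coordinates in \<open>D\<close> are added
  one by one, and the condition on \<open>h\<close> is pushed down to a condition in
  \<open>J\<close>.\<close>

lemma extend_generic:
  assumes "finite D" "prime_id F I" "J \<union> D \<subseteq> F" "h \<in> Pol (J \<union> D)" "h \<notin> I"
  shows "\<exists>g\<in>Pol J - I. \<forall>v\<in>zeros F I J. g v \<noteq> \<zero> \<longrightarrow>
         (\<exists>v'\<in>zeros F I (J \<union> D). (\<forall>j\<in>J. v' j = v j) \<and> h v' \<noteq> \<zero>)"
  using assms(1,3,4)
proof (induction D arbitrary: J rule: finite_induct)
  case empty
  then show ?case using assms(5) by (intro bexI[of _ h]) auto
next
  case (insert b D)
  show ?case
  proof (cases "b \<in> J")
    case True
    then have "J \<union> insert b D = J \<union> D" by auto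
    then show ?thesis using insert by auto
  next
    case b: False
    have e: "insert b J \<union> D = J \<union> insert b D" by auto
    obtain g' where g': "g' \<in> Pol (insert b J)" "g' \<notin> I"
      "\<forall>v\<in>zeros F I (insert b J). g' v \<noteq> \<zero> \<longrightarrow>
         (\<exists>v'\<in>zeros F I (J \<union> insert b D). (\<forall>j\<in>insert b J. v' j = v j) \<and> h v' \<noteq> \<zero>)"
      using insert.IH[of "insert b J"] insert.prems unfolding e by auto
    have J: "J \<subseteq> F" "b \<in> F" using insert.prems by auto
    obtain g where g: "g \<in> Pol J - I" "\<forall>v\<in>zeros F I J. g v \<noteq> \<zero> \<longrightarrow>
         (\<exists>x\<in>carrier K. v(b := x) \<in> zeros F I (insert b J) \<and> g' (v(b := x)) \<noteq> \<zero>)"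
      using extend_one[OF assms(2) J b g'(1,2)] by blast
    have "\<exists>v'\<in>zeros F I (J \<union> insert b D). (\<forall>j\<in>J. v' j = v j) \<and> h v' \<noteq> \<zero>"
      if v: "v \<in> zeros F I J" "g v \<noteq> \<zero>" for v
    proof -
      obtain x where "v(b := x) \<in> zeros F I (insert b J)" "g' (v(b := x)) \<noteq> \<zero>" using g v by blast
      then obtain v' where "v' \<in> zeros F I (J \<union> insert b D)" "\<forall>j\<in>insert b J. v' j = (v(b := x)) j" "h v' \<noteq> \<zero>"
        using g'(3) by blast
      then show ?thesis using b by (intro bexI[of _ v']) auto
    qed
    then show ?thesis using g(1) by blast
  qed
qed

lemma transc_anti: "J \<subseteq> J' \<Longrightarrow> transc I J' b \<Longrightarrow> transc I J b"
  unfolding transc_def using Pol_mono by blast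

text \<open>Along a tower of algebraic coordinates the openness statements compose, with the product
  of the single denominators as \<open>c\<close>. By \<open>transc_anti\<close> a coordinate
  algebraic over \<open>J\<close> stays algebraic when \<open>J\<close> grows.\<close>

lemma extend_algebraic:
  assumes "finite D" "prime_id F I" "J \<union> D \<subseteq> F" "\<forall>b\<in>D. b \<notin> J \<longrightarrow> \<not> transc I J b"
  shows "\<exists>c\<in>Pol (J \<union> D) - I. \<forall>M h. prime_id F M \<longrightarrow> I \<subseteq> M \<longrightarrow> c \<notin> M \<longrightarrow>
     h \<in> Pol (J \<union> D) \<longrightarrow> h \<notin> M \<longrightarrow> (\<exists>g\<in>Pol J - M. \<forall>v\<in>zeros F I J. g v \<noteq> \<zero> \<longrightarrow>
         (\<exists>v'\<in>zeros F I (J \<union> D). (\<forall>j\<in>J. v' j = v j) \<and> h v' \<noteq> \<zero>))"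
  using assms(1,3,4)
proof (induction D arbitrary: J rule: finite_induct)
  case empty
  have "(\<lambda>v. \<one>) \<in> Pol J - I" using prime_idD(3)[OF assms(2)] by simp
  then show ?case by (intro bexI[of _ "\<lambda>v. \<one>"]) auto
next
  case (insert b D)
  show ?case
  proof (cases "b \<in> J")
    case True
    then have "J \<union> insert b D = J \<union> D" by auto
    then show ?thesis using insert by auto
  next
    case b: False
    have e: "insert b J \<union> D = J \<union> insert b D" by auto
    have J: "J \<subseteq> F" "b \<in> F" "\<not> transc I J b" using insert.prems b by auto
    have a1: "insert b J \<union> D \<subseteq> F" using insert.prems by auto
    have a2: "\<forall>b'\<in>D. b' \<notin> insert b J \<longrightarrow> \<not> transc I (insert b J) b'"
      using insert.prems(2) transc_anti[of J "insert b J"] by blast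
    obtain c2 where c2': "c2 \<in> Pol (J \<union> insert b D) - I" and
      c2M: "\<forall>M h. prime_id F M \<longrightarrow> I \<subseteq> M \<longrightarrow> c2 \<notin> M \<longrightarrow>
     h \<in> Pol (J \<union> insert b D) \<longrightarrow> h \<notin> M \<longrightarrow> (\<exists>g\<in>Pol (insert b J) - M. \<forall>v\<in>zeros F I (insert b J). g v \<noteq> \<zero> \<longrightarrow>
         (\<exists>v'\<in>zeros F I (J \<union> insert b D). (\<forall>j\<in>insert b J. v' j = v j) \<and> h v' \<noteq> \<zero>))"
      by (rule bexE[OF insert.IH[OF a1 a2, unfolded e]])
    have c2: "c2 \<in> Pol (J \<union> insert b D)" "c2 \<notin> I" using c2' by auto
    obtain c1 where c1': "c1 \<in> Pol J - I" and
      c1M: "\<forall>M h. prime_id F M \<longrightarrow> I \<subseteq> M \<longrightarrow> c1 \<notin> M \<longrightarrow> h \<in> Pol (insert b J) \<longrightarrow> h \<notin> M \<longrightarrow>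
       (\<exists>g\<in>Pol J - M. \<forall>v\<in>zeros F I J. g v \<noteq> \<zero> \<longrightarrow>
         (\<exists>x\<in>carrier K. v(b := x) \<in> zeros F I (insert b J) \<and> h (v(b := x)) \<noteq> \<zero>))"
      by (rule bexE[OF algebraic_extend[OF assms(2) J(1,2) b J(3)]])
    have c1: "c1 \<in> Pol J" "c1 \<notin> I" using c1' by auto
    have c1': "c1 \<in> Pol (J \<union> insert b D)" using Pol_mono[OF _ c1(1), of "J \<union> insert b D"] by auto
    have PF: "p \<in> Pol F" if "p \<in> Pol (J \<union> insert b D)" for p using Pol_mono[OF _ that] insert.prems by auto
    have c: "(\<lambda>v. c1 v \<otimes> c2 v) \<in> Pol (J \<union> insert b D) - I"
      using prime_id_mult_not_in[OF assms(2) PF[OF c1'] PF[OF c2(1)] c1(2) c2(2)] Pol_mult[OF c1' c2(1)] by simp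
    have "\<exists>g\<in>Pol J - M. \<forall>v\<in>zeros F I J. g v \<noteq> \<zero> \<longrightarrow>
         (\<exists>v'\<in>zeros F I (J \<union> insert b D). (\<forall>j\<in>J. v' j = v j) \<and> h v' \<noteq> \<zero>)"
      if M: "prime_id F M" "I \<subseteq> M" "(\<lambda>v. c1 v \<otimes> c2 v) \<notin> M" and h: "h \<in> Pol (J \<union> insert b D)" "h \<notin> M" for M h
    proof -
      have n2: "c2 \<notin> M" using M(3) prime_idD(6)[OF M(1) PF[OF c1']] by blast
      have n1: "c1 \<notin> M"
      proof
        assume "c1 \<in> M"
        from prime_idD(6)[OF M(1) PF[OF c2(1)] this] have m: "(\<lambda>v. c2 v \<otimes> c1 v) \<in> M" .
        have "(\<lambda>v. c1 v \<otimes> c2 v) \<in> M"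
        proof (rule prime_idD(4)[OF M(1) _ m])
          show "(\<lambda>v. c1 v \<otimes> c2 v) \<in> Pol F" using c PF by auto
          show "c1 v \<otimes> c2 v = c2 v \<otimes> c1 v" if "v \<in> Pts F" for v
            using Pol_closed[OF PF[OF c1'] that] Pol_closed[OF PF[OF c2(1)] that] by (rule m_comm)
        qed
        then show False using M(3) by simp
      qed
      obtain g' where g': "g' \<in> Pol (insert b J)" "g' \<notin> M" "\<forall>v\<in>zeros F I (insert b J). g' v \<noteq> \<zero> \<longrightarrow>
         (\<exists>v'\<in>zeros F I (J \<union> insert b D). (\<forall>j\<in>insert b J. v' j = v j) \<and> h v' \<noteq> \<zero>)"
        using c2M[rule_format, OF M(1,2) n2 h] by blast
      obtain g where g: "g \<in> Pol J - M" "\<forall>v\<in>zeros F I J. g v \<noteq> \<zero> \<longrightarrow>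
         (\<exists>x\<in>carrier K. v(b := x) \<in> zeros F I (insert b J) \<and> g' (v(b := x)) \<noteq> \<zero>)"
        using c1M[rule_format, OF M(1,2) n1 g'(1,2)] by blast
      have "\<exists>v'\<in>zeros F I (J \<union> insert b D). (\<forall>j\<in>J. v' j = v j) \<and> h v' \<noteq> \<zero>"
        if v: "v \<in> zeros F I J" "g v \<noteq> \<zero>" for v
      proof -
        obtain x where "v(b := x) \<in> zeros F I (insert b J)" "g' (v(b := x)) \<noteq> \<zero>" using g v by blast
        then obtain v' where "v' \<in> zeros F I (J \<union> insert b D)" "\<forall>j\<in>insert b J. v' j = (v(b := x)) j" "h v' \<noteq> \<zero>"
          using g'(3) by blast
        then show ?thesis using b by (intro bexI[of _ v']) auto
      qed
      then show ?thesis using g(1) by blast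
    qed
    then show ?thesis by (intro bexI[OF _ c] allI impI)
  qed
qed

text \<open>The maximal ideal of a point; inserted for M it turns \<open>extend_algebraic\<close>
  into openness at that point.\<close>

lemma point_prime_id:
  assumes "w \<in> Pts F"
  shows "prime_id F {p \<in> Pol F. p w = \<zero>}"
proof -
  note cl = Pol_closed[OF _ assms]
  show ?thesis unfolding prime_id_def
  proof (intro conjI ballI impI)
    fix p q assume p: "p \<in> Pol F" and q: "q \<in> {p \<in> Pol F. p w = \<zero>}"
    then show "(\<lambda>v. p v \<otimes> q v) \<in> {p \<in> Pol F. p w = \<zero>}" using Pol_mult[of p F q] cl by simp
  next
    fix p q assume "p \<in> {p \<in> Pol F. p w = \<zero>}" "q \<in> {p \<in> Pol F. p w = \<zero>}"
    then show "(\<lambda>v. p v \<oplus> q v) \<in> {p \<in> Pol F. p w = \<zero>}" using Pol_add[of p F q] cl by simp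
  next
    fix p q assume "p \<in> Pol F" "q \<in> Pol F" "(\<lambda>v. p v \<otimes> q v) \<in> {p \<in> Pol F. p w = \<zero>}"
    then show "p \<in> {p \<in> Pol F. p w = \<zero>} \<or> q \<in> {p \<in> Pol F. p w = \<zero>}"
      using integral[of "p w" "q w"] cl by auto
  qed (use assms in auto)
qed

text \<open>\<open>extend_generic\<close> with \<open>J\<close> empty. In no variables polynomials
  are constants; a constant in the proper ideal \<open>I\<close> is zero, and \<open>g\<close> is a
  nonzero constant, so any valuation can be extended.\<close>

lemma nullstellensatz:
  assumes "finite F" "prime_id F I" "h \<in> Pol F" "h \<notin> I"
  shows "\<exists>v\<in>zeros F I F. h v \<noteq> \<zero>"
proof -
  obtain g where g: "g \<in> Pol {} - I" "\<forall>v\<in>zeros F I {}. g v \<noteq> \<zero> \<longrightarrow> (\<exists>v'\<in>zeros F I F. h v' \<noteq> \<zero>)"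
    using extend_generic[OF assms(1,2), of "{}" h] assms(3,4) by auto
  have const: "p v = p w" if "p \<in> Pol {}" for p and v w :: "'a \<Rightarrow> 'k" using Pol_cong[OF that, of v w] by auto
  define v0 where "v0 = (\<lambda>i::'a. \<zero>)"
  have v0: "v0 \<in> Pts F" unfolding v0_def Pts_def by auto
  have "p v0 = \<zero>" if p: "p \<in> I" "p \<in> Pol {}" for p
  proof (rule ccontr)
    assume nz: "p v0 \<noteq> \<zero>"
    have pc: "p v0 \<in> carrier K" using Pol_closed_mono[OF p(2) _ v0] by simp
    have "(\<lambda>v. inv (p v0) \<otimes> p v) \<in> I"
      using nz pc p by (intro prime_idD(6)[OF assms(2), of "\<lambda>v. inv (p v0)"] Pol_const) (auto simp: field_Units)
    moreover have "inv (p v0) \<otimes> p v = \<one>" for v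
      using const[OF p(2), of v v0] nz pc by (simp add: field_Units)
    ultimately show False using prime_idD(3)[OF assms(2)] by simp
  qed
  then have "v0 \<in> zeros F I {}" using v0 by (intro zerosI) auto
  moreover have "g v0 \<noteq> \<zero>"
  proof
    assume z: "g v0 = \<zero>"
    have "g = (\<lambda>v. \<zero>)" using const[of g _ v0] g z by auto
    then show False using g prime_idD(2)[OF assms(2)] by simp
  qed
  ultimately show ?thesis using g by blast
qed

section \<open>Algebraic independence\<close>

text \<open>Algebraic independence modulo \<open>I\<close>, stated as density of the projection to
  K^J: \<open>I\<close> puts no condition on these coordinates alone. In this form every point of
  K^J is a starting point for an extension.\<close>

definition indep :: "'i set \<Rightarrow> (('i \<Rightarrow> 'k) \<Rightarrow> 'k) set \<Rightarrow> 'i set \<Rightarrow> bool" where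
  "indep F I J \<longleftrightarrow> J \<subseteq> F \<and> zeros F I J = Pts F"

lemma zeros_full:
  assumes "prime_id F I" "v \<in> zeros F I F" "p \<in> I"
  shows "p v = \<zero>"
  using zerosD[OF assms(2,3)] prime_idD(1)[OF assms(1)] assms(3) by auto

lemma not_transc_self:
  assumes I: "prime_id F I" and b: "b \<in> J" "J \<subseteq> F"
  shows "\<not> transc I J b"
proof
  assume t: "transc I J b"
  define as where "as = [\<lambda>v. \<ominus> \<one> \<otimes> v b, \<lambda>v. \<one>]"
  have as: "set as \<subseteq> Pol J" unfolding as_def using b by (auto intro!: Pol_mult[of "\<lambda>v. \<ominus> \<one>"] Pol_const Pol_var)
  have HF: "(\<lambda>v. ceval as v (v b)) \<in> Pol F" using Pol_horner[OF as b(2)] b by auto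
  have "(\<lambda>v. ceval as v (v b)) \<in> I"
  proof (rule prime_idD(4)[OF I HF prime_idD(2)[OF I]])
    fix v :: "'a \<Rightarrow> 'k" assume "v \<in> Pts F"
    then have "v b \<in> carrier K" using b unfolding Pts_def by auto
    then show "ceval as v (v b) = \<zero>" unfolding as_def by (simp add: l_minus l_neg)
  qed
  then have "set as \<subseteq> I" using t as unfolding transc_def by blast
  then show False using prime_idD(3)[OF I] unfolding as_def by simp
qed

text \<open>Algebraic dependence seen on points: where some coefficient of a relation is nonzero,
  \<open>b\<close> is a root of a nonzero polynomial determined by the values on \<open>J\<close>.
  With \<open>transc_infinite_values\<close> as counterpart, facts about field extensions reduce to
  counting.\<close>

lemma algebraic_finite_values:
  assumes I: "prime_id F I" "J \<subseteq> F" "b \<in> F" and a: "\<not> transc I J b"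
  shows "\<exists>h\<in>Pol F - I. \<forall>w. finite ((\<lambda>v. v b) ` {v \<in> zeros F I F. h v \<noteq> \<zero> \<and> (\<forall>j\<in>J. v j = w j)})"
proof -
  obtain as where as: "set as \<subseteq> Pol J" "(\<lambda>v. ceval as v (v b)) \<in> I" "\<not> set as \<subseteq> I"
    using a unfolding transc_def by blast
  then obtain a where a: "a \<in> set as" "a \<notin> I" by blast
  have aP: "a \<in> Pol J" using a as by auto
  have "finite ((\<lambda>v. v b) ` {v \<in> zeros F I F. a v \<noteq> \<zero> \<and> (\<forall>j\<in>J. v j = w j)})" (is "finite ((\<lambda>v. v b) ` ?S)") for w
  proof (cases "?S = {}")
    case True
    then show ?thesis by (metis finite.emptyI image_empty)
  next
    case False
    then obtain u where u: "u \<in> ?S" by blast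
    have uP: "u \<in> Pts J" using u zeros_Pts[of u F I F] Pts_mono[OF I(2)] by blast
    have "(\<lambda>v. v b) ` ?S \<subseteq> {x \<in> carrier K. ceval as u x = \<zero>}"
    proof
      fix x assume "x \<in> (\<lambda>v. v b) ` ?S"
      then obtain v where v: "v \<in> ?S" "x = v b" by auto
      have "a' v = a' u" if "a' \<in> set as" for a'
        using Pol_cong[of a' J v u] that as(1) u v by auto
      then have m: "map (\<lambda>a. a v) as = map (\<lambda>a. a u) as" by simp
      have "ceval as v (v b) = \<zero>"
        using zeros_full[OF I(1) _ as(2)] v by auto
      then have "ceval as u (v b) = \<zero>" unfolding m .
      moreover have "v b \<in> carrier K" using v zeros_Pts I(3) unfolding Pts_def by blast
      ultimately show "x \<in> {x \<in> carrier K. ceval as u x = \<zero>}" using v by simp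
    qed
    moreover have "finite {x \<in> carrier K. ceval as u x = \<zero>}"
      using coeffs_closed[OF as(1) uP] a(1) u by (intro horner_finite_roots) auto
    ultimately show ?thesis by (rule finite_subset)
  qed
  then show ?thesis using a aP Pol_mono[OF I(2)] by blast
qed

text \<open>Over a general point of K^J the coordinate \<open>b\<close> may take any value outside a
  finite set, and \<open>extend_generic\<close> completes the point to a zero of \<open>I\<close>
  with \<open>h\<close> nonzero.\<close>

lemma transc_infinite_values:
  assumes F: "finite F" and I: "prime_id F I" "J \<subseteq> F" "b \<in> F" and t: "transc I J b" and h: "h \<in> Pol F" "h \<notin> I"
  shows "\<exists>w\<in>Pts F. infinite ((\<lambda>v. v b) ` {v \<in> zeros F I F. h v \<noteq> \<zero> \<and> (\<forall>j\<in>J. v j = w j)})"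
proof -
  have b: "b \<notin> J" using not_transc_self[OF I(1) _ I(2)] t by auto
  have e: "insert b J \<union> F = F" using I by auto
  obtain g' where g': "g' \<in> Pol (insert b J)" "g' \<notin> I"
    "\<forall>v\<in>zeros F I (insert b J). g' v \<noteq> \<zero> \<longrightarrow> (\<exists>v'\<in>zeros F I F. (\<forall>j\<in>insert b J. v' j = v j) \<and> h v' \<noteq> \<zero>)"
    using extend_generic[OF F I(1), of "insert b J" h] h unfolding e by blast
  obtain g where g: "g \<in> Pol J" "g \<notin> I"
    "\<forall>v\<in>Pts F. g v \<noteq> \<zero> \<longrightarrow> finite {x \<in> carrier K. g' (v(b := x)) = \<zero>}"
    using nonzero_cofinite[OF I b g'(1,2)] by blast
  obtain w where w: "w \<in> zeros F I F" "g w \<noteq> \<zero>"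
    using nullstellensatz[OF F I(1) Pol_mono[OF I(2) g(1)] g(2)] by blast
  have wJ: "w \<in> zeros F I J" using w zeros_anti[OF I(2)] by auto
  have wP: "w \<in> Pts F" using zeros_Pts w by auto
  have "carrier K - {x \<in> carrier K. g' (w(b := x)) = \<zero>} \<subseteq>
     (\<lambda>v. v b) ` {v \<in> zeros F I F. h v \<noteq> \<zero> \<and> (\<forall>j\<in>J. v j = w j)}"
  proof
    fix x assume x: "x \<in> carrier K - {x \<in> carrier K. g' (w(b := x)) = \<zero>}"
    then have "w(b := x) \<in> zeros F I (insert b J)" using transc_extend[OF I b t wJ] by auto
    then obtain v' where v': "v' \<in> zeros F I F" "\<forall>j\<in>insert b J. v' j = (w(b := x)) j" "h v' \<noteq> \<zero>"
      using g'(3) x by blast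
    then have "x = v' b" "\<forall>j\<in>J. v' j = w j" using b by auto
    then show "x \<in> (\<lambda>v. v b) ` {v \<in> zeros F I F. h v \<noteq> \<zero> \<and> (\<forall>j\<in>J. v j = w j)}"
      using v' by blast
  qed
  moreover have "infinite (carrier K - {x \<in> carrier K. g' (w(b := x)) = \<zero>})"
    using g(3) wP w(2) infinite_carrier by simp
  ultimately show ?thesis using wP infinite_super by blast
qed

lemma prime_id_common_nonzero:
  assumes "finite A" "prime_id F I" "\<forall>a\<in>A. h a \<in> Pol F - I"
  shows "\<exists>g\<in>Pol F - I. \<forall>a\<in>A. \<forall>v\<in>Pts F. g v \<noteq> \<zero> \<longrightarrow> h a v \<noteq> \<zero>"
  using assms(1,3)
proof (induction A rule: finite_induct)
  case empty
  show ?case using prime_idD(3)[OF assms(2)] by (intro bexI[of _ "\<lambda>v. \<one>"]) auto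
next
  case (insert a A)
  then obtain g where g: "g \<in> Pol F - I" "\<forall>a\<in>A. \<forall>v\<in>Pts F. g v \<noteq> \<zero> \<longrightarrow> h a v \<noteq> \<zero>" by auto
  have ha: "h a \<in> Pol F" "h a \<notin> I" using insert.prems by auto
  have gg: "(\<lambda>v. h a v \<otimes> g v) \<in> Pol F - I"
    using prime_id_mult_not_in[OF assms(2) ha(1) _ ha(2)] Pol_mult[OF ha(1)] g(1) by blast
  have "h a' v \<noteq> \<zero>" if "a' \<in> insert a A" "v \<in> Pts F" "h a v \<otimes> g v \<noteq> \<zero>" for a' v
  proof -
    have c: "h a v \<in> carrier K" "g v \<in> carrier K" using Pol_closed[OF _ that(2)] ha(1) g(1) by auto
    have "h a v \<noteq> \<zero>" "g v \<noteq> \<zero>" using that(3) c by auto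
    then show ?thesis using that(1,2) g(2) by auto
  qed
  then show ?case by (intro bexI[OF _ gg]) blast
qed

text \<open>By counting: on a dense open part, fixed values on \<open>J\<close> leave finitely many
  choices on \<open>J'\<close>, and each of these leaves finitely many values of \<open>b\<close>,
  whereas a transcendental \<open>b\<close> takes infinitely many.\<close>

lemma algebraic_trans:
  assumes F: "finite F" and I: "prime_id F I" "J \<subseteq> F" "J' \<subseteq> F" "b \<in> F"
    and a: "\<forall>j\<in>J'. \<not> transc I J j" "\<not> transc I J' b"
  shows "\<not> transc I J b"
proof
  assume t: "transc I J b"
  have "\<forall>j\<in>J'. \<exists>h\<in>Pol F - I. \<forall>w. finite ((\<lambda>v. v j) ` {v \<in> zeros F I F. h v \<noteq> \<zero> \<and> (\<forall>j\<in>J. v j = w j)})"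
    (is "\<forall>j\<in>J'. ?P j")
  proof
    fix j assume "j \<in> J'"
    then have "j \<in> F" "\<not> transc I J j" using a(1) I(3) by auto
    then show "?P j" using algebraic_finite_values[OF I(1,2), of j] by simp
  qed
  then obtain h where h: "\<forall>j\<in>J'. h j \<in> Pol F - I \<and>
     (\<forall>w. finite ((\<lambda>v. v j) ` {v \<in> zeros F I F. h j v \<noteq> \<zero> \<and> (\<forall>j\<in>J. v j = w j)}))"
    unfolding bchoice_iff Bex_def by (auto simp: )
  have finJ': "finite J'" using F I(3) finite_subset by blast
  obtain g where g: "g \<in> Pol F" "g \<notin> I" "\<forall>a\<in>J'. \<forall>v\<in>Pts F. g v \<noteq> \<zero> \<longrightarrow> h a v \<noteq> \<zero>"
    using prime_id_common_nonzero[OF finJ' I(1), of h] h by blast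
  obtain k where k: "k \<in> Pol F" "k \<notin> I"
    "\<forall>w. finite ((\<lambda>v. v b) ` {v \<in> zeros F I F. k v \<noteq> \<zero> \<and> (\<forall>j\<in>J'. v j = w j)})"
    using algebraic_finite_values[OF I(1,3,4) a(2)] by blast
  have gk: "(\<lambda>v. g v \<otimes> k v) \<in> Pol F" "(\<lambda>v. g v \<otimes> k v) \<notin> I"
    using Pol_mult[OF g(1) k(1)] prime_id_mult_not_in[OF I(1) g(1) k(1) g(2) k(2)] by auto
  obtain w where w: "infinite ((\<lambda>v. v b) ` {v \<in> zeros F I F. g v \<otimes> k v \<noteq> \<zero> \<and> (\<forall>j\<in>J. v j = w j)})"
    (is "infinite (_ ` ?S)")
    using transc_infinite_values[OF F I(1,2,4) t gk] by blast
  have nz: "g v \<noteq> \<zero> \<and> k v \<noteq> \<zero>" if v: "v \<in> ?S" for v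
  proof -
    have "v \<in> Pts F" using zeros_Pts v by auto
    then show ?thesis using v Pol_closed[OF g(1)] Pol_closed[OF k(1)] by auto
  qed
  have fin1: "finite ((\<lambda>v. v j) ` ?S)" if j: "j \<in> J'" for j
  proof -
    have "(\<lambda>v. v j) ` ?S \<subseteq> (\<lambda>v. v j) ` {v \<in> zeros F I F. h j v \<noteq> \<zero> \<and> (\<forall>j\<in>J. v j = w j)}"
      using nz g(3) j zeros_Pts by blast
    then show ?thesis using h j finite_subset by blast
  qed
  have "(\<lambda>v. restrict v J') ` ?S \<subseteq> (\<Pi>\<^sub>E j\<in>J'. (\<lambda>v. v j) ` ?S)"
  proof (rule image_subsetI)
    fix v assume v: "v \<in> ?S"
    show "restrict v J' \<in> (\<Pi>\<^sub>E j\<in>J'. (\<lambda>v. v j) ` ?S)"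
      unfolding restrict_PiE_iff using imageI[OF v] by (intro ballI)
  qed
  then have fin2: "finite ((\<lambda>v. restrict v J') ` ?S)"
    using finite_PiE[OF finJ' fin1] by (rule finite_subset)
  \<comment> \<open>The values of \<open>b\<close> are sorted by the finitely many patterns on
    \<open>J'\<close>.\<close>
  have "(\<lambda>v. v b) ` ?S \<subseteq> (\<Union>u\<in>(\<lambda>v. restrict v J') ` ?S.
      (\<lambda>v. v b) ` {v \<in> zeros F I F. k v \<noteq> \<zero> \<and> (\<forall>j\<in>J'. v j = u j)})"
  proof
    fix x assume "x \<in> (\<lambda>v. v b) ` ?S"
    then obtain v where v: "v \<in> ?S" "x = v b" by blast
    have "restrict v J' \<in> (\<lambda>v. restrict v J') ` ?S" using v(1) by (rule imageI)
    moreover have "x \<in> (\<lambda>v. v b) ` {v' \<in> zeros F I F. k v' \<noteq> \<zero> \<and> (\<forall>j\<in>J'. v' j = restrict v J' j)}"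
    proof -
      have "v \<in> {v' \<in> zeros F I F. k v' \<noteq> \<zero> \<and> (\<forall>j\<in>J'. v' j = restrict v J' j)}"
        using v(1) nz[OF v(1)] by simp
      then show ?thesis unfolding v(2) by (rule imageI)
    qed
    ultimately show "x \<in> (\<Union>u\<in>(\<lambda>v. restrict v J') ` ?S.
      (\<lambda>v. v b) ` {v \<in> zeros F I F. k v \<noteq> \<zero> \<and> (\<forall>j\<in>J'. v j = u j)})"
      by (rule UN_I[where a = "restrict v J'" and
        B = "\<lambda>u. (\<lambda>v. v b) ` {v \<in> zeros F I F. k v \<noteq> \<zero> \<and> (\<forall>j\<in>J'. v j = u j)}"])
  qed
  moreover have "finite (\<Union>u\<in>(\<lambda>v. restrict v J') ` ?S.
      (\<lambda>v. v b) ` {v \<in> zeros F I F. k v \<noteq> \<zero> \<and> (\<forall>j\<in>J'. v j = u j)})"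
    using fin2 k(3) by (intro finite_UN_I) blast+
  ultimately show False using w finite_subset by blast
qed

section \<open>Exchange and transcendence bases\<close>

lemma indep_subset: "indep F I J \<Longrightarrow> J' \<subseteq> J \<Longrightarrow> indep F I J'"
  unfolding indep_def using zeros_anti[of J' J F I] zeros_Pts by blast

lemma indep_zero: "indep F I J \<Longrightarrow> p \<in> I \<Longrightarrow> p \<in> Pol J \<Longrightarrow> v \<in> Pts F \<Longrightarrow> p v = \<zero>"
  unfolding indep_def using zerosD by blast

lemma indep_insert:
  assumes I: "prime_id F I" and J: "indep F I J" and b: "b \<in> F" "transc I J b"
  shows "indep F I (insert b J)"
proof -
  have JF: "J \<subseteq> F" using J unfolding indep_def by auto
  have bJ: "b \<notin> J" using not_transc_self[OF I _ JF] b by auto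
  have "v \<in> zeros F I (insert b J)" if v: "v \<in> Pts F" for v
  proof -
    have "v b \<in> carrier K" using v b unfolding Pts_def by auto
    moreover have "v \<in> zeros F I J" using J v unfolding indep_def by auto
    ultimately have "v(b := v b) \<in> zeros F I (insert b J)"
      using transc_extend[OF I JF b(1) bJ b(2)] by blast
    then show ?thesis by simp
  qed
  then show ?thesis using JF b zeros_Pts unfolding indep_def by blast
qed

text \<open>Fix a point and let only \<open>j\<close> move: a relation in the variables
  \<open>J\<close> vanishes along this line, so its coefficients vanish at the point.\<close>

lemma indep_transc:
  assumes I: "prime_id F I" and J: "indep F I J" and j: "j \<in> J"
  shows "transc I (J - {j}) j"
  unfolding transc_def
proof (intro allI impI subsetI)
  fix as a assume as: "set as \<subseteq> Pol (J - {j})" "(\<lambda>v. ceval as v (v j)) \<in> I"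
    and a: "a \<in> set as"
  have JF: "J \<subseteq> F" "J - {j} \<subseteq> F" using J unfolding indep_def by auto
  have aF: "a \<in> Pol F" using a as(1) Pol_mono[OF JF(2)] by auto
  have H: "(\<lambda>v. ceval as v (v j)) \<in> Pol J" using Pol_horner[OF as(1) _ j] by auto
  have "a v = \<zero>" if v: "v \<in> Pts F" for v
  proof (rule horner_zero_coeffs[of "map (\<lambda>a. a v) as" "{}"])
    show "set (map (\<lambda>a. a v) as) \<subseteq> carrier K" using coeffs_closed[OF as(1) Pts_mono[OF JF(2) v]] .
    show "a v \<in> set (map (\<lambda>a. a v) as)" using a by auto
    fix x assume "x \<in> carrier K - {}"
    then have "ceval as (v(j := x)) ((v(j := x)) j) = \<zero>"
      using indep_zero[OF J as(2) H Pts_upd[OF v]] by blast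
    moreover have "map (\<lambda>a. a (v(j := x))) as = map (\<lambda>a. a v) as"
      using as(1) Pol_upd[of _ "J - {j}" j] by (intro map_cong) auto
    ultimately show "ceval as v x = \<zero>" by simp
  qed simp
  then show "a \<in> I" using prime_idD(4)[OF I aF prime_idD(2)[OF I]] by blast
qed

text \<open>Exchange, by induction on the number of elements of \<open>J\<close> outside
  \<open>S\<close>: one of them is replaced by an element of \<open>S\<close>, which preserves
  independence and cardinality.\<close>

lemma steinitz:
  assumes F: "finite F" and I: "prime_id F I" and S: "S \<subseteq> F" and J: "indep F I J" "\<forall>j\<in>J. \<not> transc I S j"
  shows "card J \<le> card S"
  using J
proof (induction "card (J - S)" arbitrary: J rule: less_induct)
  case less
  have JF: "J \<subseteq> F" using less.prems unfolding indep_def by auto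
  have fin: "finite J" "finite S" using JF S F finite_subset by blast+
  show ?case
  proof (cases "J \<subseteq> S")
    case True
    then show ?thesis using fin card_mono by blast
  next
    case False
    then obtain j where j: "j \<in> J" "j \<notin> S" by auto
    have J0: "J - {j} \<subseteq> F" "indep F I (J - {j})" using JF indep_subset[OF less.prems(1), of "J - {j}"] by auto
    have tj: "transc I (J - {j}) j" using indep_transc[OF I less.prems(1) j(1)] .
    \<comment> \<open>If all of \<open>S\<close> were algebraic over the rest of \<open>J\<close>,
      transitivity would make \<open>j\<close> algebraic over it as well.\<close>
    obtain s where s: "s \<in> S" "transc I (J - {j}) s"
    proof (rule ccontr)
      assume "\<not> thesis"
      then have "\<forall>s\<in>S. \<not> transc I (J - {j}) s" using that by blast
      then have "\<not> transc I (J - {j}) j"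
        using algebraic_trans[OF F I J0(1) S, of j] less.prems(2) j JF by blast
      then show False using tj by simp
    qed
    have sJ: "s \<notin> J - {j}" using not_transc_self[OF I _ J0(1)] s(2) by blast
    have sj: "s \<noteq> j" using s(1) j(2) by blast
    define J' where "J' = insert s (J - {j})"
    have 1: "indep F I J'" unfolding J'_def using indep_insert[OF I J0(2)] s S by auto
    have 2: "\<forall>j\<in>J'. \<not> transc I S j"
      unfolding J'_def using less.prems(2) not_transc_self[OF I s(1) S] by auto
    have "J' - S = (J - S) - {j}" unfolding J'_def using s(1) by auto
    then have 3: "card (J' - S) < card (J - S)"
      using fin j by (metis DiffI card_Diff1_less finite_Diff)
    have "card J' = Suc (card (J - {j}))" unfolding J'_def using sJ fin by (intro card_insert_disjoint) auto
    then have "card J' = card J" using card_Suc_Diff1[OF fin(1) j(1)] by simp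
    then show ?thesis using less.hyps[OF 3 1 2] by simp
  qed
qed

text \<open>A maximal independent set between \<open>J\<close> and \<open>P\<close>; an element of
  \<open>P\<close> transcendental over it could be added.\<close>

lemma basis_exists:
  assumes F: "finite F" and I: "prime_id F I" and P: "P \<subseteq> F" and J: "indep F I J" "J \<subseteq> P"
  shows "\<exists>B. J \<subseteq> B \<and> B \<subseteq> P \<and> indep F I B \<and> (\<forall>b\<in>P. \<not> transc I B b)"
proof -
  let ?C = "{B. J \<subseteq> B \<and> B \<subseteq> P \<and> indep F I B}"
  have "finite (Pow P)" using finite_subset[OF P F] by simp
  moreover have "?C \<subseteq> Pow P" by auto
  ultimately have fin: "finite ?C" by (rule rev_finite_subset)
  have "?C \<noteq> {}" using J by auto
  from finite_has_maximal[OF fin this] obtain B where B: "B \<in> ?C" "\<forall>B'\<in>?C. B \<subseteq> B' \<longrightarrow> B = B'"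
    by auto
  have "\<not> transc I B b" if b: "b \<in> P" for b
  proof
    assume t: "transc I B b"
    have "insert b B \<in> ?C" using B(1) b indep_insert[OF I _ _ t] P by auto
    then have "b \<in> B" using B(2)[rule_format, of "insert b B"] by auto
    then show False using not_transc_self[OF I, of b B] t B(1) P by auto
  qed
  then show ?thesis using B by auto
qed

lemma indep_empty:
  assumes "prime_id F I"
  shows "indep F I {}"
proof -
  have "v \<in> zeros F I {}" if v: "v \<in> Pts F" for v
  proof (rule zerosI[OF v])
    fix p assume p: "p \<in> I" "p \<in> Pol ({} :: 'a set)"
    show "p v = \<zero>"
    proof (rule ccontr)
      assume nz: "p v \<noteq> \<zero>"
      have pc: "p v \<in> carrier K" using Pol_closed_mono[OF p(2) _ v] by simp
      have "(\<lambda>u. inv (p v) \<otimes> p u) \<in> I"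
        using nz pc p by (intro prime_idD(6)[OF assms, of "\<lambda>u. inv (p v)"] Pol_const) (auto simp: field_Units)
      moreover have "inv (p v) \<otimes> p u = \<one>" for u
        using Pol_cong[OF p(2), of u v] nz pc by (simp add: field_Units)
      ultimately show False using prime_idD(3)[OF assms] by simp
    qed
  qed
  then show ?thesis unfolding indep_def using zeros_Pts by blast
qed

text \<open>A strictly larger prime ideal has smaller transcendence degree: divide a relation between
  \<open>y\<close> and \<open>J\<close> by powers of \<open>y\<close> and restrict it to the smaller zero set.\<close>

lemma indep_insert_vanishing:
  assumes I: "prime_id F I" "prime_id F I'" "I \<subseteq> I'" and y: "y \<in> F" "(\<lambda>v. v y) \<in> I'" "(\<lambda>v. v y) \<notin> I"
    and J: "indep F I' J"
  shows "y \<notin> J" "indep F I (insert y J)"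
proof -
  have JF: "J \<subseteq> F" using J unfolding indep_def by auto
  show yJ: "y \<notin> J"
  proof
    assume "y \<in> J"
    then have "(\<lambda>v. v y) \<in> Pol J" by (rule Pol_var)
    from indep_zero[OF J y(2) this, of "\<lambda>_. \<one>"] show False by (simp add: Pts_def)
  qed
  have *: "\<forall>v\<in>Pts F. \<forall>a\<in>set as. a v = \<zero>"
    if "set as \<subseteq> Pol J" "(\<lambda>v. ceval as v (v y)) \<in> I" for as
    using that
  proof (induction as)
    case Nil
    then show ?case by simp
  next
    case (Cons a as)
    let ?H = "\<lambda>v. ceval as v (v y)"
    have aP: "a \<in> Pol J" "set as \<subseteq> Pol J" using Cons.prems by auto
    have aF: "a \<in> Pol F" using Pol_mono[OF JF aP(1)] .
    have HF: "?H \<in> Pol F" using Pol_horner[OF aP(2) JF y(1)] .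
    have yF: "(\<lambda>v. v y) \<in> Pol F" using y(1) by (rule Pol_var)
    have Hc: "?H v \<in> carrier K" "v y \<in> carrier K" "a v \<in> carrier K" if v: "v \<in> Pts F" for v
      using Pol_closed[OF HF v] Pol_closed[OF yF v] Pol_closed[OF aF v] by auto
    have yI: "(\<lambda>v. ?H v \<otimes> v y) \<in> I'" by (rule prime_idD(6)[OF I(2) HF y(2)])
    have tot: "(\<lambda>v. a v \<oplus> v y \<otimes> ?H v) \<in> I" using Cons.prems(2) by simp
    \<comment> \<open>Modulo \<open>I'\<close> only the constant coefficient survives, and it
      vanishes by independence of \<open>J\<close>. Primality of \<open>I\<close> then removes the
      factor y from what is left.\<close>
    then have "a \<in> I'"
      using prime_id_diff[OF I(2) aF yI, of "\<lambda>v. a v \<oplus> v y \<otimes> ?H v"] I(3) Hc m_comm by auto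
    then have a0: "a v = \<zero>" if "v \<in> Pts F" for v using indep_zero[OF J _ aP(1) that] by blast
    have "(\<lambda>v. v y \<otimes> ?H v) \<in> I"
    proof (rule prime_idD(4)[OF I(1) Pol_mult[OF yF HF] tot])
      fix v assume v: "v \<in> Pts F"
      show "v y \<otimes> ?H v = a v \<oplus> v y \<otimes> ?H v" using Hc[OF v] a0[OF v] by simp
    qed
    then have "?H \<in> I" using prime_idD(7)[OF I(1) yF HF] y(3) by blast
    then have "\<forall>v\<in>Pts F. \<forall>a\<in>set as. a v = \<zero>" using Cons.IH aP by blast
    then show ?case using a0 by simp
  qed
  have "v \<in> zeros F I (insert y J)" if v: "v \<in> Pts F" for v
  proof (rule zerosI[OF v])
    fix p assume p: "p \<in> I" "p \<in> Pol (insert y J)"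
    obtain as where as: "set as \<subseteq> Pol J" "\<forall>v\<in>Pts F. p v = ceval as v (v y)"
      "p \<in> I \<longleftrightarrow> (\<lambda>v. ceval as v (v y)) \<in> I"
      using Pol_insert_split[OF p(2) I(1) JF y(1) yJ] by blast
    have "set (map (\<lambda>a. a v) as) \<subseteq> {\<zero>}" using *[OF as(1)] as(3) p(1) v by auto
    moreover have "v y \<in> carrier K" using v y(1) unfolding Pts_def by auto
    ultimately show "p v = \<zero>" using as(2) v horner_all_zero by simp
  qed
  then show "indep F I (insert y J)" using JF y(1) zeros_Pts unfolding indep_def by blast
qed

section \<open>Hilbert's basis theorem\<close>

text \<open>The ideal generated by \<open>H\<close>, up to agreement on \<open>Pts F\<close>;
  multiples of generators are added one at a time, so inductions have a single step.\<close>

inductive_set Gid :: "'i set \<Rightarrow> (('i \<Rightarrow> 'k) \<Rightarrow> 'k) set \<Rightarrow> (('i \<Rightarrow> 'k) \<Rightarrow> 'k) set"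
  for F :: "'i set" and H :: "(('i \<Rightarrow> 'k) \<Rightarrow> 'k) set" where
  Gid_zero: "p \<in> Pol F \<Longrightarrow> (\<forall>v\<in>Pts F. p v = \<zero>) \<Longrightarrow> p \<in> Gid F H"
| Gid_step: "p \<in> Gid F H \<Longrightarrow> q \<in> Pol F \<Longrightarrow> h \<in> H \<Longrightarrow> r \<in> Pol F \<Longrightarrow>
    (\<forall>v\<in>Pts F. r v = p v \<oplus> q v \<otimes> h v) \<Longrightarrow> r \<in> Gid F H"

lemma Gid_Pol: "p \<in> Gid F H \<Longrightarrow> p \<in> Pol F"
  by (induction p rule: Gid.induct) auto

lemma Gid_cong:
  assumes "p \<in> Gid F H" "r \<in> Pol F" "\<forall>v\<in>Pts F. r v = p v"
  shows "r \<in> Gid F H"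
  using assms(1)
proof (cases rule: Gid.cases)
  case Gid_zero
  then show ?thesis using assms(2,3) by (intro Gid.Gid_zero) auto
next
  case (Gid_step p' q h)
  then show ?thesis using assms(2,3) Gid.Gid_step[of p' F H q h r] by simp
qed

lemma Gid_mono:
  assumes "H \<subseteq> H'" "p \<in> Gid F H"
  shows "p \<in> Gid F H'"
  using assms(2)
proof (induction p rule: Gid.induct)
  case (Gid_step p q h r)
  then show ?case using assms(1) Gid.Gid_step[of p F H' q h r] by auto
qed (rule Gid.Gid_zero)

lemma Gid_vanish:
  assumes "p \<in> Gid F H" "v \<in> Pts F" "\<forall>h\<in>H. h v = \<zero>"
  shows "p v = \<zero>"
  using assms(1)
proof (induction p rule: Gid.induct)
  case (Gid_step p q h r)
  then show ?case using assms Pol_closed[OF Gid_step(2) assms(2)] by auto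
qed (use assms in auto)

lemma Gid_add:
  assumes "H \<subseteq> Pol F" "p \<in> Gid F H" "q \<in> Gid F H"
  shows "(\<lambda>v. p v \<oplus> q v) \<in> Gid F H"
  using assms(2)
proof (induction p rule: Gid.induct)
  case (Gid_zero p)
  have "q v \<in> carrier K" if "v \<in> Pts F" for v using Pol_closed[OF Gid_Pol[OF assms(3)] that] .
  then show ?case using Gid_zero
    by (intro Gid_cong[OF assms(3)] Pol_add[of p F q] Gid_Pol[OF assms(3)]) auto
next
  case (Gid_step p q' h r)
  have r: "(\<lambda>v. r v \<oplus> q v) \<in> Pol F" using Gid_step Gid_Pol[OF assms(3)] by (intro Pol_add)
  show ?case
  proof (rule Gid.Gid_step[OF Gid_step.IH Gid_step(2,3) r], intro ballI)
    fix v assume v: "v \<in> Pts F"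
    have c: "p v \<in> carrier K" "q v \<in> carrier K" "q' v \<in> carrier K" "h v \<in> carrier K"
      using Pol_closed[OF Gid_Pol[OF Gid_step(1)] v] Pol_closed[OF Gid_Pol[OF assms(3)] v]
        Pol_closed[OF Gid_step(2) v] Pol_closed[of h F, OF _ v] Gid_step(3) assms(1) by blast+
    then have "(p v \<oplus> q' v \<otimes> h v) \<oplus> q v = p v \<oplus> q v \<oplus> q' v \<otimes> h v"
      by (simp add: a_ac)
    then show "r v \<oplus> q v = p v \<oplus> q v \<oplus> q' v \<otimes> h v" using Gid_step(5) v by simp
  qed
qed

lemma Gid_mult:
  assumes "H \<subseteq> Pol F" "p \<in> Gid F H" "q \<in> Pol F"
  shows "(\<lambda>v. q v \<otimes> p v) \<in> Gid F H"
  using assms(2)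
proof (induction p rule: Gid.induct)
  case (Gid_zero p)
  then show ?case using Pol_closed[OF assms(3)]
    by (intro Gid.Gid_zero Pol_mult[OF assms(3), of p]) auto
next
  case (Gid_step p q' h r)
  have r: "(\<lambda>v. q v \<otimes> r v) \<in> Pol F" "(\<lambda>v. q v \<otimes> q' v) \<in> Pol F"
    using Pol_mult[OF assms(3)] Gid_step by auto
  show ?case
  proof (rule Gid.Gid_step[OF Gid_step.IH r(2) Gid_step(3) r(1)], intro ballI)
    fix v assume v: "v \<in> Pts F"
    have c: "p v \<in> carrier K" "q v \<in> carrier K" "q' v \<in> carrier K" "h v \<in> carrier K"
      using Pol_closed[OF Gid_Pol[OF Gid_step(1)] v] Pol_closed[OF assms(3) v]
        Pol_closed[OF Gid_step(2) v] Pol_closed[of h F, OF _ v] Gid_step(3) assms(1) by blast+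
    then show "q v \<otimes> r v = q v \<otimes> p v \<oplus> q v \<otimes> q' v \<otimes> h v" using Gid_step(5) v
      by (simp add: r_distr m_assoc)
  qed
qed

lemma Gid_incl:
  assumes "H \<subseteq> Pol F" "h \<in> H"
  shows "h \<in> Gid F H"
proof (rule Gid.Gid_step[of "\<lambda>v. \<zero>" _ _ "\<lambda>v. \<one>" h])
  show "(\<lambda>v. \<zero>) \<in> Gid F H" by (rule Gid.Gid_zero) auto
  show "\<forall>v\<in>Pts F. h v = \<zero> \<oplus> \<one> \<otimes> h v" using Pol_closed[of h F] assms by auto
qed (use assms in auto)

lemma Gid_trans:
  assumes "H \<subseteq> Pol F" "G \<subseteq> Gid F H" "p \<in> Gid F G"
  shows "p \<in> Gid F H"
  using assms(3)
proof (induction p rule: Gid.induct)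
  case (Gid_step p q h r)
  have "(\<lambda>v. p v \<oplus> q v \<otimes> h v) \<in> Gid F H"
    using Gid_add[OF assms(1) Gid_step.IH Gid_mult[OF assms(1) _ Gid_step(2), of h]] Gid_step(3) assms(2) by blast
  then show ?case using Gid_step(4,5) by (rule Gid_cong)
qed (rule Gid.Gid_zero)

text \<open>Dependent choice in which a term may depend on the set of all earlier terms.\<close>

lemma choose_sequence:
  assumes "\<And>G. finite G \<Longrightarrow> G \<subseteq> A \<Longrightarrow> \<exists>x\<in>A. Q G x"
  shows "\<exists>f::nat \<Rightarrow> 'z. \<forall>n. f n \<in> A \<and> Q (f ` {..<n}) (f n)"
proof -
  have "\<exists>f. \<forall>n::nat. f n \<in> A \<and> Q (f ` {..<n}) (f n)"
  proof (rule dependent_wf_choice[of less_than "\<lambda>f n r. r \<in> A \<and> Q (f ` {..<n}) r"])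
    show "wf less_than" by simp
  next
    fix f g :: "nat \<Rightarrow> 'z" and x r
    assume "\<And>z. (z, x) \<in> less_than \<Longrightarrow> f z = g z"
    then have "f ` {..<x} = g ` {..<x}" by auto
    then show "(r \<in> A \<and> Q (f ` {..<x}) r) = (r \<in> A \<and> Q (g ` {..<x}) r)" by simp
  next
    fix x and f :: "nat \<Rightarrow> 'z"
    assume "\<And>y. (y, x) \<in> less_than \<Longrightarrow> f y \<in> A \<and> Q (f ` {..<y}) (f y)"
    then have "f ` {..<x} \<subseteq> A" by auto
    then show "\<exists>r. r \<in> A \<and> Q (f ` {..<x}) r" using assms[of "f ` {..<x}"] by auto
  qed
  then show ?thesis .
qed

text \<open>The ascending chain condition expressed by sequences. In this shape it applies directly
  to a sequence of leading coefficients.\<close>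

definition noeth :: "'i set \<Rightarrow> bool" where
  "noeth F \<longleftrightarrow> (\<forall>p :: nat \<Rightarrow> ('i \<Rightarrow> 'k) \<Rightarrow> 'k. range p \<subseteq> Pol F \<longrightarrow> (\<exists>n. p n \<in> Gid F (p ` {..<n})))"

lemma noeth_finite_basis:
  assumes "noeth F" "H \<subseteq> Pol F"
  shows "\<exists>H0\<subseteq>H. finite H0 \<and> H \<subseteq> Gid F H0"
proof (rule ccontr)
  assume neg: "\<not> ?thesis"
  have "\<exists>f::nat \<Rightarrow> _. \<forall>n. f n \<in> H \<and> f n \<notin> Gid F (f ` {..<n})"
  proof (rule choose_sequence)
    fix G assume "finite G" "G \<subseteq> H"
    then show "\<exists>x\<in>H. x \<notin> Gid F G" using neg by blast
  qed
  then obtain f :: "nat \<Rightarrow> _" where f: "\<forall>n. f n \<in> H \<and> f n \<notin> Gid F (f ` {..<n})" by blast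
  then have "range f \<subseteq> Pol F" using assms(2) by auto
  then show False using assms(1) f unfolding noeth_def by blast
qed

text \<open>In no variables polynomials are constants, and a nonzero constant generates everything.
  The index is 0 if the first term is zero and 1 otherwise.\<close>

lemma noeth_empty: "noeth {}"
  unfolding noeth_def
proof (intro allI impI)
  fix p :: "nat \<Rightarrow> ('a \<Rightarrow> 'k) \<Rightarrow> 'k" assume p: "range p \<subseteq> Pol {}"
  define v0 where "v0 = (\<lambda>i::'a. \<zero>)"
  have v0: "v0 \<in> Pts {}" unfolding v0_def Pts_def by auto
  have const: "p n v = p n v0" for n v using Pol_cong[of "p n" "{}" v v0] p by auto
  have pc: "p n v0 \<in> carrier K" for n using Pol_closed[OF _ v0] p by auto
  show "\<exists>n. p n \<in> Gid {} (p ` {..<n})"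
  proof (cases "p 0 v0 = \<zero>")
    case True
    then have "p 0 \<in> Gid {} (p ` {..<0})" using p const[of 0] by (intro Gid_zero) auto
    then show ?thesis by blast
  next
    case False
    have "p 1 \<in> Gid {} (p ` {..<1})"
    proof (rule Gid_step[of "\<lambda>v. \<zero>" _ _ "\<lambda>v. p 1 v0 \<otimes> inv (p 0 v0)" "p 0"])
      show "(\<lambda>v. \<zero>) \<in> Gid {} (p ` {..<1})" by (rule Gid_zero) auto
      show "(\<lambda>v. p 1 v0 \<otimes> inv (p 0 v0)) \<in> Pol {}"
        using pc False by (intro Pol_const) (auto simp: field_Units)
      show "\<forall>v\<in>Pts {}. p 1 v = \<zero> \<oplus> p 1 v0 \<otimes> inv (p 0 v0) \<otimes> p 0 v"
      proof
        fix v :: "'a \<Rightarrow> 'k"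
        have "p 1 v = p 1 v0" "p 0 v = p 0 v0" by (rule const)+
        then show "p 1 v = \<zero> \<oplus> p 1 v0 \<otimes> inv (p 0 v0) \<otimes> p 0 v"
          using pc[of 0] pc[of 1] False by (simp add: field_Units m_assoc)
      qed
    qed (use p in auto)
    then show ?thesis by blast
  qed
qed

text \<open>Hilbert's argument. In an ideal that is not finitely generated each \<open>f n\<close>
  is chosen of least degree outside the ideal of its predecessors. Some leading coefficient is
  generated by the earlier ones, and subtracting the corresponding combination lowers the
  degree.\<close>

lemma noeth_insert:
  assumes J: "noeth J" and b: "b \<notin> (J :: 'i set)"
  shows "noeth (insert b J)"
proof (rule ccontr)
  let ?F = "insert b J"
  let ?H = "\<lambda>as v. ceval as v (v b)"
  assume "\<not> noeth ?F"
  then obtain p :: "nat \<Rightarrow> ('i \<Rightarrow> 'k) \<Rightarrow> 'k" where p: "range p \<subseteq> Pol ?F" "\<And>n. p n \<notin> Gid ?F (p ` {..<n})"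
    unfolding noeth_def by blast
  define N where "N = Gid ?F (range p)"
  have NP: "N \<subseteq> Pol ?F" unfolding N_def using Gid_Pol by blast
  have vJ: "v \<in> Pts J" "v b \<in> carrier K" if "v \<in> Pts ?F" for v using that unfolding Pts_def by auto
  \<comment> \<open>Finitely many generators would lie in the ideal of finitely many terms
    \<open>p i\<close>, which would then contain the next term.\<close>
  have not_fg: "\<exists>x\<in>N. x \<notin> Gid ?F G" if G: "finite G" "G \<subseteq> N" for G
  proof (rule ccontr)
    assume "\<not> ?thesis"
    then have NG: "N \<subseteq> Gid ?F G" by blast
    have fin_char: "\<exists>n. x \<in> Gid ?F (p ` {..<n})" if "x \<in> Gid ?F (range p)" for x
      using that
    proof (induction x rule: Gid.induct)
      case (Gid_zero p')
      then show ?case by (intro exI[of _ 0] Gid.Gid_zero)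
    next
      case (Gid_step p' q h r)
      then obtain n m where n: "p' \<in> Gid ?F (p ` {..<n})" "h = p m" by blast
      have "p' \<in> Gid ?F (p ` {..<max n (Suc m)})" by (rule Gid_mono[OF _ n(1)]) auto
      moreover have "h \<in> p ` {..<max n (Suc m)}" using n(2) by (simp add: less_max_iff_disj)
      ultimately show ?case using Gid.Gid_step[OF _ Gid_step(2) _ Gid_step(4,5)] by blast
    qed
    have "\<exists>n. G \<subseteq> Gid ?F (p ` {..<n})" using G
    proof (induction G rule: finite_induct)
      case (insert x G)
      then have "x \<in> Gid ?F (range p)" "G \<subseteq> N" unfolding N_def by auto
      then obtain n m where n: "G \<subseteq> Gid ?F (p ` {..<n})" "x \<in> Gid ?F (p ` {..<m})"
        using fin_char[of x] insert.IH by blast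
      have "p ` {..<n} \<subseteq> p ` {..<max n m}" "p ` {..<m} \<subseteq> p ` {..<max n m}" by auto
      then have "insert x G \<subseteq> Gid ?F (p ` {..<max n m})" using n Gid_mono by blast
      then show ?case by blast
    qed auto
    then obtain n where n: "G \<subseteq> Gid ?F (p ` {..<n})" by blast
    have r: "p ` {..<n} \<subseteq> Pol ?F" using p(1) by auto
    have "p n \<in> N" unfolding N_def using Gid_incl[OF p(1)] by auto
    then have "p n \<in> Gid ?F (p ` {..<n})" using NG Gid_trans[OF r n] by blast
    then show False using p(2) by blast
  qed
  \<comment> \<open>One more than the degree. It is a least length because a function has several
    coefficient lists, which may end in zeros.\<close>
  define d where "d = (\<lambda>f. LEAST n. \<exists>as. length as = n \<and> set as \<subseteq> Pol J \<and> (\<forall>v\<in>Pts ?F. f v = ?H as v))"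
  have d_le: "d f \<le> length as" if "set as \<subseteq> Pol J" "\<forall>v\<in>Pts ?F. f v = ?H as v" for f as
    unfolding d_def by (rule Least_le) (use that in blast)
  have d_ex: "\<exists>as. length as = d f \<and> set as \<subseteq> Pol J \<and> (\<forall>v\<in>Pts ?F. f v = ?H as v)" if "f \<in> Pol ?F" for f
  proof -
    have "\<exists>n as. length as = n \<and> set as \<subseteq> Pol J \<and> (\<forall>v\<in>Pts ?F. f v = ?H as v)"
      using Pol_insert_coeffs[OF that] by blast
    then show ?thesis unfolding d_def by (rule LeastI_ex)
  qed
  have "\<exists>f::nat \<Rightarrow> _. \<forall>n. f n \<in> N \<and>
     (f n \<notin> Gid ?F (f ` {..<n}) \<and> (\<forall>y\<in>N. y \<notin> Gid ?F (f ` {..<n}) \<longrightarrow> d (f n) \<le> d y))"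
  proof (rule choose_sequence)
    fix G assume "finite G" "G \<subseteq> N"
    then have ex: "\<exists>x. x \<in> N \<and> x \<notin> Gid ?F G" using not_fg by blast
    then obtain x0 where "x0 \<in> N \<and> x0 \<notin> Gid ?F G" by blast
    from ex_has_least_nat[of "\<lambda>x. x \<in> N \<and> x \<notin> Gid ?F G", OF this, of d]
    show "\<exists>x\<in>N. x \<notin> Gid ?F G \<and> (\<forall>y\<in>N. y \<notin> Gid ?F G \<longrightarrow> d x \<le> d y)"
      by blast
  qed
  then obtain f :: "nat \<Rightarrow> _" where f: "\<And>n. f n \<in> N" "\<And>n. f n \<notin> Gid ?F (f ` {..<n})"
    "\<And>n y. y \<in> N \<Longrightarrow> y \<notin> Gid ?F (f ` {..<n}) \<Longrightarrow> d (f n) \<le> d y" by blast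
  have fP: "f ` {..<n} \<subseteq> Pol ?F" for n using f(1) NP by auto
  \<comment> \<open>\<open>f n\<close> was already a candidate when \<open>f i\<close> was
    chosen.\<close>
  have d_mono: "d (f i) \<le> d (f n)" if "i < n" for i n
  proof -
    have "f ` {..<i} \<subseteq> f ` {..<n}" using that by auto
    then have "f n \<notin> Gid ?F (f ` {..<i})" using f(2)[of n] Gid_mono by blast
    then show ?thesis using f(1,3) by blast
  qed
  have "\<exists>bs c. length bs = d (f n) - 1 \<and> d (f n) > 0 \<and> set bs \<subseteq> Pol J \<and> c \<in> Pol J \<and>
     (\<forall>v\<in>Pts ?F. f n v = ?H (bs @ [c]) v)" for n
  proof -
    obtain as where as: "length as = d (f n)" "set as \<subseteq> Pol J" "\<forall>v\<in>Pts ?F. f n v = ?H as v"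
      using d_ex[of "f n"] f(1) NP by blast
    have "as \<noteq> []"
    proof
      assume "as = []"
      then have "f n \<in> Gid ?F (f ` {..<n})" using as f(1) NP by (intro Gid_zero) auto
      then show False using f(2) by blast
    qed
    then obtain bs c where "as = bs @ [c]" by (meson rev_exhaust)
    then show ?thesis using as by (intro exI[of _ bs] exI[of _ c]) auto
  qed
  then have "\<exists>bs. \<forall>n. \<exists>c. length (bs n) = d (f n) - 1 \<and> d (f n) > 0 \<and> set (bs n) \<subseteq> Pol J \<and> c \<in> Pol J \<and>
     (\<forall>v\<in>Pts ?F. f n v = ?H (bs n @ [c]) v)" by (intro choice allI)
  then obtain bs where "\<forall>n. \<exists>c. length (bs n) = d (f n) - 1 \<and> d (f n) > 0 \<and> set (bs n) \<subseteq> Pol J \<and> c \<in> Pol J \<and>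
     (\<forall>v\<in>Pts ?F. f n v = ?H (bs n @ [c]) v)" by blast
  then have "\<exists>c. \<forall>n. length (bs n) = d (f n) - 1 \<and> d (f n) > 0 \<and> set (bs n) \<subseteq> Pol J \<and> c n \<in> Pol J \<and>
     (\<forall>v\<in>Pts ?F. f n v = ?H (bs n @ [c n]) v)" by (rule choice)
  then obtain c where "\<forall>n. length (bs n) = d (f n) - 1 \<and> d (f n) > 0 \<and> set (bs n) \<subseteq> Pol J \<and> c n \<in> Pol J \<and>
     (\<forall>v\<in>Pts ?F. f n v = ?H (bs n @ [c n]) v)" by blast
  then have bc: "\<And>n. length (bs n) = d (f n) - 1" "\<And>n. d (f n) > 0" "\<And>n. set (bs n) \<subseteq> Pol J" "\<And>n. c n \<in> Pol J"
    "\<And>n v. v \<in> Pts ?F \<Longrightarrow> f n v = ?H (bs n @ [c n]) v" by blast+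
  have app: "?H (as @ [a]) v = ?H as v \<oplus> v b [^] length as \<otimes> a v"
    if "set as \<subseteq> Pol J" "a \<in> Pol J" "v \<in> Pts ?F" for as a v
    using horner_append[OF coeffs_closed[OF that(1) vJ(1)[OF that(3)]], of "[a v]" "v b"] vJ[OF that(3)]
      Pol_closed[OF that(2) vJ(1)[OF that(3)]] by simp
  have Hc: "?H as v \<in> carrier K" if "set as \<subseteq> Pol J" "v \<in> Pts ?F" for as v
    using horner_coeffs_closed[OF that(1) vJ[OF that(2)]] .
  have HP: "?H as \<in> Pol ?F" if "set as \<subseteq> Pol J" for as using Pol_horner[OF that, of ?F b] by auto
  have JF: "q \<in> Pol ?F" if "q \<in> Pol J" for q using Pol_mono[OF _ that] by auto
  have "range c \<subseteq> Pol J" using bc by auto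
  then obtain n where n: "c n \<in> Gid J (c ` {..<n})" using J unfolding noeth_def by blast
  define m where "m = d (f n) - 1"
  \<comment> \<open>Every combination of the earlier leading coefficients is the coefficient in
    position \<open>m\<close> of some member of the ideal of the earlier \<open>f i\<close>, once
    these are shifted up to that degree.\<close>
  have key: "\<exists>g\<in>Gid ?F (f ` {..<n}). \<exists>ls. length ls = m \<and> set ls \<subseteq> Pol J \<and> (\<forall>v\<in>Pts ?F. g v = ?H (ls @ [a]) v)"
    if "a \<in> Gid J (c ` {..<n})" for a
    using that
  proof (induction a rule: Gid.induct)
    case (Gid_zero a)
    have P: "set (replicate m (\<lambda>v. \<zero>) :: (('i \<Rightarrow> 'k) \<Rightarrow> 'k) list) \<subseteq> Pol J" by (auto simp: set_replicate_conv_if)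
    have "?H (replicate m (\<lambda>v. \<zero>) @ [a]) v = \<zero>" if v: "v \<in> Pts ?F" for v
      using Gid_zero(2) vJ[OF v] by (intro horner_all_zero) (auto simp: set_replicate_conv_if)
    then have "\<forall>v\<in>Pts ?F. \<zero> = ?H (replicate m (\<lambda>v. \<zero>) @ [a]) v" by simp
    moreover have "(\<lambda>v. \<zero>) \<in> Gid ?F (f ` {..<n})" by (rule Gid.Gid_zero) auto
    ultimately show ?case using P
      by (intro bexI[of _ "\<lambda>v. \<zero>"] exI[of _ "replicate m (\<lambda>v. \<zero>)"] conjI) auto
  next
    case (Gid_step p' q h r)
    obtain g ls where g: "g \<in> Gid ?F (f ` {..<n})" "length ls = m" "set ls \<subseteq> Pol J" "\<forall>v\<in>Pts ?F. g v = ?H (ls @ [p']) v"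
      using Gid_step.IH by blast
    obtain i where i: "i < n" "h = c i" using Gid_step(3) by auto
    have pP: "p' \<in> Pol J" using Gid_Pol[OF Gid_step(1)] .
    \<comment> \<open>The subtraction does not truncate, since degrees do not decrease along the
      sequence.\<close>
    define k where "k = m - length (bs i)"
    have k: "k + length (bs i) = m" unfolding k_def m_def bc(1) using d_mono[OF i(1)] by simp
    define z where "z = (replicate k (\<lambda>v. \<zero>) :: (('i \<Rightarrow> 'k) \<Rightarrow> 'k) list)"
    have zP: "set z \<subseteq> Pol J" unfolding z_def by (auto simp: set_replicate_conv_if)
    have zb: "set (z @ bs i) \<subseteq> Pol J" using zP bc by auto
    obtain ss where ss: "set ss \<subseteq> Pol J" "length ss = m"
      "\<forall>v\<in>Pts J. \<forall>x\<in>carrier K. ceval ss v x = q v \<otimes> ceval (z @ bs i) v x"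
      using coeffs_scale[OF zb Gid_step(2)] k unfolding z_def by auto
    obtain ls' where ls': "set ls' \<subseteq> Pol J" "length ls' = m"
      "\<forall>v\<in>Pts J. \<forall>x\<in>carrier K. ceval ls' v x =
         ceval ls v x \<oplus> ceval ss v x"
      using coeffs_add[OF g(3) ss(1)] g(2) ss(2) by auto
    define g' where "g' = (\<lambda>v. g v \<oplus> (q v \<otimes> v b [^] k) \<otimes> f i v)"
    have qk: "(\<lambda>v. q v \<otimes> v b [^] k) \<in> Pol ?F" by (intro Pol_mult Pol_pow Pol_var JF Gid_step(2)) simp
    have fi: "f i \<in> f ` {..<n}" using i(1) by auto
    have "g' \<in> Gid ?F (f ` {..<n})" unfolding g'_def
      using Gid_add[OF fP g(1) Gid_mult[OF fP Gid_incl[OF fP fi] qk]] .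
    moreover have "g' v = ?H (ls' @ [r]) v" if v: "v \<in> Pts ?F" for v
    proof -
      define L where "L = ?H ls v"
      define B where "B = ?H (bs i) v"
      define Q where "Q = q v"
      define C where "C = c i v"
      define Xk where "Xk = v b [^] k"
      define Xi where "Xi = v b [^] length (bs i)"
      define Pv where "Pv = p' v"
      have mem: "L \<in> carrier K" "B \<in> carrier K" "Q \<in> carrier K" "C \<in> carrier K" "Xk \<in> carrier K" "Xi \<in> carrier K" "Pv \<in> carrier K"
        unfolding L_def B_def Q_def C_def Xk_def Xi_def Pv_def
        using Hc[OF g(3) v] Hc[OF bc(3) v] Pol_closed[OF Gid_step(2) vJ(1)[OF v]] Pol_closed[OF bc(4) vJ(1)[OF v]]
          Pol_closed[OF pP vJ(1)[OF v]] vJ(2)[OF v] by auto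
      have Xm: "v b [^] m = Xk \<otimes> Xi" unfolding Xk_def Xi_def using nat_pow_mult[OF vJ(2)[OF v]] k by simp
      have 1: "g v = L \<oplus> (Xk \<otimes> Xi) \<otimes> Pv" using g(4) v app[OF g(3) pP v] g(2) Xm unfolding L_def Pv_def by simp
      have 2: "f i v = B \<oplus> Xi \<otimes> C" using bc(5)[OF v] app[OF bc(3,4) v] unfolding B_def Xi_def C_def by simp
      have "?H (z @ bs i) v = Xk \<otimes> B"
        using horner_replicate_zero[OF coeffs_closed[OF bc(3) vJ(1)[OF v]] vJ(2)[OF v]]
        unfolding z_def Xk_def B_def by simp
      then have 3: "?H ls' v = L \<oplus> Q \<otimes> (Xk \<otimes> B)"
        using ls'(3) ss(3) vJ[OF v] unfolding L_def Q_def by simp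
      have rP: "r v = Pv \<oplus> Q \<otimes> C" using Gid_step(5) vJ[OF v] i unfolding Pv_def Q_def C_def by simp
      have "g' v = (L \<oplus> (Xk \<otimes> Xi) \<otimes> Pv) \<oplus> (Q \<otimes> Xk) \<otimes> (B \<oplus> Xi \<otimes> C)"
        unfolding g'_def 1 2 Q_def Xk_def by simp
      also have "\<dots> = (L \<oplus> Q \<otimes> (Xk \<otimes> B)) \<oplus> (Xk \<otimes> Xi) \<otimes> (Pv \<oplus> Q \<otimes> C)" using mem by algebra
      also have "\<dots> = ?H (ls' @ [r]) v" using app[OF ls'(1) Gid_step(4) v] ls'(2) 3 Xm rP by simp
      finally show ?thesis .
    qed
    ultimately show ?case using ls' by blast
  qed
  obtain g ls where g: "g \<in> Gid ?F (f ` {..<n})" "length ls = m" "set ls \<subseteq> Pol J" "\<forall>v\<in>Pts ?F. g v = ?H (ls @ [c n]) v"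
    using key[OF n] by blast
  obtain ms where ms: "set ms \<subseteq> Pol J" "length ms = m"
    "\<forall>v\<in>Pts J. \<forall>x\<in>carrier K. ceval ms v x = \<ominus> \<one> \<otimes> ceval ls v x"
    using coeffs_scale[OF g(3) Pol_const[of "\<ominus> \<one>"]] g(2) by auto
  obtain ds where ds: "set ds \<subseteq> Pol J" "length ds = m"
      "\<forall>v\<in>Pts J. \<forall>x\<in>carrier K. ceval ds v x =
         ceval (bs n) v x \<oplus> ceval ms v x"
    using coeffs_add[OF bc(3)[of n] ms(1)] ms(2) bc(1)[of n] unfolding m_def by auto
  have gP: "g \<in> Pol ?F" using Gid_Pol[OF g(1)] .
  \<comment> \<open>\<open>ds\<close> represents f n - g with the equal leading terms left out,
    hence has length \<open>m\<close>, one less than \<open>d (f n)\<close>.\<close>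
  have eq: "?H ds v = f n v \<oplus> \<ominus> \<one> \<otimes> g v" "f n v = ?H ds v \<oplus> g v" if v: "v \<in> Pts ?F" for v
  proof -
    define B where "B = ?H (bs n) v"
    define L where "L = ?H ls v"
    define Y where "Y = v b [^] m \<otimes> c n v"
    have mem: "B \<in> carrier K" "L \<in> carrier K" "Y \<in> carrier K" unfolding B_def L_def Y_def
      using Hc[OF bc(3) v] Hc[OF g(3) v] vJ(2)[OF v] Pol_closed[OF bc(4) vJ(1)[OF v]] by auto
    have 1: "?H ds v = B \<oplus> \<ominus> \<one> \<otimes> L" using ds(3) ms(3) vJ[OF v] unfolding B_def L_def by simp
    have 2: "f n v = B \<oplus> Y" using bc(5)[OF v] app[OF bc(3,4) v] bc(1) unfolding B_def Y_def m_def by simp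
    have 3: "g v = L \<oplus> Y" using g(4) v app[OF g(3) bc(4) v] g(2) unfolding L_def Y_def by simp
    show "?H ds v = f n v \<oplus> \<ominus> \<one> \<otimes> g v" unfolding 1 2 3 using mem by algebra
    show "f n v = ?H ds v \<oplus> g v" unfolding 1 2 3 using mem by algebra
  qed
  have "?H ds \<in> N"
  proof -
    have "f ` {..<n} \<subseteq> Gid ?F (range p)" using f(1) unfolding N_def by auto
    then have "g \<in> N" using Gid_trans[OF p(1) _ g(1)] unfolding N_def by blast
    then have "(\<lambda>v. \<ominus> \<one> \<otimes> g v) \<in> N"
      unfolding N_def by (intro Gid_mult[OF p(1), of g "\<lambda>v. \<ominus> \<one>"] Pol_const) auto
    then have "(\<lambda>v. f n v \<oplus> \<ominus> \<one> \<otimes> g v) \<in> N" using f(1) unfolding N_def by (intro Gid_add[OF p(1)]) auto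
    then show ?thesis unfolding N_def using eq(1) by (intro Gid_cong[OF _ HP[OF ds(1)]]) auto
  qed
  moreover have "?H ds \<notin> Gid ?F (f ` {..<n})"
  proof
    assume "?H ds \<in> Gid ?F (f ` {..<n})"
    from Gid_add[OF fP this g(1)] have "(\<lambda>v. ?H ds v \<oplus> g v) \<in> Gid ?F (f ` {..<n})" .
    moreover have "f n \<in> Pol ?F" using f(1) NP by blast
    moreover have "\<forall>v\<in>Pts ?F. f n v = ?H ds v \<oplus> g v" using eq(2) by blast
    ultimately have "f n \<in> Gid ?F (f ` {..<n})" by (rule Gid_cong)
    then show False using f(2) by blast
  qed
  ultimately have "d (f n) \<le> d (?H ds)" by (rule f(3))
  also have "\<dots> \<le> m" using d_le[OF ds(1)] ds(2) by auto
  finally show False using bc(2)[of n] unfolding m_def by simp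
qed

lemma noeth_finite: "finite F \<Longrightarrow> noeth F"
proof (induction F rule: finite_induct)
  case empty
  show ?case by (rule noeth_empty)
next
  case (insert b J)
  show ?case by (rule noeth_insert[OF insert(3,2)])
qed

theorem hilbert_basis:
  assumes "finite F" "H \<subseteq> Pol F"
  shows "\<exists>H0\<subseteq>H. finite H0 \<and> H \<subseteq> Gid F H0"
  using noeth_finite_basis[OF noeth_finite[OF assms(1)] assms(2)] .

end

section \<open>Irreducible sets and Krull dimension\<close>

lemma irreducible_nonempty: "irreducible_in T S \<Longrightarrow> S \<noteq> {}"
  and irreducible_topspace: "irreducible_in T S \<Longrightarrow> S \<subseteq> topspace T"
  unfolding irreducible_in_def by (elim conjE, assumption)+

lemma irreducible_in_subtopology:
  "irreducible_in (subtopology T W) S \<longleftrightarrow> S \<subseteq> W \<and> irreducible_in T S"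
proof
  assume S: "irreducible_in (subtopology T W) S"
  then have SW: "S \<subseteq> W" "S \<subseteq> topspace T" "S \<noteq> {}" unfolding irreducible_in_def by auto
  have "S \<subseteq> A \<or> S \<subseteq> B" if "closedin T A" "closedin T B" "S \<subseteq> A \<union> B" for A B
  proof -
    have "closedin (subtopology T W) (W \<inter> A)" "closedin (subtopology T W) (W \<inter> B)"
      using that by (auto simp: closedin_subtopology_Int_closed)
    moreover have "S \<subseteq> (W \<inter> A) \<union> (W \<inter> B)" using that SW by auto
    ultimately show ?thesis using S unfolding irreducible_in_def by blast
  qed
  then show "S \<subseteq> W \<and> irreducible_in T S" using SW unfolding irreducible_in_def by blast
next
  assume S: "S \<subseteq> W \<and> irreducible_in T S"
  have "S \<subseteq> A \<or> S \<subseteq> B"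
    if AB: "closedin (subtopology T W) A" "closedin (subtopology T W) B" "S \<subseteq> A \<union> B" for A B
  proof -
    obtain A' where A: "closedin T A'" "A = A' \<inter> W"
      using AB(1) unfolding closedin_subtopology by blast
    obtain B' where B: "closedin T B'" "B = B' \<inter> W"
      using AB(2) unfolding closedin_subtopology by blast
    have "S \<subseteq> A' \<union> B'" using AB(3) A B by auto
    then have "S \<subseteq> A' \<or> S \<subseteq> B'" using S A(1) B(1) unfolding irreducible_in_def by blast
    then show ?thesis using S A B by auto
  qed
  then show "irreducible_in (subtopology T W) S" using S unfolding irreducible_in_def by auto
qed

lemma irreducible_meet:
  assumes "irreducible_in T S" "openin T U" "openin T V" "S \<inter> U \<noteq> {}" "S \<inter> V \<noteq> {}"
  shows "S \<inter> U \<inter> V \<noteq> {}"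
proof
  assume e: "S \<inter> U \<inter> V = {}"
  have "S \<subseteq> (topspace T - U) \<union> (topspace T - V)" using e assms(1) unfolding irreducible_in_def by auto
  then have "S \<subseteq> topspace T - U \<or> S \<subseteq> topspace T - V"
    using assms(1-3) unfolding irreducible_in_def by (meson openin_closedin_eq closedin_diff closedin_topspace)
  then show False using assms by auto
qed

lemma irreducibleI_open:
  assumes "S \<subseteq> topspace T" "S \<noteq> {}"
    and "\<And>U V. openin T U \<Longrightarrow> openin T V \<Longrightarrow> S \<inter> U \<noteq> {} \<Longrightarrow> S \<inter> V \<noteq> {} \<Longrightarrow> S \<inter> U \<inter> V \<noteq> {}"
  shows "irreducible_in T S"
  unfolding irreducible_in_def
proof (intro conjI allI impI)
  fix A B assume AB: "closedin T A \<and> closedin T B \<and> S \<subseteq> A \<union> B"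
  show "S \<subseteq> A \<or> S \<subseteq> B"
  proof (rule ccontr)
    assume "\<not> ?thesis"
    then have "S \<inter> (topspace T - A) \<noteq> {}" "S \<inter> (topspace T - B) \<noteq> {}" using assms(1) by auto
    from assms(3)[OF _ _ this] AB show False by (auto simp: openin_diff)
  qed
qed (use assms in auto)

lemma irreducible_Int_open:
  assumes "irreducible_in T S" "openin T U" "S \<inter> U \<noteq> {}"
  shows "irreducible_in T (S \<inter> U)"
proof (rule irreducibleI_open)
  show "S \<inter> U \<subseteq> topspace T" using assms unfolding irreducible_in_def by auto
  fix A B assume AB: "openin T A" "openin T B" "S \<inter> U \<inter> A \<noteq> {}" "S \<inter> U \<inter> B \<noteq> {}"
  have "S \<inter> (U \<inter> A) \<inter> (U \<inter> B) \<noteq> {}"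
    using AB assms by (intro irreducible_meet[of T]) auto
  then show "S \<inter> U \<inter> A \<inter> B \<noteq> {}" by auto
qed (use assms in auto)

lemma irreducible_between_closure:
  assumes "irreducible_in T S" "S \<subseteq> S'" "S' \<subseteq> T closure_of S"
  shows "irreducible_in T S'"
proof (rule irreducibleI_open)
  show "S' \<subseteq> topspace T" using assms(3) closure_of_subset_topspace by fastforce
  show "S' \<noteq> {}" using assms unfolding irreducible_in_def by auto
  fix A B assume AB: "openin T A" "openin T B" "S' \<inter> A \<noteq> {}" "S' \<inter> B \<noteq> {}"
  then have "A \<inter> T closure_of S \<noteq> {}" "B \<inter> T closure_of S \<noteq> {}" using assms(3) by auto
  then have "S \<inter> A \<noteq> {}" "S \<inter> B \<noteq> {}"
    using openin_Int_closure_of_eq_empty AB(1,2) by (metis inf_commute)+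
  then have "S \<inter> A \<inter> B \<noteq> {}" using irreducible_meet[OF assms(1) AB(1,2)] by blast
  then show "S' \<inter> A \<inter> B \<noteq> {}" using assms by auto
qed

lemma irreducible_image:
  assumes "irreducible_in T S" "continuous_map (subtopology T V) T' f" "S \<subseteq> V"
  shows "irreducible_in T' (f ` S)"
proof (rule irreducibleI_open)
  have S: "S \<subseteq> topspace (subtopology T V)" "S \<noteq> {}" using assms unfolding irreducible_in_def by auto
  then show "f ` S \<subseteq> topspace T'" "f ` S \<noteq> {}"
    using assms(2) continuous_map_image_subset_topspace by blast+
  fix A B assume AB: "openin T' A" "openin T' B" "f ` S \<inter> A \<noteq> {}" "f ` S \<inter> B \<noteq> {}"
  let ?P = "\<lambda>A. {x \<in> topspace (subtopology T V). f x \<in> A}"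
  have "openin (subtopology T V) (?P A)" "openin (subtopology T V) (?P B)"
    using assms(2) AB openin_continuous_map_preimage by blast+
  moreover have "S \<inter> ?P A \<noteq> {}" "S \<inter> ?P B \<noteq> {}" using AB S by auto
  moreover have "irreducible_in (subtopology T V) S"
    using assms irreducible_in_subtopology by blast
  ultimately have "S \<inter> ?P A \<inter> ?P B \<noteq> {}" by (intro irreducible_meet)
  then show "f ` S \<inter> A \<inter> B \<noteq> {}" by auto
qed

lemma irreducible_subset_Union:
  assumes "irreducible_in T S" "finite \<A>" "\<And>A. A \<in> \<A> \<Longrightarrow> closedin T A" "S \<subseteq> \<Union>\<A>"
  shows "\<exists>A\<in>\<A>. S \<subseteq> A"
  using assms(2-4)
proof (induction \<A> rule: finite_induct)
  case empty
  then show ?case using assms(1) unfolding irreducible_in_def by auto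
next
  case (insert A \<A>)
  have "closedin T (\<Union>\<A>)" using insert.hyps(1) insert.prems(1) by (intro closedin_Union) blast+
  moreover have "closedin T A" "S \<subseteq> A \<union> \<Union>\<A>" using insert.prems by auto
  ultimately have "S \<subseteq> A \<or> S \<subseteq> \<Union>\<A>" using assms(1) unfolding irreducible_in_def by blast
  then show ?case using insert.IH insert.prems(1) by blast
qed

text \<open>Zorn's lemma. The union of a chain of irreducible sets is irreducible, because two open
  sets that meet the union both meet one common member.\<close>

lemma irreducible_in_component:
  assumes "irreducible_in T S" "S \<subseteq> W"
  obtains Z where "Z \<in> irreducible_components (subtopology T W)" "S \<subseteq> Z"
proof -
  let ?A = "{Z. irreducible_in T Z \<and> S \<subseteq> Z \<and> Z \<subseteq> W}"
  have "\<exists>M\<in>?A. \<forall>Z\<in>?A. M \<subseteq> Z \<longrightarrow> Z = M"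
  proof (rule subset_Zorn_nonempty)
    show "?A \<noteq> {}" using assms by auto
    fix \<C> assume C: "\<C> \<noteq> {}" "subset.chain ?A \<C>"
    have "\<C> \<subseteq> ?A \<and> (\<forall>X\<in>\<C>. \<forall>Y\<in>\<C>. X \<subseteq> Y \<or> Y \<subseteq> X)"
      using C(2) unfolding subset_chain_def .
    then have sub: "\<C> \<subseteq> ?A" and ch': "\<forall>X\<in>\<C>. \<forall>Y\<in>\<C>. X \<subseteq> Y \<or> Y \<subseteq> X" by blast+
    have ch: "X \<subseteq> Y \<or> Y \<subseteq> X" if "X \<in> \<C>" "Y \<in> \<C>" for X Y
      using ch' that by blast
    have "irreducible_in T (\<Union>\<C>)"
    proof (rule irreducibleI_open)
      show "\<Union>\<C> \<subseteq> topspace T" using sub irreducible_topspace by blast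
      obtain X where "X \<in> \<C>" using C(1) by blast
      then have "S \<subseteq> \<Union>\<C>" using sub by blast
      then show "\<Union>\<C> \<noteq> {}" using irreducible_nonempty[OF assms(1)] by blast
      fix U V assume UV: "openin T U" "openin T V" "\<Union>\<C> \<inter> U \<noteq> {}" "\<Union>\<C> \<inter> V \<noteq> {}"
      then obtain X Y where XY: "X \<in> \<C>" "Y \<in> \<C>" "X \<inter> U \<noteq> {}" "Y \<inter> V \<noteq> {}" by blast
      obtain M where "M \<in> \<C>" "M \<inter> U \<noteq> {}" "M \<inter> V \<noteq> {}" using ch[OF XY(1,2)] XY by blast
      then show "\<Union>\<C> \<inter> U \<inter> V \<noteq> {}" using irreducible_meet[OF _ UV(1,2), of M] sub by blast
    qed
    then show "\<Union>\<C> \<in> ?A" using C(1) sub by blast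
  qed
  then obtain M where M: "M \<in> ?A" "\<forall>Z\<in>?A. M \<subseteq> Z \<longrightarrow> Z = M" by blast
  have "M \<in> irreducible_components (subtopology T W)"
    unfolding irreducible_components_def irreducible_in_subtopology using M by blast
  then show ?thesis using that M by blast
qed

subsection \<open>Noetherian subspaces\<close>

definition noetherian_sub :: "'a topology \<Rightarrow> 'a set \<Rightarrow> bool" where
  "noetherian_sub T W \<longleftrightarrow> (\<forall>\<C>. \<C> \<noteq> {} \<longrightarrow> (\<forall>C\<in>\<C>. closedin (subtopology T W) C) \<longrightarrow>
     (\<exists>M\<in>\<C>. \<forall>C\<in>\<C>. C \<subseteq> M \<longrightarrow> C = M))"

lemma noetherian_subD:
  assumes "noetherian_sub T W" "\<C> \<noteq> {}" "\<And>C. C \<in> \<C> \<Longrightarrow> closedin (subtopology T W) C"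
  shows "\<exists>M\<in>\<C>. \<forall>C\<in>\<C>. C \<subseteq> M \<longrightarrow> C = M"
  using assms unfolding noetherian_sub_def by simp

text \<open>The closure in \<open>W\<close> of a closed subset of \<open>V\<close> has that subset
  as its trace on \<open>V\<close>, so a minimal closure comes from a minimal subset.\<close>

lemma noetherian_subset:
  assumes N: "noetherian_sub T W" and V: "V \<subseteq> W"
  shows "noetherian_sub T V"
  unfolding noetherian_sub_def
proof (intro allI impI)
  fix \<C> assume C: "\<C> \<noteq> {}" "\<forall>C\<in>\<C>. closedin (subtopology T V) C"
  let ?c = "\<lambda>C. (subtopology T W) closure_of C"
  have tr0: "?c C \<inter> V = C" if mem: "C \<in> \<C>" for C
  proof -
    have cl: "closedin (subtopology (subtopology T W) V) C" using C(2) mem V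
      by (simp add: subtopology_subtopology inf.absorb2)
    then have CV: "C \<subseteq> V" "C \<subseteq> topspace (subtopology T W)" using closedin_subset by fastforce+
    have "C = V \<inter> ?c C"
      using closure_of_subtopology[of "subtopology T W" V C] closure_of_closedin[OF cl] CV(1)
      by (simp add: inf.absorb2 Int_absorb1)
    then show ?thesis by auto
  qed
  have "?c ` \<C> \<noteq> {}" "\<And>D. D \<in> ?c ` \<C> \<Longrightarrow> closedin (subtopology T W) D" using C(1) by auto
  from noetherian_subD[OF N this]
  obtain M where M: "M \<in> ?c ` \<C>" "\<forall>D\<in>?c ` \<C>. D \<subseteq> M \<longrightarrow> D = M" by blast
  then obtain M0 where M0: "M0 \<in> \<C>" "M = ?c M0" by blast
  have "C = M0" if "C \<in> \<C>" "C \<subseteq> M0" for C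
  proof -
    have "?c C \<subseteq> M" unfolding M0(2) by (rule closure_of_mono[OF that(2)])
    then have "?c C = ?c M0" using M(2)[rule_format, OF imageI[OF that(1)]] M0(2) by simp
    then have "?c C \<inter> V = ?c M0 \<inter> V" by (rule arg_cong)
    then show ?thesis unfolding tr0[OF that(1)] tr0[OF M0(1)] .
  qed
  then show "\<exists>M\<in>\<C>. \<forall>C\<in>\<C>. C \<subseteq> M \<longrightarrow> C = M"
    by (intro bexI[of _ M0] ballI impI M0(1))
qed

text \<open>The trace on \<open>V\<close> is minimised first, then, among the sets with this trace,
  the trace on \<open>W\<close>.\<close>

lemma noetherian_Un:
  assumes "noetherian_sub T V" "noetherian_sub T W"
  shows "noetherian_sub T (V \<union> W)"
  unfolding noetherian_sub_def
proof (intro allI impI)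
  fix \<C> assume C: "\<C> \<noteq> {}" "\<forall>C\<in>\<C>. closedin (subtopology T (V \<union> W)) C"
  have tr: "closedin (subtopology T V) (C \<inter> V)" "closedin (subtopology T W) (C \<inter> W)" "C \<subseteq> V \<union> W"
    if "C \<in> \<C>" for C
  proof -
    have "closedin (subtopology T (V \<union> W)) C" using C(2) that by blast
    then obtain D where "closedin T D" "C = D \<inter> (V \<union> W)" unfolding closedin_subtopology by blast
    then have "C \<inter> V = D \<inter> V" "C \<inter> W = D \<inter> W" "C \<subseteq> V \<union> W" "closedin T D" by auto
    then show "closedin (subtopology T V) (C \<inter> V)" "closedin (subtopology T W) (C \<inter> W)" "C \<subseteq> V \<union> W"
      by (auto simp: closedin_subtopology)
  qed
  have "(\<lambda>C. C \<inter> V) ` \<C> \<noteq> {}" "\<And>D. D \<in> (\<lambda>C. C \<inter> V) ` \<C> \<Longrightarrow> closedin (subtopology T V) D"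
    using C(1) tr(1) by auto
  from noetherian_subD[OF assms(1) this]
  obtain M where M: "M \<in> (\<lambda>C. C \<inter> V) ` \<C>" "\<forall>D\<in>(\<lambda>C. C \<inter> V) ` \<C>. D \<subseteq> M \<longrightarrow> D = M" by blast
  let ?D = "{C \<in> \<C>. C \<inter> V = M}"
  have "(\<lambda>C. C \<inter> W) ` ?D \<noteq> {}" "\<And>D. D \<in> (\<lambda>C. C \<inter> W) ` ?D \<Longrightarrow> closedin (subtopology T W) D"
    using M(1) tr(2) by auto
  from noetherian_subD[OF assms(2) this]
  obtain L where L: "L \<in> (\<lambda>C. C \<inter> W) ` ?D" "\<forall>D\<in>(\<lambda>C. C \<inter> W) ` ?D. D \<subseteq> L \<longrightarrow> D = L" by blast
  then obtain C0 where C0: "C0 \<in> \<C>" "C0 \<inter> V = M" "C0 \<inter> W = L" by blast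
  have "C = C0" if C': "C \<in> \<C>" "C \<subseteq> C0" for C
  proof -
    have "C \<inter> V \<subseteq> M" "C \<inter> W \<subseteq> L" using C'(2) C0 by auto
    then have V: "C \<inter> V = M" using M(2)[rule_format, OF imageI[OF C'(1)]] by simp
    then have "C \<in> ?D" using C'(1) by simp
    then have "C \<inter> W = L" using L(2)[rule_format, OF imageI] \<open>C \<inter> W \<subseteq> L\<close> by blast
    then have "C \<inter> V = C0 \<inter> V" "C \<inter> W = C0 \<inter> W" using V C0 by simp_all
    then show ?thesis using tr(3)[OF C'(1)] tr(3)[OF C0(1)] by blast
  qed
  then show "\<exists>M\<in>\<C>. \<forall>C\<in>\<C>. C \<subseteq> M \<longrightarrow> C = M"
    by (intro bexI[of _ C0] ballI impI C0(1))
qed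

lemma noetherian_UN:
  assumes "finite \<U>" "\<And>U. U \<in> \<U> \<Longrightarrow> noetherian_sub T U"
  shows "noetherian_sub T (\<Union>\<U>)"
  using assms
proof (induction \<U> rule: finite_induct)
  case empty
  have "\<exists>M\<in>\<C>. \<forall>C\<in>\<C>. C \<subseteq> M \<longrightarrow> C = M" if "\<C> \<noteq> {}" "\<forall>C\<in>\<C>. closedin (subtopology T {}) C" for \<C>
  proof -
    have "C = {}" if "C \<in> \<C>" for C using that \<open>\<forall>C\<in>\<C>. _\<close> closedin_subset by fastforce
    then show ?thesis using \<open>\<C> \<noteq> {}\<close> by blast
  qed
  then have "noetherian_sub T {}" unfolding noetherian_sub_def by (intro allI impI)
  then show ?case by simp
next
  case (insert U \<U>)
  then show ?case using noetherian_Un[of T U "\<Union>\<U>"] by simp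
qed

text \<open>A minimal closed set without such a decomposition would be reducible, and its two proper
  closed parts would decompose.\<close>

lemma noetherian_decomposition:
  assumes N: "noetherian_sub T W" and C: "closedin (subtopology T W) C"
  shows "\<exists>\<S>. finite \<S> \<and> (\<forall>S\<in>\<S>. closedin (subtopology T W) S \<and> irreducible_in T S) \<and> C = \<Union>\<S>"
proof (rule ccontr)
  define Q where "Q = (\<lambda>S. closedin (subtopology T W) S \<and> irreducible_in T S)"
  define P where "P = (\<lambda>C. \<exists>\<S>. finite \<S> \<and> (\<forall>S\<in>\<S>. Q S) \<and> C = \<Union>\<S>)"
  define bad where "bad = {C. closedin (subtopology T W) C \<and> \<not> P C}"
  assume "\<not> ?thesis"
  then have "C \<in> bad" using C unfolding bad_def P_def Q_def by simp
  then have ne: "bad \<noteq> {}" by blast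
  have "closedin (subtopology T W) C" if "C \<in> bad" for C using that unfolding bad_def by simp
  from noetherian_subD[OF N ne this]
  obtain M where M: "M \<in> bad" "\<forall>C\<in>bad. C \<subseteq> M \<longrightarrow> C = M" by (rule bexE)
  have MP: "\<not> P M" and Mc: "closedin (subtopology T W) M" using M(1) unfolding bad_def by simp_all
  have "M \<noteq> {}"
  proof
    assume "M = {}"
    then have "P M" unfolding P_def by (intro exI[of _ "{}"]) simp
    then show False using MP by simp
  qed
  moreover have "\<not> irreducible_in (subtopology T W) M"
  proof
    assume "irreducible_in (subtopology T W) M"
    then have "Q M" unfolding Q_def using Mc irreducible_in_subtopology[of T W M] by simp
    then have "P M" unfolding P_def by (intro exI[of _ "{M}"]) simp
    then show False using MP by simp
  qed
  moreover have "M \<subseteq> topspace (subtopology T W)" using closedin_subset[OF Mc] .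
  ultimately obtain A B where AB: "closedin (subtopology T W) A" "closedin (subtopology T W) B" "M \<subseteq> A \<union> B"
    "\<not> M \<subseteq> A" "\<not> M \<subseteq> B" unfolding irreducible_in_def by blast
  have good: "P (M \<inter> A)" if A: "closedin (subtopology T W) A" "\<not> M \<subseteq> A" for A
  proof (rule ccontr)
    assume "\<not> P (M \<inter> A)"
    then have "M \<inter> A \<in> bad" unfolding bad_def using closedin_Int[OF Mc A(1)] by simp
    from M(2)[rule_format, OF this] have "M \<inter> A = M" by simp
    then show False using A(2) by blast
  qed
  obtain \<S>1 where S1: "finite \<S>1" "\<forall>S\<in>\<S>1. Q S" "M \<inter> A = \<Union>\<S>1"
    using good[OF AB(1,4)] unfolding P_def by blast
  obtain \<S>2 where S2: "finite \<S>2" "\<forall>S\<in>\<S>2. Q S" "M \<inter> B = \<Union>\<S>2"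
    using good[OF AB(2,5)] unfolding P_def by blast
  have "finite (\<S>1 \<union> \<S>2)" "\<forall>S\<in>\<S>1 \<union> \<S>2. Q S" using S1 S2 by auto
  moreover have "M = \<Union>(\<S>1 \<union> \<S>2)"
    unfolding Union_Un_distrib S1(3)[symmetric] S2(3)[symmetric] using AB(3) by blast
  ultimately have "P M" unfolding P_def by blast
  then show False using MP by simp
qed

text \<open>In a decomposition with the fewest pieces no piece is covered by the others. Removing
  the others therefore leaves a nonempty relatively open set inside a single piece.\<close>

lemma noetherian_open_pieces:
  assumes N: "noetherian_sub T W" and W: "W \<subseteq> topspace T"
  shows "\<exists>\<S>. finite \<S> \<and> W = \<Union>\<S> \<and> (\<forall>S\<in>\<S>. closedin (subtopology T W) S \<and> irreducible_in T S) \<and>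
    (\<forall>S\<in>\<S>. \<not> S \<subseteq> \<Union>(\<S> - {S}))"
proof -
  define Q where "Q = (\<lambda>S. closedin (subtopology T W) S \<and> irreducible_in T S)"
  define P where "P = (\<lambda>\<S>. finite \<S> \<and> W = \<Union>\<S> \<and> (\<forall>S\<in>\<S>. Q S))"
  have "closedin (subtopology T W) W" using W by (metis closedin_topspace topspace_subtopology_subset)
  from noetherian_decomposition[OF N this] obtain \<S>0 where "P \<S>0" unfolding P_def Q_def by blast
  from ex_has_least_nat[of P, OF this, of card]
  obtain \<S> where S: "P \<S>" "\<forall>\<S>'. P \<S>' \<longrightarrow> card \<S> \<le> card \<S>'" by blast
  have Sf: "finite \<S>" "W = \<Union>\<S>" "\<forall>S\<in>\<S>. Q S" using S(1) unfolding P_def by simp_all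
  have "\<not> A \<subseteq> \<Union>(\<S> - {A})" if A: "A \<in> \<S>" for A
  proof
    assume "A \<subseteq> \<Union>(\<S> - {A})"
    then have "\<Union>(\<S> - {A}) = \<Union>\<S>" using A by blast
    then have "P (\<S> - {A})" using Sf unfolding P_def by simp
    then have "card \<S> \<le> card (\<S> - {A})" using S(2) by blast
    then show False using card_Diff1_less[OF Sf(1) A] by simp
  qed
  then show ?thesis using Sf unfolding Q_def by (intro exI[of _ \<S>]) simp
qed

subsection \<open>Chains\<close>

text \<open>One witness for \<open>dim_of\<close>: comparing dimensions through the lengths of
  chains keeps all arguments within the natural numbers.\<close>

definition irr_chain :: "'a topology \<Rightarrow> 'a set \<Rightarrow> nat \<Rightarrow> bool" where
  "irr_chain T W n \<longleftrightarrow> (\<exists>C. (\<forall>i\<le>n. closedin (subtopology T W) (C i) \<and> irreducible_in T (C i)) \<and>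
     (\<forall>i<n. C i \<subset> C (Suc i)))"

lemma dim_of_chains: "dim_of T W = (SUP n \<in> {n. irr_chain T W n}. ereal (real n))"
proof -
  have "C \<subseteq> W" if "closedin (subtopology T W) C" for C using closedin_subset[OF that] by auto
  then have "{n. irr_chain T W n} = {n. \<exists>C :: nat \<Rightarrow> 'a set.
       (\<forall>i\<le>n. closedin (subtopology T W) (C i) \<and> irreducible_in (subtopology T W) (C i)) \<and> (\<forall>i<n. C i \<subset> C (Suc i))}"
    unfolding irr_chain_def irreducible_in_subtopology by blast
  then show ?thesis unfolding dim_of_def krull_dim_def by simp
qed

lemma irr_chain_le_dim: "irr_chain T W n \<Longrightarrow> ereal (real n) \<le> dim_of T W"
  unfolding dim_of_chains by (intro SUP_upper) auto

lemma dim_le: "(\<And>n. irr_chain T W n \<Longrightarrow> ereal (real n) \<le> e) \<Longrightarrow> dim_of T W \<le> e"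
  unfolding dim_of_chains by (intro SUP_least) auto

lemma closure_inter_closed:
  assumes "closedin (subtopology T W) C"
  shows "T closure_of C \<inter> W = C"
proof -
  obtain D where D: "closedin T D" "C = D \<inter> W" using assms unfolding closedin_subtopology by blast
  have "T closure_of C \<subseteq> D" using D closure_of_minimal by (metis inf_le1)
  moreover have "C \<subseteq> T closure_of C" using D closedin_subset[OF D(1)] by (intro closure_of_subset) auto
  ultimately show ?thesis using D(2) by auto
qed

text \<open>Closures in the larger set stay distinct because their traces on \<open>A\<close> are
  the original members.\<close>

lemma irr_chain_closures:
  assumes W: "A \<subseteq> W"
    and C: "\<forall>i\<le>n. closedin (subtopology T A) (C i) \<and> irreducible_in T (C i)" "\<forall>i<n. C i \<subset> C (Suc i)"
  shows "\<forall>i\<le>n. closedin (subtopology T W) (T closure_of (C i) \<inter> W) \<and> irreducible_in T (T closure_of (C i) \<inter> W)"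
    and "\<forall>i<n. T closure_of (C i) \<inter> W \<subset> T closure_of (C (Suc i)) \<inter> W"
proof -
  have sub: "C i \<subseteq> T closure_of (C i)" "C i \<subseteq> A" if "i \<le> n" for i
  proof -
    have c: "closedin (subtopology T A) (C i)" "irreducible_in T (C i)" using C(1) that by auto
    show "C i \<subseteq> A" using closedin_subset[OF c(1)] by auto
    show "C i \<subseteq> T closure_of (C i)" by (rule closure_of_subset[OF irreducible_topspace[OF c(2)]])
  qed
  show "\<forall>i\<le>n. closedin (subtopology T W) (T closure_of (C i) \<inter> W) \<and> irreducible_in T (T closure_of (C i) \<inter> W)"
  proof (intro allI impI conjI)
    fix i assume i: "i \<le> n"
    show "closedin (subtopology T W) (T closure_of (C i) \<inter> W)" unfolding closedin_subtopology
      by (intro exI[of _ "T closure_of (C i)"]) simp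
    show "irreducible_in T (T closure_of (C i) \<inter> W)"
    proof (rule irreducible_between_closure)
      show "irreducible_in T (C i)" using C(1) i by simp
      show "C i \<subseteq> T closure_of C i \<inter> W" using sub[OF i] W by simp
    qed simp
  qed
  show "\<forall>i<n. T closure_of (C i) \<inter> W \<subset> T closure_of (C (Suc i)) \<inter> W"
  proof (intro allI impI psubsetI)
    fix i assume i: "i < n"
    show "T closure_of (C i) \<inter> W \<subseteq> T closure_of (C (Suc i)) \<inter> W"
      using C(2) i closure_of_mono[of "C i" "C (Suc i)" T] by auto
    show "T closure_of (C i) \<inter> W \<noteq> T closure_of (C (Suc i)) \<inter> W"
    proof
      assume "T closure_of (C i) \<inter> W = T closure_of (C (Suc i)) \<inter> W"
      then have "T closure_of (C i) \<inter> A = T closure_of (C (Suc i)) \<inter> A" using W by blast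
      moreover have "T closure_of (C i) \<inter> A = C i" "T closure_of (C (Suc i)) \<inter> A = C (Suc i)"
        using C(1) i by (simp_all add: closure_inter_closed)
      ultimately show False using C(2) i by auto
    qed
  qed
qed

lemma irr_chain_mono:
  assumes "irr_chain T A n" "A \<subseteq> W"
  shows "irr_chain T W n"
proof -
  obtain C where C: "\<forall>i\<le>n. closedin (subtopology T A) (C i) \<and> irreducible_in T (C i)" "\<forall>i<n. C i \<subset> C (Suc i)"
    using assms(1) unfolding irr_chain_def by blast
  show ?thesis unfolding irr_chain_def
    by (intro exI[of _ "\<lambda>i. T closure_of (C i) \<inter> W"] conjI irr_chain_closures[OF assms(2) C])
qed

text \<open>The closed set \<open>D\<close> contains the closures of the old members in
  \<open>B\<close>, so \<open>B\<close> is strictly larger and becomes the new top.\<close>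

lemma irr_chain_Suc:
  assumes "irr_chain T A n" "A \<subseteq> B" "irreducible_in T B"
    and D: "closedin (subtopology T B) D" "A \<subseteq> D" "D \<noteq> B"
  shows "irr_chain T B (Suc n)"
proof -
  obtain C where C: "\<forall>i\<le>n. closedin (subtopology T A) (C i) \<and> irreducible_in T (C i)" "\<forall>i<n. C i \<subset> C (Suc i)"
    using assms(1) unfolding irr_chain_def by blast
  define E where "E = (\<lambda>i. if i \<le> n then T closure_of (C i) \<inter> B else B)"
  note cl = irr_chain_closures[OF assms(2) C]
  have BT: "closedin (subtopology T B) B"
    using assms(3) unfolding irreducible_in_def by (metis closedin_topspace topspace_subtopology_subset)
  have "T closure_of (C n) \<inter> B \<subseteq> D"
  proof -
    obtain D' where D': "closedin T D'" "D = D' \<inter> B" using D(1) unfolding closedin_subtopology by blast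
    have "closedin (subtopology T A) (C n)" using C(1) by simp
    then have "C n \<subseteq> A" using closedin_subset[of "subtopology T A" "C n"] by simp
    then have "T closure_of (C n) \<subseteq> D'" using D D' by (intro closure_of_minimal) auto
    then show ?thesis using D' by auto
  qed
  moreover have "D \<subseteq> B" using closedin_subset[OF D(1)] by auto
  ultimately have top: "T closure_of (C n) \<inter> B \<subset> B" using D(3) by blast
  show ?thesis unfolding irr_chain_def
  proof (intro exI[of _ E] conjI allI impI)
    fix i assume "i \<le> Suc n"
    then show "closedin (subtopology T B) (E i)" "irreducible_in T (E i)"
      unfolding E_def using cl(1) BT assms(3) by simp_all
  next
    fix i assume "i < Suc n"
    then show "E i \<subset> E (Suc i)" unfolding E_def using cl(2) top by (cases "i = n") simp_all
  qed
qed

lemma irr_chain_zero: "irreducible_in T W \<Longrightarrow> irr_chain T W 0"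
proof -
  assume W: "irreducible_in T W"
  then have "closedin (subtopology T W) W"
    by (metis irreducible_topspace closedin_topspace topspace_subtopology_subset)
  then show ?thesis unfolding irr_chain_def using W by (intro exI[of _ "\<lambda>_. W"]) simp
qed

lemma dim_at_ge:
  assumes "irreducible_in T S" "S \<subseteq> W" "x \<in> S" "irr_chain T S n"
  shows "ereal (real n) \<le> dim_at T W x"
proof -
  obtain Z where Z: "Z \<in> irreducible_components (subtopology T W)" "S \<subseteq> Z"
    using irreducible_in_component[OF assms(1,2)] by blast
  have "ereal (real n) \<le> dim_of T Z" using irr_chain_mono[OF assms(4) Z(2)] by (rule irr_chain_le_dim)
  also have "\<dots> \<le> dim_at T W x" unfolding dim_at_def using Z assms(3) by (intro SUP_upper) auto
  finally show ?thesis .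
qed

text \<open>The bound is asked of all irreducible sets through \<open>x\<close>, among them the
  components.\<close>

lemma dim_at_le:
  assumes "\<And>Z n. irreducible_in T Z \<Longrightarrow> Z \<subseteq> W \<Longrightarrow> x \<in> Z \<Longrightarrow> irr_chain T Z n \<Longrightarrow> ereal (real n) \<le> e"
  shows "dim_at T W x \<le> e"
  unfolding dim_at_def
proof (rule SUP_least)
  fix Z assume "Z \<in> {Z \<in> irreducible_components (subtopology T W). x \<in> Z}"
  then have "irreducible_in T Z" "Z \<subseteq> W" "x \<in> Z"
    unfolding irreducible_components_def irreducible_in_subtopology by auto
  then show "dim_of T Z \<le> e" using assms by (intro dim_le) blast
qed

section \<open>Affine sets\<close>

context acf
begin

text \<open>The coordinates are indexed by the functions themselves.\<close>

definition pt :: "'p \<Rightarrow> ('p \<Rightarrow> 'k) \<Rightarrow> 'k" where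
  "pt w = (\<lambda>f. f w)"

definition van :: "('p \<Rightarrow> 'k) set \<Rightarrow> 'p set \<Rightarrow> ((('p \<Rightarrow> 'k) \<Rightarrow> 'k) \<Rightarrow> 'k) set" where
  "van F S = {p \<in> Pol F. \<forall>w\<in>S. p (pt w) = \<zero>}"

text \<open>\<open>w \<mapsto> pt w\<close> is a closed embedding of \<open>C\<close> into the affine space \<open>K\<^sup>F\<close> with its Zariski topology.\<close>

definition aff :: "'p topology \<Rightarrow> 'p set \<Rightarrow> ('p \<Rightarrow> 'k) set \<Rightarrow> bool" where
  "aff T C F \<longleftrightarrow> C \<subseteq> topspace T \<and> finite F \<and> (\<forall>w\<in>C. pt w \<in> Pts F) \<and>
     (\<forall>v\<in>Pts F. (\<forall>p\<in>van F C. p v = \<zero>) \<longrightarrow> (\<exists>w\<in>C. \<forall>f\<in>F. v f = f w)) \<and>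
     (\<forall>p\<in>Pol F. openin (subtopology T C) {w \<in> C. p (pt w) \<noteq> \<zero>}) \<and>
     (\<forall>U w. openin T U \<longrightarrow> w \<in> U \<longrightarrow> w \<in> C \<longrightarrow>
        (\<exists>p\<in>Pol F. p (pt w) \<noteq> \<zero> \<and> {x \<in> C. p (pt x) \<noteq> \<zero>} \<subseteq> U)) \<and>
     (\<forall>w\<in>C. \<forall>w'\<in>C. (\<forall>f\<in>F. f w = f w') \<longrightarrow> w = w')"

lemma affD:
  assumes "aff T C F"
  shows aff_topspace: "C \<subseteq> topspace T" and aff_finite: "finite F"
    and aff_Pts: "w \<in> C \<Longrightarrow> pt w \<in> Pts F"
    and aff_point: "v \<in> Pts F \<Longrightarrow> (\<And>p. p \<in> van F C \<Longrightarrow> p v = \<zero>) \<Longrightarrow> \<exists>w\<in>C. \<forall>f\<in>F. v f = f w"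
    and aff_open: "p \<in> Pol F \<Longrightarrow> openin (subtopology T C) {w \<in> C. p (pt w) \<noteq> \<zero>}"
    and aff_basis: "openin T U \<Longrightarrow> w \<in> U \<Longrightarrow> w \<in> C \<Longrightarrow>
        \<exists>p\<in>Pol F. p (pt w) \<noteq> \<zero> \<and> {x \<in> C. p (pt x) \<noteq> \<zero>} \<subseteq> U"
    and aff_sep: "w \<in> C \<Longrightarrow> w' \<in> C \<Longrightarrow> (\<And>f. f \<in> F \<Longrightarrow> f w = f w') \<Longrightarrow> w = w'"
  using assms unfolding aff_def by simp_all

lemma pt_apply: "pt w f = f w" unfolding pt_def by simp

lemma aff_closed_value: "aff T C F \<Longrightarrow> p \<in> Pol F \<Longrightarrow> w \<in> C \<Longrightarrow> p (pt w) \<in> carrier K"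
  using Pol_closed[OF _ aff_Pts] .

lemma vanI: "p \<in> Pol F \<Longrightarrow> (\<And>w. w \<in> S \<Longrightarrow> p (pt w) = \<zero>) \<Longrightarrow> p \<in> van F S"
  unfolding van_def by simp

lemma vanD: "p \<in> van F S \<Longrightarrow> p \<in> Pol F" "p \<in> van F S \<Longrightarrow> w \<in> S \<Longrightarrow> p (pt w) = \<zero>"
  unfolding van_def by simp_all

lemma van_anti: "S \<subseteq> S' \<Longrightarrow> van F S' \<subseteq> van F S"
  unfolding van_def by auto

lemma aff_open_set:
  assumes "aff T C F" "p \<in> Pol F"
  obtains U where "openin T U" "{w \<in> C. p (pt w) \<noteq> \<zero>} = U \<inter> C"
  using aff_open[OF assms] unfolding openin_subtopology by blast

lemma aff_vanish_dense:
  assumes A: "aff T C F" and p: "p \<in> Pol F" and S: "\<And>x. x \<in> S \<Longrightarrow> p (pt x) = \<zero>"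
    and w: "w \<in> C" "w \<in> T closure_of (S \<inter> C)"
  shows "p (pt w) = \<zero>"
proof (rule ccontr)
  assume n: "p (pt w) \<noteq> \<zero>"
  obtain U where U: "openin T U" "{w \<in> C. p (pt w) \<noteq> \<zero>} = U \<inter> C" by (rule aff_open_set[OF A p])
  have "w \<in> U" using n w(1) U(2) by blast
  then obtain y where "y \<in> S \<inter> C" "y \<in> U" using w(2) U(1) unfolding in_closure_of by blast
  then show False using U(2) S by blast
qed

text \<open>Primality translates the fact that two nonempty open subsets of an irreducible set
  meet.\<close>

lemma van_prime:
  assumes A: "aff T C F" and S: "irreducible_in T S" "S \<subseteq> C"
  shows "prime_id F (van F S)"
  unfolding prime_id_def
proof (intro conjI ballI impI)
  note cl = aff_closed_value[OF A]
  show "van F S \<subseteq> Pol F" unfolding van_def by auto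
  show "(\<lambda>v. \<zero>) \<in> van F S" by (rule vanI) auto
  show "(\<lambda>v. \<one>) \<notin> van F S" using irreducible_nonempty[OF S(1)] unfolding van_def by auto
next
  fix p q assume "p \<in> Pol F" "q \<in> van F S" "\<forall>v\<in>Pts F. p v = q v"
  then show "p \<in> van F S" using aff_Pts[OF A] S(2) unfolding van_def by auto
next
  fix p q assume "p \<in> van F S" "q \<in> van F S"
  then show "(\<lambda>v. p v \<oplus> q v) \<in> van F S" using Pol_add[of p F q] unfolding van_def by auto
next
  fix p q assume p: "p \<in> Pol F" "q \<in> van F S"
  have "p (pt w) \<in> carrier K" if "w \<in> S" for w using aff_closed_value[OF A p(1)] that S(2) by auto
  then show "(\<lambda>v. p v \<otimes> q v) \<in> van F S" using p Pol_mult[of p F q] unfolding van_def by auto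
next
  fix p q assume pq: "p \<in> Pol F" "q \<in> Pol F" "(\<lambda>v. p v \<otimes> q v) \<in> van F S"
  show "p \<in> van F S \<or> q \<in> van F S"
  proof (rule ccontr)
    assume "\<not> ?thesis"
    then have n: "\<exists>w\<in>S. p (pt w) \<noteq> \<zero>" "\<exists>w\<in>S. q (pt w) \<noteq> \<zero>" using pq(1,2) unfolding van_def by auto
    obtain U where U: "openin T U" "{w \<in> C. p (pt w) \<noteq> \<zero>} = U \<inter> C" by (rule aff_open_set[OF A pq(1)])
    obtain V where V: "openin T V" "{w \<in> C. q (pt w) \<noteq> \<zero>} = V \<inter> C" by (rule aff_open_set[OF A pq(2)])
    have "S \<inter> U \<noteq> {}" "S \<inter> V \<noteq> {}" using n U(2) V(2) S(2) by blast+
    from irreducible_meet[OF S(1) U(1) V(1) this] obtain w where w: "w \<in> S" "w \<in> U" "w \<in> V" by blast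
    then have wC: "w \<in> C" using S(2) by blast
    have "p (pt w) \<noteq> \<zero>" "q (pt w) \<noteq> \<zero>" using w wC U(2) V(2) by blast+
    moreover have "p (pt w) \<otimes> q (pt w) = \<zero>" using pq(3) w(1) unfolding van_def by simp
    ultimately show False
      using integral aff_closed_value[OF A pq(1) wC] aff_closed_value[OF A pq(2) wC] by blast
  qed
qed

lemma aff_separate_closed:
  assumes A: "aff T C F" and S: "closedin (subtopology T C) S" and w: "w \<in> C" "w \<notin> S"
  shows "\<exists>p\<in>van F S. p (pt w) \<noteq> \<zero>"
proof -
  obtain D where D: "closedin T D" "S = D \<inter> C" using S unfolding closedin_subtopology by blast
  have "openin T (topspace T - D)" using D by blast
  moreover have "w \<in> topspace T - D" using w D(2) aff_topspace[OF A] by blast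
  ultimately obtain p where p: "p \<in> Pol F" "p (pt w) \<noteq> \<zero>" "{x \<in> C. p (pt x) \<noteq> \<zero>} \<subseteq> topspace T - D"
    using aff_basis[OF A] w(1) by blast
  have "p \<in> van F S" using p(1,3) D(2) by (intro vanI) auto
  then show ?thesis using p(2) by blast
qed

lemma aff_closed_subset:
  assumes A: "aff T C F" and S: "closedin (subtopology T C) S"
  shows "aff T S F"
  unfolding aff_def
proof (intro conjI ballI allI impI)
  have SC: "S \<subseteq> C" using closedin_subset[OF S] by auto
  show "S \<subseteq> topspace T" using SC aff_topspace[OF A] by auto
  show "finite F" by (rule aff_finite[OF A])
  show "pt w \<in> Pts F" if "w \<in> S" for w using aff_Pts[OF A] SC that by auto
  show "\<exists>w\<in>S. \<forall>f\<in>F. v f = f w" if v: "v \<in> Pts F" "\<forall>p\<in>van F S. p v = \<zero>" for v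
  proof -
    have "p v = \<zero>" if "p \<in> van F C" for p using v(2) that van_anti[OF SC] by auto
    then obtain w where w: "w \<in> C" "\<forall>f\<in>F. v f = f w" using aff_point[OF A v(1)] by blast
    have "w \<in> S"
    proof (rule ccontr)
      assume "w \<notin> S"
      then obtain p where p: "p \<in> van F S" "p (pt w) \<noteq> \<zero>" using aff_separate_closed[OF A S w(1)] by blast
      have "p (pt w) = p v" using Pol_cong[OF vanD(1)[OF p(1)], of "pt w" v] w(2) by (simp add: pt_apply)
      then show False using p v(2) by simp
    qed
    then show ?thesis using w(2) by blast
  qed
  show "openin (subtopology T S) {w \<in> S. p (pt w) \<noteq> \<zero>}" if p: "p \<in> Pol F" for p
  proof -
    obtain U where U: "openin T U" "{w \<in> C. p (pt w) \<noteq> \<zero>} = U \<inter> C" by (rule aff_open_set[OF A p])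
    have "{w \<in> S. p (pt w) \<noteq> \<zero>} = U \<inter> S" using U(2) SC by blast
    then show ?thesis using U(1) unfolding openin_subtopology by blast
  qed
  show "\<exists>p\<in>Pol F. p (pt w) \<noteq> \<zero> \<and> {x \<in> S. p (pt x) \<noteq> \<zero>} \<subseteq> U"
    if U: "openin T U" "w \<in> U" "w \<in> S" for U w
  proof -
    have "w \<in> C" using U(3) SC by auto
    from aff_basis[OF A U(1,2) this] obtain p where "p \<in> Pol F" "p (pt w) \<noteq> \<zero>" "{x \<in> C. p (pt x) \<noteq> \<zero>} \<subseteq> U"
      by blast
    then show ?thesis using SC by (intro bexI[of _ p]) auto
  qed
  show "w = w'" if "w \<in> S" "w' \<in> S" "\<forall>f\<in>F. f w = f w'" for w w'
    using aff_sep[OF A, of w w'] that SC by auto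
qed

text \<open>A strictly descending sequence \<open>D n\<close> yields polynomials \<open>q n\<close>
  that vanish on \<open>D (Suc n)\<close> but not on \<open>D n\<close>. By the basis property some
  \<open>q n\<close> is generated by earlier ones, and all of these vanish on
  \<open>D n\<close>.\<close>

lemma aff_noetherian:
  assumes A: "aff T C F"
  shows "noetherian_sub T C"
  unfolding noetherian_sub_def
proof (intro allI impI, rule ccontr)
  fix \<C> assume C: "\<C> \<noteq> {}" "\<forall>D\<in>\<C>. closedin (subtopology T C) D"
    and neg: "\<not> (\<exists>M\<in>\<C>. \<forall>D\<in>\<C>. D \<subseteq> M \<longrightarrow> D = M)"
  have "\<exists>f. \<forall>n::nat. f n \<in> \<C> \<and> f (Suc n) \<subset> f n"
  proof (rule dependent_nat_choice)
    show "\<exists>x. x \<in> \<C>" using C(1) by blast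
    fix x and n :: nat assume "x \<in> \<C>"
    then obtain D where "D \<in> \<C>" "D \<subseteq> x" "D \<noteq> x" using neg by blast
    then show "\<exists>y. y \<in> \<C> \<and> y \<subset> x" by blast
  qed
  then obtain D where D: "\<And>n::nat. D n \<in> \<C>" "\<And>n. D (Suc n) \<subset> D n" by blast
  have anti: "D n \<subseteq> D m" if "m \<le> n" for m n
    using that D(2) by (induction rule: dec_induct) auto
  have "\<exists>q. q \<in> van F (D (Suc n)) \<and> q \<notin> van F (D n)" for n
  proof -
    obtain w where w: "w \<in> D n" "w \<notin> D (Suc n)" using D(2)[of n] by blast
    have cl: "closedin (subtopology T C) (D (Suc n))" "closedin (subtopology T C) (D n)" using C(2) D(1) by auto
    have "w \<in> C" using w(1) closedin_subset[OF cl(2)] by auto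
    from aff_separate_closed[OF A cl(1) this w(2)] obtain q where "q \<in> van F (D (Suc n))" "q (pt w) \<noteq> \<zero>" by blast
    then show ?thesis using w(1) vanD(2)[of q F "D n" w] by blast
  qed
  then have "\<exists>q. \<forall>n. q n \<in> van F (D (Suc n)) \<and> q n \<notin> van F (D n)" by (intro choice allI)
  then obtain q where q: "\<And>n. q n \<in> van F (D (Suc n))" "\<And>n. q n \<notin> van F (D n)" by blast
  have "range q \<subseteq> Pol F" using vanD(1)[OF q(1)] by blast
  then obtain n where n: "q n \<in> Gid F (q ` {..<n})"
    using noeth_finite[OF aff_finite[OF A]] unfolding noeth_def by blast
  have "q n (pt w) = \<zero>" if w: "w \<in> D n" for w
  proof (rule Gid_vanish[OF n])
    have "closedin (subtopology T C) (D n)" using C(2) D(1) by auto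
    from closedin_subset[OF this] w have "w \<in> C" by auto
    then show "pt w \<in> Pts F" by (rule aff_Pts[OF A])
    show "\<forall>h\<in>q ` {..<n}. h (pt w) = \<zero>"
    proof
      fix h assume "h \<in> q ` {..<n}"
      then obtain i where i: "i < n" "h = q i" by blast
      have "w \<in> D (Suc i)" using anti[of "Suc i" n] i w by auto
      then show "h (pt w) = \<zero>" using vanD(2)[OF q(1)] i by simp
    qed
  qed
  then have "q n \<in> van F (D n)" using vanD(1)[OF q(1)] by (intro vanI)
  then show False using q(2) by blast
qed

text \<open>Rabinowitsch's trick: the inverse \<open>u\<close> of \<open>g\<close> becomes a
  coordinate, and so do the functions in \<open>E\<close>, which are fractions with denominator
  \<open>g\<close>. The relations u g = 1 and f g = a recover the new coordinates from the old
  ones.\<close>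

lemma aff_localize:
  assumes A: "aff T C F" and g: "g \<in> Pol F" and E: "finite E"
    and Ef: "\<And>f. f \<in> E \<Longrightarrow> \<exists>a\<in>Pol F. \<forall>w\<in>C. g (pt w) \<noteq> \<zero> \<longrightarrow> f w \<in> carrier K \<and> f w \<otimes> g (pt w) = a (pt w)"
  defines "D \<equiv> {w \<in> C. g (pt w) \<noteq> \<zero>}"
  defines "u \<equiv> (\<lambda>w. if w \<in> D then inv (g (pt w)) else \<zero>)"
  shows "aff T D (insert u (F \<union> E))"
proof -
  let ?F = "insert u (F \<union> E)"
  have DC: "D \<subseteq> C" unfolding D_def by auto
  have gD: "g (pt w) \<in> carrier K" "g (pt w) \<noteq> \<zero>" if "w \<in> D" for w
    using that aff_closed_value[OF A g] unfolding D_def by auto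
  have uD: "u w = inv (g (pt w))" "u w \<in> carrier K" "u w \<otimes> g (pt w) = \<one>" if "w \<in> D" for w
    using gD[OF that] that unfolding u_def by (auto simp: field_Units)
  have gF: "g \<in> Pol ?F" and FF: "p \<in> Pol F \<Longrightarrow> p \<in> Pol ?F" for p
    using Pol_mono[of F ?F] g by auto
  have fE: "f w \<in> carrier K" if "f \<in> E" "w \<in> D" for f w
    using Ef[OF that(1)] that(2) unfolding D_def by blast
  have ptF: "pt w \<in> Pts ?F" if w: "w \<in> D" for w
  proof -
    have "pt w \<in> Pts F" using aff_Pts[OF A] DC w by auto
    then show ?thesis using uD(2)[OF w] fE[OF _ w] unfolding Pts_def by (auto simp: pt_apply)
  qed
  \<comment> \<open>Multiplication by a power of \<open>g\<close> removes the new coordinates, so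
    open sets defined with them are already defined by polynomials in \<open>F\<close>.\<close>
  have clear: "\<exists>N. \<exists>q\<in>Pol F. \<forall>w\<in>D. g (pt w) [^] (N::nat) \<otimes> p (pt w) = q (pt w)" if "p \<in> Pol ?F" for p
    using that
  proof (induction p rule: Pol.induct)
    case (Pol_const c)
    then show ?case using Pol.Pol_const[OF Pol_const, of F] by (intro exI[of _ "0::nat"] bexI[of _ "\<lambda>v. c"]) auto
  next
    case (Pol_var f)
    then consider "f = u" | "f \<in> F" | "f \<in> E" by auto
    then show ?case
    proof cases
      case 1
      have "\<forall>w\<in>D. g (pt w) [^] (1::nat) \<otimes> pt w f = \<one>"
      proof
        fix w assume w: "w \<in> D"
        have "g (pt w) \<otimes> u w = \<one>" using uD(3)[OF w] m_comm[OF gD(1)[OF w] uD(2)[OF w]] by simp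
        then show "g (pt w) [^] (1::nat) \<otimes> pt w f = \<one>" unfolding 1 pt_apply[of w u] using gD(1)[OF w] by simp
      qed
      then show ?thesis by (intro exI[of _ "1::nat"] bexI[of _ "\<lambda>v. \<one>"]) simp_all
    next
      case 2
      have "\<forall>w\<in>D. g (pt w) [^] (0::nat) \<otimes> pt w f = pt w f" using ptF 2 unfolding Pts_def by auto
      then show ?thesis using Pol.Pol_var[OF 2] by (intro exI[of _ "0::nat"] bexI[of _ "\<lambda>v. v f"])
    next
      case 3
      from Ef[OF 3] obtain a where a: "a \<in> Pol F"
        "\<forall>w\<in>C. g (pt w) \<noteq> \<zero> \<longrightarrow> f w \<in> carrier K \<and> f w \<otimes> g (pt w) = a (pt w)" by blast
      have "\<forall>w\<in>D. g (pt w) [^] (1::nat) \<otimes> pt w f = a (pt w)"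
      proof
        fix w assume w: "w \<in> D"
        then have "f w \<otimes> g (pt w) = a (pt w)" using a(2) unfolding D_def by simp
        then show "g (pt w) [^] (1::nat) \<otimes> pt w f = a (pt w)"
          unfolding pt_apply[of w f] using gD[OF w] fE[OF 3 w] m_comm by simp
      qed
      then show ?thesis using a(1) by (intro exI[of _ "1::nat"] bexI[of _ a])
    qed
  next
    case (Pol_add p q)
    then obtain N p' M q' where pq: "p' \<in> Pol F" "\<forall>w\<in>D. g (pt w) [^] (N::nat) \<otimes> p (pt w) = p' (pt w)"
      "q' \<in> Pol F" "\<forall>w\<in>D. g (pt w) [^] (M::nat) \<otimes> q (pt w) = q' (pt w)" by blast
    let ?r = "\<lambda>v. g v [^] M \<otimes> p' v \<oplus> g v [^] N \<otimes> q' v"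
    have "?r \<in> Pol F" by (intro Pol.Pol_add Pol.Pol_mult Pol_pow g pq)
    moreover have "\<forall>w\<in>D. g (pt w) [^] (N + M) \<otimes> (p (pt w) \<oplus> q (pt w)) = ?r (pt w)"
    proof
      fix w assume w: "w \<in> D"
      define G where "G = g (pt w) [^] N"
      define H where "H = g (pt w) [^] M"
      define P where "P = p (pt w)"
      define Q where "Q = q (pt w)"
      have mem: "G \<in> carrier K" "H \<in> carrier K" "P \<in> carrier K" "Q \<in> carrier K"
        unfolding G_def H_def P_def Q_def
        using gD[OF w] Pol_closed[OF Pol_add(1) ptF[OF w]] Pol_closed[OF Pol_add(2) ptF[OF w]] by auto
      have "(G \<otimes> H) \<otimes> (P \<oplus> Q) = H \<otimes> (G \<otimes> P) \<oplus> G \<otimes> (H \<otimes> Q)" using mem by algebra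
      then show "g (pt w) [^] (N + M) \<otimes> (p (pt w) \<oplus> q (pt w)) = ?r (pt w)"
        using pq(2,4) w nat_pow_mult[OF gD(1)[OF w], of N M] unfolding G_def H_def P_def Q_def by simp
    qed
    ultimately show ?case by (intro exI[of _ "N + M"] bexI[of _ ?r])
  next
    case (Pol_mult p q)
    then obtain N p' M q' where pq: "p' \<in> Pol F" "\<forall>w\<in>D. g (pt w) [^] (N::nat) \<otimes> p (pt w) = p' (pt w)"
      "q' \<in> Pol F" "\<forall>w\<in>D. g (pt w) [^] (M::nat) \<otimes> q (pt w) = q' (pt w)" by blast
    let ?r = "\<lambda>v. p' v \<otimes> q' v"
    have "?r \<in> Pol F" by (intro Pol.Pol_mult pq)
    moreover have "\<forall>w\<in>D. g (pt w) [^] (N + M) \<otimes> (p (pt w) \<otimes> q (pt w)) = ?r (pt w)"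
    proof
      fix w assume w: "w \<in> D"
      define G where "G = g (pt w) [^] N"
      define H where "H = g (pt w) [^] M"
      define P where "P = p (pt w)"
      define Q where "Q = q (pt w)"
      have mem: "G \<in> carrier K" "H \<in> carrier K" "P \<in> carrier K" "Q \<in> carrier K"
        unfolding G_def H_def P_def Q_def
        using gD[OF w] Pol_closed[OF Pol_mult(1) ptF[OF w]] Pol_closed[OF Pol_mult(2) ptF[OF w]] by auto
      have "(G \<otimes> H) \<otimes> (P \<otimes> Q) = (G \<otimes> P) \<otimes> (H \<otimes> Q)" using mem by algebra
      then show "g (pt w) [^] (N + M) \<otimes> (p (pt w) \<otimes> q (pt w)) = ?r (pt w)"
        using pq(2,4) w nat_pow_mult[OF gD(1)[OF w], of N M] unfolding G_def H_def P_def Q_def by simp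
    qed
    ultimately show ?case by (intro exI[of _ "N + M"] bexI[of _ ?r])
  qed
  show ?thesis unfolding aff_def
  proof (intro conjI ballI allI impI)
    show "D \<subseteq> topspace T" using DC aff_topspace[OF A] by auto
    show "finite ?F" using aff_finite[OF A] E by auto
    show "pt w \<in> Pts ?F" if "w \<in> D" for w using ptF[OF that] .
    show "\<exists>w\<in>D. \<forall>f\<in>?F. v f = f w" if v: "v \<in> Pts ?F" "\<forall>p\<in>van ?F D. p v = \<zero>" for v
    proof -
      have vF: "v \<in> Pts F" using v(1) unfolding Pts_def by auto
      have "p v = \<zero>" if p: "p \<in> van F C" for p
      proof -
        have "p \<in> van ?F D" using FF[OF vanD(1)[OF p]] vanD(2)[OF p] DC by (intro vanI) auto
        then show ?thesis using v(2) by blast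
      qed
      then obtain w where w: "w \<in> C" "\<forall>f\<in>F. v f = f w" using aff_point[OF A vF] by blast
      have vw: "p v = p (pt w)" if "p \<in> Pol F" for p using Pol_cong[OF that, of v "pt w"] w(2) by (simp add: pt_apply)
      have vu: "v u \<in> carrier K" and vE: "\<And>f. f \<in> E \<Longrightarrow> v f \<in> carrier K" using v(1) unfolding Pts_def by auto
      have gv: "g v \<in> carrier K" using Pol_closed[OF g vF] .
      \<comment> \<open>The relation u g = 1 forces \<open>g v\<close> to be nonzero, so the point
        found in C lies in the smaller set D.\<close>
      have "(\<lambda>v. v u \<otimes> g v \<oplus> \<ominus> \<one>) \<in> van ?F D"
      proof (rule vanI)
        show "(\<lambda>v. v u \<otimes> g v \<oplus> \<ominus> \<one>) \<in> Pol ?F" by (intro Pol_add Pol_mult Pol_var Pol_const gF) auto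
        show "pt w u \<otimes> g (pt w) \<oplus> \<ominus> \<one> = \<zero>" if "w \<in> D" for w
          unfolding pt_apply[of w u] uD(3)[OF that] by (simp add: r_neg)
      qed
      from v(2)[rule_format, OF this] have "v u \<otimes> g v \<ominus> \<one> = \<zero>" unfolding minus_eq .
      then have vug: "v u \<otimes> g v = \<one>" using vu gv by simp
      then have "g v \<noteq> \<zero>" using vu by auto
      then have wD: "w \<in> D" unfolding D_def using vw[OF g] w(1) by simp
      have ge: "g v = g (pt w)" using vw[OF g] .
      have cancel: "a = b" if "a \<in> carrier K" "b \<in> carrier K" "a \<otimes> g (pt w) = b \<otimes> g (pt w)" for a b
        using m_rcancel[OF gD(2,1)[OF wD] that(1,2)] that(3) by simp
      have "v u = u w"
      proof (rule cancel[OF vu uD(2)[OF wD]])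
        show "v u \<otimes> g (pt w) = u w \<otimes> g (pt w)" using vug uD(3)[OF wD] unfolding ge by simp
      qed
      moreover have "v f = f w" if f: "f \<in> E" for f
      proof -
        from Ef[OF f] obtain a where a: "a \<in> Pol F"
          "\<forall>w\<in>C. g (pt w) \<noteq> \<zero> \<longrightarrow> f w \<in> carrier K \<and> f w \<otimes> g (pt w) = a (pt w)" by blast
        have aD: "f x \<otimes> g (pt x) = a (pt x)" if "x \<in> D" for x using a(2) that unfolding D_def by blast
        have ac: "a (pt x) \<in> carrier K" if "x \<in> D" for x using aff_closed_value[OF A a(1)] that DC by blast
        have av: "a v = a (pt w)" using vw[OF a(1)] .
        have "(\<lambda>v. v f \<otimes> g v \<oplus> \<ominus> \<one> \<otimes> a v) \<in> van ?F D"
        proof (rule vanI)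
          show "(\<lambda>v. v f \<otimes> g v \<oplus> \<ominus> \<one> \<otimes> a v) \<in> Pol ?F" using f
            by (intro Pol_add Pol_mult Pol_var Pol_const gF FF[OF a(1)]) auto
          show "pt x f \<otimes> g (pt x) \<oplus> \<ominus> \<one> \<otimes> a (pt x) = \<zero>" if "x \<in> D" for x
            unfolding pt_apply[of x f] aD[OF that] using ac[OF that] by (simp add: l_minus r_neg)
        qed
        from v(2)[rule_format, OF this] have "v f \<otimes> g v \<oplus> \<ominus> \<one> \<otimes> a v = \<zero>" .
        then have "v f \<otimes> g v \<ominus> a v = \<zero>" using ac[OF wD] av by (simp add: l_minus minus_eq)
        then have "v f \<otimes> g v = a v" using vE[OF f] gv ac[OF wD] av by simp
        then have "v f \<otimes> g (pt w) = f w \<otimes> g (pt w)" using aD[OF wD] av ge by simp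
        then show ?thesis using cancel[OF vE[OF f] fE[OF f wD]] by simp
      qed
      ultimately show ?thesis using wD w(2) by (intro bexI[OF _ wD]) auto
    qed
    show "openin (subtopology T D) {w \<in> D. p (pt w) \<noteq> \<zero>}" if p: "p \<in> Pol ?F" for p
    proof -
      obtain N q where q: "q \<in> Pol F" "\<forall>w\<in>D. g (pt w) [^] (N::nat) \<otimes> p (pt w) = q (pt w)"
        using clear[OF p] by blast
      obtain U where U: "openin T U" "{w \<in> C. q (pt w) \<noteq> \<zero>} = U \<inter> C" by (rule aff_open_set[OF A q(1)])
      have "p (pt w) \<noteq> \<zero> \<longleftrightarrow> q (pt w) \<noteq> \<zero>" if w: "w \<in> D" for w
      proof -
        have pc: "p (pt w) \<in> carrier K" using Pol_closed[OF p ptF[OF w]] .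
        have gN: "g (pt w) [^] N \<in> carrier K" "g (pt w) [^] N \<noteq> \<zero>"
          using gD[OF w] by (auto, induction N) (auto simp: integral_iff)
        have "q (pt w) = g (pt w) [^] N \<otimes> p (pt w)" using q(2) w by simp
        then show ?thesis using gN pc by (simp add: integral_iff)
      qed
      then have "{w \<in> D. p (pt w) \<noteq> \<zero>} = U \<inter> D" using U(2) DC by blast
      then show ?thesis using U(1) unfolding openin_subtopology by blast
    qed
    show "\<exists>p\<in>Pol ?F. p (pt w) \<noteq> \<zero> \<and> {x \<in> D. p (pt x) \<noteq> \<zero>} \<subseteq> U"
      if U: "openin T U" "w \<in> U" "w \<in> D" for U w
    proof -
      have "w \<in> C" using U(3) DC by auto
      from aff_basis[OF A U(1,2) this] obtain p where "p \<in> Pol F" "p (pt w) \<noteq> \<zero>" "{x \<in> C. p (pt x) \<noteq> \<zero>} \<subseteq> U"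
        by blast
      then show ?thesis using DC FF by (intro bexI[of _ p]) auto
    qed
    show "w = w'" if "w \<in> D" "w' \<in> D" "\<forall>f\<in>?F. f w = f w'" for w w'
      using aff_sep[OF A, of w w'] that DC by auto
  qed
qed

subsection \<open>Algebraically independent functions\<close>

text \<open>Independence without ambient coordinates: only the zero polynomial in the functions
  \<open>J\<close> vanishes on \<open>S\<close>. This makes it comparable between charts.\<close>

definition findep :: "'p set \<Rightarrow> ('p \<Rightarrow> 'k) set \<Rightarrow> bool" where
  "findep S J \<longleftrightarrow> (\<forall>p\<in>Pol J. (\<forall>w\<in>S. p (pt w) = \<zero>) \<longrightarrow> (\<forall>v\<in>Pts J. p v = \<zero>))"

lemma findepD: "findep S J \<Longrightarrow> p \<in> Pol J \<Longrightarrow> (\<And>w. w \<in> S \<Longrightarrow> p (pt w) = \<zero>) \<Longrightarrow> v \<in> Pts J \<Longrightarrow> p v = \<zero>"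
  unfolding findep_def by blast

lemma findep_indep:
  assumes J: "J \<subseteq> F"
  shows "findep S J \<longleftrightarrow> indep F (van F S) J"
proof
  assume f: "findep S J"
  have "v \<in> zeros F (van F S) J" if v: "v \<in> Pts F" for v
  proof (rule zerosI[OF v])
    fix p assume p: "p \<in> van F S" "p \<in> Pol J"
    show "p v = \<zero>" by (rule findepD[OF f p(2) vanD(2)[OF p(1)] Pts_mono[OF J v]])
  qed
  then have "zeros F (van F S) J = Pts F" using zeros_Pts[of _ F "van F S" J] by blast
  then show "indep F (van F S) J" unfolding indep_def using J by simp
next
  assume i: "indep F (van F S) J"
  show "findep S J" unfolding findep_def
  proof (intro ballI[where P = "\<lambda>p. (\<forall>w\<in>S. p (pt w) = \<zero>) \<longrightarrow> (\<forall>v\<in>Pts J. p v = \<zero>)"] impI)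
    fix p assume p: "p \<in> Pol J" "\<forall>w\<in>S. p (pt w) = \<zero>"
    show "\<forall>v\<in>Pts J. p v = \<zero>"
    proof
    fix v assume v: "v \<in> Pts J"
    \<comment> \<open>A point of \<open>Pts J\<close> may have arbitrary entries outside
      \<open>J\<close>; they are replaced by zero to obtain a point of \<open>Pts F\<close>.\<close>
    define v' where "v' = (\<lambda>i. if i \<in> J then v i else \<zero>)"
    have v': "v' \<in> Pts F" using v unfolding v'_def Pts_def by auto
    have "p \<in> van F S" using p Pol_mono[OF J p(1)] by (intro vanI) auto
    then have z: "p v' = \<zero>" by (rule indep_zero[OF i _ p(1) v'])
    have "p v' = p v" using Pol_cong[OF p(1), of v' v] unfolding v'_def by simp
    from trans[OF sym[OF this] z] show "p v = \<zero>" .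
    qed
  qed
qed

lemma findep_subset:
  assumes "findep S J" "J' \<subseteq> J"
  shows "findep S J'"
  by (rule iffD2[OF findep_indep[OF assms(2)]],
      rule indep_subset[OF iffD1[OF findep_indep[OF order_refl] assms(1)] assms(2)])

lemma findep_mono: "findep S J \<Longrightarrow> S \<subseteq> S' \<Longrightarrow> findep S' J"
  unfolding findep_def by blast

text \<open>A polynomial that vanishes on \<open>S\<close> also vanishes at all points of
  \<open>C\<close> in the closure of \<open>S \<inter> C\<close>, hence on
  \<open>S'\<close>.\<close>

lemma findep_dense:
  assumes A: "aff T C F" and J: "J \<subseteq> F" and f: "findep S' J" and S: "S' \<subseteq> C" "S' \<subseteq> T closure_of (S \<inter> C)"
  shows "findep S J"
  unfolding findep_def
proof (intro ballI[where P = "\<lambda>p. (\<forall>w\<in>S. p (pt w) = \<zero>) \<longrightarrow> (\<forall>v\<in>Pts J. p v = \<zero>)"] impI)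
  fix p assume p: "p \<in> Pol J" "\<forall>w\<in>S. p (pt w) = \<zero>"
  have pF: "p \<in> Pol F" by (rule Pol_mono[OF J p(1)])
  have S': "p (pt w) = \<zero>" if w: "w \<in> S'" for w
  proof (rule aff_vanish_dense[OF A pF])
    show "p (pt x) = \<zero>" if "x \<in> S" for x using p(2) that by simp
    show "w \<in> C" "w \<in> T closure_of (S \<inter> C)" using w S by auto
  qed
  show "\<forall>v\<in>Pts J. p v = \<zero>" by (rule ballI, rule findepD[OF f p(1) S'])
qed

lemma irreducible_open_dense:
  assumes "irreducible_in T S" "openin T U" "S \<inter> U \<noteq> {}"
  shows "S \<subseteq> T closure_of (S \<inter> U)"
proof
  fix x assume x: "x \<in> S"
  have "\<exists>y. y \<in> S \<inter> U \<and> y \<in> V" if V: "x \<in> V" "openin T V" for V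
    using irreducible_meet[OF assms(1,2) V(2) assms(3)] x V(1) by blast
  then show "x \<in> T closure_of (S \<inter> U)"
    unfolding in_closure_of using x irreducible_topspace[OF assms(1)] by blast
qed

text \<open>Modulo \<open>I\<close> the coordinate \<open>b\<close> is the fraction q / c, and the
  linear relation - q + b c is nontrivial because \<open>c\<close> is outside
  \<open>I\<close>.\<close>

lemma not_transc_fraction:
  assumes I: "prime_id F I" and J: "J \<subseteq> F" and b: "b \<in> F" and c: "c \<in> Pol J" "c \<notin> I" and q: "q \<in> Pol J"
    and rel: "(\<lambda>v. \<ominus> \<one> \<otimes> q v \<oplus> v b \<otimes> c v) \<in> I"
  shows "\<not> transc I J b"
proof
  assume t: "transc I J b"
  define as where "as = [\<lambda>v. \<ominus> \<one> \<otimes> q v, c]"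
  have as: "set as \<subseteq> Pol J" unfolding as_def using c(1) Pol_mult[of "\<lambda>v. \<ominus> \<one>" J q, OF Pol_const q] by simp
  have HF: "(\<lambda>v. ceval as v (v b)) \<in> Pol F" using Pol_horner[OF as J b] .
  have "(\<lambda>v. ceval as v (v b)) \<in> I"
  proof (rule prime_idD(4)[OF I HF rel])
    fix v :: "'a \<Rightarrow> 'k" assume v: "v \<in> Pts F"
    have "v b \<in> carrier K" "c v \<in> carrier K"
      using v b Pol_closed_mono[OF c(1) J v] unfolding Pts_def by auto
    then show "ceval as v (v b) = \<ominus> \<one> \<otimes> q v \<oplus> v b \<otimes> c v" unfolding as_def by simp
  qed
  then have "set as \<subseteq> I" using t as unfolding transc_def by blast
  then show False using c unfolding as_def by simp
qed

section \<open>Fibres over a transcendence basis\<close>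

lemma poly1_finite_roots:
  assumes "f \<in> poly1 K" "x0 \<in> carrier K" "f x0 \<noteq> \<zero>"
  shows "finite {x \<in> carrier K. f x = \<zero>}"
proof -
  obtain as where as: "set as \<subseteq> carrier K" "\<forall>x\<in>carrier K. f x = horner K as x"
    using assms(1) unfolding poly1_def by blast
  have "\<exists>a\<in>set as. a \<noteq> \<zero>"
  proof (rule ccontr)
    assume "\<not> ?thesis"
    then have "set as \<subseteq> {\<zero>}" by auto
    then have "horner K as x0 = \<zero>" by (rule horner_all_zero[OF _ assms(2)])
    then show False using assms as by simp
  qed
  from horner_finite_roots[OF as(1) this] show ?thesis using as(2) by (simp cong: conj_cong)
qed

text \<open>Restriction to a line reduces questions about nonempty open sets of K^F to the
  finiteness of roots in one variable.\<close>

lemma Pol_line: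
  assumes "p \<in> Pol F" "v \<in> Pts F" "d \<in> Pts F"
  shows "(\<lambda>s. p (\<lambda>i. v i \<oplus> s \<otimes> d i)) \<in> poly1 K"
  using assms(1)
proof (induction p rule: Pol.induct)
  case (Pol_const c)
  then show ?case by (rule poly1_const)
next
  case (Pol_var i)
  have "v i \<in> carrier K" "d i \<in> carrier K" using assms(2,3) Pol_var unfolding Pts_def by auto
  then show ?case by (intro poly1_add[of "\<lambda>s. v i"] poly1_mult[of "\<lambda>s. s"] poly1_const poly1_id)
next
  case (Pol_add p q)
  show ?case by (rule poly1_add[OF Pol_add.IH])
next
  case (Pol_mult p q)
  show ?case by (rule poly1_mult[OF Pol_mult.IH])
qed

text \<open>Two nonempty open subsets of an affine space, given by nonzero values at \<open>v\<close> and \<open>v1\<close>,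
  meet on the line through these points.\<close>

lemma common_nonzero_point:
  assumes g: "g \<in> Pol F" "v \<in> Pts F" "g v \<noteq> \<zero>" and a: "a \<in> Pol F" "v1 \<in> Pts F" "a v1 \<noteq> \<zero>"
  shows "\<exists>x\<in>Pts F. g x \<noteq> \<zero> \<and> a x \<noteq> \<zero> \<and> (\<forall>i\<in>F. v i = v1 i \<longrightarrow> x i = v i)"
proof -
  define d where "d = (\<lambda>i. v1 i \<ominus> v i)"
  define l where "l = (\<lambda>s i. v i \<oplus> s \<otimes> d i)"
  have vK: "v i \<in> carrier K" "v1 i \<in> carrier K" if "i \<in> F" for i using g(2) a(2) that unfolding Pts_def by auto
  have d: "d \<in> Pts F" unfolding d_def Pts_def using vK by simp
  have l0: "g (l \<zero>) = g v"
  proof (rule Pol_cong[OF g(1)])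
    fix i assume i: "i \<in> F"
    then have "d i \<in> carrier K" using d unfolding Pts_def by simp
    then show "l \<zero> i = v i" unfolding l_def using vK[OF i] by simp
  qed
  have l1: "a (l \<one>) = a v1"
  proof (rule Pol_cong[OF a(1)])
    fix i assume i: "i \<in> F"
    have "v i \<oplus> \<one> \<otimes> (v1 i \<ominus> v i) = v1 i" using vK[OF i] by algebra
    then show "l \<one> i = v1 i" unfolding l_def d_def .
  qed
  have P: "(\<lambda>s. g (l s)) \<in> poly1 K" "(\<lambda>s. a (l s)) \<in> poly1 K"
    unfolding l_def by (rule Pol_line[OF g(1,2) d], rule Pol_line[OF a(1) g(2) d])
  have "finite ({s \<in> carrier K. g (l s) = \<zero>} \<union> {s \<in> carrier K. a (l s) = \<zero>})"
    using poly1_finite_roots[OF P(1) zero_closed] poly1_finite_roots[OF P(2) one_closed] l0 l1 g(3) a(3) by simp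
  then obtain s where s: "s \<in> carrier K" "g (l s) \<noteq> \<zero>" "a (l s) \<noteq> \<zero>"
    using infinite_carrier finite_subset[of "carrier K" "{s \<in> carrier K. g (l s) = \<zero>} \<union> {s \<in> carrier K. a (l s) = \<zero>}"]
    by blast
  have "l s \<in> Pts F" unfolding l_def Pts_def using vK d s(1) unfolding Pts_def by simp
  moreover have "l s i = v i" if "i \<in> F" "v i = v1 i" for i
    unfolding l_def d_def using vK[OF that(1)] that(2) s(1) by (simp add: minus_eq r_neg)
  ultimately show ?thesis using s by blast
qed

lemma aff_level_closed:
  assumes A: "aff T C F" and J: "finite J" "J \<subseteq> F" and c: "\<And>f. f \<in> J \<Longrightarrow> c f \<in> carrier K"
  shows "closedin (subtopology T C) {x \<in> C. \<forall>f\<in>J. f x = c f}"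
proof -
  have one: "openin (subtopology T C) {x \<in> C. f x \<noteq> c f}" if f: "f \<in> J" for f
  proof -
    have "(\<lambda>v. v f \<oplus> \<ominus> c f) \<in> Pol F"
      using f J c by (intro Pol_add[of "\<lambda>v. v f"] Pol_var Pol_const) auto
    from aff_open[OF A this] have "openin (subtopology T C) {x \<in> C. f x \<oplus> \<ominus> c f \<noteq> \<zero>}" by (simp add: pt_apply)
    moreover have "f x \<oplus> \<ominus> c f \<noteq> \<zero> \<longleftrightarrow> f x \<noteq> c f" if x: "x \<in> C" for x
    proof -
      have "f x \<in> carrier K" using aff_Pts[OF A x] f J unfolding Pts_def by (auto simp: pt_apply)
      then show ?thesis using c[OF f] unfolding minus_eq[symmetric] by simp
    qed
    ultimately show ?thesis by (simp cong: conj_cong)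
  qed
  have o: "openin (subtopology T C) (\<Union>f\<in>J. {x \<in> C. f x \<noteq> c f})" using one by (intro openin_Union) auto
  have CT: "topspace (subtopology T C) = C" using aff_topspace[OF A] by auto
  have e: "{x \<in> C. \<forall>f\<in>J. f x = c f} = topspace (subtopology T C) - (\<Union>f\<in>J. {x \<in> C. f x \<noteq> c f})"
    unfolding CT by auto
  show ?thesis unfolding e by (rule closedin_diff[OF closedin_topspace o])
qed

lemma van_not_in:
  assumes "p \<in> Pol F" "p \<notin> van F S"
  obtains w where "w \<in> S" "p (pt w) \<noteq> \<zero>"
  using assms unfolding van_def by blast

lemma findep_not_van:
  assumes J: "J \<subseteq> F" "findep C J" and p: "p \<in> Pol J" "v \<in> Pts J" "p v \<noteq> \<zero>"
  shows "p \<notin> van F C"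
  using findepD[OF J(2) p(1) _ p(2)] p(3) vanD(2)[of p F C] by blast

text \<open>Lower bound for fibres: the components of a coordinate slice through a general point dominate
  the remaining coordinates.  If \<open>a\<close> is a product of relations on the components through \<open>w\<close> and
  \<open>h\<close> vanishes on the others, but not at \<open>w\<close>, then \<open>a h = 0\<close> on the slice; this contradicts the
  openness of the projection to \<open>K\<^sup>J\<close>.\<close>

lemma fibre_component_dominates:
  assumes A: "aff T C F" and C: "irreducible_in T C" and J: "J \<subseteq> F" "findep C J"
    and alg: "\<forall>f\<in>F. \<not> transc (van F C) J f"
  shows "\<exists>g\<in>Pol F. g \<notin> van F C \<and> (\<forall>w I0. w \<in> C \<longrightarrow> g (pt w) \<noteq> \<zero> \<longrightarrow> I0 \<subseteq> J \<longrightarrow>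
     (\<exists>S. irreducible_in T S \<and> closedin (subtopology T C) S \<and> w \<in> S \<and> (\<forall>x\<in>S. \<forall>f\<in>I0. f x = f w) \<and>
        findep S (J - I0)))"
proof -
  let ?I = "van F C"
  have I: "prime_id F ?I" by (rule van_prime[OF A C order_refl])
  have fin: "finite F" by (rule aff_finite[OF A])
  have e: "J \<union> F = F" using J(1) by auto
  have full: "zeros F ?I J = Pts F" using J(2) unfolding findep_indep[OF J(1)] indep_def by simp
  \<comment> \<open>All coordinates are algebraic over \<open>J\<close>, so the projection of C to
    K^J is open at the points where \<open>c\<close> does not vanish.\<close>
  obtain c where c': "c \<in> Pol (J \<union> F) - ?I" and
    cM: "\<forall>M h. prime_id F M \<longrightarrow> ?I \<subseteq> M \<longrightarrow> c \<notin> M \<longrightarrow>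
     h \<in> Pol (J \<union> F) \<longrightarrow> h \<notin> M \<longrightarrow> (\<exists>g\<in>Pol J - M. \<forall>v\<in>zeros F ?I J. g v \<noteq> \<zero> \<longrightarrow>
         (\<exists>v'\<in>zeros F ?I (J \<union> F). (\<forall>j\<in>J. v' j = v j) \<and> h v' \<noteq> \<zero>))"
  proof (rule bexE[OF extend_algebraic[OF fin I, of J]])
    show "J \<union> F \<subseteq> F" using J(1) by simp
    show "\<forall>b\<in>F. b \<notin> J \<longrightarrow> \<not> transc ?I J b" using alg by simp
  qed
  have c: "c \<in> Pol F" "c \<notin> ?I" using c' unfolding e by simp_all
  have main: "\<exists>S. irreducible_in T S \<and> closedin (subtopology T C) S \<and> w \<in> S \<and> (\<forall>x\<in>S. \<forall>f\<in>I0. f x = f w) \<and>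
        findep S (J - I0)"
    if w: "w \<in> C" "c (pt w) \<noteq> \<zero>" and I0: "I0 \<subseteq> J" for w I0
  proof (rule ccontr)
    assume neg: "\<not> ?thesis"
    have wP: "pt w \<in> Pts F" by (rule aff_Pts[OF A w(1)])
    define M where "M = {p \<in> Pol F. p (pt w) = \<zero>}"
    have M: "prime_id F M" unfolding M_def by (rule point_prime_id[OF wP])
    have IM: "?I \<subseteq> M" unfolding M_def van_def using w(1) by auto
    have cNM: "c \<notin> M" unfolding M_def using w(2) by simp
    define Fw where "Fw = {x \<in> C. \<forall>f\<in>I0. f x = f w}"
    have I0F: "I0 \<subseteq> F" "finite I0" using I0 J(1) finite_subset[OF _ fin, of I0] by auto
    have fwK: "f w \<in> carrier K" if "f \<in> F" for f using wP that unfolding Pts_def by (auto simp: pt_apply)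
    have "closedin (subtopology T C) Fw" unfolding Fw_def
      using I0F fwK by (intro aff_level_closed[OF A]) auto
    from noetherian_decomposition[OF aff_noetherian[OF A] this]
    obtain \<S> where S: "finite \<S>" "\<forall>S\<in>\<S>. closedin (subtopology T C) S \<and> irreducible_in T S" "Fw = \<Union>\<S>"
      by blast
    let ?S1 = "{S \<in> \<S>. w \<in> S}"
    let ?S2 = "{S \<in> \<S>. w \<notin> S}"
    \<comment> \<open>A component through \<open>w\<close> that does not dominate satisfies a
      relation in \<open>J - I0\<close>. Since \<open>J\<close> is independent on C, this relation
      does not vanish on all of C.\<close>
    have "\<exists>p. p \<in> Pol (J - I0) \<and> (\<forall>x\<in>S. p (pt x) = \<zero>) \<and> p \<notin> ?I" if "S \<in> ?S1" for S
    proof -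
      have "S \<subseteq> Fw" using that S(3) by blast
      then have "\<forall>x\<in>S. \<forall>f\<in>I0. f x = f w" unfolding Fw_def by blast
      then have "\<not> findep S (J - I0)" using neg that S(2) by blast
      then obtain p v where p: "p \<in> Pol (J - I0)" "\<forall>x\<in>S. p (pt x) = \<zero>" "v \<in> Pts (J - I0)" "p v \<noteq> \<zero>"
        unfolding findep_def by blast
      have JF: "J - I0 \<subseteq> F" using J(1) by auto
      have "p \<notin> ?I" using findep_not_van[of "J - I0" F C p v, OF JF findep_subset[OF J(2) Diff_subset] p(1,3,4)] .
      then show ?thesis using p(1,2) by (intro exI[of _ p] conjI)
    qed
    then have "\<forall>S\<in>?S1. \<exists>p. p \<in> Pol (J - I0) \<and> (\<forall>x\<in>S. p (pt x) = \<zero>) \<and> p \<notin> ?I" by (rule ballI)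
    from bchoice[OF this]
    obtain p where p: "\<forall>S\<in>?S1. p S \<in> Pol (J - I0) \<and> (\<forall>x\<in>S. p S (pt x) = \<zero>) \<and> p S \<notin> ?I" by (rule exE)
    have prodp: "\<exists>a\<in>Pol (J - I0). a \<notin> ?I \<and> (\<forall>S\<in>\<T>. \<forall>x\<in>S. x \<in> C \<longrightarrow> a (pt x) = \<zero>)" if "finite \<T>" "\<T> \<subseteq> ?S1" for \<T>
      using that
    proof (induction \<T> rule: finite_induct)
      case empty
      show ?case using prime_idD(3)[OF I] by (intro bexI[of _ "\<lambda>v. \<one>"]) auto
    next
      case (insert S \<T>)
      then obtain a where a: "a \<in> Pol (J - I0)" "a \<notin> ?I" "\<forall>S\<in>\<T>. \<forall>x\<in>S. x \<in> C \<longrightarrow> a (pt x) = \<zero>" by auto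
      have pS: "p S \<in> Pol (J - I0)" "\<forall>x\<in>S. p S (pt x) = \<zero>" "p S \<notin> ?I" using p insert.prems by auto
      have JF: "J - I0 \<subseteq> F" using J(1) by auto
      have cl: "a (pt x) \<in> carrier K" "p S (pt x) \<in> carrier K" if "x \<in> C" for x
        using aff_closed_value[OF A Pol_mono[OF JF a(1)] that] aff_closed_value[OF A Pol_mono[OF JF pS(1)] that] .
      have "(\<lambda>v. p S v \<otimes> a v) \<in> Pol (J - I0)" by (rule Pol_mult[OF pS(1) a(1)])
      moreover have "(\<lambda>v. p S v \<otimes> a v) \<notin> ?I"
        by (rule prime_id_mult_not_in[OF I Pol_mono[OF JF pS(1)] Pol_mono[OF JF a(1)] pS(3) a(2)])
      moreover have "\<forall>S'\<in>insert S \<T>. \<forall>x\<in>S'. x \<in> C \<longrightarrow> p S (pt x) \<otimes> a (pt x) = \<zero>"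
        using a(3) pS(2) cl by auto
      ultimately show ?case by (intro bexI[of _ "\<lambda>v. p S v \<otimes> a v"] conjI)
    qed
    have "finite ?S1" using S(1) by simp
    from prodp[OF this order_refl] obtain a where a: "a \<in> Pol (J - I0)" "a \<notin> ?I"
      "\<forall>S\<in>?S1. \<forall>x\<in>S. x \<in> C \<longrightarrow> a (pt x) = \<zero>" by blast
    have SC: "S \<subseteq> C" if "S \<in> \<S>" for S
      using closedin_subset[of "subtopology T C" S] S(2) that by auto
    have "closedin (subtopology T C) (\<Union>?S2)" using S(1,2) by (intro closedin_Union) auto
    from aff_separate_closed[OF A this w(1)] obtain h where h: "h \<in> van F (\<Union>?S2)" "h (pt w) \<noteq> \<zero>" by blast
    have hF: "h \<in> Pol F" "h \<notin> M" using vanD(1)[OF h(1)] h(2) unfolding M_def by auto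
    from cM[rule_format, OF M IM cNM, of h] hF
    obtain g where g: "g \<in> Pol J" "g \<notin> M" "\<forall>v\<in>Pts F. g v \<noteq> \<zero> \<longrightarrow>
         (\<exists>v'\<in>zeros F ?I F. (\<forall>j\<in>J. v' j = v j) \<and> h v' \<noteq> \<zero>)" unfolding e full by blast
    have gF: "g \<in> Pol F" by (rule Pol_mono[OF J(1) g(1)])
    have gw: "g (pt w) \<noteq> \<zero>" using g(2) gF unfolding M_def by simp
    have aF: "a \<in> Pol F" using Pol_mono[OF _ a(1), of F] J(1) by auto
    obtain x1 where x1: "x1 \<in> C" "a (pt x1) \<noteq> \<zero>" by (rule van_not_in[OF aF a(2)])
    \<comment> \<open>\<open>v1\<close> takes the values of \<open>w\<close> on \<open>I0\<close>
      and those of \<open>x1\<close> elsewhere. As \<open>a\<close> involves only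
      \<open>J - I0\<close>, it is nonzero at \<open>v1\<close>, and on the line from
      \<open>w\<close> to \<open>v1\<close> the coordinates in \<open>I0\<close> stay fixed.\<close>
    define v1 where "v1 = (\<lambda>i. if i \<in> I0 then pt w i else pt x1 i)"
    have v1: "v1 \<in> Pts F" using wP aff_Pts[OF A x1(1)] unfolding v1_def Pts_def by auto
    have "a v1 = a (pt x1)" using Pol_cong[OF a(1), of v1 "pt x1"] unfolding v1_def by simp
    then have av1: "a v1 \<noteq> \<zero>" using x1(2) by simp
    from common_nonzero_point[of g F "pt w" a v1, OF gF wP gw aF v1 av1]
    obtain v where v: "v \<in> Pts F" "g v \<noteq> \<zero>" "a v \<noteq> \<zero>" "\<forall>i\<in>F. pt w i = v1 i \<longrightarrow> v i = pt w i" by blast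
    \<comment> \<open>Openness lifts the chosen point of K^J to a point of C with \<open>h\<close>
      nonzero. The lift lies in the slice, but on a component through \<open>w\<close> the value of
      \<open>a\<close> would be zero, on any other that of \<open>h\<close>.\<close>
    from g(3)[rule_format, OF v(1,2)] obtain v' where v': "v' \<in> zeros F ?I F" "\<forall>j\<in>J. v' j = v j" "h v' \<noteq> \<zero>" by blast
    have "\<exists>x\<in>C. \<forall>f\<in>F. v' f = f x"
      using aff_point[OF A zeros_Pts[OF v'(1)]] zeros_full[OF I v'(1)] by blast
    then obtain x where x: "x \<in> C" "\<forall>f\<in>F. v' f = f x" by blast
    have px: "q (pt x) = q v'" if "q \<in> Pol F" for q using Pol_cong[OF that, of "pt x" v'] x(2) by (simp add: pt_apply)
    have "x \<in> Fw" unfolding Fw_def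
    proof (intro CollectI conjI ballI x(1))
      fix f assume f: "f \<in> I0"
      have "f x = v' f" using x(2) f I0F by auto
      also have "\<dots> = v f" using v'(2) f I0 by auto
      also have "\<dots> = pt w f" using v(4) f I0F(1) unfolding v1_def by auto
      finally show "f x = f w" by (simp add: pt_apply)
    qed
    then obtain S0 where S0: "S0 \<in> \<S>" "x \<in> S0" using S(3) by blast
    show False
    proof (cases "w \<in> S0")
      case True
      then have "a (pt x) = \<zero>" using a(3) S0 x(1) by blast
      moreover have "a v' = a v" using Pol_cong[OF a(1), of v' v] v'(2) by auto
      ultimately show False using px[OF aF] v(3) by simp
    next
      case False
      then have "h (pt x) = \<zero>" using vanD(2)[OF h(1), of x] S0 by blast
      then show False using px[OF hF(1)] v'(3) by simp
    qed
  qed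
  then show ?thesis using c by blast
qed

text \<open>The upper bound for fibres, by counting. Inside a fibre of \<open>I0\<close> a function
  of \<open>P\<close> has finitely many values, hence is constant on an irreducible set. Moreover
  fixing \<open>J - I0\<close> there fixes all of \<open>J\<close>, so every coordinate is algebraic
  over \<open>J - I0\<close>. The polynomial \<open>g\<close> collects the finitely many open
  conditions.\<close>

lemma fibre_dimension_bound:
  assumes A: "aff T C F" and C: "irreducible_in T C" and J: "J \<subseteq> F" and I0: "I0 \<subseteq> J" and P: "P \<subseteq> F"
    and alg: "\<forall>f\<in>F. \<not> transc (van F C) J f" "\<forall>f\<in>P. \<not> transc (van F C) I0 f"
  shows "\<exists>g\<in>Pol F. g \<notin> van F C \<and> (\<forall>S. irreducible_in T S \<longrightarrow> S \<subseteq> {w \<in> C. g (pt w) \<noteq> \<zero>} \<longrightarrow>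
     (\<forall>x\<in>S. \<forall>y\<in>S. \<forall>f\<in>I0. f x = f y) \<longrightarrow>
     (\<forall>x\<in>S. \<forall>y\<in>S. \<forall>f\<in>P. f x = f y) \<and> (\<forall>L\<subseteq>F. findep S L \<longrightarrow> card L \<le> card (J - I0)))"
proof -
  let ?I = "van F C"
  have I: "prime_id F ?I" by (rule van_prime[OF A C order_refl])
  have fin: "finite F" by (rule aff_finite[OF A])
  have I0F: "I0 \<subseteq> F" using I0 J by auto
  have "\<forall>f\<in>F. \<exists>h. h \<in> Pol F - ?I \<and> (\<forall>w. finite ((\<lambda>v. v f) ` {v \<in> zeros F ?I F. h v \<noteq> \<zero> \<and> (\<forall>j\<in>J. v j = w j)}))"
  proof
    fix f assume "f \<in> F"
    then show "\<exists>h. h \<in> Pol F - ?I \<and> (\<forall>w. finite ((\<lambda>v. v f) ` {v \<in> zeros F ?I F. h v \<noteq> \<zero> \<and> (\<forall>j\<in>J. v j = w j)}))"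
      using algebraic_finite_values[OF I J, of f] alg(1) by (simp add: Bex_def)
  qed
  from bchoice[OF this] obtain h where h: "\<forall>f\<in>F. h f \<in> Pol F - ?I \<and>
     (\<forall>w. finite ((\<lambda>v. v f) ` {v \<in> zeros F ?I F. h f v \<noteq> \<zero> \<and> (\<forall>j\<in>J. v j = w j)}))" by blast
  have "\<forall>f\<in>P. \<exists>h. h \<in> Pol F - ?I \<and> (\<forall>w. finite ((\<lambda>v. v f) ` {v \<in> zeros F ?I F. h v \<noteq> \<zero> \<and> (\<forall>j\<in>I0. v j = w j)}))"
  proof
    fix f assume "f \<in> P"
    then show "\<exists>h. h \<in> Pol F - ?I \<and> (\<forall>w. finite ((\<lambda>v. v f) ` {v \<in> zeros F ?I F. h v \<noteq> \<zero> \<and> (\<forall>j\<in>I0. v j = w j)}))"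
      using algebraic_finite_values[OF I I0F, of f] alg(2) P by (auto simp: Bex_def)
  qed
  from bchoice[OF this] obtain k where k: "\<forall>f\<in>P. k f \<in> Pol F - ?I \<and>
     (\<forall>w. finite ((\<lambda>v. v f) ` {v \<in> zeros F ?I F. k f v \<noteq> \<zero> \<and> (\<forall>j\<in>I0. v j = w j)}))" by blast
  obtain g1 where g1: "g1 \<in> Pol F" "g1 \<notin> ?I" "\<forall>f\<in>F. \<forall>v\<in>Pts F. g1 v \<noteq> \<zero> \<longrightarrow> h f v \<noteq> \<zero>"
    using prime_id_common_nonzero[OF fin I, of h] h by blast
  obtain g2 where g2: "g2 \<in> Pol F" "g2 \<notin> ?I" "\<forall>f\<in>P. \<forall>v\<in>Pts F. g2 v \<noteq> \<zero> \<longrightarrow> k f v \<noteq> \<zero>"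
    using prime_id_common_nonzero[OF finite_subset[OF P fin] I, of k] k by blast
  define g where "g = (\<lambda>v. g1 v \<otimes> g2 v)"
  have g: "g \<in> Pol F" "g \<notin> ?I" unfolding g_def
    using Pol_mult[OF g1(1) g2(1)] prime_id_mult_not_in[OF I g1(1) g2(1) g1(2) g2(2)] by simp_all
  have gnz: "g1 v \<noteq> \<zero>" "g2 v \<noteq> \<zero>" if "v \<in> Pts F" "g v \<noteq> \<zero>" for v
    using that(2) Pol_closed[OF g1(1) that(1)] Pol_closed[OF g2(1) that(1)] unfolding g_def by auto
  have zC: "pt x \<in> zeros F ?I F" if "x \<in> C" for x
    using aff_Pts[OF A that] vanD(2)[OF _ that] by (intro zerosI)
  have main: "(\<forall>x\<in>S. \<forall>y\<in>S. \<forall>f\<in>P. f x = f y) \<and> (\<forall>L\<subseteq>F. findep S L \<longrightarrow> card L \<le> card (J - I0))"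
    if S: "irreducible_in T S" "S \<subseteq> {w \<in> C. g (pt w) \<noteq> \<zero>}" and const: "\<forall>x\<in>S. \<forall>y\<in>S. \<forall>f\<in>I0. f x = f y" for S
  proof -
    have SC: "S \<subseteq> C" and Sg: "\<And>x. x \<in> S \<Longrightarrow> g (pt x) \<noteq> \<zero>" using S(2) by auto
    obtain x0 where x0: "x0 \<in> S" using irreducible_nonempty[OF S(1)] by blast
    have fK: "f x \<in> carrier K" if "f \<in> F" "x \<in> C" for f x
      using aff_Pts[OF A that(2)] that(1) unfolding Pts_def by (auto simp: pt_apply)
    have Pconst: "f x = f y" if f: "f \<in> P" and xy: "x \<in> S" "y \<in> S" for f x y
    proof -
      have "f ` S \<subseteq> (\<lambda>v. v f) ` {v \<in> zeros F ?I F. k f v \<noteq> \<zero> \<and> (\<forall>j\<in>I0. v j = pt x0 j)}"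
      proof
        fix c assume "c \<in> f ` S"
        then obtain z where z: "z \<in> S" "c = f z" by blast
        have zP: "pt z \<in> Pts F" using aff_Pts[OF A] z(1) SC by auto
        have "k f (pt z) \<noteq> \<zero>" using g2(3) f zP gnz(2)[OF zP Sg[OF z(1)]] by blast
        moreover have "\<forall>j\<in>I0. pt z j = pt x0 j" using const z(1) x0 by (auto simp: pt_apply)
        ultimately have "pt z \<in> {v \<in> zeros F ?I F. k f v \<noteq> \<zero> \<and> (\<forall>j\<in>I0. v j = pt x0 j)}"
          using zC z(1) SC by blast
        then have "(\<lambda>v. v f) (pt z) \<in> (\<lambda>v. v f) ` {v \<in> zeros F ?I F. k f v \<noteq> \<zero> \<and> (\<forall>j\<in>I0. v j = pt x0 j)}"
          by (rule imageI)
        then show "c \<in> (\<lambda>v. v f) ` {v \<in> zeros F ?I F. k f v \<noteq> \<zero> \<and> (\<forall>j\<in>I0. v j = pt x0 j)}"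
          unfolding z(2) pt_apply .
      qed
      then have finS: "finite (f ` S)" using k f finite_subset by blast
      have fF: "f \<in> F" using f P by auto
      \<comment> \<open>The level sets of the finitely many values are closed and cover
        \<open>S\<close>; an irreducible set lies in one of them.\<close>
      let ?L = "\<lambda>c. {x \<in> C. \<forall>f'\<in>{f}. f' x = c}"
      have "closedin (subtopology T C) (?L c)" if "c \<in> f ` S" for c
        using fF that fK SC by (intro aff_level_closed[OF A, of "{f}" "\<lambda>_. c"]) auto
      moreover have "S \<subseteq> \<Union>(?L ` f ` S)" using SC by auto
      moreover have "irreducible_in (subtopology T C) S" using S(1) SC irreducible_in_subtopology by blast
      ultimately obtain D where "D \<in> ?L ` f ` S" "S \<subseteq> D"
        using irreducible_subset_Union[of "subtopology T C" S "?L ` f ` S"] finS by blast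
      then obtain c where "S \<subseteq> ?L c" by blast
      then have "f z = c" if "z \<in> S" for z using that by blast
      then show ?thesis using xy by simp
    qed
    have "card L \<le> card (J - I0)" if L: "L \<subseteq> F" "findep S L" for L
    proof (rule steinitz[OF fin van_prime[OF A S(1) SC]])
      let ?IS = "van F S"
      have IS: "prime_id F ?IS" by (rule van_prime[OF A S(1) SC])
      show JF: "J - I0 \<subseteq> F" using J by auto
      show "indep F ?IS L" using L findep_indep by blast
      show "\<forall>l\<in>L. \<not> transc ?IS (J - I0) l"
      proof (rule ballI, rule notI)
        fix l assume l: "l \<in> L" and t: "transc ?IS (J - I0) l"
        have lF: "l \<in> F" using l L by auto
        have gS: "g \<notin> ?IS" using x0 Sg vanD(2)[of g F S x0] by blast
        obtain w where w: "infinite ((\<lambda>v. v l) ` {v \<in> zeros F ?IS F. g v \<noteq> \<zero> \<and> (\<forall>j\<in>J - I0. v j = w j)})"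
          using transc_infinite_values[OF fin IS JF lF t g(1) gS] by blast
        \<comment> \<open>On \<open>S\<close> the coordinates in \<open>I0\<close> have the values
          they take at \<open>x0\<close>, so a fibre over \<open>J - I0\<close> in the zero set for
          \<open>S\<close> lies in a fibre over \<open>J\<close>.\<close>
        define w' where "w' = (\<lambda>i. if i \<in> I0 then i x0 else w i)"
        have "{v \<in> zeros F ?IS F. g v \<noteq> \<zero> \<and> (\<forall>j\<in>J - I0. v j = w j)} \<subseteq>
          {v \<in> zeros F ?I F. h l v \<noteq> \<zero> \<and> (\<forall>j\<in>J. v j = w' j)}"
        proof
          fix v assume "v \<in> {v \<in> zeros F ?IS F. g v \<noteq> \<zero> \<and> (\<forall>j\<in>J - I0. v j = w j)}"
          then have v: "v \<in> zeros F ?IS F" "g v \<noteq> \<zero>" "\<forall>j\<in>J - I0. v j = w j" by auto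
          have vP: "v \<in> Pts F" by (rule zeros_Pts[OF v(1)])
          have "v \<in> zeros F ?I F"
          proof (rule zerosI[OF vP])
            fix p assume "p \<in> ?I" "p \<in> Pol F"
            then show "p v = \<zero>" using zerosD[OF v(1), of p] van_anti[OF SC, of F] by blast
          qed
          moreover have "h l v \<noteq> \<zero>" using g1(3) lF vP gnz(1)[OF vP v(2)] by blast
          moreover have "v j = w' j" if j: "j \<in> J" for j
          proof (cases "j \<in> I0")
            case True
            have jF: "j \<in> F" using j J by auto
            have jx: "j x0 \<in> carrier K" using fK[OF jF] x0 SC by auto
            have m: "(\<lambda>v. v j \<oplus> \<ominus> (j x0)) \<in> ?IS"
            proof (rule vanI)
              show "(\<lambda>v. v j \<oplus> \<ominus> (j x0)) \<in> Pol F" using jF jx by (intro Pol_add[of "\<lambda>v. v j"] Pol_var Pol_const) auto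
              fix x assume x: "x \<in> S"
              have "j x = j x0" using const x x0 True by blast
              then show "pt x j \<oplus> \<ominus> (j x0) = \<zero>" unfolding pt_apply using jx by (simp add: r_neg)
            qed
            from zeros_full[OF IS v(1) m] have "v j \<ominus> j x0 = \<zero>" unfolding minus_eq .
            then have "v j = j x0" using jx vP jF unfolding Pts_def by simp
            then show ?thesis unfolding w'_def using True by simp
          next
            case False
            then show ?thesis unfolding w'_def using v(3) j by simp
          qed
          ultimately show "v \<in> {v \<in> zeros F ?I F. h l v \<noteq> \<zero> \<and> (\<forall>j\<in>J. v j = w' j)}" by blast
        qed
        then have "(\<lambda>v. v l) ` {v \<in> zeros F ?IS F. g v \<noteq> \<zero> \<and> (\<forall>j\<in>J - I0. v j = w j)} \<subseteq>
          (\<lambda>v. v l) ` {v \<in> zeros F ?I F. h l v \<noteq> \<zero> \<and> (\<forall>j\<in>J. v j = w' j)}" by (rule image_mono)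
        moreover have "finite ((\<lambda>v. v l) ` {v \<in> zeros F ?I F. h l v \<noteq> \<zero> \<and> (\<forall>j\<in>J. v j = w' j)})"
          using h lF by blast
        ultimately show False using w finite_subset by blast
      qed
    qed
    then show ?thesis using Pconst by blast
  qed
  show ?thesis
  proof (intro bexI[OF _ g(1)] conjI g(2) allI impI)
    fix S assume S: "irreducible_in T S" "S \<subseteq> {w \<in> C. g (pt w) \<noteq> \<zero>}" "\<forall>x\<in>S. \<forall>y\<in>S. \<forall>f\<in>I0. f x = f y"
    note m = main[OF S]
    show "\<forall>x\<in>S. \<forall>y\<in>S. \<forall>f\<in>P. f x = f y" using m by (rule conjunct1)
    fix L assume "L \<subseteq> F" "findep S L"
    then show "card L \<le> card (J - I0)" using m by blast
  qed
qed

lemma findep_not_constant: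
  assumes "findep S J" "y \<in> J" "c \<in> carrier K"
  shows "\<exists>x\<in>S. y x \<noteq> c"
proof (rule ccontr)
  assume "\<not> ?thesis"
  then have "y x = c" if "x \<in> S" for x using that by blast
  then have z: "pt x y \<oplus> \<ominus> c = \<zero>" if "x \<in> S" for x using that assms(3) by (simp add: pt_apply r_neg)
  have "(\<lambda>v. v y \<oplus> \<ominus> c) \<in> Pol J" using assms by (intro Pol_add[of "\<lambda>v. v y"] Pol_var Pol_const) auto
  from findepD[OF assms(1) this z, of "\<lambda>_. c \<oplus> \<one>"] assms(3)
  have "c \<oplus> \<one> \<oplus> \<ominus> c = \<zero>" unfolding Pts_def by simp
  moreover have "c \<oplus> \<one> \<oplus> \<ominus> c = \<one>" using assms(3) by algebra
  ultimately show False by simp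
qed

text \<open>The image of an irreducible set under a map that determines \<open>d\<close> independent functions contains
  a chain of length \<open>d\<close>: cut with the level sets of one function at a time.\<close>

lemma image_irr_chain:
  assumes "aff T C F" "irreducible_in T C" "I0 \<subseteq> F" "findep C I0" "card I0 = d"
    and "continuous_map (subtopology T C) T' \<phi>"
    and "\<And>f a. f \<in> I0 \<Longrightarrow> a \<in> carrier K \<Longrightarrow> \<exists>D. closedin T' D \<and> (\<forall>x\<in>C. \<phi> x \<in> D \<longleftrightarrow> f x = a)"
  shows "irr_chain T' (\<phi> ` C) d"
  using assms
proof (induction d arbitrary: C I0)
  case 0
  show ?case by (rule irr_chain_zero, rule irreducible_image[OF 0(2) 0(6) order_refl])
next
  case (Suc d)
  note A = Suc.prems(1) and C = Suc.prems(2)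
  have fin: "finite F" by (rule aff_finite[OF A])
  have I: "prime_id F (van F C)" by (rule van_prime[OF A C order_refl])
  have finI0: "finite I0" using fin Suc.prems(3) finite_subset by blast
  then obtain y where y: "y \<in> I0" using Suc.prems(5) by fastforce
  have yF: "y \<in> F" using y Suc.prems(3) by auto
  have ind: "indep F (van F C) I0" using Suc.prems(4) findep_indep[OF Suc.prems(3)] by blast
  \<comment> \<open>\<open>I0\<close> is completed to a transcendence basis, over which the
    components of slices dominate the remaining coordinates.\<close>
  from basis_exists[OF fin I order_refl ind Suc.prems(3)]
  obtain J where J: "I0 \<subseteq> J" "J \<subseteq> F" "indep F (van F C) J" "\<forall>b\<in>F. \<not> transc (van F C) J b" by blast
  have fJ: "findep C J" using J(3) findep_indep[OF J(2)] by blast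
  obtain g where g: "g \<in> Pol F" "g \<notin> van F C" and
    gS: "\<forall>w I0. w \<in> C \<longrightarrow> g (pt w) \<noteq> \<zero> \<longrightarrow> I0 \<subseteq> J \<longrightarrow>
     (\<exists>S. irreducible_in T S \<and> closedin (subtopology T C) S \<and> w \<in> S \<and> (\<forall>x\<in>S. \<forall>f\<in>I0. f x = f w) \<and>
        findep S (J - I0))"
    using fibre_component_dominates[OF A C J(2) fJ J(4)] by blast
  obtain w where w: "w \<in> C" "g (pt w) \<noteq> \<zero>" by (rule van_not_in[OF g])
  have "{y} \<subseteq> J" using y J(1) by auto
  \<comment> \<open>Inside a level set of \<open>y\<close> this piece keeps the other basis
    functions independent; its image carries the rest of the chain.\<close>
  from gS[rule_format, OF w this] obtain S where S: "irreducible_in T S" "closedin (subtopology T C) S" "w \<in> S"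
    "\<forall>x\<in>S. \<forall>f\<in>{y}. f x = f w" "findep S (J - {y})" by blast
  have SC: "S \<subseteq> C" using closedin_subset[OF S(2)] by auto
  have ywK: "y w \<in> carrier K" using aff_Pts[OF A w(1)] yF unfolding Pts_def by (auto simp: pt_apply)
  have chain: "irr_chain T' (\<phi> ` S) d"
  proof (rule Suc.IH[of S "I0 - {y}"])
    show "aff T S F" by (rule aff_closed_subset[OF A S(2)])
    show "irreducible_in T S" by fact
    show "I0 - {y} \<subseteq> F" using Suc.prems(3) by auto
    show "findep S (I0 - {y})" using findep_subset[OF S(5), of "I0 - {y}"] J(1) by auto
    show "card (I0 - {y}) = d" using Suc.prems(5) y finI0 by simp
    show "continuous_map (subtopology T S) T' \<phi>"
      using continuous_map_from_subtopology_mono[OF Suc.prems(6) SC] .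
    fix f a assume "f \<in> I0 - {y}" "a \<in> carrier K"
    then obtain D where "closedin T' D" "\<forall>x\<in>C. \<phi> x \<in> D \<longleftrightarrow> f x = a" using Suc.prems(7)[of f a] by auto
    then show "\<exists>D. closedin T' D \<and> (\<forall>x\<in>S. \<phi> x \<in> D \<longleftrightarrow> f x = a)" using SC by (intro exI[of _ D]) auto
  qed
  obtain D where D: "closedin T' D" "\<forall>x\<in>C. \<phi> x \<in> D \<longleftrightarrow> y x = y w" using Suc.prems(7)[OF y ywK] by blast
  show ?case
  proof (rule irr_chain_Suc[OF chain])
    show "\<phi> ` S \<subseteq> \<phi> ` C" using SC by auto
    show "irreducible_in T' (\<phi> ` C)" by (rule irreducible_image[OF C Suc.prems(6) order_refl])
    show "closedin (subtopology T' (\<phi> ` C)) (D \<inter> \<phi> ` C)" unfolding closedin_subtopology using D(1) by blast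
    show "\<phi> ` S \<subseteq> D \<inter> \<phi> ` C" using S(4) SC D(2) by auto
    obtain x where "x \<in> C" "y x \<noteq> y w" using findep_not_constant[OF Suc.prems(4) y ywK] by blast
    then show "D \<inter> \<phi> ` C \<noteq> \<phi> ` C" using D(2) by blast
  qed
qed

section \<open>Charts\<close>

text \<open>Near \<open>w\<close> the function \<open>f\<close> is the fraction a / g. The identity
  is asked on \<open>C \<inter> V\<close> only, since a composite with a map is meaningful only on
  the domain of that map, which may be merely locally closed.\<close>

definition regular_at :: "'p set \<Rightarrow> ('p \<Rightarrow> 'k) set \<Rightarrow> 'p set \<Rightarrow> ('p \<Rightarrow> 'k) \<Rightarrow> 'p \<Rightarrow> bool" where
  "regular_at C F V f w \<longleftrightarrow> (\<exists>a\<in>Pol F. \<exists>g\<in>Pol F. g (pt w) \<noteq> \<zero> \<and>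
     (\<forall>x\<in>C \<inter> V. g (pt x) \<noteq> \<zero> \<longrightarrow> f x \<in> carrier K \<and> f x \<otimes> g (pt x) = a (pt x)))"

text \<open>Charts \<open>(U, F)\<close>, with \<open>F\<close> a finite set of generators of the regular functions on \<open>U\<close>.\<close>

definition atlas :: "'p topology \<Rightarrow> ('p set \<times> ('p \<Rightarrow> 'k) set) set \<Rightarrow> bool" where
  "atlas T \<A> \<longleftrightarrow> finite \<A> \<and> (\<forall>U F. (U, F) \<in> \<A> \<longrightarrow> openin T U \<and> aff T U F) \<and>
     (\<forall>x\<in>topspace T. \<exists>U F. (U, F) \<in> \<A> \<and> x \<in> U) \<and>
     (\<forall>U F U' F' f w. (U, F) \<in> \<A> \<longrightarrow> (U', F') \<in> \<A> \<longrightarrow> f \<in> F' \<longrightarrow> w \<in> U \<longrightarrow> w \<in> U' \<longrightarrow> regular_at U F U' f w)"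

lemma atlasD:
  assumes "atlas T \<A>"
  shows "finite \<A>" "(U, F) \<in> \<A> \<Longrightarrow> openin T U" "(U, F) \<in> \<A> \<Longrightarrow> aff T U F"
    and "x \<in> topspace T \<Longrightarrow> \<exists>U F. (U, F) \<in> \<A> \<and> x \<in> U"
    and "(U, F) \<in> \<A> \<Longrightarrow> (U', F') \<in> \<A> \<Longrightarrow> f \<in> F' \<Longrightarrow> w \<in> U \<Longrightarrow> w \<in> U' \<Longrightarrow> regular_at U F U' f w"
proof -
  note a = assms[unfolded atlas_def]
  show "finite \<A>" by (rule conjunct1[OF a])
  show "openin T U" "aff T U F" if "(U, F) \<in> \<A>"
    using conjunct1[OF conjunct2[OF a]] that by simp_all
  show "\<exists>U F. (U, F) \<in> \<A> \<and> x \<in> U" if "x \<in> topspace T"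
    by (rule bspec[OF conjunct1[OF conjunct2[OF conjunct2[OF a]]] that])
  show "regular_at U F U' f w" if "(U, F) \<in> \<A>" "(U', F') \<in> \<A>" "f \<in> F'" "w \<in> U" "w \<in> U'"
    by (rule conjunct2[OF conjunct2[OF conjunct2[OF a]], rule_format, OF that])
qed

text \<open>The enlarged coordinates \<open>F'\<close> are fractions in the old ones
  \<open>F\<close>, so adjoining them leaves the transcendence degree unchanged.\<close>

definition fractions_over :: "'p set \<Rightarrow> ('p \<Rightarrow> 'k) set \<Rightarrow> ('p \<Rightarrow> 'k) set \<Rightarrow> bool" where
  "fractions_over D F F' \<longleftrightarrow> (\<forall>f\<in>F'. \<exists>a\<in>Pol F. \<exists>g\<in>Pol F. \<forall>x\<in>D. g (pt x) \<noteq> \<zero> \<and> f x \<otimes> g (pt x) = a (pt x))"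

text \<open>Denominators are multiplied one function at a time. The nonvanishing locus stays inside
  \<open>N\<close>, where the regularity conditions apply.\<close>

lemma common_denominator:
  assumes A: "aff T C F" and g: "g \<in> Pol F" and gw: "g (pt w) \<noteq> \<zero>" and w: "w \<in> C" and E: "finite E"
    and N: "{x \<in> C. g (pt x) \<noteq> \<zero>} \<subseteq> N" and reg: "\<forall>f\<in>E. regular_at C F N f w"
  shows "\<exists>g\<in>Pol F. g (pt w) \<noteq> \<zero> \<and> {x \<in> C. g (pt x) \<noteq> \<zero>} \<subseteq> N \<and>
     (\<forall>f\<in>E. \<exists>a\<in>Pol F. \<forall>x\<in>C. g (pt x) \<noteq> \<zero> \<longrightarrow> f x \<in> carrier K \<and> f x \<otimes> g (pt x) = a (pt x))"
  using E reg
proof (induction E rule: finite_induct)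
  case empty
  show ?case using g gw N by (intro bexI[of _ g]) auto
next
  case (insert f E)
  then obtain g1 where g1: "g1 \<in> Pol F" "g1 (pt w) \<noteq> \<zero>" "{x \<in> C. g1 (pt x) \<noteq> \<zero>} \<subseteq> N"
    "\<forall>f\<in>E. \<exists>a\<in>Pol F. \<forall>x\<in>C. g1 (pt x) \<noteq> \<zero> \<longrightarrow> f x \<in> carrier K \<and> f x \<otimes> g1 (pt x) = a (pt x)" by auto
  have "regular_at C F N f w" using insert.prems by simp
  then obtain b g2 where g2: "b \<in> Pol F" "g2 \<in> Pol F" "g2 (pt w) \<noteq> \<zero>"
    "\<forall>x\<in>C \<inter> N. g2 (pt x) \<noteq> \<zero> \<longrightarrow> f x \<in> carrier K \<and> f x \<otimes> g2 (pt x) = b (pt x)"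
    unfolding regular_at_def by blast
  let ?g = "\<lambda>v. g1 v \<otimes> g2 v"
  have cl: "g1 (pt x) \<in> carrier K" "g2 (pt x) \<in> carrier K" if "x \<in> C" for x
    using aff_closed_value[OF A g1(1) that] aff_closed_value[OF A g2(2) that] .
  have nz: "g1 (pt x) \<noteq> \<zero>" "g2 (pt x) \<noteq> \<zero>" if "x \<in> C" "g1 (pt x) \<otimes> g2 (pt x) \<noteq> \<zero>" for x
    using that(2) cl[OF that(1)] by auto
  show ?case
  proof (rule bexI[of _ ?g], intro conjI ballI)
    show "?g \<in> Pol F" by (rule Pol_mult[OF g1(1) g2(2)])
    show "g1 (pt w) \<otimes> g2 (pt w) \<noteq> \<zero>" using g1(2) g2(3) cl[OF w] by (simp add: integral_iff)
    show "{x \<in> C. g1 (pt x) \<otimes> g2 (pt x) \<noteq> \<zero>} \<subseteq> N" using nz(1) g1(3) by blast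
    fix f' assume f': "f' \<in> insert f E"
    show "\<exists>a\<in>Pol F. \<forall>x\<in>C. g1 (pt x) \<otimes> g2 (pt x) \<noteq> \<zero> \<longrightarrow>
       f' x \<in> carrier K \<and> f' x \<otimes> (g1 (pt x) \<otimes> g2 (pt x)) = a (pt x)"
    proof (cases "f' = f")
      case True
      have "f x \<in> carrier K \<and> f x \<otimes> (g1 (pt x) \<otimes> g2 (pt x)) = g1 (pt x) \<otimes> b (pt x)"
        if x: "x \<in> C" "g1 (pt x) \<otimes> g2 (pt x) \<noteq> \<zero>" for x
      proof -
        have "x \<in> N" using nz(1)[OF x] x(1) g1(3) by blast
        then have f: "f x \<in> carrier K" "f x \<otimes> g2 (pt x) = b (pt x)" using g2(4) nz(2)[OF x] x(1) by auto
        have "f x \<otimes> (g1 (pt x) \<otimes> g2 (pt x)) = g1 (pt x) \<otimes> (f x \<otimes> g2 (pt x))"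
          using f(1) cl[OF x(1)] by (simp add: m_ac)
        then show ?thesis using f by simp
      qed
      then show ?thesis unfolding True by (intro bexI[of _ "\<lambda>v. g1 v \<otimes> b v"] Pol_mult g1(1) g2(1)) blast
    next
      case False
      then obtain a where a: "a \<in> Pol F" "\<forall>x\<in>C. g1 (pt x) \<noteq> \<zero> \<longrightarrow> f' x \<in> carrier K \<and> f' x \<otimes> g1 (pt x) = a (pt x)"
        using g1(4) f' by blast
      have "f' x \<in> carrier K \<and> f' x \<otimes> (g1 (pt x) \<otimes> g2 (pt x)) = a (pt x) \<otimes> g2 (pt x)"
        if x: "x \<in> C" "g1 (pt x) \<otimes> g2 (pt x) \<noteq> \<zero>" for x
      proof -
        have f: "f' x \<in> carrier K" "f' x \<otimes> g1 (pt x) = a (pt x)" using a(2) nz(1)[OF x] x(1) by auto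
        show ?thesis unfolding f(2)[symmetric] using f(1) cl[OF x(1)] by (simp add: m_assoc)
      qed
      then show ?thesis by (intro bexI[of _ "\<lambda>v. a v \<otimes> g2 v"] Pol_mult a(1) g2(2)) blast
    qed
  qed
qed

text \<open>After shrinking the chart, finitely many functions regular at \<open>w\<close> become
  coordinates, and all coordinates remain fractions in the old ones.\<close>

lemma localize_at:
  assumes A: "aff T C F" and w: "w \<in> C" "w \<in> N" and N: "openin T N" and E: "finite E"
    and reg: "\<forall>f\<in>E. regular_at C F N f w"
  shows "\<exists>W F'. openin T W \<and> w \<in> W \<and> C \<inter> W \<subseteq> N \<and> aff T (C \<inter> W) F' \<and> F \<subseteq> F' \<and> E \<subseteq> F' \<and>
     fractions_over (C \<inter> W) F F'"
proof -
  obtain g0 where g0: "g0 \<in> Pol F" "g0 (pt w) \<noteq> \<zero>" "{x \<in> C. g0 (pt x) \<noteq> \<zero>} \<subseteq> N"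
    using aff_basis[OF A N w(2,1)] by blast
  from common_denominator[OF A g0(1,2) w(1) E g0(3) reg]
  obtain g where g: "g \<in> Pol F" "g (pt w) \<noteq> \<zero>" "{x \<in> C. g (pt x) \<noteq> \<zero>} \<subseteq> N"
     "\<forall>f\<in>E. \<exists>a\<in>Pol F. \<forall>x\<in>C. g (pt x) \<noteq> \<zero> \<longrightarrow> f x \<in> carrier K \<and> f x \<otimes> g (pt x) = a (pt x)" by blast
  obtain W where W: "openin T W" "{x \<in> C. g (pt x) \<noteq> \<zero>} = W \<inter> C" by (rule aff_open_set[OF A g(1)])
  define D where "D = {w \<in> C. g (pt w) \<noteq> \<zero>}"
  define u where "u = (\<lambda>w. if w \<in> D then inv (g (pt w)) else \<zero>)"
  have DW: "C \<inter> W = D" using W(2) unfolding D_def by auto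
  have "\<exists>a\<in>Pol F. \<forall>w\<in>C. g (pt w) \<noteq> \<zero> \<longrightarrow> f w \<in> carrier K \<and> f w \<otimes> g (pt w) = a (pt w)" if "f \<in> E" for f
    using g(4) that by blast
  from aff_localize[OF A g(1) E this, folded D_def u_def]
  have a: "aff T (C \<inter> W) (insert u (F \<union> E))" unfolding DW .
  have gD: "g (pt x) \<in> carrier K" "g (pt x) \<noteq> \<zero>" if "x \<in> D" for x
    using that aff_closed_value[OF A g(1)] unfolding D_def by auto
  have "\<exists>a\<in>Pol F. \<exists>g\<in>Pol F. \<forall>x\<in>D. g (pt x) \<noteq> \<zero> \<and> f x \<otimes> g (pt x) = a (pt x)" if f: "f \<in> insert u (F \<union> E)" for f
  proof -
    consider "f = u" | "f \<in> F" | "f \<in> E" using f by auto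
    then show ?thesis
    proof cases
      case 1
      have "\<forall>x\<in>D. g (pt x) \<noteq> \<zero> \<and> u x \<otimes> g (pt x) = \<one>" using gD unfolding u_def by (simp add: field_Units)
      then show ?thesis unfolding 1 by (intro bexI[of _ "\<lambda>v. \<one>"] bexI[OF _ g(1)]) simp_all
    next
      case 2
      have "f x \<in> carrier K" if "x \<in> D" for x
        using aff_Pts[OF A, of x] that 2 unfolding D_def Pts_def by (auto simp: pt_apply)
      then have "\<forall>x\<in>D. \<one> \<noteq> \<zero> \<and> f x \<otimes> \<one> = pt x f" by (simp add: pt_apply)
      then show ?thesis using Pol_var[OF 2] by (intro bexI[of _ "\<lambda>v. v f"] bexI[of _ "\<lambda>v. \<one>"]) simp_all
    next
      case 3
      then obtain a where a: "a \<in> Pol F" "\<forall>x\<in>C. g (pt x) \<noteq> \<zero> \<longrightarrow> f x \<in> carrier K \<and> f x \<otimes> g (pt x) = a (pt x)"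
        using g(4) by blast
      then have "\<forall>x\<in>D. g (pt x) \<noteq> \<zero> \<and> f x \<otimes> g (pt x) = a (pt x)" unfolding D_def by blast
      then show ?thesis by (intro bexI[OF _ a(1)] bexI[OF _ g(1)])
    qed
  qed
  then have fr: "fractions_over (C \<inter> W) F (insert u (F \<union> E))" unfolding fractions_over_def DW by blast
  have "w \<in> W" using W(2) w(1) g(2) by blast
  moreover have "C \<inter> W \<subseteq> N" using g(3) W(2) by blast
  ultimately show ?thesis using W(1) a fr
    by (intro exI[of _ W] exI[of _ "insert u (F \<union> E)"]) auto
qed

section \<open>Transcendence degree, chains and change of charts\<close>

lemma fractions_algebraic:
  assumes A: "aff T D F'" and F: "F \<subseteq> F'" and S: "irreducible_in T S" "S \<subseteq> D"
    and fr: "fractions_over D F F'" and f: "f \<in> F'"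
  shows "\<not> transc (van F' S) F f"
proof -
  have I: "prime_id F' (van F' S)" by (rule van_prime[OF A S])
  obtain a g where ag: "a \<in> Pol F" "g \<in> Pol F" "\<forall>x\<in>D. g (pt x) \<noteq> \<zero> \<and> f x \<otimes> g (pt x) = a (pt x)"
    using fr f unfolding fractions_over_def by blast
  have P: "a \<in> Pol F'" "g \<in> Pol F'" using Pol_mono[OF F] ag by auto
  obtain x where "x \<in> S" using irreducible_nonempty[OF S(1)] by blast
  then have g: "g \<notin> van F' S" using ag(3) S(2) vanD(2)[of g F' S x] by blast
  have "(\<lambda>v. \<ominus> \<one> \<otimes> a v \<oplus> v f \<otimes> g v) \<in> van F' S"
  proof (rule vanI)
    show "(\<lambda>v. \<ominus> \<one> \<otimes> a v \<oplus> v f \<otimes> g v) \<in> Pol F'" using f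
      by (intro Pol_add Pol_mult[of "\<lambda>v. \<ominus> \<one>"] Pol_mult[of "\<lambda>v. v f"] Pol_const Pol_var P) auto
    fix x assume x: "x \<in> S"
    then have xD: "x \<in> D" using S(2) by blast
    have "f x \<otimes> g (pt x) = a (pt x)" using ag(3) xD by blast
    moreover have "a (pt x) \<in> carrier K" by (rule aff_closed_value[OF A P(1) xD])
    ultimately show "\<ominus> \<one> \<otimes> a (pt x) \<oplus> pt x f \<otimes> g (pt x) = \<zero>" unfolding pt_apply by (simp add: l_minus l_neg)
  qed
  from not_transc_fraction[OF I F f ag(2) g ag(1) this] show ?thesis .
qed

text \<open>A transcendence basis on \<open>S\<close> chosen inside \<open>F\<close> makes all of
  \<open>F'\<close> algebraic, since the new coordinates are fractions. Steinitz compares it with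
  \<open>J\<close>.\<close>

lemma exchange_generators:
  assumes A: "aff T D F'" and F: "F \<subseteq> F'" and S: "irreducible_in T S" "S \<subseteq> D"
    and fr: "fractions_over D F F'" and J: "J \<subseteq> F'" "findep S J"
  shows "\<exists>B\<subseteq>F. findep S B \<and> card J \<le> card B"
proof -
  have I: "prime_id F' (van F' S)" by (rule van_prime[OF A S])
  have fin: "finite F'" by (rule aff_finite[OF A])
  from basis_exists[OF fin I F indep_empty[OF I]]
  obtain B where B: "B \<subseteq> F" "indep F' (van F' S) B" "\<forall>b\<in>F. \<not> transc (van F' S) B b" by blast
  have BF: "B \<subseteq> F'" using B(1) F by auto
  have "card J \<le> card B"
  proof (rule steinitz[OF fin I BF])
    show "indep F' (van F' S) J" by (rule iffD1[OF findep_indep[OF J(1)] J(2)])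
    show "\<forall>j\<in>J. \<not> transc (van F' S) B j"
    proof
      fix j assume "j \<in> J"
      then have j: "j \<in> F'" using J(1) by auto
      show "\<not> transc (van F' S) B j"
        by (rule algebraic_trans[OF fin I BF F j B(3) fractions_algebraic[OF A F S fr j]])
    qed
  qed
  moreover have "findep S B" by (rule iffD2[OF findep_indep[OF BF] B(2)])
  ultimately show ?thesis using B(1) by blast
qed

text \<open>The transcendence degree bounds the length of chains: for each step adjoin a function that
  vanishes on the smaller set but not on the larger one.\<close>

lemma chain_independent:
  fixes n :: nat
  assumes A: "aff T U F" and U: "openin T U"
    and C: "\<forall>i\<le>n. closedin (subtopology T W) (C i) \<and> irreducible_in T (C i)" "\<forall>i<n. C i \<subset> C (Suc i)"
    and C0: "C 0 \<inter> U \<noteq> {}"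
  shows "\<exists>B\<subseteq>F. findep (C n \<inter> U) B \<and> n \<le> card B"
proof -
  \<comment> \<open>The members of the chain are closed only in \<open>W\<close>. Their closures,
    cut with the chart, are closed in the chart and still form a strict chain.\<close>
  define D where "D = (\<lambda>i. T closure_of (C i) \<inter> U)"
  have Cmono: "C 0 \<subseteq> C i" if "i \<le> n" for i using that
  proof (induction i)
    case (Suc i)
    then have "C i \<subset> C (Suc i)" using C(2) by simp
    then show ?case using Suc by auto
  qed simp
  have CU: "C i \<inter> U \<noteq> {}" if "i \<le> n" for i using Cmono[OF that] C0 by blast
  have irr: "irreducible_in T (C i)" and cl: "closedin (subtopology T W) (C i)" if "i \<le> n" for i
    using C(1) that by auto
  have dense: "C i \<subseteq> T closure_of (C i \<inter> U)" if "i \<le> n" for i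
    by (rule irreducible_open_dense[OF irr[OF that] U CU[OF that]])
  have CD: "C i \<inter> U \<subseteq> D i" if "i \<le> n" for i
    unfolding D_def using closure_of_subset[OF irreducible_topspace[OF irr[OF that]]] by blast
  have Ddense: "D i \<subseteq> T closure_of (C i \<inter> U)" if "i \<le> n" for i
  proof -
    have "T closure_of (C i) \<subseteq> T closure_of (C i \<inter> U)"
      by (rule closure_of_minimal[OF dense[OF that] closedin_closure_of])
    then show ?thesis unfolding D_def by blast
  qed
  have Dirr: "irreducible_in T (D i)" if "i \<le> n" for i
    by (rule irreducible_between_closure[OF irreducible_Int_open[OF irr[OF that] U CU[OF that]] CD[OF that] Ddense[OF that]])
  have Dcl: "closedin (subtopology T U) (D i)" for i
    unfolding D_def closedin_subtopology by (intro exI[of _ "T closure_of (C i)"]) simp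
  have DU: "D i \<subseteq> U" for i unfolding D_def by auto
  have Dmono: "D i \<subseteq> D (Suc i)" if "i < n" for i
    unfolding D_def using closure_of_mono[of "C i" "C (Suc i)" T] C(2) that by auto
  have Dne: "\<not> D (Suc i) \<subseteq> D i" if i: "i < n" for i
  proof
    assume "D (Suc i) \<subseteq> D i"
    then have "C (Suc i) \<inter> U \<subseteq> T closure_of (C i)" using CD[of "Suc i"] i unfolding D_def by auto
    then have "T closure_of (C (Suc i) \<inter> U) \<subseteq> T closure_of (C i)"
      by (rule closure_of_minimal[OF _ closedin_closure_of])
    then have "C (Suc i) \<subseteq> T closure_of (C i)" using dense[of "Suc i"] i by auto
    moreover have "C (Suc i) \<subseteq> W" using closedin_subset[OF cl[of "Suc i"]] i by auto
    moreover have "T closure_of (C i) \<inter> W = C i" by (rule closure_inter_closed) (use cl i in auto)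
    ultimately have "C (Suc i) \<subseteq> C i" by auto
    then show False using C(2) i by auto
  qed
  have "\<forall>i\<in>{..<n}. \<exists>q. q \<in> van F (D i) \<and> (\<exists>x\<in>D (Suc i). q (pt x) \<noteq> \<zero>)"
  proof
    fix i assume "i \<in> {..<n}"
    then obtain x where x: "x \<in> D (Suc i)" "x \<notin> D i" using Dne[of i] by auto
    have "x \<in> U" using x DU by auto
    from aff_separate_closed[OF A Dcl this x(2)] x(1)
    show "\<exists>q. q \<in> van F (D i) \<and> (\<exists>x\<in>D (Suc i). q (pt x) \<noteq> \<zero>)" by blast
  qed
  from bchoice[OF this] obtain q where q: "\<forall>i\<in>{..<n}. q i \<in> van F (D i) \<and> (\<exists>x\<in>D (Suc i). q i (pt x) \<noteq> \<zero>)"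
    by (rule exE)
  \<comment> \<open>The functions that separate consecutive members become coordinates, because
    \<open>indep_insert_vanishing\<close> adjoins a coordinate.\<close>
  define E where "E = (\<lambda>i x. q i (pt x)) ` {..<n}"
  have Efr: "\<exists>a\<in>Pol F. \<forall>w\<in>U. (\<lambda>v. \<one>) (pt w) \<noteq> \<zero> \<longrightarrow> f w \<in> carrier K \<and> f w \<otimes> (\<lambda>v. \<one>) (pt w) = a (pt w)" if fE: "f \<in> E" for f
  proof -
    obtain i where i: "i < n" "f = (\<lambda>x. q i (pt x))" using fE unfolding E_def by auto
    have qP: "q i \<in> Pol F" using q i(1) vanD(1) by blast
    have "\<forall>w\<in>U. \<one> \<noteq> \<zero> \<longrightarrow> f w \<in> carrier K \<and> f w \<otimes> \<one> = q i (pt w)"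
      unfolding i(2) using aff_closed_value[OF A qP] by simp
    then show ?thesis by (intro bexI[of _ "q i"] qP)
  qed
  have "finite E" unfolding E_def by simp
  \<comment> \<open>Localising at the constant one adjoins \<open>E\<close> without shrinking the
    chart; the further coordinate \<open>u\<close> is the constant inverse of one.\<close>
  from aff_localize[OF A Pol_one this Efr]
  obtain u where a': "aff T {w \<in> U. \<one> \<noteq> \<zero>} (insert u (F \<union> E))" and u: "\<forall>x\<in>U. u x = inv \<one>" by simp
  define F' where "F' = insert u (F \<union> E)"
  have A': "aff T U F'" using a' unfolding F'_def by simp
  have FF: "F \<subseteq> F'" unfolding F'_def by auto
  have fr: "fractions_over U F F'" unfolding fractions_over_def
  proof
    fix f assume "f \<in> F'"
    then consider "f = u" | "f \<in> F" | "f \<in> E" unfolding F'_def by auto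
    then have "\<exists>a\<in>Pol F. \<forall>x\<in>U. f x \<otimes> \<one> = a (pt x)"
    proof cases
      case 1
      have "\<forall>x\<in>U. f x \<otimes> \<one> = \<one>" using u unfolding 1 by simp
      then show ?thesis by (intro bexI[of _ "\<lambda>v. \<one>"]) simp_all
    next
      case 2
      have "\<forall>x\<in>U. f x \<otimes> \<one> = pt x f" using aff_Pts[OF A] 2 unfolding Pts_def by (auto simp: pt_apply)
      then show ?thesis using Pol_var[OF 2] by (intro bexI[of _ "\<lambda>v. v f"])
    next
      case 3
      then show ?thesis using Efr[OF 3] by auto
    qed
    then obtain a where "a \<in> Pol F" "\<forall>x\<in>U. f x \<otimes> \<one> = a (pt x)" by blast
    then show "\<exists>a\<in>Pol F. \<exists>g\<in>Pol F. \<forall>x\<in>U. g (pt x) \<noteq> \<zero> \<and> f x \<otimes> g (pt x) = a (pt x)"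
      by (intro bexI[of _ a] bexI[of _ "\<lambda>v. \<one>"]) simp_all
  qed
  have step: "i \<le> n \<Longrightarrow> \<exists>J\<subseteq>F'. findep (D i) J \<and> card J = i" for i
  proof (induction i)
    case 0
    have "prime_id F' (van F' (D 0))" using van_prime[OF A' Dirr DU] by simp
    from indep_empty[OF this] have "findep (D 0) {}" using findep_indep[of "{}" F' "D 0"] by simp
    then show ?case by (intro exI[of _ "{}"]) simp
  next
    case (Suc i)
    then obtain J where J: "J \<subseteq> F'" "findep (D i) J" "card J = i" by auto
    have i: "i < n" using Suc.prems by simp
    have I1: "prime_id F' (van F' (D (Suc i)))" using van_prime[OF A' Dirr DU] Suc.prems by simp
    have I2: "prime_id F' (van F' (D i))" using van_prime[OF A' Dirr DU] i by simp
    define y where "y = (\<lambda>x. q i (pt x))"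
    have yF: "y \<in> F'" unfolding F'_def E_def y_def using i by auto
    have qi: "q i \<in> van F (D i)" "\<exists>x\<in>D (Suc i). q i (pt x) \<noteq> \<zero>" using q i by auto
    have "(\<lambda>v. v y) \<in> van F' (D i)"
      using vanD(2)[OF qi(1)] by (intro vanI Pol_var[OF yF]) (simp add: pt_apply y_def)
    moreover have "(\<lambda>v. v y) \<notin> van F' (D (Suc i))"
    proof
      assume m: "(\<lambda>v. v y) \<in> van F' (D (Suc i))"
      obtain x where x: "x \<in> D (Suc i)" "q i (pt x) \<noteq> \<zero>" using qi(2) by blast
      from vanD(2)[OF m x(1)] show False using x(2) unfolding pt_apply y_def by simp
    qed
    moreover have "indep F' (van F' (D i)) J" by (rule iffD1[OF findep_indep[OF J(1)] J(2)])
    ultimately have yJ: "y \<notin> J" "indep F' (van F' (D (Suc i))) (insert y J)"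
      using indep_insert_vanishing[OF I1 I2 van_anti[OF Dmono[OF i]] yF] by blast+
    have JF: "insert y J \<subseteq> F'" using J(1) yF by auto
    have "finite J" using J(1) aff_finite[OF A'] finite_subset by blast
    then have "card (insert y J) = Suc i" using yJ(1) J(3) by simp
    moreover have "findep (D (Suc i)) (insert y J)" by (rule iffD2[OF findep_indep[OF JF] yJ(2)])
    ultimately show ?case using JF by blast
  qed
  obtain J where J: "J \<subseteq> F'" "findep (D n) J" "card J = n" using step[of n] by auto
  obtain B where B: "B \<subseteq> F" "findep (D n) B" "card J \<le> card B"
    using exchange_generators[OF A' FF Dirr[OF order_refl] DU fr J(1,2)] by blast
  have "findep (C n \<inter> U) B"
  proof (rule findep_dense[OF A B(1,2) DU])
    have "C n \<inter> U \<inter> U = C n \<inter> U" by auto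
    then show "D n \<subseteq> T closure_of (C n \<inter> U \<inter> U)" using Ddense[of n] by simp
  qed
  then show ?thesis using B J(3) by auto
qed

text \<open>The chart is taken around a point of the smallest member of the chain, so it meets all
  members. \<open>Z\<close> is the largest member.\<close>

lemma irr_chain_independent:
  assumes At: "atlas T \<A>" and n: "irr_chain T W n"
  shows "\<exists>U F B Z. (U, F) \<in> \<A> \<and> irreducible_in T Z \<and> closedin (subtopology T W) Z \<and> Z \<inter> U \<noteq> {} \<and>
     B \<subseteq> F \<and> findep (Z \<inter> U) B \<and> n \<le> card B"
proof -
  obtain C where C: "\<forall>i\<le>n. closedin (subtopology T W) (C i) \<and> irreducible_in T (C i)" "\<forall>i<n. C i \<subset> C (Suc i)"
    using n unfolding irr_chain_def by blast
  have "irreducible_in T (C 0)" using C(1) by simp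
  then obtain x where x: "x \<in> C 0" "x \<in> topspace T"
    using irreducible_nonempty irreducible_topspace by blast
  obtain U F where U: "(U, F) \<in> \<A>" "x \<in> U" using atlasD(4)[OF At x(2)] by blast
  have C0: "C 0 \<inter> U \<noteq> {}" using x U by auto
  have "C 0 \<subseteq> C i" if "i \<le> n" for i using that
  proof (induction i)
    case (Suc i)
    then have "C i \<subset> C (Suc i)" using C(2) by simp
    then show ?case using Suc by auto
  qed simp
  then have "C n \<inter> U \<noteq> {}" using C0 by blast
  then show ?thesis
    using chain_independent[OF atlasD(3)[OF At U(1)] atlasD(2)[OF At U(1)] C C0] U(1) C(1) by blast
qed

text \<open>The charts share a point of \<open>S\<close>, near which the coordinates of the first
  are fractions in those of the second. This neighbourhood is dense in \<open>S\<close>, so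
  independence passes into it and out of it again.\<close>

lemma change_chart:
  assumes At: "atlas T \<A>" and S: "irreducible_in T S" and 1: "(U1, F1) \<in> \<A>" "S \<inter> U1 \<noteq> {}"
    and 2: "(U2, F2) \<in> \<A>" "S \<inter> U2 \<noteq> {}" and B: "B \<subseteq> F1" "findep (S \<inter> U1) B"
  shows "\<exists>B'\<subseteq>F2. findep (S \<inter> U2) B' \<and> card B \<le> card B'"
proof -
  note A1 = atlasD(3)[OF At 1(1)] and A2 = atlasD(3)[OF At 2(1)]
  note o1 = atlasD(2)[OF At 1(1)] and o2 = atlasD(2)[OF At 2(1)]
  obtain w where w: "w \<in> S" "w \<in> U1" "w \<in> U2"
    using irreducible_meet[OF S o1 o2 1(2) 2(2)] by blast
  have "\<forall>f\<in>F1. regular_at U2 F2 U1 f w" using atlasD(5)[OF At 2(1) 1(1)] w by blast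
  from localize_at[OF A2 w(3,2) o1 aff_finite[OF A1] this]
  obtain W F' where W: "openin T W" "w \<in> W" "U2 \<inter> W \<subseteq> U1" "aff T (U2 \<inter> W) F'" "F2 \<subseteq> F'" "F1 \<subseteq> F'"
    "fractions_over (U2 \<inter> W) F2 F'" by blast
  have oW: "openin T (U2 \<inter> W)" using o2 W(1) by blast
  have ne: "S \<inter> (U2 \<inter> W) \<noteq> {}" using w W(2) by blast
  have irr: "irreducible_in T (S \<inter> (U2 \<inter> W))" by (rule irreducible_Int_open[OF S oW ne])
  have dense: "S \<subseteq> T closure_of (S \<inter> (U2 \<inter> W))" by (rule irreducible_open_dense[OF S oW ne])
  have "findep (S \<inter> (U2 \<inter> W)) B"
  proof (rule findep_dense[OF A1 B])
    have "S \<inter> (U2 \<inter> W) \<inter> U1 = S \<inter> (U2 \<inter> W)" using W(3) by auto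
    then show "S \<inter> U1 \<subseteq> T closure_of (S \<inter> (U2 \<inter> W) \<inter> U1)" using dense by auto
  qed auto
  then obtain B' where B': "B' \<subseteq> F2" "findep (S \<inter> (U2 \<inter> W)) B'" "card B \<le> card B'"
    using exchange_generators[OF W(4,5) irr _ W(7), of B] B(1) W(6) by blast
  have "findep (S \<inter> U2) B'" by (rule findep_mono[OF B'(2)]) auto
  then show ?thesis using B' by blast
qed

lemma atlas_noetherian:
  assumes At: "atlas T \<A>" and W: "W \<subseteq> topspace T"
  shows "noetherian_sub T W"
proof (rule noetherian_subset[OF _ W])
  have "topspace T = \<Union>(fst ` \<A>)"
  proof
    show "topspace T \<subseteq> \<Union>(fst ` \<A>)" using atlasD(4)[OF At] by force
    show "\<Union>(fst ` \<A>) \<subseteq> topspace T" using atlasD(2)[OF At] openin_subset by fastforce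
  qed
  moreover have "noetherian_sub T (\<Union>(fst ` \<A>))"
    using atlasD(1)[OF At] aff_noetherian[OF atlasD(3)[OF At]] by (intro noetherian_UN) auto
  ultimately show "noetherian_sub T (topspace T)" by simp
qed

section \<open>Modality and parameters in charts\<close>

lemma regular_at_subset:
  assumes "regular_at C F V f w" "C' \<inter> V' \<subseteq> C \<inter> V"
  shows "regular_at C' F V' f w"
proof -
  obtain a g where "a \<in> Pol F" "g \<in> Pol F" "g (pt w) \<noteq> \<zero>" and
    *: "\<forall>x\<in>C \<inter> V. g (pt x) \<noteq> \<zero> \<longrightarrow> f x \<in> carrier K \<and> f x \<otimes> g (pt x) = a (pt x)"
    using assms(1) unfolding regular_at_def by blast
  moreover have "\<forall>x\<in>C' \<inter> V'. g (pt x) \<noteq> \<zero> \<longrightarrow> f x \<in> carrier K \<and> f x \<otimes> g (pt x) = a (pt x)"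
    by (rule ballI, rule bspec[OF *], rule subsetD[OF assms(2)])
  ultimately show ?thesis unfolding regular_at_def by (intro bexI[of _ a] bexI[of _ g] conjI)
qed

text \<open>\<open>image_irr_chain\<close> for the identity map turns independent functions into a
  chain. Independence survives the passage to the open piece because the piece is dense in
  \<open>S\<close>.\<close>

lemma open_piece_chain:
  assumes A: "aff T C F" and S: "closedin (subtopology T C) S" "irreducible_in T S"
    and g: "g \<in> Pol F" "w \<in> S" "g (pt w) \<noteq> \<zero>" and L: "L \<subseteq> F" "findep S L"
  defines "S' \<equiv> {x \<in> S. g (pt x) \<noteq> \<zero>}"
  shows "irreducible_in T S'" "findep S' L" "irr_chain T S' (card L)"
proof -
  have SC: "S \<subseteq> C" using closedin_subset[OF S(1)] by auto
  have AS: "aff T S F" by (rule aff_closed_subset[OF A S(1)])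
  obtain G where G: "openin T G" "{x \<in> S. g (pt x) \<noteq> \<zero>} = G \<inter> S" by (rule aff_open_set[OF AS g(1)])
  have S'G: "S' = S \<inter> G" unfolding S'_def G(2) by auto
  have ne: "S \<inter> G \<noteq> {}" using g(2,3) G(2) by blast
  show irr: "irreducible_in T S'" unfolding S'G by (rule irreducible_Int_open[OF S(2) G(1) ne])
  show fi: "findep S' L"
  proof (rule findep_dense[OF AS L order_refl])
    have "S' \<inter> S = S \<inter> G" unfolding S'G by auto
    then show "S \<subseteq> T closure_of (S' \<inter> S)" using irreducible_open_dense[OF S(2) G(1) ne] by simp
  qed
  have "\<exists>F'. aff T S' F' \<and> F \<subseteq> F'"
    unfolding S'_def using aff_localize[OF AS g(1), of "{}"] by (intro exI conjI) (assumption | simp | blast)+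
  then obtain F' where F': "aff T S' F'" "F \<subseteq> F'" by blast
  have LF: "L \<subseteq> F'" using L(1) F'(2) by auto
  have "irr_chain T ((\<lambda>x. x) ` S') (card L)"
  proof (rule image_irr_chain[OF F'(1) irr LF fi refl])
    show "continuous_map (subtopology T S') T (\<lambda>x. x)" by simp
    fix f a assume f: "f \<in> L" "a \<in> carrier K"
    have "closedin (subtopology T S') {x \<in> S'. \<forall>f\<in>{f}. f x = a}"
      using f LF by (intro aff_level_closed[OF F'(1), of "{f}" "\<lambda>_. a"]) auto
    then obtain D where D: "closedin T D" "{x \<in> S'. f x = a} = D \<inter> S'" unfolding closedin_subtopology by auto
    then show "\<exists>D. closedin T D \<and> (\<forall>x\<in>S'. x \<in> D \<longleftrightarrow> f x = a)" by (intro exI[of _ D]) blast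
  qed
  then show "irr_chain T S' (card L)" by simp
qed

text \<open>Near a general point all fibres of \<open>P\<close> are equidimensional.\<close>

lemma general_fibres:
  assumes A: "aff T C F" and C: "irreducible_in T C" and P: "P \<subseteq> F" and L: "L \<subseteq> P" "findep C L"
  shows "\<exists>J I0 g. J \<subseteq> F \<and> L \<subseteq> I0 \<and> I0 \<subseteq> J \<and> I0 \<subseteq> P \<and> findep C J \<and> (\<forall>B\<subseteq>F. findep C B \<longrightarrow> card B \<le> card J) \<and>
     g \<in> Pol F \<and> g \<notin> van F C \<and>
     (\<forall>w\<in>C. g (pt w) \<noteq> \<zero> \<longrightarrow> (\<exists>S. irreducible_in T S \<and> w \<in> S \<and> S \<subseteq> C \<and> (\<forall>x\<in>S. \<forall>f\<in>P. f x = f w) \<and>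
        irr_chain T S (card (J - I0)))) \<and>
     (\<forall>S. irreducible_in T S \<longrightarrow> S \<subseteq> {w \<in> C. g (pt w) \<noteq> \<zero>} \<longrightarrow> (\<forall>x\<in>S. \<forall>y\<in>S. \<forall>f\<in>P. f x = f y) \<longrightarrow>
        (\<forall>B\<subseteq>F. findep S B \<longrightarrow> card B \<le> card (J - I0)))"
proof -
  have I: "prime_id F (van F C)" by (rule van_prime[OF A C order_refl])
  have fin: "finite F" by (rule aff_finite[OF A])
  have LF: "L \<subseteq> F" using L(1) P by auto
  have "indep F (van F C) L" by (rule iffD1[OF findep_indep[OF LF] L(2)])
  \<comment> \<open>\<open>I0\<close> is a transcendence basis of the functions in \<open>P\<close>,
    and \<open>J\<close> will extend it to one of all coordinates. Hence
    \<open>card (J - I0)\<close> is the dimension of the general fibre.\<close>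
  from basis_exists[OF fin I P this L(1)]
  obtain I0 where I0: "L \<subseteq> I0" "I0 \<subseteq> P" "indep F (van F C) I0" "\<forall>b\<in>P. \<not> transc (van F C) I0 b" by blast
  have I0F: "I0 \<subseteq> F" using I0(2) P by auto
  from basis_exists[OF fin I order_refl I0(3) I0F]
  obtain J where J: "I0 \<subseteq> J" "J \<subseteq> F" "indep F (van F C) J" "\<forall>b\<in>F. \<not> transc (van F C) J b" by blast
  have fJ: "findep C J" by (rule iffD2[OF findep_indep[OF J(2)] J(3)])
  have max: "card B \<le> card J" if B: "B \<subseteq> F" "findep C B" for B
  proof (rule steinitz[OF fin I J(2)])
    show "indep F (van F C) B" by (rule iffD1[OF findep_indep[OF B(1)] B(2)])
    show "\<forall>j\<in>B. \<not> transc (van F C) J j" using J(4) B(1) by blast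
  qed
  obtain g0 where g0: "g0 \<in> Pol F" "g0 \<notin> van F C" and g0S: "\<forall>w I0. w \<in> C \<longrightarrow> g0 (pt w) \<noteq> \<zero> \<longrightarrow> I0 \<subseteq> J \<longrightarrow>
     (\<exists>S. irreducible_in T S \<and> closedin (subtopology T C) S \<and> w \<in> S \<and> (\<forall>x\<in>S. \<forall>f\<in>I0. f x = f w) \<and>
        findep S (J - I0))"
    by (rule bexE[OF fibre_component_dominates[OF A C J(2) fJ J(4)]], erule conjE, rule that)
  obtain g1 where g1: "g1 \<in> Pol F" "g1 \<notin> van F C" and g1S: "\<forall>S. irreducible_in T S \<longrightarrow> S \<subseteq> {w \<in> C. g1 (pt w) \<noteq> \<zero>} \<longrightarrow>
     (\<forall>x\<in>S. \<forall>y\<in>S. \<forall>f\<in>I0. f x = f y) \<longrightarrow>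
     (\<forall>x\<in>S. \<forall>y\<in>S. \<forall>f\<in>P. f x = f y) \<and> (\<forall>L\<subseteq>F. findep S L \<longrightarrow> card L \<le> card (J - I0))"
    by (rule bexE[OF fibre_dimension_bound[OF A C J(2,1) P J(4) I0(4)]], erule conjE, rule that)
  define g where "g = (\<lambda>v. g0 v \<otimes> g1 v)"
  have g: "g \<in> Pol F" "g \<notin> van F C" unfolding g_def
    using Pol_mult[OF g0(1) g1(1)] prime_id_mult_not_in[OF I g0(1) g1(1) g0(2) g1(2)] by simp_all
  have gnz: "g0 (pt w) \<noteq> \<zero>" "g1 (pt w) \<noteq> \<zero>" if "w \<in> C" "g (pt w) \<noteq> \<zero>" for w
    using that(2) aff_closed_value[OF A g0(1) that(1)] aff_closed_value[OF A g1(1) that(1)] unfolding g_def by auto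
  have lower: "\<exists>S. irreducible_in T S \<and> w \<in> S \<and> S \<subseteq> C \<and> (\<forall>x\<in>S. \<forall>f\<in>P. f x = f w) \<and> irr_chain T S (card (J - I0))"
    if w: "w \<in> C" "g (pt w) \<noteq> \<zero>" for w
  proof -
    from g0S[rule_format, OF w(1) gnz(1)[OF w] J(1)]
    obtain S where S: "irreducible_in T S" "closedin (subtopology T C) S" "w \<in> S" "\<forall>x\<in>S. \<forall>f\<in>I0. f x = f w"
      "findep S (J - I0)" by blast
    have SC: "S \<subseteq> C" using closedin_subset[OF S(2)] by auto
    \<comment> \<open>So far only the functions in \<open>I0\<close> are constant on the component.
      Where \<open>g1\<close> does not vanish, this makes all of \<open>P\<close> constant.\<close>
    define S' where "S' = {x \<in> S. g1 (pt x) \<noteq> \<zero>}"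
    have JI: "J - I0 \<subseteq> F" using J(2) by auto
    note S' = open_piece_chain[OF A S(2,1) g1(1) S(3) gnz(2)[OF w] JI S(5), folded S'_def]
    have wS': "w \<in> S'" unfolding S'_def using S(3) gnz(2)[OF w] by simp
    have sub: "S' \<subseteq> {w \<in> C. g1 (pt w) \<noteq> \<zero>}" unfolding S'_def using SC by auto
    have c: "\<forall>x\<in>S'. \<forall>y\<in>S'. \<forall>f\<in>I0. f x = f y"
    proof (intro ballI)
      fix x y f assume "x \<in> S'" "y \<in> S'" "f \<in> I0"
      then have "f x = f w" "f y = f w" using S(4) unfolding S'_def by blast+
      then show "f x = f y" by simp
    qed
    have "\<forall>x\<in>S'. \<forall>y\<in>S'. \<forall>f\<in>P. f x = f y" by (rule conjunct1[OF g1S[rule_format, OF S'(1) sub]]) (use c in blast)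
    then have "\<forall>x\<in>S'. \<forall>f\<in>P. f x = f w" using wS' by blast
    moreover have "S' \<subseteq> C" using sub by auto
    ultimately show ?thesis using S'(1,3) wS' by blast
  qed
  have upper: "card B \<le> card (J - I0)"
    if S: "irreducible_in T S" "S \<subseteq> {w \<in> C. g (pt w) \<noteq> \<zero>}" "\<forall>x\<in>S. \<forall>y\<in>S. \<forall>f\<in>P. f x = f y"
      and B: "B \<subseteq> F" "findep S B" for S B
  proof -
    have "S \<subseteq> {w \<in> C. g1 (pt w) \<noteq> \<zero>}" using S(2) gnz(2) by blast
    moreover have "\<forall>x\<in>S. \<forall>y\<in>S. \<forall>f\<in>I0. f x = f y" using S(3) I0(2) by blast
    ultimately show ?thesis using g1S S(1) B by blast
  qed
  show ?thesis
  proof (rule exI[of _ J], rule exI[of _ I0], rule exI[of _ g], intro conjI)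
    show "J \<subseteq> F" "L \<subseteq> I0" "I0 \<subseteq> J" "I0 \<subseteq> P" "findep C J" "g \<in> Pol F" "g \<notin> van F C"
      using J(1,2) I0(1,2) fJ g by simp_all
    show "\<forall>B\<subseteq>F. findep C B \<longrightarrow> card B \<le> card J" using max by blast
    show "\<forall>w\<in>C. g (pt w) \<noteq> \<zero> \<longrightarrow> (\<exists>S. irreducible_in T S \<and> w \<in> S \<and> S \<subseteq> C \<and> (\<forall>x\<in>S. \<forall>f\<in>P. f x = f w) \<and>
        irr_chain T S (card (J - I0)))" by (intro ballI impI lower)
    show "\<forall>S. irreducible_in T S \<longrightarrow> S \<subseteq> {w \<in> C. g (pt w) \<noteq> \<zero>} \<longrightarrow> (\<forall>x\<in>S. \<forall>y\<in>S. \<forall>f\<in>P. f x = f y) \<longrightarrow>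
        (\<forall>B\<subseteq>F. findep S B \<longrightarrow> card B \<le> card (J - I0))" by (intro allI impI upper)
  qed
qed

section \<open>Regular maps in charts and their general fibres\<close>

definition regular_map ::
  "'p topology \<Rightarrow> ('p set \<times> ('p \<Rightarrow> 'k) set) set \<Rightarrow> 'p set \<Rightarrow> 'q topology \<Rightarrow> ('q set \<times> ('q \<Rightarrow> 'k) set) set \<Rightarrow> ('p \<Rightarrow> 'q) \<Rightarrow> bool"
  where "regular_map T \<A> V T' \<A>' \<phi> \<longleftrightarrow> continuous_map (subtopology T V) T' \<phi> \<and>
    (\<forall>U F U' F' f w. (U, F) \<in> \<A> \<longrightarrow> (U', F') \<in> \<A>' \<longrightarrow> f \<in> F' \<longrightarrow> w \<in> V \<longrightarrow> w \<in> U \<longrightarrow> \<phi> w \<in> U' \<longrightarrow>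
       regular_at U F {x \<in> V. \<phi> x \<in> U'} (\<lambda>x. f (\<phi> x)) w)"

lemma regular_mapD:
  assumes "regular_map T \<A> V T' \<A>' \<phi>"
  shows "continuous_map (subtopology T V) T' \<phi>"
    and "(U, F) \<in> \<A> \<Longrightarrow> (U', F') \<in> \<A>' \<Longrightarrow> f \<in> F' \<Longrightarrow> w \<in> V \<Longrightarrow> w \<in> U \<Longrightarrow> \<phi> w \<in> U' \<Longrightarrow>
       regular_at U F {x \<in> V. \<phi> x \<in> U'} (\<lambda>x. f (\<phi> x)) w"
proof -
  note a = assms[unfolded regular_map_def]
  show "continuous_map (subtopology T V) T' \<phi>" by (rule conjunct1[OF a])
  show "regular_at U F {x \<in> V. \<phi> x \<in> U'} (\<lambda>x. f (\<phi> x)) w"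
    if "(U, F) \<in> \<A>" "(U', F') \<in> \<A>'" "f \<in> F'" "w \<in> V" "w \<in> U" "\<phi> w \<in> U'"
    by (rule conjunct2[OF a, rule_format, OF that])
qed

text \<open>\<open>Z\<close> itself need not be locally closed, so the chart is made on its closure.
  Near \<open>w\<close> the closure stays inside \<open>V\<close>; there the map is defined and its
  coordinate functions are regular, hence can be adjoined.\<close>

lemma map_chart:
  assumes At: "atlas T \<A>" and At': "atlas T' \<A>'" and \<phi>: "regular_map T \<A> V T' \<A>' \<phi>"
    and Z: "irreducible_in T Z" and U: "(U, F) \<in> \<A>" "w \<in> Z" "w \<in> U" and U': "(U', F') \<in> \<A>'" "\<phi> w \<in> U'"
    and w: "w \<in> V" and N: "openin T N" "w \<in> N" "T closure_of Z \<inter> N \<subseteq> V"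
  shows "\<exists>M F1. openin T M \<and> w \<in> M \<and> M \<subseteq> N \<and> M \<subseteq> U \<and>
     aff T (T closure_of Z \<inter> M) F1 \<and> irreducible_in T (T closure_of Z \<inter> M) \<and> F \<subseteq> F1 \<and> (\<lambda>f x. f (\<phi> x)) ` F' \<subseteq> F1 \<and>
     (\<forall>x\<in>T closure_of Z \<inter> M. x \<in> V \<and> \<phi> x \<in> U')"
proof -
  note A = atlasD(3)[OF At U(1)] and o = atlasD(2)[OF At U(1)]
  note A' = atlasD(3)[OF At' U'(1)] and o' = atlasD(2)[OF At' U'(1)]
  let ?Z = "T closure_of Z"
  have "openin (subtopology T V) {x \<in> topspace (subtopology T V). \<phi> x \<in> U'}"
    by (rule openin_continuous_map_preimage[OF regular_mapD(1)[OF \<phi>] o'])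
  then obtain N0 where N0: "openin T N0" "{x \<in> topspace (subtopology T V). \<phi> x \<in> U'} = N0 \<inter> V"
    unfolding openin_subtopology by blast
  have wT: "w \<in> topspace T" using irreducible_topspace[OF Z] U(2) by auto
  define C where "C = ?Z \<inter> U"
  have Zsub: "Z \<subseteq> ?Z" by (rule closure_of_subset[OF irreducible_topspace[OF Z]])
  have wC: "w \<in> C" unfolding C_def using Zsub U by auto
  have "closedin (subtopology T U) C" unfolding C_def closedin_subtopology by (intro exI[of _ ?Z]) simp
  then have AC: "aff T C F" by (rule aff_closed_subset[OF A])
  define N1 where "N1 = N0 \<inter> N"
  have oN1: "openin T N1" unfolding N1_def using N0(1) N(1) by blast
  have "w \<in> {x \<in> topspace (subtopology T V). \<phi> x \<in> U'}" using wT w U'(2) by simp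
  then have wN1: "w \<in> N1" unfolding N1_def using N0(2) N(2) by blast
  have CN: "C \<inter> N1 \<subseteq> U \<inter> {x \<in> V. \<phi> x \<in> U'}" unfolding C_def N1_def using N(3) N0(2) by blast
  have "\<forall>f\<in>(\<lambda>f x. f (\<phi> x)) ` F'. regular_at C F N1 f w"
  proof
    fix f assume "f \<in> (\<lambda>f x. f (\<phi> x)) ` F'"
    then obtain f' where f': "f' \<in> F'" "f = (\<lambda>x. f' (\<phi> x))" by blast
    show "regular_at C F N1 f w" unfolding f'(2)
      by (rule regular_at_subset[OF regular_mapD(2)[OF \<phi> U(1) U'(1) f'(1) w U(3) U'(2)] CN])
  qed
  from localize_at[OF AC wC wN1 oN1 _ this] aff_finite[OF A']
  obtain W F1 where W: "openin T W" "w \<in> W" "C \<inter> W \<subseteq> N1" "aff T (C \<inter> W) F1" "F \<subseteq> F1"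
    "(\<lambda>f x. f (\<phi> x)) ` F' \<subseteq> F1" by blast
  define M where "M = U \<inter> W \<inter> N1"
  have oM: "openin T M" unfolding M_def using o W(1) oN1 by blast
  have CM: "C \<inter> W = ?Z \<inter> M" unfolding M_def using W(3) unfolding C_def by blast
  have wM: "w \<in> M" unfolding M_def using U(3) W(2) wN1 by simp
  have irrZ: "irreducible_in T ?Z" by (rule irreducible_between_closure[OF Z Zsub order_refl])
  have "irreducible_in T (?Z \<inter> M)"
    by (rule irreducible_Int_open[OF irrZ oM]) (use Zsub U(2) wM in blast)
  moreover have "\<forall>x\<in>?Z \<inter> M. x \<in> V \<and> \<phi> x \<in> U'" using CN CM W(3) by blast
  ultimately show ?thesis using oM wM W(4,5,6) unfolding CM
    by (intro exI[of _ M] exI[of _ F1]) (auto simp: M_def N1_def)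
qed

text \<open>The coordinates of a chart of the target separate points, so fibres of the map are
  common level sets of the composites.\<close>

lemma fibre_coordinates:
  assumes At': "atlas T' \<A>'" "(U', F') \<in> \<A>'" and "\<phi> x \<in> U'" "\<phi> y \<in> U'"
    and "\<And>f. f \<in> (\<lambda>f x. f (\<phi> x)) ` F' \<Longrightarrow> f x = f y"
  shows "\<phi> x = \<phi> y"
proof (rule aff_sep[OF atlasD(3)[OF At']])
  show "\<phi> x \<in> U'" "\<phi> y \<in> U'" by fact+
  fix f assume "f \<in> F'"
  then show "f (\<phi> x) = f (\<phi> y)" using assms(5)[of "\<lambda>x. f (\<phi> x)"] by blast
qed

text \<open>A level set of a composite is the preimage of a level set in the target chart, which is
  relatively closed there. This is what \<open>image_irr_chain\<close> asks for.\<close>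

lemma image_chain_in_chart:
  assumes At': "atlas T' \<A>'" "(U', F') \<in> \<A>'" and A: "aff T C F" "irreducible_in T C"
    and \<phi>: "continuous_map (subtopology T C) T' \<phi>" "\<forall>x\<in>C. \<phi> x \<in> U'"
    and I0: "I0 \<subseteq> (\<lambda>f x. f (\<phi> x)) ` F'" "I0 \<subseteq> F" "findep C I0"
  shows "irr_chain T' (\<phi> ` C) (card I0)"
proof (rule image_irr_chain[OF A I0(2,3) refl \<phi>(1)])
  fix f a assume f: "f \<in> I0" and a: "a \<in> carrier K"
  obtain f' where f': "f' \<in> F'" "f = (\<lambda>x. f' (\<phi> x))" using f I0(1) by blast
  have "closedin (subtopology T' U') {x \<in> U'. \<forall>f\<in>{f'}. f x = a}"
    using f' a by (intro aff_level_closed[OF atlasD(3)[OF At'], of "{f'}" "\<lambda>_. a"]) auto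
  then obtain D where D: "closedin T' D" "{x \<in> U'. f' x = a} = D \<inter> U'" unfolding closedin_subtopology by auto
  have "\<forall>x\<in>C. \<phi> x \<in> D \<longleftrightarrow> f x = a" using D(2) \<phi>(2) unfolding f'(2) by blast
  then show "\<exists>D. closedin T' D \<and> (\<forall>x\<in>C. \<phi> x \<in> D \<longleftrightarrow> f x = a)" using D(1) by blast
qed

text \<open>In a chart of the closure of \<open>Z\<close> the fibres through general points have
  dimension at least \<open>card (J - I0)\<close>, and \<open>I0\<close> gives a chain in the image,
  so d is \<open>card I0\<close>. A general point can be found in \<open>Z\<close> itself, where the
  fibre dimension is \<open>i\<close>. Hence card B is at most card J = card (J - I0) + card I0, and
  this is at most i + d.\<close>

lemma parameters_le_modality:
  assumes At: "atlas T \<A>" and At': "atlas T' \<A>'" and \<phi>: "regular_map T \<A> V T' \<A>' \<phi>"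
    and V: "openin T Q" "closedin T D" "V = Q \<inter> D"
    and Z: "irreducible_in T Z" "Z \<subseteq> T closure_of (Z \<inter> V)"
    and fib: "\<And>w. w \<in> Z \<Longrightarrow> w \<in> V \<Longrightarrow> dim_at T {v \<in> V. \<phi> v = \<phi> w} w = ereal (real i)"
    and B: "(U, F) \<in> \<A>" "Z \<inter> U \<noteq> {}" "B \<subseteq> F" "findep (Z \<inter> U) B"
  shows "\<exists>d. irr_chain T' (\<phi> ` V) d \<and> card B \<le> i + d"
proof -
  let ?Z = "T closure_of Z"
  \<comment> \<open>Density of the part in \<open>V\<close> puts the closure of \<open>Z\<close>
    inside \<open>D\<close>, so its points in the open set \<open>Q\<close> belong to
    \<open>V\<close>.\<close>
  have ZD: "?Z \<subseteq> D"
  proof -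
    have "T closure_of (Z \<inter> V) \<subseteq> D" using V by (intro closure_of_minimal) auto
    then have "Z \<subseteq> D" using Z(2) by blast
    then show ?thesis using V(2) by (rule closure_of_minimal)
  qed
  have Zsub: "Z \<subseteq> ?Z" by (rule closure_of_subset[OF irreducible_topspace[OF Z(1)]])
  have "Z \<inter> V \<noteq> {}" using Z(2) irreducible_nonempty[OF Z(1)] by auto
  then have "Z \<inter> Q \<noteq> {}" using V(3) by auto
  from irreducible_meet[OF Z(1) V(1) atlasD(2)[OF At B(1)] this B(2)]
  obtain w1 where w1: "w1 \<in> Z" "w1 \<in> Q" "w1 \<in> U" by blast
  have w1V: "w1 \<in> V" using w1 Zsub ZD V(3) by auto
  have "w1 \<in> topspace T" using irreducible_topspace[OF Z(1)] w1(1) by auto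
  then have "\<phi> w1 \<in> topspace T'"
    using continuous_map_image_subset_topspace[OF regular_mapD(1)[OF \<phi>]] w1V by auto
  then obtain U' F' where U': "(U', F') \<in> \<A>'" "\<phi> w1 \<in> U'" using atlasD(4)[OF At'] by blast
  have "?Z \<inter> Q \<subseteq> V" using ZD V(3) by auto
  from map_chart[OF At At' \<phi> Z(1) B(1) w1(1,3) U' w1V V(1) w1(2) this]
  obtain M F1 where M: "openin T M" "w1 \<in> M" "M \<subseteq> U" "aff T (?Z \<inter> M) F1" "irreducible_in T (?Z \<inter> M)" "F \<subseteq> F1"
     "(\<lambda>f x. f (\<phi> x)) ` F' \<subseteq> F1" "\<forall>x\<in>?Z \<inter> M. x \<in> V \<and> \<phi> x \<in> U'" by blast
  define C where "C = ?Z \<inter> M"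
  note A = M(4)[folded C_def] and C = M(5)[folded C_def] and CV = M(8)[folded C_def]
  have neZM: "Z \<inter> M \<noteq> {}" using w1(1) M(2) by auto
  have ZM: "Z \<subseteq> T closure_of (Z \<inter> M)" by (rule irreducible_open_dense[OF Z(1) M(1) neZM])
  have fB: "findep C B"
  proof (rule findep_mono)
    show "findep (Z \<inter> M) B"
    proof (rule findep_dense[OF atlasD(3)[OF At B(1)] B(3,4)])
      have "Z \<inter> M \<inter> U = Z \<inter> M" using M(3) by auto
      then show "Z \<inter> U \<subseteq> T closure_of (Z \<inter> M \<inter> U)" using ZM by auto
    qed auto
    show "Z \<inter> M \<subseteq> C" unfolding C_def using Zsub by auto
  qed
  let ?P = "(\<lambda>f x. f (\<phi> x)) ` F'"
  have "findep C {}"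
    using iffD2[OF findep_indep[of "{}" F1 C] indep_empty[OF van_prime[OF A C order_refl]]] by simp
  note general_fibres[OF A C M(7) empty_subsetI this]
  then obtain J I0 g where J: "J \<subseteq> F1" "I0 \<subseteq> J" "I0 \<subseteq> ?P" "findep C J" "\<forall>B\<subseteq>F1. findep C B \<longrightarrow> card B \<le> card J"
    and g: "g \<in> Pol F1" "g \<notin> van F1 C"
     "\<forall>w\<in>C. g (pt w) \<noteq> \<zero> \<longrightarrow> (\<exists>S. irreducible_in T S \<and> w \<in> S \<and> S \<subseteq> C \<and> (\<forall>x\<in>S. \<forall>f\<in>?P. f x = f w) \<and>
        irr_chain T S (card (J - I0)))"
    by - (elim exE conjE, rule that)
  have BJ: "card B \<le> card J" using J(5) B(3) M(6) fB by blast
  obtain x where x: "x \<in> C" "g (pt x) \<noteq> \<zero>" by (rule van_not_in[OF g(1,2)])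
  obtain G where G: "openin T G" "{x \<in> C. g (pt x) \<noteq> \<zero>} = G \<inter> C" by (rule aff_open_set[OF A g(1)])
  \<comment> \<open>\<open>x\<close> is a general point of the closure of \<open>Z\<close>; its open
    neighbourhood \<open>G \<inter> M\<close> contains a point \<open>w\<close> of
    \<open>Z\<close>.\<close>
  have "x \<in> G \<inter> M" "x \<in> ?Z" using x G(2) unfolding C_def by blast+
  moreover have "openin T (G \<inter> M)" using G(1) M(1) by blast
  ultimately obtain w where w: "w \<in> Z" "w \<in> G" "w \<in> M" unfolding in_closure_of by blast
  have wC: "w \<in> C" unfolding C_def using w Zsub by auto
  have gw: "g (pt w) \<noteq> \<zero>" using G(2) w(2) wC by blast
  obtain S where S: "irreducible_in T S" "w \<in> S" "S \<subseteq> C" "\<forall>x\<in>S. \<forall>f\<in>?P. f x = f w" "irr_chain T S (card (J - I0))"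
    using g(3) wC gw by blast
  have "S \<subseteq> {v \<in> V. \<phi> v = \<phi> w}"
  proof
    fix v assume v: "v \<in> S"
    have vw: "v \<in> V" "\<phi> v \<in> U'" "\<phi> w \<in> U'" using CV v S(3) wC by blast+
    have "\<phi> v = \<phi> w" by (rule fibre_coordinates[where \<phi>=\<phi> and x=v and y=w, OF At' U'(1) vw(2,3)]) (erule bspec[OF bspec[OF S(4) v]])
    then show "v \<in> {v \<in> V. \<phi> v = \<phi> w}" using vw(1) by simp
  qed
  from dim_at_ge[OF S(1) this S(2,5)]
  have "card (J - I0) \<le> i" using fib[OF w(1)] CV wC by simp
  moreover have "card J = card (J - I0) + card I0"
    using card_Diff_subset[of I0 J] card_mono[of J I0] J(1,2) aff_finite[OF A] finite_subset by (metis le_add_diff_inverse2)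
  moreover have "irr_chain T' (\<phi> ` V) (card I0)"
  proof (rule irr_chain_mono)
    have CVs: "C \<subseteq> V" using CV by blast
    show "irr_chain T' (\<phi> ` C) (card I0)"
    proof (rule image_chain_in_chart[OF At' U'(1) A C])
      show "continuous_map (subtopology T C) T' \<phi>"
        by (rule continuous_map_from_subtopology_mono[OF regular_mapD(1)[OF \<phi>] CVs])
      show "findep C I0" by (rule findep_subset[OF J(4,2)])
    qed (use CV J in blast)+
    show "\<phi> ` C \<subseteq> \<phi> ` V" using CVs by blast
  qed
  ultimately show ?thesis using BJ by (intro exI[of _ "card I0"]) simp
qed

text \<open>Two functions of \<open>L\<close> with the same composite, or a relation between
  composites, would give a relation between the functions on the image.\<close>

lemma findep_pullback:
  assumes fi: "findep (\<phi> ` C) L" and cl: "\<forall>x\<in>C. \<forall>f\<in>L. f (\<phi> x) \<in> carrier K"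
  shows "findep C ((\<lambda>f x. f (\<phi> x)) ` L)" "inj_on (\<lambda>f x. f (\<phi> x)) L"
proof -
  let ?\<Phi> = "\<lambda>f x. f (\<phi> x)"
  let ?r = "inv_into L ?\<Phi>"
  have r: "?r g \<in> L" "?\<Phi> (?r g) = g" if "g \<in> ?\<Phi> ` L" for g
    by (rule inv_into_into[OF that], rule f_inv_into_f[OF that])
  show "inj_on ?\<Phi> L"
  proof (rule inj_onI, rule ccontr)
    fix f f' assume f: "f \<in> L" "f' \<in> L" "?\<Phi> f = ?\<Phi> f'" "f \<noteq> f'"
    define p where "p = (\<lambda>v. v f \<oplus> \<ominus> \<one> \<otimes> v f' :: 'k)"
    have p: "p \<in> Pol L" unfolding p_def
      by (rule Pol_add[OF Pol_var[OF f(1)] Pol_mult[OF Pol_const Pol_var[OF f(2)]]]) simp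
    have "p (pt w) = \<zero>" if w: "w \<in> \<phi> ` C" for w
    proof -
      obtain x where x: "x \<in> C" "w = \<phi> x" using w by blast
      have "f w = f' w" using fun_cong[OF f(3), of x] x(2) by simp
      moreover have "f' w \<in> carrier K" using bspec[OF bspec[OF cl x(1)] f(2)] x(2) by simp
      ultimately show ?thesis unfolding p_def pt_apply by (simp add: l_minus r_neg)
    qed
    moreover define v where "v = (\<lambda>j. if j = f then \<one> else \<zero> :: 'k)"
    have v: "v \<in> Pts L" unfolding Pts_def v_def by simp
    ultimately have "p v = \<zero>" by (intro findepD[OF fi p _ v])
    moreover have "p v = \<one>" unfolding p_def v_def using f(4) by simp
    ultimately show False by simp
  qed
  show "findep C (?\<Phi> ` L)" unfolding findep_def
  proof (rule ballI, rule impI)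
    fix p assume p: "p \<in> Pol (?\<Phi> ` L)" and p0: "\<forall>w\<in>C. p (pt w) = \<zero>"
    have "p v = \<zero>" if v: "v \<in> Pts (?\<Phi> ` L)" for v
    proof -
    \<comment> \<open>Variables are named by functions, so the polynomial is renamed along
      \<open>?r\<close>, which picks for each composite a function of \<open>L\<close>.\<close>
    define q where "q = (\<lambda>u. p (\<lambda>g. u (?r g)))"
    have q: "q \<in> Pol L" unfolding q_def
      by (rule Pol_subst[OF p]) (rule Pol_var[OF r(1)])
    have "q (pt w) = \<zero>" if w: "w \<in> \<phi> ` C" for w
    proof -
      obtain x where x: "x \<in> C" "w = \<phi> x" using w by blast
      have "q (pt w) = p (pt x)" unfolding q_def
      proof (rule Pol_cong[OF p])
        fix g assume g: "g \<in> ?\<Phi> ` L"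
        show "pt w (?r g) = pt x g" using fun_cong[OF r(2)[OF g], of x] unfolding pt_apply x(2) .
      qed
      then show ?thesis using p0 x(1) by simp
    qed
    moreover define u where "u = (\<lambda>f. v (?\<Phi> f))"
    have u: "u \<in> Pts L" using v unfolding Pts_def u_def by simp
    ultimately have "q u = \<zero>" by (intro findepD[OF fi q _ u])
    moreover have "q u = p v" unfolding q_def u_def
      by (rule Pol_cong[OF p], rule arg_cong[where f=v], erule r(2))
    ultimately show "p v = \<zero>" by simp
    qed
    then show "\<forall>v\<in>Pts (?\<Phi> ` L). p v = \<zero>" by (rule ballI)
  qed
qed

text \<open>\<open>V\<close> may have several irreducible pieces. The irreducible set
  \<open>E0\<close> lies in the closure of the image of one piece, and removing the others leaves an
  open part of \<open>V\<close> inside this piece. Density keeps the functions \<open>L\<close>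
  independent on the image of that part.\<close>

lemma dominating_chart:
  assumes At: "atlas T \<A>" and At': "atlas T' \<A>'" and \<phi>: "regular_map T \<A> V T' \<A>' \<phi>"
    and V: "openin T Q" "closedin T D" "V = Q \<inter> D"
    and U': "(U', E) \<in> \<A>'" and E0: "irreducible_in T' E0" "E0 \<subseteq> \<phi> ` V" "E0 \<inter> U' \<noteq> {}"
    and L: "L \<subseteq> E" "findep (E0 \<inter> U') L"
  shows "\<exists>M F1 U F. (U, F) \<in> \<A> \<and> openin T M \<and> M \<subseteq> U \<and> aff T (V \<inter> M) F1 \<and> irreducible_in T (V \<inter> M) \<and> F \<subseteq> F1 \<and>
     (\<lambda>f x. f (\<phi> x)) ` E \<subseteq> F1 \<and> (\<forall>x\<in>V \<inter> M. \<phi> x \<in> U') \<and> findep (\<phi> ` (V \<inter> M)) L"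
proof -
  note o' = atlasD(2)[OF At' U'] and A' = atlasD(3)[OF At' U']
  have VT: "V \<subseteq> topspace T" using V openin_subset[OF V(1)] by auto
  from noetherian_open_pieces[OF atlas_noetherian[OF At VT] VT]
  obtain \<S> where \<S>: "finite \<S>" "V = \<Union>\<S>" "\<forall>S\<in>\<S>. closedin (subtopology T V) S \<and> irreducible_in T S"
     "\<forall>S\<in>\<S>. \<not> S \<subseteq> \<Union>(\<S> - {S})" by blast
  have \<phi>T: "\<phi> x \<in> topspace T'" if "x \<in> V" for x
    using continuous_map_image_subset_topspace[OF regular_mapD(1)[OF \<phi>]] that VT by auto
  have "E0 \<subseteq> \<Union>((\<lambda>S. T' closure_of (\<phi> ` S)) ` \<S>)"
  proof
    fix y assume "y \<in> E0"
    then obtain x where x: "x \<in> V" "y = \<phi> x" using E0(2) by blast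
    then obtain S where S: "S \<in> \<S>" "x \<in> S" using \<S>(2) by blast
    have "S \<subseteq> V" using S(1) \<S>(2) by blast
    then have "\<phi> ` S \<subseteq> topspace T'" using \<phi>T by blast
    from closure_of_subset[OF this] show "y \<in> \<Union>((\<lambda>S. T' closure_of (\<phi> ` S)) ` \<S>)" using S x(2) by blast
  qed
  then have "\<exists>A\<in>(\<lambda>S. T' closure_of (\<phi> ` S)) ` \<S>. E0 \<subseteq> A"
    by (intro irreducible_subset_Union[OF E0(1) finite_imageI[OF \<S>(1)]]) auto
  then obtain S where S: "S \<in> \<S>" "E0 \<subseteq> T' closure_of (\<phi> ` S)" by blast
  have SV: "S \<subseteq> V" using S(1) \<S>(2) by blast
  have irrS: "irreducible_in T S" using \<S>(3) S(1) by blast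
  define R where "R = \<Union>(\<S> - {S})"
  \<comment> \<open>\<open>N1\<close> removes the other pieces; by irredundancy some point of
    \<open>S\<close> remains.\<close>
  have "closedin (subtopology T V) R" unfolding R_def using \<S>(1,3) by (intro closedin_Union) auto
  then have "openin (subtopology T V) (topspace (subtopology T V) - R)" by blast
  then obtain N1 where N1: "openin T N1" "topspace (subtopology T V) - R = N1 \<inter> V" unfolding openin_subtopology by blast
  have VN1: "V \<inter> N1 \<subseteq> S"
  proof
    fix x assume "x \<in> V \<inter> N1"
    then have "x \<notin> R" "x \<in> V" using N1(2) by blast+
    then show "x \<in> S" unfolding R_def using \<S>(2) by blast
  qed
  have "\<not> S \<subseteq> R" unfolding R_def using \<S>(4) S(1) by blast
  then obtain x0 where x0: "x0 \<in> S" "x0 \<notin> R" by blast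
  then have "x0 \<in> topspace (subtopology T V) - R" using SV VT by auto
  then have ne1: "S \<inter> N1 \<noteq> {}" using N1(2) x0(1) by blast
  have "openin (subtopology T V) {x \<in> topspace (subtopology T V). \<phi> x \<in> U'}"
    by (rule openin_continuous_map_preimage[OF regular_mapD(1)[OF \<phi>] o'])
  then obtain N0 where N0: "openin T N0" "{x \<in> topspace (subtopology T V). \<phi> x \<in> U'} = N0 \<inter> V"
    unfolding openin_subtopology by blast
  obtain y where y: "y \<in> E0" "y \<in> U'" using E0(3) by blast
  have "y \<in> T' closure_of (\<phi> ` S)" using S(2) y(1) by blast
  from this[unfolded in_closure_of] y(2) o'
  obtain x1 where x1: "x1 \<in> S" "\<phi> x1 \<in> U'" by blast
  have "x1 \<in> {x \<in> topspace (subtopology T V). \<phi> x \<in> U'}" using x1 SV VT by auto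
  then have "S \<inter> N0 \<noteq> {}" using N0(2) x1(1) by blast
  from irreducible_meet[OF irrS N1(1) N0(1) ne1 this]
  obtain w where w: "w \<in> S" "w \<in> N1" "w \<in> N0" by blast
  have wV: "w \<in> V" using w(1) SV by blast
  have \<phi>w: "\<phi> w \<in> U'" using N0(2) w(3) wV by blast
  have "w \<in> topspace T" using wV VT by blast
  then obtain U F where U: "(U, F) \<in> \<A>" "w \<in> U" using atlasD(4)[OF At] by blast
  have oN: "openin T (N1 \<inter> Q)" using N1(1) V(1) by blast
  have wN: "w \<in> N1 \<inter> Q" using w(2) wV V(3) by blast
  have SD: "T closure_of S \<subseteq> D" using SV V(2,3) by (intro closure_of_minimal) auto
  then have cN: "T closure_of S \<inter> (N1 \<inter> Q) \<subseteq> V" using V(3) by blast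
  from map_chart[OF At At' \<phi> irrS U(1) w(1) U(2) U' \<phi>w wV oN wN cN]
  obtain M F1 where M: "openin T M" "w \<in> M" "M \<subseteq> N1 \<inter> Q" "M \<subseteq> U" "aff T (T closure_of S \<inter> M) F1"
     "irreducible_in T (T closure_of S \<inter> M)" "F \<subseteq> F1" "(\<lambda>f x. f (\<phi> x)) ` E \<subseteq> F1"
     "\<forall>x\<in>T closure_of S \<inter> M. x \<in> V \<and> \<phi> x \<in> U'" by blast
  have ST: "S \<subseteq> topspace T" using SV VT by blast
  have clM: "T closure_of S \<inter> M = V \<inter> M"
  proof
    show "T closure_of S \<inter> M \<subseteq> V \<inter> M" using M(9) by blast
    show "V \<inter> M \<subseteq> T closure_of S \<inter> M" using VN1 M(3) closure_of_subset[OF ST] by blast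
  qed
  have fi: "findep (\<phi> ` (V \<inter> M)) L"
  proof (rule findep_dense[OF A' L])
    \<comment> \<open>The map is continuous on \<open>V\<close> only, so closure points are compared
      just at the points of \<open>S\<close>.\<close>
    have "\<phi> ` (S \<inter> T closure_of (S \<inter> M)) \<subseteq> T' closure_of (\<phi> ` (S \<inter> M))"
    proof
      fix y assume "y \<in> \<phi> ` (S \<inter> T closure_of (S \<inter> M))"
      then obtain x where x: "x \<in> S" "x \<in> T closure_of (S \<inter> M)" "y = \<phi> x" by blast
      show "y \<in> T' closure_of (\<phi> ` (S \<inter> M))" unfolding in_closure_of
      proof (intro conjI allI impI)
        show "y \<in> topspace T'" using \<phi>T x(1,3) SV by blast
        fix H assume H: "y \<in> H \<and> openin T' H"
        have "openin (subtopology T V) {x \<in> topspace (subtopology T V). \<phi> x \<in> H}"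
          by (rule openin_continuous_map_preimage[OF regular_mapD(1)[OF \<phi>]]) (use H in blast)
        then obtain H0 where H0: "openin T H0" "{x \<in> topspace (subtopology T V). \<phi> x \<in> H} = H0 \<inter> V"
          unfolding openin_subtopology by blast
        have "x \<in> {x \<in> topspace (subtopology T V). \<phi> x \<in> H}" using x ST SV H by auto
        then have "x \<in> H0" using H0(2) by blast
        then obtain z where z: "z \<in> S \<inter> M" "z \<in> H0" using x(2) H0(1) unfolding in_closure_of by blast
        then have "\<phi> z \<in> H" using H0(2) SV by blast
        then show "\<exists>y. y \<in> \<phi> ` (S \<inter> M) \<and> y \<in> H" using z(1) by blast
      qed
    qed
    moreover have "S \<subseteq> T closure_of (S \<inter> M)"
      by (rule irreducible_open_dense[OF irrS M(1)]) (use w(1) M(2) in blast)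
    ultimately have "\<phi> ` S \<subseteq> T' closure_of (\<phi> ` (S \<inter> M))" by (simp add: Int_absorb2)
    then have "T' closure_of (\<phi> ` S) \<subseteq> T' closure_of (\<phi> ` (S \<inter> M))"
      by (intro closure_of_minimal closedin_closure_of)
    also have "\<dots> \<subseteq> T' closure_of (\<phi> ` (V \<inter> M))" by (rule closure_of_mono) (use SV in blast)
    also have "\<phi> ` (V \<inter> M) = \<phi> ` (V \<inter> M) \<inter> U'" using M(9) unfolding clM by blast
    finally show "E0 \<inter> U' \<subseteq> T' closure_of (\<phi> ` (V \<inter> M) \<inter> U')" using S(2) by blast
    show "E0 \<inter> U' \<subseteq> U'" by blast
  qed
  show ?thesis
  proof (rule exI[of _ M], rule exI[of _ F1], rule exI[of _ U], rule exI[of _ F], intro conjI)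
    show "(U, F) \<in> \<A>" "openin T M" "M \<subseteq> U" "F \<subseteq> F1" "(\<lambda>f x. f (\<phi> x)) ` E \<subseteq> F1" by fact+
    show "aff T (V \<inter> M) F1" "irreducible_in T (V \<inter> M)" using M(5,6) unfolding clM .
    show "\<forall>x\<in>V \<inter> M. \<phi> x \<in> U'" using M(9) unfolding clM by blast
    show "findep (\<phi> ` (V \<inter> M)) L" by (rule fi)
  qed
qed

text \<open>A chain in the image gives at least \<open>d\<close> functions independent on a part of
  it, and their composites are included in the basis \<open>I0\<close> of the fibre functions. On an
  open part of a chart all fibres have dimension \<open>card (J - I0)\<close>, while that part
  carries a chain of length \<open>card J\<close>. So i is \<open>card (J - I0)\<close>, n is
  \<open>card J\<close>, and d is at most \<open>card I0\<close>.\<close>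

lemma modality_le_parameters:
  assumes At: "atlas T \<A>" and At': "atlas T' \<A>'" and \<phi>: "regular_map T \<A> V T' \<A>' \<phi>"
    and V: "openin T Q" "closedin T D" "V = Q \<inter> D" and d: "irr_chain T' (\<phi> ` V) d"
  shows "\<exists>i n. irr_chain T {w \<in> V. dim_at T {v \<in> V. \<phi> v = \<phi> w} w = ereal (real i)} n \<and> d + i \<le> n"
proof -
  from irr_chain_independent[OF At' d]
  obtain U' E L E0 where E: "(U', E) \<in> \<A>'" "irreducible_in T' E0" "closedin (subtopology T' (\<phi> ` V)) E0"
    "E0 \<inter> U' \<noteq> {}" "L \<subseteq> E" "findep (E0 \<inter> U') L" "d \<le> card L" by blast
  have E0: "E0 \<subseteq> \<phi> ` V" using closedin_subset[OF E(3)] by auto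
  from dominating_chart[OF At At' \<phi> V E(1,2) E0 E(4,5,6)]
  obtain M F1 U F where M: "(U, F) \<in> \<A>" "openin T M" "M \<subseteq> U" "aff T (V \<inter> M) F1" "irreducible_in T (V \<inter> M)" "F \<subseteq> F1"
     "(\<lambda>f x. f (\<phi> x)) ` E \<subseteq> F1" "\<forall>x\<in>V \<inter> M. \<phi> x \<in> U'" "findep (\<phi> ` (V \<inter> M)) L" by blast
  define C where "C = V \<inter> M"
  note A = M(4)[folded C_def] and C = M(5)[folded C_def] and CU' = M(8)[folded C_def] and fi = M(9)[folded C_def]
  let ?P = "(\<lambda>f x. f (\<phi> x)) ` E" and ?L = "(\<lambda>f x. f (\<phi> x)) ` L"
  have cl: "\<forall>x\<in>C. \<forall>f\<in>L. f (\<phi> x) \<in> carrier K"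
  proof (intro ballI)
    fix x f assume x: "x \<in> C" and f: "f \<in> L"
    have "(\<lambda>x. f (\<phi> x)) \<in> F1" using M(7) E(5) f by blast
    moreover have "\<forall>i\<in>F1. pt x i \<in> carrier K" using aff_Pts[OF A x] unfolding Pts_def by simp
    ultimately have "pt x (\<lambda>x. f (\<phi> x)) \<in> carrier K" by (rule bspec[rotated])
    then show "f (\<phi> x) \<in> carrier K" unfolding pt_apply .
  qed
  have fL: "findep C ?L" by (rule findep_pullback(1)[where \<phi>=\<phi> and C=C and L=L, OF fi cl])
  have cL: "card ?L = card L" by (rule card_image[OF findep_pullback(2)[where \<phi>=\<phi> and C=C and L=L, OF fi cl]])
  have LP: "?L \<subseteq> ?P" using E(5) by blast
  note general_fibres[OF A C M(7) LP fL]
  then obtain J I0 g where J: "J \<subseteq> F1" "?L \<subseteq> I0" "I0 \<subseteq> J" "I0 \<subseteq> ?P" "findep C J"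
    and g: "g \<in> Pol F1" "g \<notin> van F1 C"
    and lower: "\<forall>w\<in>C. g (pt w) \<noteq> \<zero> \<longrightarrow> (\<exists>S. irreducible_in T S \<and> w \<in> S \<and> S \<subseteq> C \<and> (\<forall>x\<in>S. \<forall>f\<in>?P. f x = f w) \<and>
        irr_chain T S (card (J - I0)))"
    and upper: "\<forall>S. irreducible_in T S \<longrightarrow> S \<subseteq> {w \<in> C. g (pt w) \<noteq> \<zero>} \<longrightarrow> (\<forall>x\<in>S. \<forall>y\<in>S. \<forall>f\<in>?P. f x = f y) \<longrightarrow>
        (\<forall>B\<subseteq>F1. findep S B \<longrightarrow> card B \<le> card (J - I0))"
    by - (elim exE conjE, rule that)
  define C1 where "C1 = {x \<in> C. g (pt x) \<noteq> \<zero>}"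
  obtain G where G: "openin T G" "{x \<in> C. g (pt x) \<noteq> \<zero>} = G \<inter> C" by (rule aff_open_set[OF A g(1)])
  have C1: "C1 = V \<inter> (G \<inter> M)" unfolding C1_def G(2) unfolding C_def by blast
  have oGM: "openin T (G \<inter> M)" using G(1) M(2) by blast
  have fibre: "dim_at T {v \<in> V. \<phi> v = \<phi> w} w = ereal (real (card (J - I0)))" if w: "w \<in> C1" for w
  proof (rule antisym)
    have wC: "w \<in> C" "g (pt w) \<noteq> \<zero>" using w unfolding C1_def by blast+
    obtain S where S: "irreducible_in T S" "w \<in> S" "S \<subseteq> C" "\<forall>x\<in>S. \<forall>f\<in>?P. f x = f w" "irr_chain T S (card (J - I0))"
      using lower[rule_format, OF wC] by - (elim exE conjE, rule that)
    have "S \<subseteq> {v \<in> V. \<phi> v = \<phi> w}"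
    proof
      fix v assume v: "v \<in> S"
      have vw: "\<phi> v \<in> U'" "\<phi> w \<in> U'" using CU' v S(3) wC(1) by blast+
      have "\<phi> v = \<phi> w"
        by (rule fibre_coordinates[where \<phi>=\<phi> and x=v and y=w, OF At' E(1) vw]) (erule bspec[OF bspec[OF S(4) v]])
      moreover have "v \<in> V" using v S(3) unfolding C_def by blast
      ultimately show "v \<in> {v \<in> V. \<phi> v = \<phi> w}" by simp
    qed
    from dim_at_ge[OF S(1) this S(2,5)]
    show "ereal (real (card (J - I0))) \<le> dim_at T {v \<in> V. \<phi> v = \<phi> w} w" .
    show "dim_at T {v \<in> V. \<phi> v = \<phi> w} w \<le> ereal (real (card (J - I0)))"
    proof (rule dim_at_le)
      fix Z m assume Z: "irreducible_in T Z" "Z \<subseteq> {v \<in> V. \<phi> v = \<phi> w}" "w \<in> Z" "irr_chain T Z m"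
      \<comment> \<open>The functions measuring the chain may live in another chart. Independence is
        moved to the chart \<open>U\<close> around \<open>w\<close> and from there to the open part
        where the bound \<open>upper\<close> holds.\<close>
      from irr_chain_independent[OF At Z(4)]
      obtain U1 F' B Z' where B: "(U1, F') \<in> \<A>" "closedin (subtopology T Z) Z'" "Z' \<inter> U1 \<noteq> {}" "B \<subseteq> F'"
        "findep (Z' \<inter> U1) B" "m \<le> card B" by blast
      have ZZ: "Z' \<subseteq> Z" using closedin_subset[OF B(2)] by auto
      have "findep (Z \<inter> U1) B" by (rule findep_mono[OF B(5)]) (use ZZ in blast)
      moreover have "Z \<inter> U1 \<noteq> {}" using ZZ B(3) by blast
      moreover have wU: "w \<in> U" using wC(1) M(3) unfolding C_def by blast
      then have "Z \<inter> U \<noteq> {}" using Z(3) by blast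
      ultimately obtain B' where B': "B' \<subseteq> F" "findep (Z \<inter> U) B'" "card B \<le> card B'"
        using change_chart[OF At Z(1) B(1) _ M(1) _ B(4)] by blast
      let ?S = "Z \<inter> (G \<inter> M)"
      have wGM: "w \<in> G \<inter> M" using w unfolding C1 by blast
      have ne: "?S \<noteq> {}" using Z(3) wGM by blast
      have fS: "findep ?S B'"
      proof (rule findep_dense[OF atlasD(3)[OF At M(1)] B'(1,2)])
        have "?S \<inter> U = ?S" using M(3) by blast
        then show "Z \<inter> U \<subseteq> T closure_of (?S \<inter> U)" using irreducible_open_dense[OF Z(1) oGM ne] by auto
      qed auto
      have irr: "irreducible_in T ?S" by (rule irreducible_Int_open[OF Z(1) oGM ne])
      have SC: "?S \<subseteq> {w \<in> C. g (pt w) \<noteq> \<zero>}" using Z(2) unfolding C1[unfolded C1_def] by blast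
      have const: "\<forall>x\<in>?S. \<forall>y\<in>?S. \<forall>f\<in>?P. f x = f y"
      proof (intro ballI)
        fix x y f assume xy: "x \<in> ?S" "y \<in> ?S" and f: "f \<in> ?P"
        obtain f' where f': "f = (\<lambda>x. f' (\<phi> x))" using f by blast
        have "\<phi> x = \<phi> w" "\<phi> y = \<phi> w" using xy Z(2) by blast+
        then show "f x = f y" unfolding f' by simp
      qed
      have BF: "B' \<subseteq> F1" using B'(1) M(6) by blast
      have "card B' \<le> card (J - I0)"
        by (rule upper[THEN spec, THEN mp, OF irr, THEN mp, OF SC, THEN mp, OF const, THEN spec, THEN mp, OF BF, THEN mp, OF fS])
      then show "ereal (real m) \<le> ereal (real (card (J - I0)))" using B(6) B'(3) by simp
    qed
  qed
  obtain x where x: "x \<in> C" "g (pt x) \<noteq> \<zero>" by (rule van_not_in[OF g])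
  have "C \<subseteq> topspace T" by (rule aff_topspace[OF A])
  then have "closedin (subtopology T C) C" using closedin_topspace[of "subtopology T C"] by (simp add: Int_absorb1)
  from open_piece_chain(3)[OF A this C g(1) x J(1,5)]
  have "irr_chain T C1 (card J)" unfolding C1_def .
  moreover have "C1 \<subseteq> {w \<in> V. dim_at T {v \<in> V. \<phi> v = \<phi> w} w = ereal (real (card (J - I0)))}"
  proof
    fix w assume w: "w \<in> C1"
    then have "w \<in> V" unfolding C1 by blast
    then show "w \<in> {w \<in> V. dim_at T {v \<in> V. \<phi> v = \<phi> w} w = ereal (real (card (J - I0)))}"
      using fibre[OF w] by simp
  qed
  ultimately have "irr_chain T {w \<in> V. dim_at T {v \<in> V. \<phi> v = \<phi> w} w = ereal (real (card (J - I0)))} (card J)"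
    by (rule irr_chain_mono)
  moreover have "d + card (J - I0) \<le> card J"
  proof -
    have finJ: "finite J" by (rule finite_subset[OF J(1) aff_finite[OF A]])
    then have finI: "finite I0" by (rule finite_subset[OF J(3)])
    have "d \<le> card I0" using card_mono[OF finI J(2)] cL E(7) by simp
    moreover have "card (J - I0) = card J - card I0" by (rule card_Diff_subset[OF finI J(3)])
    moreover have "card I0 \<le> card J" by (rule card_mono[OF finJ J(3)])
    ultimately show ?thesis by simp
  qed
  ultimately show ?thesis by (rule exI[of _ "card (J - I0)", OF exI[of _ "card J", OF conjI]])
qed

text \<open>Orbits enter only through \<open>fib\<close>, which makes them fibres of the given maps
  on the pieces \<open>V j\<close>.\<close>

lemma parameters_eq_modality:
  fixes I :: "'j set"
  assumes At: "atlas T \<A>" and I: "finite I" and U': "U' \<subseteq> topspace T" "U' = (\<Union>j\<in>I. V j)"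
    and V: "\<And>j. j \<in> I \<Longrightarrow> \<exists>Q D. openin T Q \<and> closedin T D \<and> V j = Q \<inter> D"
    and AtY: "\<And>j. j \<in> I \<Longrightarrow> atlas (TY j) (\<A>Y j)"
    and \<phi>: "\<And>j. j \<in> I \<Longrightarrow> regular_map T \<A> (V j) (TY j) (\<A>Y j) (\<phi> j)"
    and fib: "\<And>j u. j \<in> I \<Longrightarrow> u \<in> V j \<Longrightarrow> U' \<inter> orb u = {v \<in> V j. \<phi> j v = \<phi> j u}"
  shows "(SUP i::nat. dim_of T {u \<in> U'. dim_at T (U' \<inter> orb u) u = ereal (real i)} - ereal (real i)) =
     (SUP j\<in>I. dim_of (TY j) (\<phi> j ` V j))"
    (is "(SUP i. dim_of T (?P i) - _) = ?R")
proof (rule antisym)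
  have "dim_of T (?P i) - ereal (real i) \<le> ?R" for i
  proof -
    have "dim_of T (?P i) \<le> ?R + ereal (real i)"
    proof (rule dim_le)
      fix n assume n: "irr_chain T (?P i) n"
      from irr_chain_independent[OF At n]
      obtain U F B Z where B: "(U, F) \<in> \<A>" "irreducible_in T Z" "closedin (subtopology T (?P i)) Z" "Z \<inter> U \<noteq> {}"
        "B \<subseteq> F" "findep (Z \<inter> U) B" "n \<le> card B" by blast
      have ZP: "Z \<subseteq> ?P i" using closedin_subset[OF B(3)] by auto
      \<comment> \<open>A parameter stratum may cross several \<open>V j\<close>; the irreducible
        \<open>Z\<close> has a dense part in one of them.\<close>
      have "Z \<subseteq> \<Union>((\<lambda>j. T closure_of (Z \<inter> V j)) ` I)"
      proof
        fix x assume x: "x \<in> Z"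
        then have "x \<in> U'" using ZP by blast
        then obtain j where j: "j \<in> I" "x \<in> V j" unfolding U'(2) by blast
        have "Z \<inter> V j \<subseteq> T closure_of (Z \<inter> V j)"
          using irreducible_topspace[OF B(2)] by (intro closure_of_subset) blast
        then show "x \<in> \<Union>((\<lambda>j. T closure_of (Z \<inter> V j)) ` I)" using x j by blast
      qed
      then have "\<exists>A\<in>(\<lambda>j. T closure_of (Z \<inter> V j)) ` I. Z \<subseteq> A"
        by (intro irreducible_subset_Union[OF B(2) finite_imageI[OF I]]) auto
      then obtain j where j: "j \<in> I" "Z \<subseteq> T closure_of (Z \<inter> V j)" by blast
      obtain Q D where QD: "openin T Q" "closedin T D" "V j = Q \<inter> D" using V[OF j(1)] by blast
      have fib': "dim_at T {v \<in> V j. \<phi> j v = \<phi> j w} w = ereal (real i)" if w: "w \<in> Z" "w \<in> V j" for w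
        using ZP w(1) unfolding fib[OF j(1) w(2), symmetric] by blast
      from parameters_le_modality[OF At AtY[OF j(1)] \<phi>[OF j(1)] QD B(2) j(2) fib' B(1,4,5,6)]
      obtain d where d: "irr_chain (TY j) (\<phi> j ` V j) d" "card B \<le> i + d" by blast
      have "ereal (real n) \<le> ereal (real d) + ereal (real i)" using d(2) B(7) by simp
      also have "dim_of (TY j) (\<phi> j ` V j) \<le> ?R" by (rule SUP_upper[OF j(1)])
      then have "ereal (real d) \<le> ?R" by (rule order_trans[OF irr_chain_le_dim[OF d(1)]])
      then have "ereal (real d) + ereal (real i) \<le> ?R + ereal (real i)" by (rule add_right_mono)
      finally show "ereal (real n) \<le> ?R + ereal (real i)" .
    qed
    then show ?thesis by (simp add: ereal_minus_le)
  qed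
  then show "(SUP i. dim_of T (?P i) - ereal (real i)) \<le> ?R" by (intro SUP_least)
  show "?R \<le> (SUP i. dim_of T (?P i) - ereal (real i))"
  proof (intro SUP_least dim_le)
    fix j d assume j: "j \<in> I" and d: "irr_chain (TY j) (\<phi> j ` V j) d"
    obtain Q D where QD: "openin T Q" "closedin T D" "V j = Q \<inter> D" using V[OF j] by blast
    from modality_le_parameters[OF At AtY[OF j] \<phi>[OF j] QD d]
    obtain i n where n: "irr_chain T {w \<in> V j. dim_at T {v \<in> V j. \<phi> j v = \<phi> j w} w = ereal (real i)} n" "d + i \<le> n"
      by blast
    have "{w \<in> V j. dim_at T {v \<in> V j. \<phi> j v = \<phi> j w} w = ereal (real i)} \<subseteq> ?P i"
    proof
      fix w assume w: "w \<in> {w \<in> V j. dim_at T {v \<in> V j. \<phi> j v = \<phi> j w} w = ereal (real i)}"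
      then have wV: "w \<in> V j" by blast
      then have "w \<in> U'" unfolding U'(2) using j by blast
      moreover have "dim_at T {v \<in> V j. \<phi> j v = \<phi> j w} w = ereal (real i)" using w by simp
      then have "dim_at T (U' \<inter> orb w) w = ereal (real i)" unfolding fib[OF j wV] .
      ultimately show "w \<in> ?P i" by simp
    qed
    from irr_chain_le_dim[OF irr_chain_mono[OF n(1) this]]
    have "ereal (real n) \<le> dim_of T (?P i)" .
    moreover have "ereal (real d) + ereal (real i) \<le> ereal (real n)" using n(2) by simp
    ultimately have "ereal (real d) + ereal (real i) \<le> dim_of T (?P i)" by (rule order_trans[rotated])
    then have "ereal (real d) \<le> dim_of T (?P i) - ereal (real i)" by (simp add: ereal_le_minus)
    also have "\<dots> \<le> (SUP i. dim_of T (?P i) - ereal (real i))" by (rule SUP_upper) simp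
    finally show "ereal (real d) \<le> (SUP i. dim_of T (?P i) - ereal (real i))" .
  qed
qed

section \<open>Residue fields of finitely generated algebras\<close>

text \<open>\<open>poly_rel A \<kappa> J p a\<close>: the element \<open>a\<close> of the \<open>K\<close>-algebra \<open>A\<close> is the value of a polynomial
  expression in the elements of \<open>J\<close>, whose associated function on \<open>K\<^sup>J\<close> is \<open>p\<close>.\<close>

inductive poly_rel :: "('a, 'm) ring_scheme \<Rightarrow> ('k \<Rightarrow> 'a) \<Rightarrow> 'a set \<Rightarrow> (('a \<Rightarrow> 'k) \<Rightarrow> 'k) \<Rightarrow> 'a \<Rightarrow> bool"
  for A :: "('a, 'm) ring_scheme" and \<kappa> :: "'k \<Rightarrow> 'a" and J :: "'a set" where
  poly_rel_const: "c \<in> carrier K \<Longrightarrow> poly_rel A \<kappa> J (\<lambda>v. c) (\<kappa> c)"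
| poly_rel_var: "j \<in> J \<Longrightarrow> poly_rel A \<kappa> J (\<lambda>v. v j) j"
| poly_rel_add: "poly_rel A \<kappa> J p a \<Longrightarrow> poly_rel A \<kappa> J q b \<Longrightarrow> poly_rel A \<kappa> J (\<lambda>v. p v \<oplus> q v) (a \<oplus>\<^bsub>A\<^esub> b)"
| poly_rel_mult: "poly_rel A \<kappa> J p a \<Longrightarrow> poly_rel A \<kappa> J q b \<Longrightarrow> poly_rel A \<kappa> J (\<lambda>v. p v \<otimes> q v) (a \<otimes>\<^bsub>A\<^esub> b)"

lemma poly_rel_Pol: "poly_rel A \<kappa> J p a \<Longrightarrow> p \<in> Pol J"
proof (induction rule: poly_rel.induct)
  case (poly_rel_const c) then show ?case by (rule Pol_const)
next
  case (poly_rel_var j) then show ?case by (rule Pol_var)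
next
  case (poly_rel_add p a q b) show ?case by (rule Pol_add[OF poly_rel_add.IH])
next
  case (poly_rel_mult p a q b) show ?case by (rule Pol_mult[OF poly_rel_mult.IH])
qed

lemma poly_rel_carrier:
  assumes "cring A" "\<kappa> \<in> ring_hom K A" "J \<subseteq> carrier A" "poly_rel A \<kappa> J p a"
  shows "a \<in> carrier A"
proof -
  interpret A: cring A by fact
  show ?thesis using assms(4)
    by (induction rule: poly_rel.induct) (use assms(2,3) in \<open>auto simp: ring_hom_closed\<close>)
qed

lemma poly_rel_total: "p \<in> Pol J \<Longrightarrow> \<exists>a. poly_rel A \<kappa> J p a"
proof (induction rule: Pol.induct)
  case (Pol_const c) show ?case by (rule exI, rule poly_rel_const[OF Pol_const])
next
  case (Pol_var j) show ?case by (rule exI, rule poly_rel_var[OF Pol_var])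
next
  case (Pol_add p q)
  then obtain a b where "poly_rel A \<kappa> J p a" "poly_rel A \<kappa> J q b" by blast
  from poly_rel_add[OF this] show ?case by (rule exI)
next
  case (Pol_mult p q)
  then obtain a b where "poly_rel A \<kappa> J p a" "poly_rel A \<kappa> J q b" by blast
  from poly_rel_mult[OF this] show ?case by (rule exI)
qed

lemma poly_rel_surj:
  assumes A: "cring A" and \<kappa>: "\<kappa> \<in> ring_hom K A" and J: "J \<subseteq> carrier A"
    and a: "a \<in> generate_ring A (\<kappa> ` carrier K \<union> J)"
  shows "\<exists>p. poly_rel A \<kappa> J p a"
proof -
  interpret A: cring A by fact
  have \<kappa>1: "\<kappa> \<one> = \<one>\<^bsub>A\<^esub>" by (rule ring_hom_one[OF \<kappa>])
  interpret \<kappa>: ring_hom_ring K A \<kappa> by (rule ring_hom_ringI2[OF ring_axioms A.ring_axioms \<kappa>])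
  show ?thesis using a
  proof (induction rule: generate_ring.induct)
    case one
    show ?case using poly_rel_const[OF one_closed, of A \<kappa> J] unfolding \<kappa>1 by (rule exI[of _ "\<lambda>v. \<one>"])
  next
    case (incl a)
    then show ?case
    proof
      assume "a \<in> \<kappa> ` carrier K"
      then obtain c where c: "c \<in> carrier K" "a = \<kappa> c" by blast
      show ?thesis unfolding c(2) by (rule exI, rule poly_rel_const[OF c(1)])
    next
      assume "a \<in> J"
      then show ?thesis by (intro exI, rule poly_rel_var)
    qed
  next
    case (a_inv a)
    then obtain p where p: "poly_rel A \<kappa> J p a" by blast
    have m: "\<ominus> \<one> \<in> carrier K" by simp
    have "\<kappa> (\<ominus> \<one>) \<otimes>\<^bsub>A\<^esub> a = \<ominus>\<^bsub>A\<^esub> a"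
      using poly_rel_carrier[OF A \<kappa> J p] by (simp add: \<kappa>1 A.l_minus)
    then show ?case using poly_rel_mult[OF poly_rel_const[OF m] p] by auto
  next
    case (eng_add a b)
    then obtain p q where "poly_rel A \<kappa> J p a" "poly_rel A \<kappa> J q b" by blast
    from poly_rel_add[OF this] show ?case by (rule exI[of _ "\<lambda>v. p v \<oplus> q v"])
  next
    case (eng_mult a b)
    then obtain p q where "poly_rel A \<kappa> J p a" "poly_rel A \<kappa> J q b" by blast
    from poly_rel_mult[OF this] show ?case by (rule exI[of _ "\<lambda>v. p v \<otimes> q v"])
  qed
qed

text \<open>Polynomials in one further generator whose coefficients are pairs of a function on K^J
  and a matching element of the algebra: \<open>fst\<close> computes the function,
  \<open>snd\<close> the element.\<close>

definition coeff_pairs :: "('a, 'm) ring_scheme \<Rightarrow> ('k \<Rightarrow> 'a) \<Rightarrow> 'a set \<Rightarrow> ((('a \<Rightarrow> 'k) \<Rightarrow> 'k) \<times> 'a) list set" where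
  "coeff_pairs A \<kappa> J = {l. \<forall>z\<in>set l. poly_rel A \<kappa> J (fst z) (snd z)}"

abbreviation (input) hval :: "((('a \<Rightarrow> 'k) \<Rightarrow> 'k) \<times> 'a) list \<Rightarrow> ('a \<Rightarrow> 'k) \<Rightarrow> 'k \<Rightarrow> 'k" where
  "hval l v x \<equiv> horner K (map (\<lambda>z. fst z v) l) x"

lemma coeff_pairs_Cons: "(q, c) # l \<in> coeff_pairs A \<kappa> J \<longleftrightarrow> poly_rel A \<kappa> J q c \<and> l \<in> coeff_pairs A \<kappa> J"
  unfolding coeff_pairs_def by simp

lemma hval_closed: "l \<in> coeff_pairs A \<kappa> J \<Longrightarrow> v \<in> Pts J \<Longrightarrow> x \<in> carrier K \<Longrightarrow> hval l v x \<in> carrier K"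
proof (induction l)
  case (Cons z l)
  obtain q c where z: "z = (q, c)" by (cases z)
  have "q v \<in> carrier K" using Pol_closed[OF poly_rel_Pol Cons.prems(2)] Cons.prems(1) unfolding z coeff_pairs_Cons by blast
  then show ?case using Cons unfolding z coeff_pairs_Cons by simp
qed simp

context
  fixes A :: "('a, 'm) ring_scheme" and \<kappa> :: "'k \<Rightarrow> 'a" and J :: "'a set" and b :: 'a
  assumes A: "cring A" and \<kappa>: "\<kappa> \<in> ring_hom K A" and J: "J \<subseteq> carrier A" and b: "b \<in> carrier A"
begin

interpretation A: cring A by (rule A)

lemma ha_closed: "l \<in> coeff_pairs A \<kappa> J \<Longrightarrow> horner A (map snd l) b \<in> carrier A"
proof (induction l)
  case (Cons z l)
  obtain q c where z: "z = (q, c)" by (cases z)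
  have "c \<in> carrier A" using poly_rel_carrier[OF A \<kappa> J] Cons.prems(1) unfolding z coeff_pairs_Cons by blast
  then show ?case using Cons b unfolding z coeff_pairs_Cons by simp
qed simp

lemma pairs_add:
  assumes "l \<in> coeff_pairs A \<kappa> J" "l' \<in> coeff_pairs A \<kappa> J"
  shows "\<exists>m\<in>coeff_pairs A \<kappa> J. (\<forall>v\<in>Pts J. \<forall>x\<in>carrier K. hval m v x = hval l v x \<oplus> hval l' v x) \<and>
     horner A (map snd m) b = horner A (map snd l) b \<oplus>\<^bsub>A\<^esub> horner A (map snd l') b"
  using assms
proof (induction l arbitrary: l')
  case Nil
  show ?case
    by (rule bexI[of _ l'])
       (use Nil hval_closed[OF Nil(2)] ha_closed[OF Nil(2)] in simp_all)
next
  case (Cons z l)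
  obtain q c where z: "z = (q, c)" by (cases z)
  have zl: "poly_rel A \<kappa> J q c" "l \<in> coeff_pairs A \<kappa> J" using Cons.prems(1) unfolding z coeff_pairs_Cons by blast+
  show ?case
  proof (cases l')
    case Nil
    show ?thesis unfolding Nil
      by (rule bexI[of _ "z # l"])
         (use Cons.prems(1) hval_closed[OF Cons.prems(1)] ha_closed[OF Cons.prems(1)] in simp_all)
  next
    case l': (Cons z' k)
    obtain q' c' where z': "z' = (q', c')" by (cases z')
    have zk: "poly_rel A \<kappa> J q' c'" "k \<in> coeff_pairs A \<kappa> J"
      using Cons.prems(2) unfolding l' z' coeff_pairs_Cons by blast+
    from Cons.IH[OF zl(2) zk(2)]
    obtain m where m: "m \<in> coeff_pairs A \<kappa> J" "\<forall>v\<in>Pts J. \<forall>x\<in>carrier K. hval m v x = hval l v x \<oplus> hval k v x"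
     "horner A (map snd m) b = horner A (map snd l) b \<oplus>\<^bsub>A\<^esub> horner A (map snd k) b" by (elim bexE conjE)
    show ?thesis
    proof (rule bexI[of _ "(\<lambda>v. q v \<oplus> q' v, c \<oplus>\<^bsub>A\<^esub> c') # m"], intro conjI ballI)
      show "(\<lambda>v. q v \<oplus> q' v, c \<oplus>\<^bsub>A\<^esub> c') # m \<in> coeff_pairs A \<kappa> J"
        unfolding coeff_pairs_Cons using poly_rel_add[OF zl(1) zk(1)] m(1) by (rule conjI)
      have "c \<in> carrier A" "c' \<in> carrier A" using poly_rel_carrier[OF A \<kappa> J] zl(1) zk(1) by blast+
      then show "horner A (map snd ((\<lambda>v. q v \<oplus> q' v, c \<oplus>\<^bsub>A\<^esub> c') # m)) b =
          horner A (map snd (z # l)) b \<oplus>\<^bsub>A\<^esub> horner A (map snd l') b"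
        using m(3) A.horner_step_identities(1)[OF _ _ b ha_closed[OF zl(2)] ha_closed[OF zk(2)]] unfolding z l' z' by simp
      fix v x assume v: "v \<in> Pts J" and x: "x \<in> carrier K"
      have "q v \<in> carrier K" "q' v \<in> carrier K" by (rule Pol_closed[OF poly_rel_Pol v], fact)+
      then show "hval ((\<lambda>v. q v \<oplus> q' v, c \<oplus>\<^bsub>A\<^esub> c') # m) v x = hval (z # l) v x \<oplus> hval l' v x"
        using m(2) v x horner_step_identities(1)[OF _ _ x hval_closed[OF zl(2) v x] hval_closed[OF zk(2) v x]]
        unfolding z l' z' by simp
    qed
  qed
qed

lemma pairs_scale:
  assumes q: "poly_rel A \<kappa> J q c" and l: "l \<in> coeff_pairs A \<kappa> J"
  shows "\<exists>m\<in>coeff_pairs A \<kappa> J. (\<forall>v\<in>Pts J. \<forall>x\<in>carrier K. hval m v x = q v \<otimes> hval l v x) \<and>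
     horner A (map snd m) b = c \<otimes>\<^bsub>A\<^esub> horner A (map snd l) b"
  using l
proof (induction l)
  case Nil
  have "c \<in> carrier A" using poly_rel_carrier[OF A \<kappa> J q] .
  moreover have "q v \<in> carrier K" if "v \<in> Pts J" for v by (rule Pol_closed[OF poly_rel_Pol[OF q] that])
  ultimately show ?case by (intro bexI[of _ "[]"]) (use Nil in simp_all)
next
  case (Cons z l)
  obtain q' c' where z: "z = (q', c')" by (cases z)
  have zl: "poly_rel A \<kappa> J q' c'" "l \<in> coeff_pairs A \<kappa> J" using Cons.prems(1) unfolding z coeff_pairs_Cons by blast+
  from Cons.IH[OF zl(2)]
  obtain m where m: "m \<in> coeff_pairs A \<kappa> J" "\<forall>v\<in>Pts J. \<forall>x\<in>carrier K. hval m v x = q v \<otimes> hval l v x"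
     "horner A (map snd m) b = c \<otimes>\<^bsub>A\<^esub> horner A (map snd l) b" by (elim bexE conjE)
  show ?case
  proof (rule bexI[of _ "(\<lambda>v. q v \<otimes> q' v, c \<otimes>\<^bsub>A\<^esub> c') # m"], intro conjI ballI)
    show "(\<lambda>v. q v \<otimes> q' v, c \<otimes>\<^bsub>A\<^esub> c') # m \<in> coeff_pairs A \<kappa> J"
      unfolding coeff_pairs_Cons using poly_rel_mult[OF q zl(1)] m(1) by (rule conjI)
    have "c \<in> carrier A" "c' \<in> carrier A" using poly_rel_carrier[OF A \<kappa> J] zl(1) q by blast+
    then show "horner A (map snd ((\<lambda>v. q v \<otimes> q' v, c \<otimes>\<^bsub>A\<^esub> c') # m)) b = c \<otimes>\<^bsub>A\<^esub> horner A (map snd (z # l)) b"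
      using m(3) A.horner_step_identities(2)[OF _ _ b ha_closed[OF zl(2)]] ha_closed[OF zl(2)] unfolding z by simp
    fix v x assume v: "v \<in> Pts J" and x: "x \<in> carrier K"
    have "q v \<in> carrier K" "q' v \<in> carrier K" by (rule Pol_closed[OF poly_rel_Pol v], fact)+
    then show "hval ((\<lambda>v. q v \<otimes> q' v, c \<otimes>\<^bsub>A\<^esub> c') # m) v x = q v \<otimes> hval (z # l) v x"
      using m(2) v x horner_step_identities(2)[OF _ _ x hval_closed[OF zl(2) v x]] hval_closed[OF zl(2) v x]
      unfolding z by simp
  qed
qed

lemma pairs_mult:
  assumes l: "l \<in> coeff_pairs A \<kappa> J" and l': "l' \<in> coeff_pairs A \<kappa> J"
  shows "\<exists>m\<in>coeff_pairs A \<kappa> J. (\<forall>v\<in>Pts J. \<forall>x\<in>carrier K. hval m v x = hval l v x \<otimes> hval l' v x) \<and>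
     horner A (map snd m) b = horner A (map snd l) b \<otimes>\<^bsub>A\<^esub> horner A (map snd l') b"
  using l
proof (induction l)
  case Nil
  show ?case
    by (rule bexI[of _ "[]"]) (use hval_closed[OF l'] ha_closed[OF l'] Nil in simp_all)
next
  case (Cons z l)
  obtain q c where z: "z = (q, c)" by (cases z)
  have zl: "poly_rel A \<kappa> J q c" "l \<in> coeff_pairs A \<kappa> J" using Cons.prems(1) unfolding z coeff_pairs_Cons by blast+
  from Cons.IH[OF zl(2)]
  obtain m where m: "m \<in> coeff_pairs A \<kappa> J" "\<forall>v\<in>Pts J. \<forall>x\<in>carrier K. hval m v x = hval l v x \<otimes> hval l' v x"
     "horner A (map snd m) b = horner A (map snd l) b \<otimes>\<^bsub>A\<^esub> horner A (map snd l') b" by (elim bexE conjE)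
  from pairs_scale[OF zl(1) l']
  obtain n where n: "n \<in> coeff_pairs A \<kappa> J" "\<forall>v\<in>Pts J. \<forall>x\<in>carrier K. hval n v x = q v \<otimes> hval l' v x"
     "horner A (map snd n) b = c \<otimes>\<^bsub>A\<^esub> horner A (map snd l') b" by (elim bexE conjE)
  have \<kappa>0: "\<kappa> \<zero> = \<zero>\<^bsub>A\<^esub>" by (rule ring_hom_zero[OF \<kappa> ring_axioms A.ring_axioms])
  have zm: "(\<lambda>v. \<zero>, \<zero>\<^bsub>A\<^esub>) # m \<in> coeff_pairs A \<kappa> J"
    unfolding coeff_pairs_Cons using poly_rel_const[OF zero_closed, of A \<kappa> J] m(1) unfolding \<kappa>0 by (rule conjI)
  from pairs_add[OF n(1) zm]
  obtain t where t: "t \<in> coeff_pairs A \<kappa> J"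
     "\<forall>v\<in>Pts J. \<forall>x\<in>carrier K. hval t v x = hval n v x \<oplus> hval ((\<lambda>v. \<zero>, \<zero>\<^bsub>A\<^esub>) # m) v x"
     "horner A (map snd t) b = horner A (map snd n) b \<oplus>\<^bsub>A\<^esub> horner A (map snd ((\<lambda>v. \<zero>, \<zero>\<^bsub>A\<^esub>) # m)) b"
    by (elim bexE conjE)
  show ?case
  proof (rule bexI[OF _ t(1)], intro conjI ballI)
    have "c \<in> carrier A" using poly_rel_carrier[OF A \<kappa> J] zl(1) by blast
    then show "horner A (map snd t) b = horner A (map snd (z # l)) b \<otimes>\<^bsub>A\<^esub> horner A (map snd l') b"
      using t(3) n(3) m(3) A.horner_step_identities(3)[OF _ ha_closed[OF l'] b ha_closed[OF zl(2)] ha_closed[OF l']]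
      unfolding z by simp
    fix v x assume v: "v \<in> Pts J" and x: "x \<in> carrier K"
    have "q v \<in> carrier K" by (rule Pol_closed[OF poly_rel_Pol v], fact)
    then show "hval t v x = hval (z # l) v x \<otimes> hval l' v x"
      using t(2) n(2) m(2) v x horner_step_identities(3)[OF _ hval_closed[OF l' v x] x hval_closed[OF zl(2) v x] hval_closed[OF l' v x]]
      unfolding z by simp
  qed
qed

text \<open>Powers of \<open>b\<close> are collected in the function and in the element at the same
  time, so matching coefficients stay matched. This carries the induction over generators in
  \<open>poly_rel_zero\<close>.\<close>

lemma poly_rel_insert_normal_form:
  assumes "poly_rel A \<kappa> (insert b J) p a"
  shows "\<exists>l\<in>coeff_pairs A \<kappa> J. (\<forall>v\<in>Pts (insert b J). p v = hval l v (v b)) \<and> a = horner A (map snd l) b"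
  using assms
proof (induction rule: poly_rel.induct)
  case (poly_rel_const c)
  have "[((\<lambda>v. c), \<kappa> c)] \<in> coeff_pairs A \<kappa> J"
    unfolding coeff_pairs_def using poly_rel.poly_rel_const[OF poly_rel_const, of A \<kappa> J] by simp
  then show ?case
    using poly_rel_const ring_hom_closed[OF \<kappa> poly_rel_const] b
    by (intro bexI[of _ "[((\<lambda>v. c), \<kappa> c)]"]) (simp_all add: Pts_def)
next
  case (poly_rel_var j)
  have \<kappa>01: "\<kappa> \<zero> = \<zero>\<^bsub>A\<^esub>" "\<kappa> \<one> = \<one>\<^bsub>A\<^esub>"
    by (rule ring_hom_zero[OF \<kappa> ring_axioms A.ring_axioms], rule ring_hom_one[OF \<kappa>])
  show ?case
  proof (cases "j = b")
    case True
    have "[(\<lambda>v. \<zero>, \<kappa> \<zero>), (\<lambda>v. \<one>, \<kappa> \<one>)] \<in> coeff_pairs A \<kappa> J"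
      unfolding coeff_pairs_def
      using poly_rel.poly_rel_const[OF zero_closed, of A \<kappa> J] poly_rel.poly_rel_const[OF one_closed, of A \<kappa> J] by simp
    then show ?thesis using True b
      by (intro bexI[of _ "[(\<lambda>v. \<zero>, \<kappa> \<zero>), (\<lambda>v. \<one>, \<kappa> \<one>)]"]) (simp_all add: Pts_def \<kappa>01)
  next
    case False
    then have j: "j \<in> J" using poly_rel_var by simp
    have "[(\<lambda>v. v j, j)] \<in> coeff_pairs A \<kappa> J"
      unfolding coeff_pairs_def using poly_rel.poly_rel_var[OF j, of A \<kappa>] by simp
    then show ?thesis using j J b
      by (intro bexI[of _ "[(\<lambda>v. v j, j)]"]) (auto simp: Pts_def)
  qed
next
  case (poly_rel_add p a q d)
  from poly_rel_add.IH obtain l l' where l: "l \<in> coeff_pairs A \<kappa> J" "\<forall>v\<in>Pts (insert b J). p v = hval l v (v b)"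
     "a = horner A (map snd l) b" and l': "l' \<in> coeff_pairs A \<kappa> J" "\<forall>v\<in>Pts (insert b J). q v = hval l' v (v b)"
     "d = horner A (map snd l') b" by (elim bexE conjE)
  from pairs_add[OF l(1) l'(1)] obtain m where m: "m \<in> coeff_pairs A \<kappa> J"
    "\<forall>v\<in>Pts J. \<forall>x\<in>carrier K. hval m v x = hval l v x \<oplus> hval l' v x"
    "horner A (map snd m) b = horner A (map snd l) b \<oplus>\<^bsub>A\<^esub> horner A (map snd l') b" by (elim bexE conjE)
  show ?case
  proof (rule bexI[OF _ m(1)], intro conjI ballI)
    show "a \<oplus>\<^bsub>A\<^esub> d = horner A (map snd m) b" using m(3) l(3) l'(3) by simp
    fix v assume v: "v \<in> Pts (insert b J)"
    then have "v \<in> Pts J" "v b \<in> carrier K" unfolding Pts_def by simp_all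
    then show "p v \<oplus> q v = hval m v (v b)" using m(2) l(2) l'(2) v by simp
  qed
next
  case (poly_rel_mult p a q d)
  from poly_rel_mult.IH obtain l l' where l: "l \<in> coeff_pairs A \<kappa> J" "\<forall>v\<in>Pts (insert b J). p v = hval l v (v b)"
     "a = horner A (map snd l) b" and l': "l' \<in> coeff_pairs A \<kappa> J" "\<forall>v\<in>Pts (insert b J). q v = hval l' v (v b)"
     "d = horner A (map snd l') b" by (elim bexE conjE)
  from pairs_mult[OF l(1) l'(1)] obtain m where m: "m \<in> coeff_pairs A \<kappa> J"
    "\<forall>v\<in>Pts J. \<forall>x\<in>carrier K. hval m v x = hval l v x \<otimes> hval l' v x"
    "horner A (map snd m) b = horner A (map snd l) b \<otimes>\<^bsub>A\<^esub> horner A (map snd l') b" by (elim bexE conjE)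
  show ?case
  proof (rule bexI[OF _ m(1)], intro conjI ballI)
    show "a \<otimes>\<^bsub>A\<^esub> d = horner A (map snd m) b" using m(3) l(3) l'(3) by simp
    fix v assume v: "v \<in> Pts (insert b J)"
    then have "v \<in> Pts J" "v b \<in> carrier K" unfolding Pts_def by simp_all
    then show "p v \<otimes> q v = hval m v (v b)" using m(2) l(2) l'(2) v by simp
  qed
qed

end

text \<open>Since \<open>K\<close> is infinite, a polynomial expression with zero function is formally zero.\<close>

lemma poly_rel_zero:
  assumes A: "cring A" and \<kappa>: "\<kappa> \<in> ring_hom K A" and "finite J" "J \<subseteq> carrier A"
    and "poly_rel A \<kappa> J p a" "\<forall>v\<in>Pts J. p v = \<zero>"
  shows "a = \<zero>\<^bsub>A\<^esub>"
  using assms(3-)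
proof (induction J arbitrary: p a rule: finite_induct)
  case empty
  interpret A: cring A by (rule A)
  interpret \<kappa>: ring_hom_ring K A \<kappa> by (rule ring_hom_ringI2[OF ring_axioms A.ring_axioms \<kappa>])
  have "\<exists>c\<in>carrier K. p = (\<lambda>v. c) \<and> a = \<kappa> c" using empty(2)
  proof (induction rule: poly_rel.induct)
    case (poly_rel_const c) then show ?case by (intro bexI[of _ c]) simp_all
  next
    case (poly_rel_var j) then show ?case by simp
  next
    case (poly_rel_add p a q d)
    then obtain c c' where c: "c \<in> carrier K" "p = (\<lambda>v. c)" "a = \<kappa> c" "c' \<in> carrier K" "q = (\<lambda>v. c')" "d = \<kappa> c'"
      by (elim bexE conjE)
    show ?case by (rule bexI[of _ "c \<oplus> c'"]) (use c in simp_all)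
  next
    case (poly_rel_mult p a q d)
    then obtain c c' where c: "c \<in> carrier K" "p = (\<lambda>v. c)" "a = \<kappa> c" "c' \<in> carrier K" "q = (\<lambda>v. c')" "d = \<kappa> c'"
      by (elim bexE conjE)
    show ?case by (rule bexI[of _ "c \<otimes> c'"]) (use c in simp_all)
  qed
  then obtain c where c: "c \<in> carrier K" "p = (\<lambda>v. c)" "a = \<kappa> c" by (elim bexE conjE)
  have "(\<lambda>_. \<zero>) \<in> Pts {}" unfolding Pts_def by simp
  then have "p (\<lambda>_. \<zero>) = \<zero>" using empty(3) by (rule bspec[rotated])
  then show ?case using c by simp
next
  case (insert b J)
  interpret A: cring A by (rule A)
  have bJ: "J \<subseteq> carrier A" "b \<in> carrier A" using insert.prems(1) by auto
  from poly_rel_insert_normal_form[OF A \<kappa> bJ insert.prems(2)]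
  obtain l where l: "l \<in> coeff_pairs A \<kappa> J" "\<forall>v\<in>Pts (insert b J). p v = hval l v (v b)" "a = horner A (map snd l) b"
    by (elim bexE conjE)
  \<comment> \<open>The function vanishes on every line in direction \<open>b\<close>, so the
    coefficient functions are zero; the induction hypothesis then makes the coefficient elements
    zero.\<close>
  have "snd z = \<zero>\<^bsub>A\<^esub>" if z: "z \<in> set l" for z
  proof -
    have zr: "poly_rel A \<kappa> J (fst z) (snd z)" using l(1) z unfolding coeff_pairs_def by blast
    have "fst z v = \<zero>" if v: "v \<in> Pts J" for v
    proof (rule horner_zero_coeffs[of "map (\<lambda>z. fst z v) l" "{}"])
      show "set (map (\<lambda>z. fst z v) l) \<subseteq> carrier K"
      proof
        fix y assume "y \<in> set (map (\<lambda>z. fst z v) l)"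
        then obtain z' where z': "z' \<in> set l" "y = fst z' v" by auto
        have "poly_rel A \<kappa> J (fst z') (snd z')" using l(1) z'(1) unfolding coeff_pairs_def by blast
        then show "y \<in> carrier K" unfolding z'(2) by (rule Pol_closed[OF poly_rel_Pol v])
      qed
      fix x assume "x \<in> carrier K - {}"
      then have x: "x \<in> carrier K" by simp
      have v': "v(b := x) \<in> Pts (insert b J)" using v x unfolding Pts_def by simp
      have "map (\<lambda>z. fst z (v(b := x))) l = map (\<lambda>z. fst z v) l"
      proof (rule map_cong[OF refl])
        fix z' assume "z' \<in> set l"
        then have "poly_rel A \<kappa> J (fst z') (snd z')" using l(1) unfolding coeff_pairs_def by blast
        then show "fst z' (v(b := x)) = fst z' v" by (rule Pol_upd[OF poly_rel_Pol insert.hyps(2)])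
      qed
      moreover have "p (v(b := x)) = hval l (v(b := x)) x" using bspec[OF l(2) v'] by simp
      ultimately have "hval l v x = p (v(b := x))" by (simp only:)
      then show "hval l v x = \<zero>" using bspec[OF insert.prems(3) v'] by simp
    qed (use z in auto)
    then have "\<forall>v\<in>Pts J. fst z v = \<zero>" by (rule ballI)
    from insert.IH[OF bJ(1) zr this] show ?thesis .
  qed
  then have "set (map snd l) \<subseteq> {\<zero>\<^bsub>A\<^esub>}" by auto
  from A.horner_all_zero[OF this bJ(2)] show ?case using l(3) by simp
qed

text \<open>The sum of \<open>M\<close> and the principal ideal of \<open>x\<close> is the whole
  ring, so it contains one.\<close>

lemma maximalideal_inverse:
  assumes A: "cring A" and M: "maximalideal M A" and x: "x \<in> carrier A" "x \<notin> M"
  shows "\<exists>y\<in>carrier A. \<exists>m\<in>M. \<one>\<^bsub>A\<^esub> = m \<oplus>\<^bsub>A\<^esub> y \<otimes>\<^bsub>A\<^esub> x"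
proof -
  interpret A: cring A by (rule A)
  interpret M: maximalideal M A by (rule M)
  have i: "ideal (PIdl\<^bsub>A\<^esub> x) A" by (rule A.cgenideal_ideal[OF x(1)])
  have s: "ideal (M <+>\<^bsub>A\<^esub> (PIdl\<^bsub>A\<^esub> x)) A" by (rule A.add_ideals[OF M.ideal_axioms i])
  have MS: "M \<subseteq> M <+>\<^bsub>A\<^esub> (PIdl\<^bsub>A\<^esub> x)"
  proof
    fix m assume m: "m \<in> M"
    have "\<zero>\<^bsub>A\<^esub> \<in> PIdl\<^bsub>A\<^esub> x" by (rule additive_subgroup.zero_closed[OF ideal.axioms(1)[OF i]])
    moreover have "m = m \<oplus>\<^bsub>A\<^esub> \<zero>\<^bsub>A\<^esub>" using M.Icarr[OF m] by simp
    ultimately show "m \<in> M <+>\<^bsub>A\<^esub> (PIdl\<^bsub>A\<^esub> x)" using m unfolding set_add_def' by blast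
  qed
  have xS: "x \<in> M <+>\<^bsub>A\<^esub> (PIdl\<^bsub>A\<^esub> x)"
  proof -
    have "\<zero>\<^bsub>A\<^esub> \<in> M" by (rule M.zero_closed)
    moreover have "x \<in> PIdl\<^bsub>A\<^esub> x" by (rule A.cgenideal_self[OF x(1)])
    moreover have "x = \<zero>\<^bsub>A\<^esub> \<oplus>\<^bsub>A\<^esub> x" using x(1) by simp
    ultimately show ?thesis unfolding set_add_def' by blast
  qed
  have "M <+>\<^bsub>A\<^esub> (PIdl\<^bsub>A\<^esub> x) \<subseteq> carrier A" by (rule additive_subgroup.a_subset[OF ideal.axioms(1)[OF s]])
  from M.I_maximal[OF s MS this] have "M <+>\<^bsub>A\<^esub> (PIdl\<^bsub>A\<^esub> x) = carrier A" using xS x(2) by blast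
  then have "\<one>\<^bsub>A\<^esub> \<in> M <+>\<^bsub>A\<^esub> (PIdl\<^bsub>A\<^esub> x)" by simp
  then obtain m z where "m \<in> M" "z \<in> PIdl\<^bsub>A\<^esub> x" "\<one>\<^bsub>A\<^esub> = m \<oplus>\<^bsub>A\<^esub> z" unfolding set_add_def' by blast
  moreover then obtain y where "y \<in> carrier A" "z = y \<otimes>\<^bsub>A\<^esub> x" unfolding cgenideal_def by blast
  ultimately show ?thesis by blast
qed

text \<open>Zariski's lemma: the residue field at a maximal ideal is K. The polynomials that
  represent members of \<open>M\<close> form a prime ideal, which has a zero \<open>w\<close>; c is
  the value of \<open>a\<close> at \<open>w\<close>. If a - c were outside \<open>M\<close>, an
  equation 1 = m + y (a - c) would read 1 = 0 at \<open>w\<close>.\<close>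

lemma residue_exists:
  assumes A: "cring A" and \<kappa>: "\<kappa> \<in> ring_hom K A" and F: "finite F" "F \<subseteq> carrier A"
    and gen: "carrier A = generate_ring A (\<kappa> ` carrier K \<union> F)" and M: "maximalideal M A" and a: "a \<in> carrier A"
  shows "\<exists>c\<in>carrier K. a \<ominus>\<^bsub>A\<^esub> \<kappa> c \<in> M"
proof -
  interpret A: cring A by (rule A)
  interpret \<kappa>: ring_hom_ring K A \<kappa> by (rule ring_hom_ringI2[OF ring_axioms A.ring_axioms \<kappa>])
  interpret M: maximalideal M A by (rule M)
  interpret P: primeideal M A by (rule A.maximalideal_prime[OF M])
  have surj: "\<exists>p. poly_rel A \<kappa> F p a" if "a \<in> carrier A" for a
    by (rule poly_rel_surj[OF A \<kappa> F(2)]) (use that gen in simp)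
  \<comment> \<open>An element is determined by its function, so membership in the ideal of
    polynomials below does not depend on the chosen expression.\<close>
  have uniq: "a = b" if p: "poly_rel A \<kappa> F p a" and q: "poly_rel A \<kappa> F q b" and eq: "\<forall>v\<in>Pts F. p v = q v" for p q a b
  proof -
    have m: "\<ominus> \<one> \<in> carrier K" by simp
    have c: "a \<in> carrier A" "b \<in> carrier A" by (rule poly_rel_carrier[OF A \<kappa> F(2)], fact)+
    have "\<forall>v\<in>Pts F. p v \<oplus> \<ominus> \<one> \<otimes> q v = \<zero>"
    proof
      fix v assume v: "v \<in> Pts F"
      have "q v \<in> carrier K" by (rule Pol_closed[OF poly_rel_Pol[OF q] v])
      then show "p v \<oplus> \<ominus> \<one> \<otimes> q v = \<zero>" using bspec[OF eq v] by (simp add: l_minus r_neg)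
    qed
    from poly_rel_zero[OF A \<kappa> F poly_rel_add[OF p poly_rel_mult[OF poly_rel_const[OF m] q]] this]
    have "a \<oplus>\<^bsub>A\<^esub> \<ominus>\<^bsub>A\<^esub> b = \<zero>\<^bsub>A\<^esub>" using c by (simp add: A.l_minus)
    then show "a = b" using A.r_right_minus_eq[OF c] unfolding A.minus_eq by simp
  qed
  define I where "I = {p \<in> Pol F. \<exists>a\<in>M. poly_rel A \<kappa> F p a}"
  have II: "p \<in> I" if "poly_rel A \<kappa> F p a" "a \<in> M" for p a
    unfolding I_def using that poly_rel_Pol[OF that(1)] by blast
  have ID: "a \<in> M" if p: "p \<in> I" and a: "poly_rel A \<kappa> F p a" for p a
  proof -
    obtain b where b: "b \<in> M" "poly_rel A \<kappa> F p b" using p unfolding I_def by blast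
    have "a = b" by (rule uniq[OF a b(2)]) simp
    then show ?thesis using b(1) by simp
  qed
  have I: "prime_id F I" unfolding prime_id_def
  proof (intro conjI ballI impI)
    show "I \<subseteq> Pol F" unfolding I_def by blast
    show "(\<lambda>v. \<zero>) \<in> I" using II[OF poly_rel_const[OF zero_closed]] by simp
    show "(\<lambda>v. \<one>) \<notin> I"
    proof
      assume "(\<lambda>v. \<one>) \<in> I"
      then have "\<one>\<^bsub>A\<^esub> \<in> M" using ID[OF _ poly_rel_const[OF one_closed]] by simp
      then show False using M.one_imp_carrier M.I_notcarr by simp
    qed
  next
    fix p q assume p: "p \<in> Pol F" and q: "q \<in> I" and eq: "\<forall>v\<in>Pts F. p v = q v"
    obtain a where a: "poly_rel A \<kappa> F p a" using poly_rel_total[OF p] by blast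
    obtain b where b: "b \<in> M" "poly_rel A \<kappa> F q b" using q unfolding I_def by blast
    show "p \<in> I" using II[OF a] uniq[OF a b(2) eq] b(1) by simp
  next
    fix p q assume p: "p \<in> I" and q: "q \<in> I"
    obtain a where a: "a \<in> M" "poly_rel A \<kappa> F p a" using p unfolding I_def by blast
    obtain b where b: "b \<in> M" "poly_rel A \<kappa> F q b" using q unfolding I_def by blast
    show "(\<lambda>v. p v \<oplus> q v) \<in> I" by (rule II[OF poly_rel_add[OF a(2) b(2)] M.a_closed[OF a(1) b(1)]])
  next
    fix p q assume p: "p \<in> Pol F" and q: "q \<in> I"
    obtain a where a: "poly_rel A \<kappa> F p a" using poly_rel_total[OF p] by blast
    obtain b where b: "b \<in> M" "poly_rel A \<kappa> F q b" using q unfolding I_def by blast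
    show "(\<lambda>v. p v \<otimes> q v) \<in> I"
      by (rule II[OF poly_rel_mult[OF a b(2)] M.I_l_closed[OF b(1) poly_rel_carrier[OF A \<kappa> F(2) a]]])
  next
    fix p q assume p: "p \<in> Pol F" and q: "q \<in> Pol F" and pq: "(\<lambda>v. p v \<otimes> q v) \<in> I"
    obtain a where a: "poly_rel A \<kappa> F p a" using poly_rel_total[OF p] by blast
    obtain b where b: "poly_rel A \<kappa> F q b" using poly_rel_total[OF q] by blast
    have "a \<otimes>\<^bsub>A\<^esub> b \<in> M" by (rule ID[OF pq poly_rel_mult[OF a b]])
    then have "a \<in> M \<or> b \<in> M"
      by (rule P.I_prime[OF poly_rel_carrier[OF A \<kappa> F(2) a] poly_rel_carrier[OF A \<kappa> F(2) b]])
    then show "p \<in> I \<or> q \<in> I" using II[OF a] II[OF b] by blast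
  qed
  from nullstellensatz[OF F(1) I Pol_one prime_idD(3)[OF I]]
  obtain w where w: "w \<in> zeros F I F" by blast
  have wP: "w \<in> Pts F" by (rule zeros_Pts[OF w])
  obtain p where p: "poly_rel A \<kappa> F p a" using surj[OF a] by blast
  define c where "c = p w"
  have c: "c \<in> carrier K" unfolding c_def by (rule Pol_closed[OF poly_rel_Pol[OF p] wP])
  have mc: "\<ominus> c \<in> carrier K" using c by simp
  have x: "a \<ominus>\<^bsub>A\<^esub> \<kappa> c \<in> carrier A" using a c by simp
  have "a \<ominus>\<^bsub>A\<^esub> \<kappa> c = a \<oplus>\<^bsub>A\<^esub> \<kappa> (\<ominus> c)" using c by (simp add: A.minus_eq)
  then have px: "poly_rel A \<kappa> F (\<lambda>v. p v \<oplus> \<ominus> c) (a \<ominus>\<^bsub>A\<^esub> \<kappa> c)"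
    using poly_rel_add[OF p poly_rel_const[OF mc]] by simp
  have "a \<ominus>\<^bsub>A\<^esub> \<kappa> c \<in> M"
  proof (rule ccontr)
    assume "a \<ominus>\<^bsub>A\<^esub> \<kappa> c \<notin> M"
    from maximalideal_inverse[OF A M x this]
    obtain y m where ym: "y \<in> carrier A" "m \<in> M" "\<one>\<^bsub>A\<^esub> = m \<oplus>\<^bsub>A\<^esub> y \<otimes>\<^bsub>A\<^esub> (a \<ominus>\<^bsub>A\<^esub> \<kappa> c)" by blast
    obtain q r where q: "poly_rel A \<kappa> F q y" and r: "poly_rel A \<kappa> F r m"
      using surj[OF ym(1)] surj[OF M.Icarr[OF ym(2)]] by blast
    have rw: "r w = \<zero>" by (rule zerosD[OF w II[OF r ym(2)] poly_rel_Pol[OF r]])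
    have "poly_rel A \<kappa> F (\<lambda>v. \<one>) \<one>\<^bsub>A\<^esub>" using poly_rel_const[OF one_closed, of A \<kappa> F] by simp
    moreover have "poly_rel A \<kappa> F (\<lambda>v. r v \<oplus> q v \<otimes> (p v \<oplus> \<ominus> c)) \<one>\<^bsub>A\<^esub>"
      unfolding ym(3) by (rule poly_rel_add[OF r poly_rel_mult[OF q px]])
    moreover have "\<ominus> \<one> \<in> carrier K" by simp
    ultimately have "poly_rel A \<kappa> F (\<lambda>v. \<one> \<oplus> \<ominus> \<one> \<otimes> (r v \<oplus> q v \<otimes> (p v \<oplus> \<ominus> c))) (\<one>\<^bsub>A\<^esub> \<oplus>\<^bsub>A\<^esub> \<kappa> (\<ominus> \<one>) \<otimes>\<^bsub>A\<^esub> \<one>\<^bsub>A\<^esub>)"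
      by (intro poly_rel_add poly_rel_mult poly_rel_const)
    \<comment> \<open>This polynomial represents zero, hence belongs to the ideal and vanishes at
      \<open>w\<close>.\<close>
    then have s: "poly_rel A \<kappa> F (\<lambda>v. \<one> \<oplus> \<ominus> \<one> \<otimes> (r v \<oplus> q v \<otimes> (p v \<oplus> \<ominus> c))) \<zero>\<^bsub>A\<^esub>"
      by (simp add: A.r_neg)
    have "\<one> \<oplus> \<ominus> \<one> \<otimes> (r w \<oplus> q w \<otimes> (p w \<oplus> \<ominus> c)) = \<zero>"
      by (rule zerosD[OF w II[OF s M.zero_closed] poly_rel_Pol[OF s]])
    moreover have "q w \<in> carrier K" by (rule Pol_closed[OF poly_rel_Pol[OF q] wP])
    ultimately show False using c rw unfolding c_def[symmetric] by (simp add: r_neg)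
  qed
  then show ?thesis using c by blast
qed

end

section \<open>Values of sections\<close>

lemma (in cring) residue_identities:
  assumes "a \<in> carrier R" "b \<in> carrier R" "c \<in> carrier R" "d \<in> carrier R"
  shows "(a \<oplus> b) \<ominus> (c \<oplus> d) = (a \<ominus> c) \<oplus> (b \<ominus> d)"
    and "a \<otimes> b \<ominus> c \<otimes> d = (a \<ominus> c) \<otimes> b \<oplus> c \<otimes> (b \<ominus> d)"
    and "d \<ominus> c = (a \<ominus> c) \<oplus> \<ominus> \<one> \<otimes> (a \<ominus> d)"
    and "c = a \<oplus> \<ominus> \<one> \<otimes> (a \<ominus> c)"
    and "a \<otimes> (b \<ominus> d) = (a \<otimes> b \<ominus> c \<otimes> d) \<oplus> (\<ominus> d) \<otimes> (a \<ominus> c)"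
  using assms by algebra+

context acf
begin

text \<open>The relation behind \<open>germ_val\<close>. It is kept as a relation because uniqueness
  holds in every local algebra over K, while existence comes from finite type.\<close>

definition residue_val :: "'f ring \<Rightarrow> ('k \<Rightarrow> 'f) \<Rightarrow> 'f \<Rightarrow> 'k \<Rightarrow> bool" where
  "residue_val R \<kappa> a c \<longleftrightarrow> c \<in> carrier K \<and> a \<ominus>\<^bsub>R\<^esub> \<kappa> c \<notin> Units R"

context
  fixes R :: "'f ring" and \<kappa> :: "'k \<Rightarrow> 'f"
  assumes R: "local_ring R" and \<kappa>: "\<kappa> \<in> ring_hom K R"
begin

interpretation R: cring R using R unfolding local_ring_def by blast
interpretation \<kappa>: ring_hom_ring K R \<kappa> by (rule ring_hom_ringI2[OF ring_axioms R.ring_axioms \<kappa>])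

lemma nonunit_add: "a \<in> carrier R \<Longrightarrow> b \<in> carrier R \<Longrightarrow> a \<notin> Units R \<Longrightarrow> b \<notin> Units R \<Longrightarrow> a \<oplus>\<^bsub>R\<^esub> b \<notin> Units R"
  using R unfolding local_ring_def by blast

lemma nonunit_mult: "a \<in> carrier R \<Longrightarrow> b \<in> carrier R \<Longrightarrow> b \<notin> Units R \<Longrightarrow> a \<otimes>\<^bsub>R\<^esub> b \<notin> Units R"
  using R.unit_factor[of b a] R.m_comm[of a b] by auto

lemma nonunit_zero: "\<zero>\<^bsub>R\<^esub> \<notin> Units R"
proof
  assume "\<zero>\<^bsub>R\<^esub> \<in> Units R"
  then have "\<one>\<^bsub>R\<^esub> = \<zero>\<^bsub>R\<^esub>" using R.Units_r_inv R.l_null[OF R.Units_inv_closed] by metis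
  then show False using R unfolding local_ring_def by blast
qed

lemma const_unit: assumes c: "c \<in> carrier K" "c \<noteq> \<zero>" shows "\<kappa> c \<in> Units R"
proof -
  have u: "c \<in> Units K" using c unfolding field_Units by simp
  have i: "inv c \<in> carrier K" using u by simp
  have "\<kappa> c \<otimes>\<^bsub>R\<^esub> \<kappa> (inv c) = \<kappa> (c \<otimes> inv c)" using c(1) i by simp
  then have "\<kappa> c \<otimes>\<^bsub>R\<^esub> \<kappa> (inv c) \<in> Units R" using u by simp
  then show ?thesis by (rule R.unit_factor) (use c(1) i in simp_all)
qed

text \<open>The difference of two distinct residues is a nonzero constant, hence a unit, but also a
  sum of nonunits.\<close>

lemma residue_val_unique:
  assumes "residue_val R \<kappa> a c" "residue_val R \<kappa> a d" and a: "a \<in> carrier R"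
  shows "c = d"
proof (rule ccontr)
  assume cd: "c \<noteq> d"
  have c: "c \<in> carrier K" "a \<ominus>\<^bsub>R\<^esub> \<kappa> c \<notin> Units R" and d: "d \<in> carrier K" "a \<ominus>\<^bsub>R\<^esub> \<kappa> d \<notin> Units R"
    using assms unfolding residue_val_def by blast+
  have "d \<ominus> c \<noteq> \<zero>" using cd c(1) d(1) by simp
  then have "\<kappa> (d \<ominus> c) \<in> Units R" using c(1) d(1) by (intro const_unit) simp_all
  moreover have "\<kappa> (d \<ominus> c) = \<kappa> d \<ominus>\<^bsub>R\<^esub> \<kappa> c" using c(1) d(1) by (simp add: minus_eq R.minus_eq)
  moreover have "\<dots> = (a \<ominus>\<^bsub>R\<^esub> \<kappa> c) \<oplus>\<^bsub>R\<^esub> \<ominus>\<^bsub>R\<^esub> \<one>\<^bsub>R\<^esub> \<otimes>\<^bsub>R\<^esub> (a \<ominus>\<^bsub>R\<^esub> \<kappa> d)"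
    by (rule R.residue_identities(3)[OF a a]) (use c(1) d(1) in simp_all)
  moreover have "\<dots> \<notin> Units R" by (intro nonunit_add nonunit_mult) (use a c d in simp_all)
  ultimately show False by simp
qed

lemma residue_val_const: "c \<in> carrier K \<Longrightarrow> residue_val R \<kappa> (\<kappa> c) c"
  unfolding residue_val_def using nonunit_zero R.r_neg[of "\<kappa> c"] by (simp add: R.minus_eq)

lemma residue_val_add:
  assumes "residue_val R \<kappa> a c" "residue_val R \<kappa> b d" "a \<in> carrier R" "b \<in> carrier R"
  shows "residue_val R \<kappa> (a \<oplus>\<^bsub>R\<^esub> b) (c \<oplus> d)"
proof -
  have c: "c \<in> carrier K" "a \<ominus>\<^bsub>R\<^esub> \<kappa> c \<notin> Units R" and d: "d \<in> carrier K" "b \<ominus>\<^bsub>R\<^esub> \<kappa> d \<notin> Units R"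
    using assms unfolding residue_val_def by blast+
  have "(a \<ominus>\<^bsub>R\<^esub> \<kappa> c) \<oplus>\<^bsub>R\<^esub> (b \<ominus>\<^bsub>R\<^esub> \<kappa> d) \<notin> Units R" by (rule nonunit_add) (use assms c d in simp_all)
  then show ?thesis
    unfolding residue_val_def using c(1) d(1) R.residue_identities(1)[OF assms(3,4), of "\<kappa> c" "\<kappa> d"] by simp
qed

lemma residue_val_mult:
  assumes "residue_val R \<kappa> a c" "residue_val R \<kappa> b d" "a \<in> carrier R" "b \<in> carrier R"
  shows "residue_val R \<kappa> (a \<otimes>\<^bsub>R\<^esub> b) (c \<otimes> d)"
proof -
  have c: "c \<in> carrier K" "a \<ominus>\<^bsub>R\<^esub> \<kappa> c \<notin> Units R" and d: "d \<in> carrier K" "b \<ominus>\<^bsub>R\<^esub> \<kappa> d \<notin> Units R"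
    using assms unfolding residue_val_def by blast+
  have "b \<otimes>\<^bsub>R\<^esub> (a \<ominus>\<^bsub>R\<^esub> \<kappa> c) \<notin> Units R" by (rule nonunit_mult) (use assms c in simp_all)
  moreover have "b \<otimes>\<^bsub>R\<^esub> (a \<ominus>\<^bsub>R\<^esub> \<kappa> c) = (a \<ominus>\<^bsub>R\<^esub> \<kappa> c) \<otimes>\<^bsub>R\<^esub> b" by (rule R.m_comm) (use assms c in simp_all)
  ultimately have "(a \<ominus>\<^bsub>R\<^esub> \<kappa> c) \<otimes>\<^bsub>R\<^esub> b \<oplus>\<^bsub>R\<^esub> \<kappa> c \<otimes>\<^bsub>R\<^esub> (b \<ominus>\<^bsub>R\<^esub> \<kappa> d) \<notin> Units R"
    by (intro nonunit_add[OF _ _ _ nonunit_mult]) (use assms c d in simp_all)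
  then show ?thesis
    unfolding residue_val_def using c(1) d(1) R.residue_identities(2)[OF assms(3,4), of "\<kappa> c" "\<kappa> d"] by simp
qed

lemma residue_val_unit:
  assumes "residue_val R \<kappa> a c" "a \<in> carrier R"
  shows "a \<in> Units R \<longleftrightarrow> c \<noteq> \<zero>"
proof
  have c: "c \<in> carrier K" "a \<ominus>\<^bsub>R\<^esub> \<kappa> c \<notin> Units R" using assms unfolding residue_val_def by blast+
  show "c \<noteq> \<zero>" if "a \<in> Units R" using c that assms(2) by (auto simp: R.minus_eq)
  show "a \<in> Units R" if "c \<noteq> \<zero>"
  proof (rule ccontr)
    assume "a \<notin> Units R"
    then have "a \<oplus>\<^bsub>R\<^esub> \<ominus>\<^bsub>R\<^esub> \<one>\<^bsub>R\<^esub> \<otimes>\<^bsub>R\<^esub> (a \<ominus>\<^bsub>R\<^esub> \<kappa> c) \<notin> Units R"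
      by (intro nonunit_add nonunit_mult) (use assms c in simp_all)
    moreover have "\<kappa> c = a \<oplus>\<^bsub>R\<^esub> \<ominus>\<^bsub>R\<^esub> \<one>\<^bsub>R\<^esub> \<otimes>\<^bsub>R\<^esub> (a \<ominus>\<^bsub>R\<^esub> \<kappa> c)"
      by (rule R.residue_identities(4)[OF assms(2,2)]) (use assms c in simp_all)
    ultimately show False using const_unit[OF c(1) that] by simp
  qed
qed

text \<open>Gives residues of quotients: a germ is a section over an affine open set divided by an
  invertible germ, and residues of sections are already known.\<close>

lemma residue_val_divide:
  assumes u: "residue_val R \<kappa> u c" "u \<in> carrier R" "c \<noteq> \<zero>" and b: "b \<in> carrier R"
    and d: "residue_val R \<kappa> (u \<otimes>\<^bsub>R\<^esub> b) d"
  shows "\<exists>r. residue_val R \<kappa> b r"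
proof -
  have c: "c \<in> carrier K" "u \<ominus>\<^bsub>R\<^esub> \<kappa> c \<notin> Units R" and d: "d \<in> carrier K" "u \<otimes>\<^bsub>R\<^esub> b \<ominus>\<^bsub>R\<^esub> \<kappa> d \<notin> Units R"
    using assms unfolding residue_val_def by blast+
  have cu: "c \<in> Units K" using c u(3) unfolding field_Units by simp
  define r where "r = d \<otimes> inv c"
  have r: "r \<in> carrier K" "c \<otimes> r = d"
    unfolding r_def using c(1) d(1) m_lcomm[OF c(1) d(1) Units_inv_closed[OF cu]] cu by simp_all
  then have \<kappa>r: "\<kappa> c \<otimes>\<^bsub>R\<^esub> \<kappa> r = \<kappa> d" using c(1) by (metis \<kappa>.hom_mult)
  have e: "u \<otimes>\<^bsub>R\<^esub> (b \<ominus>\<^bsub>R\<^esub> \<kappa> r) = (u \<otimes>\<^bsub>R\<^esub> b \<ominus>\<^bsub>R\<^esub> \<kappa> d) \<oplus>\<^bsub>R\<^esub> (\<ominus>\<^bsub>R\<^esub> \<kappa> r) \<otimes>\<^bsub>R\<^esub> (u \<ominus>\<^bsub>R\<^esub> \<kappa> c)"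
    unfolding \<kappa>r[symmetric] by (rule R.residue_identities(5)[OF u(2) b]) (use c r in simp_all)
  have "\<dots> \<notin> Units R" by (intro nonunit_add nonunit_mult) (use assms c d r in simp_all)
  then have "u \<otimes>\<^bsub>R\<^esub> (b \<ominus>\<^bsub>R\<^esub> \<kappa> r) \<notin> Units R" unfolding e .
  moreover have "u \<in> Units R" using residue_val_unit[OF u(1,2)] u(3) by simp
  ultimately have "b \<ominus>\<^bsub>R\<^esub> \<kappa> r \<notin> Units R" by blast
  then show ?thesis unfolding residue_val_def using r(1) by blast
qed

end

lemma locally_ringedD:
  assumes "locally_ringed_kspace K X"
  shows "x \<in> pts X \<Longrightarrow> local_ring (Stalk X x)" "x \<in> pts X \<Longrightarrow> Scal X x \<in> ring_hom K (Stalk X x)"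
    and "openin (Top X) U \<Longrightarrow> s \<in> Sect X U \<Longrightarrow> s \<in> (\<Pi>\<^sub>E x\<in>U. carrier (Stalk X x))"
    and "openin (Top X) U \<Longrightarrow> cring (sect_ring X U)"
    and "openin (Top X) U \<Longrightarrow> sect_const X U \<in> ring_hom K (sect_ring X U)"
    and "openin (Top X) U \<Longrightarrow> openin (Top X) V \<Longrightarrow> V \<subseteq> U \<Longrightarrow> s \<in> Sect X U \<Longrightarrow> restrict s V \<in> Sect X V"
    and "x \<in> pts X \<Longrightarrow> a \<in> carrier (Stalk X x) \<Longrightarrow> \<exists>U s. openin (Top X) U \<and> x \<in> U \<and> s \<in> Sect X U \<and> s x = a"
    and "openin (Top X) U \<Longrightarrow> s \<in> Sect X U \<Longrightarrow> t \<in> Sect X U \<Longrightarrow> x \<in> U \<Longrightarrow> s x = t x \<Longrightarrow>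
          \<exists>V. openin (Top X) V \<and> x \<in> V \<and> V \<subseteq> U \<and> restrict s V = restrict t V"
proof -
  note a = assms[unfolded locally_ringed_kspace_def]
  note c1 = conjunct1[OF a] and a2 = conjunct2[OF a] note c2 = conjunct1[OF a2] and a3 = conjunct2[OF a2]
  note c3 = conjunct1[OF a3] and a4 = conjunct2[OF a3] note c4 = conjunct1[OF a4] and a5 = conjunct2[OF a4]
  note a6 = conjunct2[OF a5] note c6 = conjunct1[OF a6] and c7 = conjunct2[OF a6]
  show "x \<in> pts X \<Longrightarrow> local_ring (Stalk X x)" by (rule conjunct1[OF bspec[OF c1]])
  show "x \<in> pts X \<Longrightarrow> Scal X x \<in> ring_hom K (Stalk X x)" by (rule conjunct2[OF bspec[OF c1]])
  show "openin (Top X) U \<Longrightarrow> s \<in> Sect X U \<Longrightarrow> s \<in> (\<Pi>\<^sub>E x\<in>U. carrier (Stalk X x))"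
    by (rule subsetD[OF mp[OF spec[OF c2]]])
  show "openin (Top X) U \<Longrightarrow> cring (sect_ring X U)" by (rule conjunct1[OF mp[OF spec[OF c3]]])
  show "openin (Top X) U \<Longrightarrow> sect_const X U \<in> ring_hom K (sect_ring X U)" by (rule conjunct2[OF mp[OF spec[OF c3]]])
  show "openin (Top X) U \<Longrightarrow> openin (Top X) V \<Longrightarrow> V \<subseteq> U \<Longrightarrow> s \<in> Sect X U \<Longrightarrow> restrict s V \<in> Sect X V"
    by (rule c4[rule_format]) (intro conjI)
  show "x \<in> pts X \<Longrightarrow> a \<in> carrier (Stalk X x) \<Longrightarrow> \<exists>U s. openin (Top X) U \<and> x \<in> U \<and> s \<in> Sect X U \<and> s x = a"
    by (rule c6[rule_format])
  show "\<exists>V. openin (Top X) V \<and> x \<in> V \<and> V \<subseteq> U \<and> restrict s V = restrict t V"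
    if "openin (Top X) U" "s \<in> Sect X U" "t \<in> Sect X U" "x \<in> U" "s x = t x"
    by (rule c7[rule_format, OF conjI[OF that(1) conjI[OF that(2,3)]] that(4,5)])
qed

lemma sect_ring_simps [simp]:
  "carrier (sect_ring X U) = Sect X U"
  "x \<in> U \<Longrightarrow> (s \<otimes>\<^bsub>sect_ring X U\<^esub> t) x = s x \<otimes>\<^bsub>Stalk X x\<^esub> t x"
  "x \<in> U \<Longrightarrow> (s \<oplus>\<^bsub>sect_ring X U\<^esub> t) x = s x \<oplus>\<^bsub>Stalk X x\<^esub> t x"
  "x \<in> U \<Longrightarrow> \<one>\<^bsub>sect_ring X U\<^esub> x = \<one>\<^bsub>Stalk X x\<^esub>"
  unfolding sect_ring_def by simp_all

lemma section_value: "locally_ringed_kspace K X \<Longrightarrow> openin (Top X) U \<Longrightarrow> s \<in> Sect X U \<Longrightarrow> x \<in> U \<Longrightarrow> s x \<in> carrier (Stalk X x)"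
  using locally_ringedD(3) by (blast dest: PiE_mem)

lemma eval_hom:
  assumes L: "locally_ringed_kspace K X" and U: "openin (Top X) U" "x \<in> U"
  shows "(\<lambda>s. s x) \<in> ring_hom (sect_ring X U) (Stalk X x)"
  by (rule ring_hom_memI) (use U section_value[OF L U(1)] in simp_all)

lemma affine_openD:
  assumes "affine_open K X U"
  shows "openin (Top X) U"
    and "\<exists>F. finite F \<and> F \<subseteq> Sect X U \<and> Sect X U = generate_ring (sect_ring X U) (sect_const X U ` carrier K \<union> F)"
    and "bij_betw (\<lambda>x. {f \<in> Sect X U. f x \<notin> Units (Stalk X x)}) U {M. maximalideal M (sect_ring X U)}"
    and "V \<subseteq> U \<Longrightarrow> openin (Top X) V \<longleftrightarrow> (\<exists>F \<subseteq> Sect X U. V = (\<Union>f\<in>F. nonvan X U f))"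
    and "f \<in> Sect X U \<Longrightarrow> s \<in> Sect X (nonvan X U f) \<Longrightarrow> \<exists>n::nat. \<exists>a \<in> Sect X U.
       (restrict f (nonvan X U f) [^]\<^bsub>sect_ring X (nonvan X U f)\<^esub> n) \<otimes>\<^bsub>sect_ring X (nonvan X U f)\<^esub> s = restrict a (nonvan X U f)"
proof -
  note a = assms[unfolded affine_open_def Let_def sect_ring_simps(1)]
  show "openin (Top X) U" by (rule conjunct1[OF a])
  show "\<exists>F. finite F \<and> F \<subseteq> Sect X U \<and> Sect X U = generate_ring (sect_ring X U) (sect_const X U ` carrier K \<union> F)"
    by (rule conjunct1[OF conjunct2[OF a]])
  show "bij_betw (\<lambda>x. {f \<in> Sect X U. f x \<notin> Units (Stalk X x)}) U {M. maximalideal M (sect_ring X U)}"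
    by (rule conjunct1[OF conjunct2[OF conjunct2[OF a]]])
  show "V \<subseteq> U \<Longrightarrow> openin (Top X) V \<longleftrightarrow> (\<exists>F \<subseteq> Sect X U. V = (\<Union>f\<in>F. nonvan X U f))"
    by (rule conjunct1[OF conjunct2[OF conjunct2[OF conjunct2[OF a]]], rule_format])
  show "\<exists>n::nat. \<exists>a \<in> Sect X U.
       (restrict f (nonvan X U f) [^]\<^bsub>sect_ring X (nonvan X U f)\<^esub> n) \<otimes>\<^bsub>sect_ring X (nonvan X U f)\<^esub> s = restrict a (nonvan X U f)"
    if "f \<in> Sect X U" "s \<in> Sect X (nonvan X U f)"
    using conjunct2[OF conjunct2[OF conjunct2[OF conjunct2[OF a]]]] that by blast
qed

lemma nonvan_neighbourhood:
  assumes U: "affine_open K X U" and N: "openin (Top X) N" and w: "w \<in> N" "w \<in> U"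
  shows "\<exists>f\<in>Sect X U. w \<in> nonvan X U f \<and> nonvan X U f \<subseteq> N"
proof -
  have "openin (Top X) (N \<inter> U)" using N affine_openD(1)[OF U] by blast
  then obtain F where "F \<subseteq> Sect X U" "N \<inter> U = (\<Union>f\<in>F. nonvan X U f)" using affine_openD(4)[OF U, of "N \<inter> U"] by blast
  then show ?thesis using w by blast
qed

lemma nonvan_open:
  assumes U: "affine_open K X U" and f: "f \<in> Sect X U"
  shows "openin (Top X) (nonvan X U f)"
proof -
  have "nonvan X U f \<subseteq> U" unfolding nonvan_def by blast
  moreover have "\<exists>F \<subseteq> Sect X U. nonvan X U f = (\<Union>f\<in>F. nonvan X U f)" using f by (intro exI[of _ "{f}"]) simp
  ultimately show ?thesis using affine_openD(4)[OF U] by blast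
qed

text \<open>Affineness makes the sections that are not invertible at \<open>x\<close> a maximal
  ideal, to which \<open>residue_exists\<close> applies.\<close>

lemma section_residue:
  assumes L: "locally_ringed_kspace K X" and U: "affine_open K X U" "x \<in> U" and s: "s \<in> Sect X U"
  shows "\<exists>c. residue_val (Stalk X x) (Scal X x) (s x) c"
proof -
  note o = affine_openD(1)[OF U(1)]
  have xX: "x \<in> pts X" using openin_subset[OF o] U(2) by blast
  note A = locally_ringedD(4)[OF L o] and \<kappa> = locally_ringedD(5)[OF L o]
  interpret A: cring "sect_ring X U" by (rule A)
  interpret R: cring "Stalk X x" using locally_ringedD(1)[OF L xX] unfolding local_ring_def by blast
  interpret ev: ring_hom_ring "sect_ring X U" "Stalk X x" "\<lambda>s. s x"
    by (rule ring_hom_ringI2[OF A.ring_axioms R.ring_axioms eval_hom[OF L o U(2)]])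
  obtain F where F: "finite F" "F \<subseteq> carrier (sect_ring X U)"
    "carrier (sect_ring X U) = generate_ring (sect_ring X U) (sect_const X U ` carrier K \<union> F)"
    using affine_openD(2)[OF U(1)] by auto
  have M: "maximalideal {f \<in> Sect X U. f x \<notin> Units (Stalk X x)} (sect_ring X U)"
    using bij_betwE[OF affine_openD(3)[OF U(1)]] U(2) by blast
  have s': "s \<in> carrier (sect_ring X U)" using s by simp
  obtain c where c: "c \<in> carrier K" "s \<ominus>\<^bsub>sect_ring X U\<^esub> sect_const X U c \<in> {f \<in> Sect X U. f x \<notin> Units (Stalk X x)}"
    using residue_exists[OF A \<kappa> F M s'] by blast
  have k: "sect_const X U c \<in> carrier (sect_ring X U)" by (rule ring_hom_closed[OF \<kappa> c(1)])
  have "(s \<ominus>\<^bsub>sect_ring X U\<^esub> sect_const X U c) x = s x \<ominus>\<^bsub>Stalk X x\<^esub> sect_const X U c x"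
    using s' k unfolding A.minus_eq R.minus_eq by (simp only: ev.hom_add ev.hom_a_inv A.a_inv_closed)
  then have "s x \<ominus>\<^bsub>Stalk X x\<^esub> Scal X x c \<notin> Units (Stalk X x)" using c(2) U(2) unfolding sect_const_def by simp
  then show ?thesis unfolding residue_val_def using c(1) by blast
qed

lemma finite_type_ringed: "finite_type_scheme K X \<Longrightarrow> locally_ringed_kspace K X"
  unfolding finite_type_scheme_def by (rule conjunct1)

text \<open>The localisation condition read germ by germ: over the nonvanishing locus of
  \<open>f\<close> a section is a fraction with a power of \<open>f\<close> as denominator.\<close>

lemma localised_section:
  assumes L: "locally_ringed_kspace K X" and U: "affine_open K X U" and f: "f \<in> Sect X U"
    and s: "s \<in> Sect X (nonvan X U f)"
  shows "\<exists>n::nat. \<exists>a\<in>Sect X U. \<forall>y\<in>nonvan X U f. f y [^]\<^bsub>Stalk X y\<^esub> n \<otimes>\<^bsub>Stalk X y\<^esub> s y = a y"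
proof -
  let ?D = "nonvan X U f"
  note oU = affine_openD(1)[OF U] and oD = nonvan_open[OF U f]
  have DU: "?D \<subseteq> U" unfolding nonvan_def by blast
  from affine_openD(5)[OF U f s] obtain n :: nat and a where a: "a \<in> Sect X U"
    "(restrict f ?D [^]\<^bsub>sect_ring X ?D\<^esub> n) \<otimes>\<^bsub>sect_ring X ?D\<^esub> s = restrict a ?D" by blast
  have fD: "restrict f ?D \<in> carrier (sect_ring X ?D)" using locally_ringedD(6)[OF L oU oD DU f] by simp
  have "f y [^]\<^bsub>Stalk X y\<^esub> n \<otimes>\<^bsub>Stalk X y\<^esub> s y = a y" if y: "y \<in> ?D" for y
  proof -
    have yX: "y \<in> pts X" using openin_subset[OF oD] y by blast
    interpret D: cring "sect_ring X ?D" by (rule locally_ringedD(4)[OF L oD])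
    interpret R: cring "Stalk X y" using locally_ringedD(1)[OF L yX] unfolding local_ring_def by blast
    interpret ev: ring_hom_cring "sect_ring X ?D" "Stalk X y" "\<lambda>s. s y"
      by unfold_locales (rule eval_hom[OF L oD y])
    have "(restrict f ?D [^]\<^bsub>sect_ring X ?D\<^esub> n) y = f y [^]\<^bsub>Stalk X y\<^esub> n" using ev.hom_pow[OF fD, of n] y by simp
    moreover have "((restrict f ?D [^]\<^bsub>sect_ring X ?D\<^esub> n) \<otimes>\<^bsub>sect_ring X ?D\<^esub> s) y = a y" unfolding a(2) using y by simp
    ultimately show ?thesis using y by simp
  qed
  then show ?thesis using a(1) by blast
qed

section \<open>Values of germs in the ground field\<close>

context
  fixes X :: "('k, 'p, 'f) kspace" and x :: 'p
  assumes X: "finite_type_scheme K X" and x: "x \<in> pts X"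
begin

lemmas LX = finite_type_ringed[OF X]
lemmas local = locally_ringedD(1)[OF LX x] and scal = locally_ringedD(2)[OF LX x]

interpretation R: cring "Stalk X x" using local unfolding local_ring_def by blast

text \<open>A germ comes from a section on some neighbourhood, which shrinks to the nonvanishing
  locus of a section \<open>f\<close> on an affine open set. There it is a section of the affine set
  divided by a power of \<open>f\<close>.\<close>

lemma germ_residue_exists:
  assumes a: "a \<in> carrier (Stalk X x)"
  shows "\<exists>c. residue_val (Stalk X x) (Scal X x) a c"
proof -
  obtain U where U: "affine_open K X U" "x \<in> U" using X x unfolding finite_type_scheme_def by blast
  note oU = affine_openD(1)[OF U(1)]
  from locally_ringedD(7)[OF LX x a] obtain N s where N: "openin (Top X) N" "x \<in> N" and s: "s \<in> Sect X N" "s x = a" by blast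
  from nonvan_neighbourhood[OF U(1) N U(2)] obtain f where f: "f \<in> Sect X U" "x \<in> nonvan X U f" "nonvan X U f \<subseteq> N" by blast
  note oD = nonvan_open[OF U(1) f(1)]
  from localised_section[OF LX U(1) f(1) locally_ringedD(6)[OF LX N(1) oD f(3) s(1)]]
  obtain n :: nat and b where b: "b \<in> Sect X U"
    "\<forall>y\<in>nonvan X U f. f y [^]\<^bsub>Stalk X y\<^esub> n \<otimes>\<^bsub>Stalk X y\<^esub> restrict s (nonvan X U f) y = b y" by blast
  have e: "f x [^]\<^bsub>Stalk X x\<^esub> n \<otimes>\<^bsub>Stalk X x\<^esub> a = b x" using bspec[OF b(2) f(2)] f(2) s(2) by simp
  interpret A: cring "sect_ring X U" by (rule locally_ringedD(4)[OF LX oU])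
  interpret ev: ring_hom_cring "sect_ring X U" "Stalk X x" "\<lambda>s. s x"
    by unfold_locales (rule eval_hom[OF LX oU U(2)])
  have fA: "f \<in> carrier (sect_ring X U)" using f(1) by simp
  have "f [^]\<^bsub>sect_ring X U\<^esub> n \<in> Sect X U" using A.nat_pow_closed[OF fA, of n] by simp
  from section_residue[OF LX U this]
  obtain c where c: "residue_val (Stalk X x) (Scal X x) (f x [^]\<^bsub>Stalk X x\<^esub> n) c" unfolding ev.hom_pow[OF fA] by blast
  have fx: "f x \<in> Units (Stalk X x)" using f(2) unfolding nonvan_def by blast
  have fxn: "f x [^]\<^bsub>Stalk X x\<^esub> n \<in> Units (Stalk X x)" by (rule R.Units_pow_closed[OF fx])
  have fxc: "f x [^]\<^bsub>Stalk X x\<^esub> n \<in> carrier (Stalk X x)" using fxn by (rule R.Units_closed)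
  have "c \<noteq> \<zero>" using residue_val_unit[OF local scal c fxc] fxn by blast
  moreover obtain d where "residue_val (Stalk X x) (Scal X x) (b x) d" using section_residue[OF LX U b(1)] by blast
  then have "residue_val (Stalk X x) (Scal X x) (f x [^]\<^bsub>Stalk X x\<^esub> n \<otimes>\<^bsub>Stalk X x\<^esub> a) d" unfolding e .
  ultimately show ?thesis by (intro residue_val_divide[OF local scal c fxc _ a])
qed

lemma germ_valI: "a \<in> carrier (Stalk X x) \<Longrightarrow> residue_val (Stalk X x) (Scal X x) a c \<Longrightarrow> germ_val K X x a = c"
  unfolding germ_val_def residue_val_def[symmetric] by (rule the_equality) (auto dest: residue_val_unique[OF local scal])

lemma germ_val_residue: "a \<in> carrier (Stalk X x) \<Longrightarrow> residue_val (Stalk X x) (Scal X x) a (germ_val K X x a)"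
  using germ_residue_exists germ_valI by metis

lemma germ_val_closed: "a \<in> carrier (Stalk X x) \<Longrightarrow> germ_val K X x a \<in> carrier K"
  using germ_val_residue unfolding residue_val_def by blast

lemma germ_val_add: "a \<in> carrier (Stalk X x) \<Longrightarrow> b \<in> carrier (Stalk X x) \<Longrightarrow>
    germ_val K X x (a \<oplus>\<^bsub>Stalk X x\<^esub> b) = germ_val K X x a \<oplus> germ_val K X x b"
  by (intro germ_valI residue_val_add[OF local scal] germ_val_residue) simp_all

lemma germ_val_mult: "a \<in> carrier (Stalk X x) \<Longrightarrow> b \<in> carrier (Stalk X x) \<Longrightarrow>
    germ_val K X x (a \<otimes>\<^bsub>Stalk X x\<^esub> b) = germ_val K X x a \<otimes> germ_val K X x b"
  by (intro germ_valI residue_val_mult[OF local scal] germ_val_residue) simp_all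

lemma germ_val_const: "c \<in> carrier K \<Longrightarrow> germ_val K X x (Scal X x c) = c"
  by (intro germ_valI residue_val_const[OF local scal] ring_hom_closed[OF scal])

lemma germ_val_one: "germ_val K X x \<one>\<^bsub>Stalk X x\<^esub> = \<one>"
  using germ_val_const[OF one_closed] unfolding ring_hom_one[OF scal] .

lemma germ_val_unit: "a \<in> carrier (Stalk X x) \<Longrightarrow> a \<in> Units (Stalk X x) \<longleftrightarrow> germ_val K X x a \<noteq> \<zero>"
  by (rule residue_val_unit[OF local scal germ_val_residue])

lemma germ_val_pow: "a \<in> carrier (Stalk X x) \<Longrightarrow> germ_val K X x (a [^]\<^bsub>Stalk X x\<^esub> (n::nat)) = germ_val K X x a [^] n"
  by (induction n) (simp_all add: germ_val_one germ_val_mult)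

end

definition sval :: "('k, 'p, 'f) kspace \<Rightarrow> ('p \<Rightarrow> 'f) \<Rightarrow> 'p \<Rightarrow> 'k" where
  "sval X s x = germ_val K X x (s x)"

text \<open>The homomorphism of stalks is local and respects constants, so it sends the nonunit b -
  c to a nonunit.\<close>

lemma sval_morphism:
  assumes X: "finite_type_scheme K X" and Y: "finite_type_scheme K Y" and f: "morphism K X Y f" and x: "x \<in> pts X"
    and b: "b \<in> carrier (Stalk Y (Pt f x))"
  shows "germ_val K X x (Com f x b) = germ_val K Y (Pt f x) b"
proof -
  note f = f[unfolded morphism_def]
  have y: "Pt f x \<in> pts Y" using continuous_map_image_subset_topspace[OF conjunct1[OF f]] x by blast
  note m = bspec[OF conjunct1[OF conjunct2[OF f]] x]
  note hom = conjunct1[OF m] and loc = conjunct1[OF conjunct2[OF m]] and con = conjunct2[OF conjunct2[OF m]]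
  interpret R: cring "Stalk X x" using local[OF X x] unfolding local_ring_def by blast
  interpret S: cring "Stalk Y (Pt f x)" using local[OF Y y] unfolding local_ring_def by blast
  interpret h: ring_hom_ring "Stalk Y (Pt f x)" "Stalk X x" "Com f x"
    by (rule ring_hom_ringI2[OF S.ring_axioms R.ring_axioms hom])
  let ?c = "germ_val K Y (Pt f x) b"
  have c: "?c \<in> carrier K" "b \<ominus>\<^bsub>Stalk Y (Pt f x)\<^esub> Scal Y (Pt f x) ?c \<notin> Units (Stalk Y (Pt f x))"
    using germ_val_residue[OF Y y b] unfolding residue_val_def by blast+
  have s: "Scal Y (Pt f x) ?c \<in> carrier (Stalk Y (Pt f x))" by (rule ring_hom_closed[OF scal[OF Y y] c(1)])
  have "Com f x (b \<ominus>\<^bsub>Stalk Y (Pt f x)\<^esub> Scal Y (Pt f x) ?c) = Com f x b \<ominus>\<^bsub>Stalk X x\<^esub> Scal X x ?c"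
    using b s bspec[OF con c(1)] by (simp add: S.minus_eq R.minus_eq)
  moreover have "Com f x (b \<ominus>\<^bsub>Stalk Y (Pt f x)\<^esub> Scal Y (Pt f x) ?c) \<notin> Units (Stalk X x)"
    using loc c(2) S.minus_closed[OF b s] by blast
  ultimately have "residue_val (Stalk X x) (Scal X x) (Com f x b) ?c" unfolding residue_val_def using c(1) by simp
  then show ?thesis by (rule germ_valI[OF X x h.hom_closed[OF b]])
qed

lemma preimage_open: "morphism K X Y f \<Longrightarrow> openin (Top Y) W \<Longrightarrow> openin (Top X) (preimage X f W)"
  unfolding preimage_def morphism_def by (rule openin_continuous_map_preimage) simp_all

lemma pullback_section: "morphism K X Y f \<Longrightarrow> openin (Top Y) W \<Longrightarrow> s \<in> Sect Y W \<Longrightarrow> pullback X f W s \<in> Sect X (preimage X f W)"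
  unfolding morphism_def by (elim conjE) (drule spec[of _ W], drule mp, assumption, erule bspec)

lemma sval_pullback:
  assumes X: "finite_type_scheme K X" and Y: "finite_type_scheme K Y" and f: "morphism K X Y f"
    and W: "openin (Top Y) W" "s \<in> Sect Y W" and x: "x \<in> preimage X f W"
  shows "sval X (pullback X f W s) x = sval Y s (Pt f x)"
proof -
  have x': "x \<in> pts X" "Pt f x \<in> W" using x unfolding preimage_def by blast+
  show ?thesis unfolding sval_def pullback_def
    using x sval_morphism[OF X Y f x'(1) section_value[OF finite_type_ringed[OF Y] W x'(2)]] by simp
qed

section \<open>Sections on affine charts as polynomial functions\<close>

definition chart :: "('k, 'p, 'f) kspace \<Rightarrow> 'p set \<Rightarrow> ('p \<Rightarrow> 'f) set \<Rightarrow> bool" where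
  "chart X U F \<longleftrightarrow> affine_open K X U \<and> finite F \<and> F \<subseteq> Sect X U \<and>
     Sect X U = generate_ring (sect_ring X U) (sect_const X U ` carrier K \<union> F)"

context
  fixes X :: "('k, 'p, 'f) kspace" and U :: "'p set" and F :: "('p \<Rightarrow> 'f) set"
  assumes X: "finite_type_scheme K X" and C: "chart X U F"
begin

lemmas LU = finite_type_ringed[OF X]

lemma chart_affine: "affine_open K X U" using C unfolding chart_def by blast
lemmas oU = affine_openD(1)[OF chart_affine]
lemma chart_pts: "x \<in> U \<Longrightarrow> x \<in> pts X" using openin_subset[OF oU] by blast

interpretation A: cring "sect_ring X U" by (rule locally_ringedD(4)[OF LU oU])

lemmas sv = section_value[OF LU oU]

lemma sval_closed: "s \<in> Sect X U \<Longrightarrow> x \<in> U \<Longrightarrow> sval X s x \<in> carrier K"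
  unfolding sval_def by (rule germ_val_closed[OF X chart_pts sv])

lemma sval_add: "s \<in> Sect X U \<Longrightarrow> t \<in> Sect X U \<Longrightarrow> x \<in> U \<Longrightarrow> sval X (s \<oplus>\<^bsub>sect_ring X U\<^esub> t) x = sval X s x \<oplus> sval X t x"
  unfolding sval_def using germ_val_add[OF X chart_pts sv sv] by simp

lemma sval_mult: "s \<in> Sect X U \<Longrightarrow> t \<in> Sect X U \<Longrightarrow> x \<in> U \<Longrightarrow> sval X (s \<otimes>\<^bsub>sect_ring X U\<^esub> t) x = sval X s x \<otimes> sval X t x"
  unfolding sval_def using germ_val_mult[OF X chart_pts sv sv] by simp

lemma sval_const: "c \<in> carrier K \<Longrightarrow> x \<in> U \<Longrightarrow> sval X (sect_const X U c) x = c"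
  unfolding sval_def sect_const_def using germ_val_const[OF X chart_pts] by simp

lemma const_section: "c \<in> carrier K \<Longrightarrow> sect_const X U c \<in> Sect X U"
  using ring_hom_closed[OF locally_ringedD(5)[OF LU oU]] by simp

lemma nonvan_sval: "s \<in> Sect X U \<Longrightarrow> nonvan X U s = {x \<in> U. sval X s x \<noteq> \<zero>}"
  unfolding nonvan_def sval_def using germ_val_unit[OF X chart_pts sv] by blast

lemma sections_closed:
  "s \<in> Sect X U \<Longrightarrow> t \<in> Sect X U \<Longrightarrow> s \<oplus>\<^bsub>sect_ring X U\<^esub> t \<in> Sect X U"
  "s \<in> Sect X U \<Longrightarrow> t \<in> Sect X U \<Longrightarrow> s \<otimes>\<^bsub>sect_ring X U\<^esub> t \<in> Sect X U"
  using A.a_closed[of s t] A.m_closed[of s t] by simp_all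

lemma polynomial_section:
  assumes "p \<in> Pol (sval X ` F)"
  shows "\<exists>s\<in>Sect X U. \<forall>x\<in>U. p (pt x) = sval X s x"
  using assms
proof (induction rule: Pol.induct)
  case (Pol_const c)
  show ?case by (rule bexI[OF _ const_section[OF Pol_const]]) (use sval_const[OF Pol_const] in simp)
next
  case (Pol_var j)
  then obtain f where f: "f \<in> F" "j = sval X f" by blast
  have "f \<in> Sect X U" using C f(1) unfolding chart_def by blast
  then show ?case unfolding f(2) pt_apply by (intro bexI[of _ f]) simp_all
next
  case (Pol_add p q)
  then obtain s t where s: "s \<in> Sect X U" "\<forall>x\<in>U. p (pt x) = sval X s x" and t: "t \<in> Sect X U" "\<forall>x\<in>U. q (pt x) = sval X t x"
    by (elim bexE)
  show ?case by (rule bexI[OF _ sections_closed(1)[OF s(1) t(1)]]) (use s t sval_add in simp)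
next
  case (Pol_mult p q)
  then obtain s t where s: "s \<in> Sect X U" "\<forall>x\<in>U. p (pt x) = sval X s x" and t: "t \<in> Sect X U" "\<forall>x\<in>U. q (pt x) = sval X t x"
    by (elim bexE)
  show ?case by (rule bexI[OF _ sections_closed(2)[OF s(1) t(1)]]) (use s t sval_mult in simp)
qed

text \<open>An expression of the section in the generators is carried over to their values.
  Generators with the same values give one and the same coordinate.\<close>

lemma section_polynomial:
  assumes "s \<in> Sect X U"
  shows "\<exists>p\<in>Pol (sval X ` F). \<forall>x\<in>U. p (pt x) = sval X s x"
proof -
  have gen: "Sect X U = generate_ring (sect_ring X U) (sect_const X U ` carrier K \<union> F)"
    using C unfolding chart_def by blast
  have "poly_rel (sect_ring X U) (sect_const X U) F p s \<Longrightarrow>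
     s \<in> Sect X U \<and> (\<exists>p\<in>Pol (sval X ` F). \<forall>x\<in>U. p (pt x) = sval X s x)" for p s
  proof (induction rule: poly_rel.induct)
    case (poly_rel_const c)
    show ?case
      by (intro conjI const_section[OF poly_rel_const] bexI[OF _ Pol_const[OF poly_rel_const]])
         (use sval_const[OF poly_rel_const] in simp)
  next
    case (poly_rel_var f)
    then have f: "f \<in> Sect X U" using C unfolding chart_def by blast
    have "(\<lambda>v. v (sval X f)) \<in> Pol (sval X ` F)" by (rule Pol_var) (use poly_rel_var in blast)
    then show ?case by (intro conjI f bexI[of _ "\<lambda>v. v (sval X f)"]) (simp_all add: pt_apply)
  next
    case (poly_rel_add p s q t)
    then obtain p' q' where p: "p' \<in> Pol (sval X ` F)" "\<forall>x\<in>U. p' (pt x) = sval X s x"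
      and q: "q' \<in> Pol (sval X ` F)" "\<forall>x\<in>U. q' (pt x) = sval X t x" and st: "s \<in> Sect X U" "t \<in> Sect X U" by (elim conjE bexE)
    show ?case by (intro conjI sections_closed st bexI[OF _ Pol_add[OF p(1) q(1)]]) (use p(2) q(2) sval_add[OF st] in simp)
  next
    case (poly_rel_mult p s q t)
    then obtain p' q' where p: "p' \<in> Pol (sval X ` F)" "\<forall>x\<in>U. p' (pt x) = sval X s x"
      and q: "q' \<in> Pol (sval X ` F)" "\<forall>x\<in>U. q' (pt x) = sval X t x" and st: "s \<in> Sect X U" "t \<in> Sect X U" by (elim conjE bexE)
    show ?case by (intro conjI sections_closed st bexI[OF _ Pol_mult[OF p(1) q(1)]]) (use p(2) q(2) sval_mult[OF st] in simp)
  qed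
  moreover obtain p where "poly_rel (sect_ring X U) (sect_const X U) F p s"
    using poly_rel_surj[OF A.cring_axioms locally_ringedD(5)[OF LU oU], of F s] assms gen C unfolding chart_def by auto
  ultimately show ?thesis by blast
qed

text \<open>The sections whose polynomials vanish at \<open>v\<close> form a maximal ideal, and on
  an affine open set every maximal ideal belongs to a point.\<close>

lemma chart_character:
  assumes v: "v \<in> Pts (sval X ` F)" and van: "\<And>p. p \<in> van (sval X ` F) U \<Longrightarrow> p v = \<zero>"
  shows "\<exists>w\<in>U. \<forall>f\<in>sval X ` F. v f = f w"
proof -
  \<comment> \<open>The condition is put on all representing polynomials. By the hypothesis on
    \<open>v\<close> it is enough to check one of them, which is \<open>MI\<close>.\<close>
  define M where "M = {s \<in> Sect X U. \<forall>p\<in>Pol (sval X ` F). (\<forall>x\<in>U. p (pt x) = sval X s x) \<longrightarrow> p v = \<zero>}"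
  have MI: "s \<in> M" if s: "s \<in> Sect X U" and p: "p \<in> Pol (sval X ` F)" "\<forall>x\<in>U. p (pt x) = sval X s x" "p v = \<zero>" for s p
    unfolding M_def
  proof (intro CollectI conjI s ballI impI)
    fix q assume q: "q \<in> Pol (sval X ` F)" and qs: "\<forall>x\<in>U. q (pt x) = sval X s x"
    have m: "\<ominus> \<one> \<in> carrier K" by simp
    have "(\<lambda>u. q u \<oplus> \<ominus> \<one> \<otimes> p u) \<in> van (sval X ` F) U"
      by (rule vanI[OF Pol_add[OF q Pol_mult[OF Pol_const[OF m] p(1)]]])
         (use p(2) qs sval_closed[OF s] in \<open>simp add: l_minus r_neg\<close>)
    from van[OF this] show "q v = \<zero>" using p(3) Pol_closed[OF q v] by simp
  qed
  have MD: "p v = \<zero>" if "s \<in> M" "p \<in> Pol (sval X ` F)" "\<forall>x\<in>U. p (pt x) = sval X s x" for s p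
    using that unfolding M_def by blast
  have Mc: "\<exists>p\<in>Pol (sval X ` F). (\<forall>x\<in>U. p (pt x) = sval X s x) \<and> p v = \<zero>" if s: "s \<in> M" for s
  proof -
    have "s \<in> Sect X U" using s unfolding M_def by blast
    from section_polynomial[OF this] obtain p where p: "p \<in> Pol (sval X ` F)" "\<forall>x\<in>U. p (pt x) = sval X s x" by (elim bexE)
    show ?thesis by (rule bexI[OF _ p(1)], rule conjI[OF p(2) MD[OF s p]])
  qed
  have one: "\<one>\<^bsub>sect_ring X U\<^esub> \<in> Sect X U" using A.one_closed by simp
  have onev: "\<forall>x\<in>U. \<one> = sval X \<one>\<^bsub>sect_ring X U\<^esub> x"
    using germ_val_one[OF X chart_pts] unfolding sval_def by simp
  have add: "s \<oplus>\<^bsub>sect_ring X U\<^esub> t \<in> M" if s: "s \<in> M" and t: "t \<in> M" for s t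
  proof -
    have st: "s \<in> Sect X U" "t \<in> Sect X U" using s t unfolding M_def by blast+
    obtain p q where p: "p \<in> Pol (sval X ` F)" "\<forall>x\<in>U. p (pt x) = sval X s x" "p v = \<zero>"
      and q: "q \<in> Pol (sval X ` F)" "\<forall>x\<in>U. q (pt x) = sval X t x" "q v = \<zero>" using Mc[OF s] Mc[OF t] by (elim bexE conjE)
    show ?thesis by (rule MI[OF sections_closed(1)[OF st] Pol_add[OF p(1) q(1)]]) (use p q sval_add[OF st] in simp_all)
  qed
  have mul: "s \<otimes>\<^bsub>sect_ring X U\<^esub> t \<in> M" if s: "s \<in> Sect X U" and t: "t \<in> M" for s t
  proof -
    have t': "t \<in> Sect X U" using t unfolding M_def by blast
    obtain p where p: "p \<in> Pol (sval X ` F)" "\<forall>x\<in>U. p (pt x) = sval X s x" using section_polynomial[OF s] by (elim bexE)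
    obtain q where q: "q \<in> Pol (sval X ` F)" "\<forall>x\<in>U. q (pt x) = sval X t x" "q v = \<zero>" using Mc[OF t] by (elim bexE conjE)
    show ?thesis
      by (rule MI[OF sections_closed(2)[OF s t'] Pol_mult[OF p(1) q(1)]])
         (use p q sval_mult[OF s t'] Pol_closed[OF p(1) v] in simp_all)
  qed
  have zero: "\<zero>\<^bsub>sect_ring X U\<^esub> \<in> M"
  proof -
    have "sect_const X U \<zero> = \<zero>\<^bsub>sect_ring X U\<^esub>"
      by (rule ring_hom_zero[OF locally_ringedD(5)[OF LU oU] ring_axioms A.ring_axioms])
    then show ?thesis using MI[OF const_section[OF zero_closed] Pol_zero] sval_const[OF zero_closed] by simp
  qed
  have neg: "\<ominus>\<^bsub>sect_ring X U\<^esub> s \<in> M" if s: "s \<in> M" for s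
  proof -
    have "\<ominus>\<^bsub>sect_ring X U\<^esub> \<one>\<^bsub>sect_ring X U\<^esub> \<otimes>\<^bsub>sect_ring X U\<^esub> s \<in> M"
      by (rule mul[OF _ s]) (use A.a_inv_closed[OF A.one_closed] in simp)
    moreover have "s \<in> carrier (sect_ring X U)" using s unfolding M_def by simp
    ultimately show ?thesis by (simp add: A.l_minus del: sect_ring_simps)
  qed
  have idl: "ideal M (sect_ring X U)"
  proof (rule idealI[OF A.ring_axioms])
    show "subgroup M (add_monoid (sect_ring X U))"
    proof (rule subgroup.intro)
      show "M \<subseteq> carrier (add_monoid (sect_ring X U))" unfolding M_def by auto
      show "s \<otimes>\<^bsub>add_monoid (sect_ring X U)\<^esub> t \<in> M" if "s \<in> M" "t \<in> M" for s t using add[OF that] by simp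
      show "\<one>\<^bsub>add_monoid (sect_ring X U)\<^esub> \<in> M" using zero by simp
      show "inv\<^bsub>add_monoid (sect_ring X U)\<^esub> s \<in> M" if "s \<in> M" for s using neg[OF that] unfolding a_inv_def .
    qed
    fix s t assume s: "s \<in> M" and t: "t \<in> carrier (sect_ring X U)"
    show ts: "t \<otimes>\<^bsub>sect_ring X U\<^esub> s \<in> M" using mul[OF _ s] t by simp
    have "s \<in> carrier (sect_ring X U)" using s unfolding M_def by simp
    from A.m_comm[OF this t] show "s \<otimes>\<^bsub>sect_ring X U\<^esub> t \<in> M" using ts by simp
  qed
  have shift: "s \<oplus>\<^bsub>sect_ring X U\<^esub> sect_const X U (\<ominus> p v) \<in> M"
    if s: "s \<in> Sect X U" and p: "p \<in> Pol (sval X ` F)" "\<forall>x\<in>U. p (pt x) = sval X s x" for s p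
  proof -
    have c: "\<ominus> p v \<in> carrier K" "p v \<in> carrier K" using Pol_closed[OF p(1) v] by simp_all
    show ?thesis
      by (rule MI[OF sections_closed(1)[OF s const_section[OF c(1)]] Pol_add[OF p(1) Pol_const[OF c(1)]]])
         (use p(2) c sval_add[OF s const_section[OF c(1)]] sval_const[OF c(1)] in \<open>simp_all add: r_neg\<close>)
  qed
  have max: "maximalideal M (sect_ring X U)"
  proof (rule maximalidealI[OF idl])
    show "carrier (sect_ring X U) \<noteq> M"
    proof
      assume "carrier (sect_ring X U) = M"
      then have "\<one>\<^bsub>sect_ring X U\<^esub> \<in> M" using A.one_closed by blast
      from MD[OF this Pol_one onev] show False by simp
    qed
    fix J assume J: "ideal J (sect_ring X U)" "M \<subseteq> J" "J \<subseteq> carrier (sect_ring X U)"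
    show "J = M \<or> J = carrier (sect_ring X U)"
    proof (cases "J \<subseteq> M")
      case False
      interpret J: ideal J "sect_ring X U" by (rule J(1))
      \<comment> \<open>A section outside \<open>M\<close> is scaled to have the value one at
        \<open>v\<close>. Its difference from one then lies in \<open>M\<close>, so the larger ideal
        contains one.\<close>
      obtain s where s: "s \<in> J" "s \<notin> M" using False by blast
      have sU: "s \<in> Sect X U" using J(3) s(1) by auto
      from section_polynomial[OF sU] obtain p where p: "p \<in> Pol (sval X ` F)" "\<forall>x\<in>U. p (pt x) = sval X s x" by (elim bexE)
      have pv: "p v \<in> carrier K" "p v \<noteq> \<zero>" using Pol_closed[OF p(1) v] MI[OF sU p] s(2) by blast+
      have u: "p v \<in> Units K" using pv unfolding field_Units by simp
      have i: "inv (p v) \<in> carrier K" using u by simp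
      define q where "q = (\<lambda>u. p u \<otimes> inv (p v))"
      have q: "q \<in> Pol (sval X ` F)" unfolding q_def by (rule Pol_mult[OF p(1) Pol_const[OF i]])
      let ?t = "s \<otimes>\<^bsub>sect_ring X U\<^esub> sect_const X U (inv (p v))"
      have t: "?t \<in> Sect X U" by (rule sections_closed(2)[OF sU const_section[OF i]])
      have "\<forall>x\<in>U. q (pt x) = sval X ?t x" unfolding q_def using p(2) sval_mult[OF sU const_section[OF i]] sval_const[OF i] by simp
      from shift[OF t q this] have "?t \<oplus>\<^bsub>sect_ring X U\<^esub> sect_const X U (\<ominus> \<one>) \<in> J" unfolding q_def using u J(2) by auto
      moreover have "?t \<in> J" by (rule J.I_r_closed[OF s(1)]) (use const_section[OF i] in simp)
      moreover have k: "sect_const X U (\<ominus> \<one>) = \<ominus>\<^bsub>sect_ring X U\<^esub> \<one>\<^bsub>sect_ring X U\<^esub>"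
      proof -
        interpret \<kappa>: ring_hom_ring K "sect_ring X U" "sect_const X U"
          by (rule ring_hom_ringI2[OF ring_axioms A.ring_axioms locally_ringedD(5)[OF LU oU]])
        show ?thesis using \<kappa>.hom_a_inv[OF one_closed] \<kappa>.hom_one by (simp only:)
      qed
      moreover have "?t \<oplus>\<^bsub>sect_ring X U\<^esub> \<ominus>\<^bsub>sect_ring X U\<^esub> (?t \<oplus>\<^bsub>sect_ring X U\<^esub> \<ominus>\<^bsub>sect_ring X U\<^esub> \<one>\<^bsub>sect_ring X U\<^esub>) = \<one>\<^bsub>sect_ring X U\<^esub>"
        using t A.minus_add[of ?t "\<ominus>\<^bsub>sect_ring X U\<^esub> \<one>\<^bsub>sect_ring X U\<^esub>"] A.r_neg1[of ?t "\<one>\<^bsub>sect_ring X U\<^esub>"]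
          A.r_neg2[of ?t "\<one>\<^bsub>sect_ring X U\<^esub>"] A.one_closed A.a_inv_closed[OF A.one_closed] by (simp only: sect_ring_simps(1) A.minus_minus)
      ultimately have "\<one>\<^bsub>sect_ring X U\<^esub> \<in> J" using J.a_closed[OF _ J.a_inv_closed] by metis
      then show ?thesis using J.one_imp_carrier by blast
    qed (use J(2) in blast)
  qed
  have "M \<in> (\<lambda>x. {f \<in> Sect X U. f x \<notin> Units (Stalk X x)}) ` U"
    using bij_betw_imp_surj_on[OF affine_openD(3)[OF chart_affine]] max by blast
  then obtain w where w: "w \<in> U" "M = {f \<in> Sect X U. f w \<notin> Units (Stalk X w)}" by blast
  have "v (sval X f) = sval X f w" if f: "f \<in> F" for f
  proof -
    have fU: "f \<in> Sect X U" using C f unfolding chart_def by blast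
    have p: "(\<lambda>u. u (sval X f)) \<in> Pol (sval X ` F)" by (rule Pol_var) (use f in blast)
    have c: "v (sval X f) \<in> carrier K" using v f unfolding Pts_def by blast
    let ?t = "f \<oplus>\<^bsub>sect_ring X U\<^esub> sect_const X U (\<ominus> v (sval X f))"
    have t: "?t \<in> Sect X U" by (rule sections_closed(1)[OF fU const_section]) (use c in simp)
    have "?t \<in> M" by (rule shift[OF fU p]) (simp add: pt_apply)
    then have "w \<notin> nonvan X U ?t" unfolding w(2) nonvan_def by blast
    then have "sval X ?t w = \<zero>" using nonvan_sval[OF t] w(1) by blast
    moreover have "sval X ?t w = sval X f w \<oplus> \<ominus> v (sval X f)"
      using sval_add[OF fU const_section w(1)] sval_const[OF _ w(1)] c by simp
    ultimately show ?thesis using sval_closed[OF fU w(1)] c r_right_minus_eq[of "sval X f w" "v (sval X f)"] by (simp add: minus_eq)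
  qed
  then show ?thesis using w(1) by blast
qed

text \<open>Basic open sets correspond because sections and polynomials have the same values. Points
  with equal coordinates have the same maximal ideal, hence coincide.\<close>

lemma chart_aff: "aff (Top X) U (sval X ` F)"
  unfolding aff_def
proof (intro conjI ballI allI impI)
  show "U \<subseteq> pts X" by (rule openin_subset[OF oU])
  show "finite (sval X ` F)" using C unfolding chart_def by blast
  have FU: "F \<subseteq> Sect X U" using C unfolding chart_def by blast
  show "pt w \<in> Pts (sval X ` F)" if "w \<in> U" for w
    unfolding Pts_def pt_def using sval_closed FU that by blast
  show "\<exists>w\<in>U. \<forall>f\<in>sval X ` F. v f = f w" if "v \<in> Pts (sval X ` F)" "\<forall>p\<in>van (sval X ` F) U. p v = \<zero>" for v
    by (rule chart_character[OF that(1)]) (use that(2) in \<open>rule bspec\<close>)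
next
  fix p assume p: "p \<in> Pol (sval X ` F)"
  obtain s where s: "s \<in> Sect X U" "\<forall>x\<in>U. p (pt x) = sval X s x" using polynomial_section[OF p] by (elim bexE)
  have "{w \<in> U. p (pt w) \<noteq> \<zero>} = U \<inter> nonvan X U s" unfolding nonvan_sval[OF s(1)] using s(2) by auto
  then show "openin (subtopology (Top X) U) {w \<in> U. p (pt w) \<noteq> \<zero>}"
    using nonvan_open[OF chart_affine s(1)] unfolding openin_subtopology by blast
next
  fix N w assume N: "openin (Top X) N" "w \<in> N" "w \<in> U"
  obtain s where s: "s \<in> Sect X U" "w \<in> nonvan X U s" "nonvan X U s \<subseteq> N" using nonvan_neighbourhood[OF chart_affine N] by blast
  obtain p where p: "p \<in> Pol (sval X ` F)" "\<forall>x\<in>U. p (pt x) = sval X s x" using section_polynomial[OF s(1)] by (elim bexE)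
  have e: "{x \<in> U. p (pt x) \<noteq> \<zero>} = nonvan X U s" unfolding nonvan_sval[OF s(1)] using p(2) by auto
  show "\<exists>p\<in>Pol (sval X ` F). p (pt w) \<noteq> \<zero> \<and> {x \<in> U. p (pt x) \<noteq> \<zero>} \<subseteq> N"
    by (rule bexI[OF _ p(1)], rule conjI) (use e s in blast)+
next
  fix w w' assume w: "w \<in> U" "w' \<in> U" and eq: "\<forall>f\<in>sval X ` F. f w = f w'"
  have "sval X s w = sval X s w'" if s: "s \<in> Sect X U" for s
  proof -
    obtain p where p: "p \<in> Pol (sval X ` F)" "\<forall>x\<in>U. p (pt x) = sval X s x" using section_polynomial[OF s] by (elim bexE)
    have "p (pt w) = p (pt w')" by (rule Pol_cong[OF p(1)]) (unfold pt_apply, erule bspec[OF eq])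
    then show ?thesis unfolding bspec[OF p(2) w(1)] bspec[OF p(2) w(2)] .
  qed
  moreover have "f y \<notin> Units (Stalk X y) \<longleftrightarrow> sval X f y = \<zero>" if "f \<in> Sect X U" "y \<in> U" for f y
    unfolding sval_def using germ_val_unit[OF X chart_pts[OF that(2)] sv[OF that]] by blast
  ultimately have "{f \<in> Sect X U. f w \<notin> Units (Stalk X w)} = {f \<in> Sect X U. f w' \<notin> Units (Stalk X w')}"
    using w by (intro Collect_cong conj_cong refl) simp
  then show "w = w'" using bij_betw_imp_inj_on[OF affine_openD(3)[OF chart_affine]] w unfolding inj_on_def by blast
qed

text \<open>Near \<open>w\<close> the section is b / f^n with sections \<open>b\<close> and
  \<open>f\<close> of the affine set, whose values are polynomials in the coordinates.\<close>

lemma section_regular: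
  assumes N: "openin (Top X) N" "t \<in> Sect X N" and w: "w \<in> U" "w \<in> N"
    and \<phi>: "\<forall>x\<in>U \<inter> V. x \<in> N \<longrightarrow> \<phi> x = sval X t x"
  shows "regular_at U (sval X ` F) V \<phi> w"
proof -
  obtain f where f: "f \<in> Sect X U" "w \<in> nonvan X U f" "nonvan X U f \<subseteq> N" using nonvan_neighbourhood[OF chart_affine N(1) w(2,1)] by blast
  note oD = nonvan_open[OF chart_affine f(1)]
  from localised_section[OF LU chart_affine f(1) locally_ringedD(6)[OF LU N(1) oD f(3) N(2)]]
  obtain n :: nat and b where b: "b \<in> Sect X U"
    "\<forall>y\<in>nonvan X U f. f y [^]\<^bsub>Stalk X y\<^esub> n \<otimes>\<^bsub>Stalk X y\<^esub> restrict t (nonvan X U f) y = b y" by blast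
  obtain p where p: "p \<in> Pol (sval X ` F)" "\<forall>x\<in>U. p (pt x) = sval X f x" using section_polynomial[OF f(1)] by (elim bexE)
  obtain q where q: "q \<in> Pol (sval X ` F)" "\<forall>x\<in>U. q (pt x) = sval X b x" using section_polynomial[OF b(1)] by (elim bexE)
  \<comment> \<open>One power of \<open>f\<close> more than the localisation provides: for n = 0 the
    denominator would be the constant one and would not confine \<open>x\<close> to the nonvanishing
    locus of \<open>f\<close>.\<close>
  define g where "g = (\<lambda>u. p u [^] Suc n)"
  define a where "a = (\<lambda>u. p u \<otimes> q u)"
  have g: "g \<in> Pol (sval X ` F)" unfolding g_def by (rule Pol_pow[OF p(1)])
  have a: "a \<in> Pol (sval X ` F)" unfolding a_def by (rule Pol_mult[OF p(1) q(1)])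
  have "p (pt w) \<noteq> \<zero>" "p (pt w) \<in> carrier K" using p(2) f(2) sval_closed[OF f(1) w(1)] w(1) unfolding nonvan_sval[OF f(1)] by auto
  then have "p (pt w) \<in> Units K" unfolding field_Units by simp
  from Units_pow_closed[OF this, of "Suc n"] have gw: "g (pt w) \<noteq> \<zero>" unfolding g_def field_Units by simp
  have main: "\<phi> x \<in> carrier K \<and> \<phi> x \<otimes> g (pt x) = a (pt x)" if x: "x \<in> U \<inter> V" "g (pt x) \<noteq> \<zero>" for x
  proof -
    have xU: "x \<in> U" using x(1) by blast
    have px: "p (pt x) = sval X f x" "p (pt x) \<in> carrier K" using p(2) xU sval_closed[OF f(1) xU] by simp_all
    have "p (pt x) \<noteq> \<zero>" using x(2) px(2) unfolding g_def by auto
    then have xD: "x \<in> nonvan X U f" unfolding nonvan_sval[OF f(1)] using xU px(1) by simp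
    then have xN: "x \<in> N" using f(3) by blast
    have xX: "x \<in> pts X" by (rule chart_pts[OF xU])
    interpret R: cring "Stalk X x" using local[OF X xX] unfolding local_ring_def by blast
    have fx: "f x \<in> carrier (Stalk X x)" by (rule sv[OF f(1) xU])
    have tx: "t x \<in> carrier (Stalk X x)" by (rule section_value[OF LU N xN])
    have e: "\<phi> x = germ_val K X x (t x)" using \<phi> x(1) xN unfolding sval_def by blast
    have tc: "germ_val K X x (t x) \<in> carrier K" by (rule germ_val_closed[OF X xX tx])
    have "f x [^]\<^bsub>Stalk X x\<^esub> n \<otimes>\<^bsub>Stalk X x\<^esub> t x = b x" using b(2) xD by simp
    then have "germ_val K X x (f x) [^] n \<otimes> germ_val K X x (t x) = germ_val K X x (b x)"
      using germ_val_mult[OF X xX R.nat_pow_closed[OF fx] tx, of n] germ_val_pow[OF X xX fx] by simp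
    then have "p (pt x) [^] n \<otimes> \<phi> x = q (pt x)" using px(1) q(2) xU e unfolding sval_def by simp
    then have "a (pt x) = p (pt x) \<otimes> (p (pt x) [^] n \<otimes> \<phi> x)" unfolding a_def by simp
    also have "\<dots> = \<phi> x \<otimes> g (pt x)" unfolding g_def using px(2) tc e by (simp add: m_ac)
    finally show ?thesis using tc e by simp
  qed
  show ?thesis unfolding regular_at_def
    by (rule bexI[OF _ a], rule bexI[OF _ g], intro conjI gw ballI impI main)
qed

end

lemma scheme_atlas:
  assumes X: "finite_type_scheme K X"
  shows "\<exists>\<A>. atlas (Top X) \<A> \<and> (\<forall>U F. (U, F) \<in> \<A> \<longrightarrow> (\<exists>F0. chart X U F0 \<and> F = sval X ` F0))"
proof -
  obtain \<U> where \<U>: "finite \<U>" "\<forall>U\<in>\<U>. affine_open K X U" "\<Union>\<U> = pts X" using X unfolding finite_type_scheme_def by blast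
  have "\<exists>F. chart X U F" if "U \<in> \<U>" for U
    unfolding chart_def using affine_openD(2)[OF bspec[OF \<U>(2) that]] bspec[OF \<U>(2) that] by (simp only: simp_thms)
  then have "\<forall>U\<in>\<U>. \<exists>F. chart X U F" by (rule ballI)
  from bchoice[OF this] obtain \<Phi> where \<Phi>: "\<forall>U\<in>\<U>. chart X U (\<Phi> U)" by (rule exE)
  define \<A> where "\<A> = (\<lambda>U. (U, sval X ` \<Phi> U)) ` \<U>"
  have AD: "U \<in> \<U> \<and> F = sval X ` \<Phi> U" if "(U, F) \<in> \<A>" for U F using that unfolding \<A>_def by blast
  have "atlas (Top X) \<A>" unfolding atlas_def
  proof (intro conjI allI impI ballI)
    show "finite \<A>" unfolding \<A>_def using \<U>(1) by simp
    fix U F assume UF: "(U, F) \<in> \<A>"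
    have c: "chart X U (\<Phi> U)" and F: "F = sval X ` \<Phi> U" using AD[OF UF] \<Phi> by blast+
    show "openin (Top X) U" by (rule oU[OF X c])
    show "aff (Top X) U F" unfolding F by (rule chart_aff[OF X c])
    fix U' F' f w assume U': "(U', F') \<in> \<A>" "f \<in> F'" "w \<in> U" "w \<in> U'"
    have c': "chart X U' (\<Phi> U')" and F': "F' = sval X ` \<Phi> U'" using AD[OF U'(1)] \<Phi> by blast+
    obtain t where t: "t \<in> \<Phi> U'" "f = sval X t" using U'(2) F' by blast
    have "t \<in> Sect X U'" using c' t(1) unfolding chart_def by blast
    from section_regular[OF X c oU[OF X c'] this U'(3,4), of U' f]
    show "regular_at U F U' f w" unfolding F t(2) by simp
  next
    fix x assume "x \<in> pts X"
    then obtain U where "U \<in> \<U>" "x \<in> U" using \<U>(3) by blast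
    then show "\<exists>U F. (U, F) \<in> \<A> \<and> x \<in> U" unfolding \<A>_def by blast
  qed
  moreover have "\<exists>F0. chart X U F0 \<and> F = sval X ` F0" if "(U, F) \<in> \<A>" for U F
    by (rule exI[of _ "\<Phi> U"]) (use AD[OF that] \<Phi> in blast)
  ultimately show ?thesis by (intro exI[of _ \<A>]) simp
qed

section \<open>Strata\<close>

text \<open>The points of the product are those of its generating open sets, so one of these must
  contain the pair: the nonvanishing locus of the tensor of the two unit sections.\<close>

lemma product_point:
  assumes G: "finite_type_scheme K G" and Z: "finite_type_scheme K Z" and g: "g \<in> pts G" and z: "z \<in> pts Z"
  shows "(g, z) \<in> pts (prod_space K G Z)"
proof -
  have oG: "openin (Top G) (pts G)" and oZ: "openin (Top Z) (pts Z)" by simp_all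
  interpret A: cring "sect_ring G (pts G)" by (rule locally_ringedD(4)[OF finite_type_ringed[OF G] oG])
  interpret B: cring "sect_ring Z (pts Z)" by (rule locally_ringedD(4)[OF finite_type_ringed[OF Z] oZ])
  define t where "t = [(\<one>\<^bsub>sect_ring G (pts G)\<^esub>, \<one>\<^bsub>sect_ring Z (pts Z)\<^esub>)]"
  have t: "t \<in> lists (Sect G (pts G) \<times> Sect Z (pts Z))"
    unfolding t_def using A.one_closed B.one_closed by simp
  have "tensor_val K G Z (g, z) (tensor_germ t (g, z)) \<noteq> \<zero>"
    unfolding t_def tensor_val_def tensor_germ_def list_sum_def
    using g z germ_val_one[OF G g] germ_val_one[OF Z z] by simp
  then have "(g, z) \<in> {z \<in> pts G \<times> pts Z. tensor_val K G Z z (tensor_germ t z) \<noteq> \<zero>}" using g z by simp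
  moreover have "{z \<in> pts G \<times> pts Z. tensor_val K G Z z (tensor_germ t z) \<noteq> \<zero>} \<in>
      {{z \<in> U \<times> V. tensor_val K G Z z (tensor_germ t z) \<noteq> \<zero>} | U V t.
        openin (Top G) U \<and> openin (Top Z) V \<and> t \<in> lists (Sect G U \<times> Sect Z V)}"
    by (rule CollectI, rule exI[of _ "pts G"], rule exI[of _ "pts Z"], rule exI[of _ t]) (use t oG oZ in simp)
  ultimately show ?thesis
    unfolding prod_space_def prod_top_def kspace.select_convs topology_generated_by_topspace by (rule UnionI[rotated])
qed

text \<open>The immersion of the stratum is equivariant and the identity on points, so the orbit
  formed inside the stratum is the orbit in the whole space.\<close>

lemma quotient_fibre:
  assumes G: "finite_type_scheme K G" and Z: "finite_type_scheme K Z"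
    and I: "invariant_subvariety K G X act Z \<epsilon> \<tau>" and Q: "geometric_quotient K G Z \<tau> Y p" and z: "z \<in> pts Z"
  shows "{w \<in> pts Z. Pt p w = Pt p z} = orbit_of G act z"
proof -
  have \<epsilon>: "\<forall>z\<in>pts Z. Pt \<epsilon> z = z" and \<tau>: "morphism K (prod_space K G Z) Z \<tau>"
    and eq: "mor_eq (prod_space K G Z) X (\<epsilon> \<circ>\<^sub>m \<tau>)
       (act \<circ>\<^sub>m mor_pair (prod_space K G Z) (mor_fst K G Z) (\<epsilon> \<circ>\<^sub>m mor_snd K G Z))"
    using I unfolding invariant_subvariety_def locally_closed_subvariety_def by blast+
  have "Pt \<tau> (g, z) = Pt act (g, z)" if g: "g \<in> pts G" for g
  proof -
    have gz: "(g, z) \<in> pts (prod_space K G Z)" by (rule product_point[OF G Z g z])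
    have "continuous_map (Top (prod_space K G Z)) (Top Z) (Pt \<tau>)" using \<tau> unfolding morphism_def by blast
    then have "Pt \<tau> (g, z) \<in> pts Z" using continuous_map_image_subset_topspace gz by blast
    moreover have "Pt \<epsilon> (Pt \<tau> (g, z)) = Pt act (g, Pt \<epsilon> z)"
      using eq gz unfolding mor_eq_def mor_comp_def mor_pair_def mor_fst_def mor_snd_def by simp
    ultimately show ?thesis using \<epsilon> z by simp
  qed
  then have "orbit_of G \<tau> z = orbit_of G act z" unfolding orbit_of_def by (intro image_cong refl)
  moreover have "{w \<in> pts Z. Pt p w = Pt p z} = orbit_of G \<tau> z" using Q z unfolding geometric_quotient_def by blast
  ultimately show ?thesis by simp
qed

text \<open>A section of \<open>Y\<close> pulls back to \<open>Z\<close>, extends locally from \<open>Z\<close> to \<open>X\<close> because the stalks of \<open>X\<close> surject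
  onto those of \<open>Z\<close>, and is then pulled back to \<open>X'\<close>.\<close>

lemma stratum_section:
  assumes X': "finite_type_scheme K X'" and X: "finite_type_scheme K X" and Z: "finite_type_scheme K Z"
    and Y: "finite_type_scheme K Y" and h: "morphism K X' X h" and \<epsilon>: "locally_closed_subvariety K X Z \<epsilon>"
    and p: "morphism K Z Y p" and s: "openin (Top Y) W" "s \<in> Sect Y W"
    and w: "w \<in> pts X'" "Pt h w \<in> pts Z" "Pt p (Pt h w) \<in> W"
  shows "\<exists>N t. openin (Top X') N \<and> w \<in> N \<and> t \<in> Sect X' N \<and>
    (\<forall>x\<in>N. Pt h x \<in> pts Z \<longrightarrow> Pt p (Pt h x) \<in> W \<longrightarrow> sval Y s (Pt p (Pt h x)) = sval X' t x)"
proof -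
  note LX = finite_type_ringed[OF X] and LZ = finite_type_ringed[OF Z]
  have e: "morphism K Z X \<epsilon>" "\<forall>z\<in>pts Z. Pt \<epsilon> z = z" "Top Z = subtopology (Top X) (pts Z)"
    "\<forall>z\<in>pts Z. Com \<epsilon> z ` carrier (Stalk X z) = carrier (Stalk Z z)"
    using \<epsilon> unfolding locally_closed_subvariety_def by blast+
  define z where "z = Pt h w"
  have z: "z \<in> pts Z" "Pt p z \<in> W" using w unfolding z_def by simp_all
  have zX: "z \<in> pts X" using z(1) e(3) by (metis IntD1 topspace_subtopology)
  let ?P = "preimage Z p W" and ?s = "pullback Z p W s"
  have P: "openin (Top Z) ?P" "?s \<in> Sect Z ?P" "z \<in> ?P"
    using preimage_open[OF p s(1)] pullback_section[OF p s] z unfolding preimage_def by blast+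
  have "?s z \<in> carrier (Stalk Z z)" by (rule section_value[OF LZ P])
  then obtain b where b: "b \<in> carrier (Stalk X z)" "?s z = Com \<epsilon> z b" using bspec[OF e(4) z(1)] by blast
  from locally_ringedD(7)[OF LX zX b(1)]
  obtain N t where N: "openin (Top X) N" "z \<in> N" "t \<in> Sect X N" "t z = b" by blast
  let ?P' = "preimage Z \<epsilon> N" and ?t = "pullback Z \<epsilon> N t"
  have P': "openin (Top Z) ?P'" "?t \<in> Sect Z ?P'" by (rule preimage_open[OF e(1) N(1)], rule pullback_section[OF e(1) N(1,3)])
  have zP': "z \<in> ?P'" unfolding preimage_def using z(1) N(2) e(2) by simp
  have tz: "?t z = Com \<epsilon> z b" unfolding pullback_def using zP' N(4) e(2) z(1) by simp
  have PP: "openin (Top Z) (?P \<inter> ?P')" using P(1) P'(1) by blast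
  have r: "restrict ?s (?P \<inter> ?P') \<in> Sect Z (?P \<inter> ?P')" "restrict ?t (?P \<inter> ?P') \<in> Sect Z (?P \<inter> ?P')"
    by (rule locally_ringedD(6)[OF LZ P(1) PP Int_lower1 P(2)], rule locally_ringedD(6)[OF LZ P'(1) PP Int_lower2 P'(2)])
  have zPP: "z \<in> ?P \<inter> ?P'" using P(3) zP' by blast
  have "restrict ?s (?P \<inter> ?P') z = restrict ?t (?P \<inter> ?P') z" using zPP b(2) tz by simp
  \<comment> \<open>The two sections over Z have the same germ at \<open>z\<close>, hence agree on a
    neighbourhood \<open>H\<close>. It is the trace of an open set of X, which is needed to go back
    to X'.\<close>
  from locally_ringedD(8)[OF LZ PP r zPP this]
  obtain H where H: "openin (Top Z) H" "z \<in> H" "H \<subseteq> ?P \<inter> ?P'"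
    "restrict (restrict ?s (?P \<inter> ?P')) H = restrict (restrict ?t (?P \<inter> ?P')) H" by blast
  have agree: "?s y = ?t y" if y: "y \<in> H" for y
  proof -
    have "y \<in> ?P \<inter> ?P'" using y H(3) by blast
    then show ?thesis using fun_cong[OF H(4), of y] y by simp
  qed
  obtain H' where H': "openin (Top X) H'" "H = H' \<inter> pts Z" using H(1) unfolding e(3)[THEN arg_cong[where f=openin]] openin_subtopology
    by (metis openin_subtopology e(3))
  define N' where "N' = N \<inter> H'"
  have N': "openin (Top X) N'" "N' \<subseteq> N" unfolding N'_def using N(1) H'(1) by blast+
  note t' = locally_ringedD(6)[OF LX N(1) N' N(3)]
  show ?thesis
  proof (rule exI[of _ "preimage X' h N'"], rule exI[of _ "pullback X' h N' (restrict t N')"], intro conjI ballI impI)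
    show "openin (Top X') (preimage X' h N')" by (rule preimage_open[OF h N'(1)])
    show "pullback X' h N' (restrict t N') \<in> Sect X' (preimage X' h N')" by (rule pullback_section[OF h N'(1) t'])
    have "z \<in> N'" unfolding N'_def using N(2) H(2) H'(2) by blast
    then show "w \<in> preimage X' h N'" unfolding preimage_def using w(1) z_def by simp
    fix x assume x: "x \<in> preimage X' h N'" "Pt h x \<in> pts Z" "Pt p (Pt h x) \<in> W"
    define y where "y = Pt h x"
    have yN: "y \<in> N'" using x(1) unfolding preimage_def y_def by blast
    have yZ: "y \<in> pts Z" using x(2) unfolding y_def .
    have yH: "y \<in> H" using yN yZ unfolding N'_def H'(2) by blast
    have yP: "y \<in> ?P" "y \<in> ?P'" using H(3) yH by blast+
    have "sval Y s (Pt p y) = sval Z ?s y" by (rule sval_pullback[OF Z Y p s yP(1), symmetric])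
    also have "\<dots> = sval Z ?t y" unfolding sval_def agree[OF yH] ..
    also have "\<dots> = sval X t y" using sval_pullback[OF Z X e(1) N(1,3) yP(2)] e(2) yZ by simp
    also have "\<dots> = sval X (restrict t N') y" unfolding sval_def using yN by simp
    also have "\<dots> = sval X' (pullback X' h N' (restrict t N')) x"
      unfolding y_def by (rule sval_pullback[OF X' X h N'(1) t' x(1), symmetric])
    finally show "sval Y s (Pt p (Pt h x)) = sval X' (pullback X' h N' (restrict t N')) x" unfolding y_def .
  qed
qed

text \<open>Continuity passes through the subspace topology of the stratum, and
  \<open>stratum_section\<close> turns coordinates of the quotient into values of sections of X'
  near each point.\<close>

lemma stratum_regular_map:
  assumes X': "finite_type_scheme K X'" and X: "finite_type_scheme K X" and Z: "finite_type_scheme K Z"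
    and Y: "finite_type_scheme K Y" and h: "morphism K X' X h" and \<epsilon>: "locally_closed_subvariety K X Z \<epsilon>"
    and p: "morphism K Z Y p" and V: "V \<subseteq> preimage X' h (pts Z)"
    and \<A>: "\<forall>U F. (U, F) \<in> \<A> \<longrightarrow> (\<exists>F0. chart X' U F0 \<and> F = sval X' ` F0)"
    and \<A>': "\<forall>U F. (U, F) \<in> \<A>' \<longrightarrow> (\<exists>F0. chart Y U F0 \<and> F = sval Y ` F0)"
  shows "regular_map (Top X') \<A> V (Top Y) \<A>' (\<lambda>x. Pt p (Pt h x))"
  unfolding regular_map_def
proof (intro conjI allI impI)
  have TZ: "Top Z = subtopology (Top X) (pts Z)" using \<epsilon> unfolding locally_closed_subvariety_def by blast
  have "continuous_map (subtopology (Top X') V) (Top X) (Pt h)"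
    using h unfolding morphism_def by (intro continuous_map_from_subtopology) blast
  moreover have "Pt h ` topspace (subtopology (Top X') V) \<subseteq> pts Z" using V unfolding preimage_def by auto
  ultimately have "continuous_map (subtopology (Top X') V) (Top Z) (Pt h)"
    by (subst TZ) (simp add: continuous_map_in_subtopology image_subset_iff_funcset)
  moreover have "continuous_map (Top Z) (Top Y) (Pt p)" using p unfolding morphism_def by blast
  ultimately have "continuous_map (subtopology (Top X') V) (Top Y) (Pt p \<circ> Pt h)" by (rule continuous_map_compose)
  then show "continuous_map (subtopology (Top X') V) (Top Y) (\<lambda>x. Pt p (Pt h x))" unfolding comp_def .
next
  fix U F W E f w assume UF: "(U, F) \<in> \<A>" and WE: "(W, E) \<in> \<A>'" and f: "f \<in> E" and w: "w \<in> V" "w \<in> U" "Pt p (Pt h w) \<in> W"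
  obtain F0 where F0: "chart X' U F0" "F = sval X' ` F0" using \<A> UF by blast
  obtain E0 where E0: "chart Y W E0" "E = sval Y ` E0" using \<A>' WE by blast
  obtain s where s: "s \<in> E0" "f = sval Y s" using f E0(2) by blast
  have sW: "s \<in> Sect Y W" using E0(1) s(1) unfolding chart_def by blast
  have w': "w \<in> pts X'" "Pt h w \<in> pts Z" using w(1) V unfolding preimage_def by blast+
  from stratum_section[OF X' X Z Y h \<epsilon> p oU[OF Y E0(1)] sW w' w(3)]
  obtain N t where N: "openin (Top X') N" "w \<in> N" "t \<in> Sect X' N" and
    Nt: "\<forall>x\<in>N. Pt h x \<in> pts Z \<longrightarrow> Pt p (Pt h x) \<in> W \<longrightarrow> sval Y s (Pt p (Pt h x)) = sval X' t x" by (elim exE conjE)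
  show "regular_at U F {x \<in> V. Pt p (Pt h x) \<in> W} (\<lambda>x. f (Pt p (Pt h x))) w" unfolding F0(2) s(2)
  proof (rule section_regular[OF X' F0(1) N(1,3) w(2) N(2)], intro ballI impI)
    fix x assume x: "x \<in> U \<inter> {x \<in> V. Pt p (Pt h x) \<in> W}" and xN: "x \<in> N"
    have "Pt h x \<in> pts Z" "Pt p (Pt h x) \<in> W" using x V unfolding preimage_def by blast+
    then show "sval Y s (Pt p (Pt h x)) = sval X' t x" using bspec[OF Nt xN] by blast
  qed
qed

lemma parameters_eq_modality_open:
  assumes G: "finite_type_scheme K G" and X: "finite_type_scheme K X" and X': "finite_type_scheme K X'"
    and h: "morphism K X' X h" and S: "rosenlicht_stratification K G X act s Z \<epsilon> \<tau> Y p"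
    and U': "openin (Top X') U'"
  shows "G_par G act X' h U' = G_mod s Z Y p X' h U'"
proof -
  have cov: "pts X = (\<Union>j\<in>{1..s}. pts (Z j))" using S unfolding rosenlicht_stratification_def by (rule conjunct1)
  have strata: "\<forall>j\<in>{1..s}. invariant_subvariety K G X act (Z j) (\<epsilon> j) (\<tau> j) \<and> variety K (Y j) \<and>
      geometric_quotient K G (Z j) (\<tau> j) (Y j) (p j)"
    using S unfolding rosenlicht_stratification_def Let_def by blast
  have I: "invariant_subvariety K G X act (Z j) (\<epsilon> j) (\<tau> j)" and Y: "finite_type_scheme K (Y j)"
    and Q: "geometric_quotient K G (Z j) (\<tau> j) (Y j) (p j)" if "j \<in> {1..s}" for j
    using bspec[OF strata that] unfolding variety_def by blast+
  have \<epsilon>: "locally_closed_subvariety K X (Z j) (\<epsilon> j)" if "j \<in> {1..s}" for j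
    using I[OF that] unfolding invariant_subvariety_def by (rule conjunct1)
  have Z: "finite_type_scheme K (Z j)" if "j \<in> {1..s}" for j
    using \<epsilon>[OF that] unfolding locally_closed_subvariety_def variety_def by blast
  have p: "morphism K (Z j) (Y j) (p j)" if "j \<in> {1..s}" for j
    using Q[OF that] unfolding geometric_quotient_def by (rule conjunct1)
  have ch: "continuous_map (Top X') (Top X) (Pt h)" using h unfolding morphism_def by (rule conjunct1)
  have U'X: "U' \<subseteq> pts X'" by (rule openin_subset[OF U'])
  obtain \<A> where \<A>: "atlas (Top X') \<A>" "\<forall>U F. (U, F) \<in> \<A> \<longrightarrow> (\<exists>F0. chart X' U F0 \<and> F = sval X' ` F0)"
    using scheme_atlas[OF X'] by (elim exE conjE)
  have "\<forall>j\<in>{1..s}. \<exists>\<A>. atlas (Top (Y j)) \<A> \<and> (\<forall>U F. (U, F) \<in> \<A> \<longrightarrow> (\<exists>F0. chart (Y j) U F0 \<and> F = sval (Y j) ` F0))"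
    by (rule ballI, rule scheme_atlas[OF Y])
  from bchoice[OF this] obtain \<B> where \<B>: "\<forall>j\<in>{1..s}. atlas (Top (Y j)) (\<B> j) \<and>
      (\<forall>U F. (U, F) \<in> \<B> j \<longrightarrow> (\<exists>F0. chart (Y j) U F0 \<and> F = sval (Y j) ` F0))" by (rule exE)
  define V where "V = (\<lambda>j. U' \<inter> preimage X' h (pts (Z j)))"
  have "(SUP i::nat. dim_of (Top X') {u \<in> U'. dim_at (Top X') (U' \<inter> orbit_preimage G act X' h u) u = ereal (real i)} - ereal (real i)) =
     (SUP j\<in>{1..s}. dim_of (Top (Y j)) ((\<lambda>x. Pt (p j) (Pt h x)) ` V j))"
  proof (rule parameters_eq_modality[OF \<A>(1)])
    show "finite {1..s}" by simp
    show "U' \<subseteq> pts X'" by (rule U'X)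
    have "Pt h x \<in> pts X" if "x \<in> U'" for x using continuous_map_image_subset_topspace[OF ch] U'X that by blast
    then show "U' = (\<Union>j\<in>{1..s}. V j)" unfolding V_def preimage_def using U'X cov by blast
    fix j assume j: "j \<in> {1..s}"
    show "\<exists>Q D. openin (Top X') Q \<and> closedin (Top X') D \<and> V j = Q \<inter> D"
    proof -
      obtain O' C' where O': "openin (Top X) O'" "closedin (Top X) C'" "pts (Z j) = O' \<inter> C'"
        using \<epsilon>[OF j] unfolding locally_closed_subvariety_def by blast
      have "openin (Top X') (U' \<inter> preimage X' h O')" using U' preimage_open[OF h O'(1)] by blast
      moreover have "closedin (Top X') (preimage X' h C')"
        unfolding preimage_def by (rule closedin_continuous_map_preimage[OF ch O'(2)])
      moreover have "V j = (U' \<inter> preimage X' h O') \<inter> preimage X' h C'" unfolding V_def O'(3) preimage_def by blast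
      ultimately show ?thesis by blast
    qed
    show "atlas (Top (Y j)) (\<B> j)" by (rule conjunct1[OF bspec[OF \<B> j]])
    have Vj: "V j \<subseteq> preimage X' h (pts (Z j))" unfolding V_def by blast
    show "regular_map (Top X') \<A> (V j) (Top (Y j)) (\<B> j) (\<lambda>x. Pt (p j) (Pt h x))"
      by (rule stratum_regular_map[OF X' X Z[OF j] Y[OF j] h \<epsilon>[OF j] p[OF j] Vj \<A>(2) conjunct2[OF bspec[OF \<B> j]]])
    fix u assume u: "u \<in> V j"
    then have "Pt h u \<in> pts (Z j)" unfolding V_def preimage_def by blast
    note o = quotient_fibre[OF G Z[OF j] I[OF j] Q[OF j] this]
    \<comment> \<open>By \<open>o\<close> the orbit stays inside its stratum, so the part of its
      preimage in \<open>U'\<close> lies in \<open>V j\<close>.\<close>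
    show "U' \<inter> orbit_preimage G act X' h u = {v \<in> V j. Pt (p j) (Pt h v) = Pt (p j) (Pt h u)}"
      unfolding orbit_preimage_def o[symmetric] V_def preimage_def by blast
  qed
  then show ?thesis unfolding G_par_def G_mod_def par_stratum_def V_def image_image .
qed

end

theorem propositionA7:
  fixes K :: "'k ring"
    and G :: "('k, 'g, 'a) kspace"
    and \<mu> :: "('g \<times> 'g, 'g, ('a, 'a) fraction set, 'a) mor"
    and e :: 'g
    and \<iota> :: "('g, 'g, 'a, 'a) mor"
    and X :: "('k, 'x, 'b) kspace"
    and \<sigma> :: "('g \<times> 'x, 'x, ('a, 'b) fraction set, 'b) mor"
    and X' :: "('k, 'w, 'm) kspace"
    and h :: "('w, 'x, 'm, 'b) mor"
    and s :: nat
    and Z :: "nat \<Rightarrow> ('k, 'x, 'c) kspace"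
    and \<epsilon> :: "nat \<Rightarrow> ('x, 'x, 'c, 'b) mor"
    and \<tau> :: "nat \<Rightarrow> ('g \<times> 'x, 'x, ('a, 'c) fraction set, 'c) mor"
    and Y :: "nat \<Rightarrow> ('k, 'y, 'd) kspace"
    and p :: "nat \<Rightarrow> ('x, 'y, 'c, 'd) mor"
  assumes "algebraically_closed K"
    and "algebraic_group K G \<mu> e \<iota>"
    and "variety K X"
    and "algebraic_action K G \<mu> e X \<sigma>"
    and "variety K X'"
    and "morphism K X' X h"
    and "rosenlicht_stratification K G X \<sigma> s Z \<epsilon> \<tau> Y p"
  shows "(\<forall>x' \<in> pts X'. \<forall>U'. openin (Top X') U' \<and> x' \<in> U' \<longrightarrow>
            G_par G \<sigma> X' h U' = G_mod s Z Y p X' h U') \<and>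
         (\<forall>x' \<in> pts X'. G_par_at G \<sigma> X' h x' = G_mod_at s Z Y p X' h x')"
proof -
  interpret acf K unfolding acf_def by fact
  have G: "finite_type_scheme K G" and X: "finite_type_scheme K X" and X': "finite_type_scheme K X'"
    using assms(2,3,5) unfolding algebraic_group_def variety_def by blast+
  have eq: "G_par G \<sigma> X' h U' = G_mod s Z Y p X' h U'" if "openin (Top X') U'" for U'
    by (rule parameters_eq_modality_open[OF G X X' assms(6,7) that])
  have "G_par_at G \<sigma> X' h x' = G_mod_at s Z Y p X' h x'" for x'
    unfolding G_par_at_def G_mod_at_def by (rule INF_cong) (use eq in auto)
  then show ?thesis using eq by blast
qed

end
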